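(* Let $G$ be a sofic group with sofic approximation $\Sigma$, and let $G$ act freely by simplicial automorphisms on a simplicial complex $L$. Let $\mathbb{K}$ be a finite field and let $\delta^i:C^{i-1}(L,\mathbb{K})\to C^i(L,\mathbb{K})$ be the coboundary map. If $p\ge1$ and the action of $G$ on the $p$-skeleton of $L$ is cocompact, then $$h^\Sigma_{\mathrm{top}}(G\curvearrowright C^{p-1}(L,\mathbb{K}))+\beta^p_{(2)}(L:G)\cdot\log|\mathbb{K}|\le h^\Sigma_{\mathrm{top}}(G\curvearrowright\ker(\delta^p))+h^\Sigma_{\mathrm{top}}(G\curvearrowright\ker(\delta^{p+1})).$$
   Context: Cochains: $C^i(L,\mathbb{K})$ is the group of all simplicial $i$-cochains of $L$ with coefficients in $\mathbb{K}$, with the topology of pointwise convergence ($\mathbb{K}$ discrete) and the natural $G$-action; $\ker(\delta^p)\subseteq C^{p-1}(L,\mathbb{K})$ and $\ker(\delta^{p+1})\subseteq C^p(L,\mathbb{K})$ are closed $G$-invariant subgroups. The action on $L$ is free in the sense that it is free on the geometric realization (no nontrivial element maps a simplex to itself). Sofic approximation: A sofic approximation to a countable group $G$ is a sequence $\Sigma=(\sigma_n:G\to\mathrm{Sym}(D_n))$ of maps (not necessarily homomorphisms), $D_n$ finite sets with $|D_n|\to\infty$, $\sigma_n(1_G)=\mathrm{id}$, such that $|\{i\in D_n:\sigma_n(g)(i)\ne i\}|/|D_n|\to1$ for all $g\ne1_G$, and $|\{i\in D_n:\sigma_n(g)\circ\sigma_n(h)(i)=\sigma_n(gh)(i)\}|/|D_n|\to1$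 for all $g,h\in G$. $G$ is sofic if it admits one. Topological sofic entropy: Let $G\curvearrowright X$ be a continuous action on a compact metrizable space. Let $\rho$ be a continuous pseudo-metric on $X$ that is generating (for $x\ne y$ there is $g\in G$ with $\rho(g\cdot x,g\cdot y)>0$). For $\phi,\phi':D_n\to X$ let $\rho_2(\phi,\phi')=\bigl(\frac1{|D_n|}\sum_{i}\rho(\phi(i),\phi'(i))^2\bigr)^{1/2}$ and $\rho_\infty(\phi,\phi')=\max_i\rho(\phi(i),\phi'(i))$. For finite $F\subseteq G$, $\delta>0$ let $\mathrm{Map}(\rho,F,\delta,\sigma_n)=\{\phi:D_n\to X:\rho_2(\phi\circ\sigma_n(f),f\cdot\phi)<\delta\ \forall f\in F\}$, and let $N_\kappa(\cdot,\rho_\infty)$ be the maximum cardinality of a subset whose distinct elements satisfy $\rho_\infty(\phi,\phi')\ge\kappa$. Then $$h^\Sigma_{\mathrm{top}}(G\curvearrowright X)=\sup_{\kappa>0}\inf_{\delta>0}\inf_{F}\limsup_{n\to\infty}\frac1{|D_n|}\log N_\kappa(\mathrm{Map}(\rho,F,\delta,\sigma_n),\rho_\infty)$$ ($F$ ranging over finite subsets of $G$, $\log 0=-\infty$); this is independent of $\rho$. $\ell^2$-Betti numbers of an action: If $G$ acts freely and cocompactly on a simplicial complex $L$, let $C^p_{(2)}(L)$ be the Hilbert space of square-summable complex $p$-cochains, $\delta^{p+1}_{(2)}:C^p_{(2)}(L)\to C^{p+1}_{(2)}(L)$ the coboundary operator, $\overline H^p_{(2)}(L)=\ker\delta^{p+1}_{(2)}/\overline{\mathrm{Im}\,\delta^p_{(2)}}$,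 and $\beta^p_{(2)}(L:G)=\dim_G\overline H^p_{(2)}(L)$ (von Neumann dimension). For a free, not necessarily cocompact action write $L=\bigcup_iL_i$ as an increasing union of a sequence of $G$-invariant cocompact subcomplexes and set $\beta^p_{(2)}(L:G)=\lim_{i}\lim_{j\ge i}\dim_G\overline{\mathrm{Im}}(\overline H^p_{(2)}(L_j)\to\overline H^p_{(2)}(L_i))$ (maps induced by restriction of cochains; increasing limit in $i$ of decreasing limits in $j$; independent of the exhaustion). *)

theory Defs
  imports "HOL-Analysis.Analysis" "HOL-Algebra.Group_Action"
begin

section \<open>Sofic approximations\<close>

definition sofic_approximation ::
    "('g, 'm) monoid_scheme \<Rightarrow> (nat \<Rightarrow> 'd set) \<Rightarrow> (nat \<Rightarrow> 'g \<Rightarrow> 'd \<Rightarrow> 'd) \<Rightarrow> bool" where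
  "sofic_approximation G D \<sigma> \<longleftrightarrow>
     (\<forall>n. finite (D n)) \<and>
     filterlim (\<lambda>n. card (D n)) at_top sequentially \<and>
     (\<forall>n. \<forall>g\<in>carrier G. bij_betw (\<sigma> n g) (D n) (D n)) \<and>
     (\<forall>n. \<forall>i\<in>D n. \<sigma> n \<one>\<^bsub>G\<^esub> i = i) \<and>
     (\<forall>g\<in>carrier G. g \<noteq> \<one>\<^bsub>G\<^esub> \<longrightarrow>
        (\<lambda>n. real (card {i \<in> D n. \<sigma> n g i \<noteq> i}) / real (card (D n))) \<longlonglongrightarrow> 1) \<and>
     (\<forall>g\<in>carrier G. \<forall>h\<in>carrier G.
        (\<lambda>n. real (card {i \<in> D n. \<sigma> n g (\<sigma> n h i) = \<sigma> n (g \<otimes>\<^bsub>G\<^esub> h) i}) / real (card (D n)))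
          \<longlonglongrightarrow> 1)"


section \<open>Topological sofic entropy\<close>

definition continuous_pseudometric :: "'x topology \<Rightarrow> ('x \<Rightarrow> 'x \<Rightarrow> real) \<Rightarrow> bool" where
  "continuous_pseudometric X \<rho> \<longleftrightarrow>
     (\<forall>x\<in>topspace X. \<forall>y\<in>topspace X. 0 \<le> \<rho> x y) \<and>
     (\<forall>x\<in>topspace X. \<rho> x x = 0) \<and>
     (\<forall>x\<in>topspace X. \<forall>y\<in>topspace X. \<rho> x y = \<rho> y x) \<and>
     (\<forall>x\<in>topspace X. \<forall>y\<in>topspace X. \<forall>z\<in>topspace X. \<rho> x z \<le> \<rho> x y + \<rho> y z) \<and>
     continuous_map (prod_topology X X) euclideanreal (\<lambda>(x, y). \<rho> x y)"

definition generating_pseudometric ::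
    "('g, 'm) monoid_scheme \<Rightarrow> 'x topology \<Rightarrow> ('g \<Rightarrow> 'x \<Rightarrow> 'x) \<Rightarrow> ('x \<Rightarrow> 'x \<Rightarrow> real) \<Rightarrow> bool" where
  "generating_pseudometric G X act \<rho> \<longleftrightarrow>
     continuous_pseudometric X \<rho> \<and>
     (\<forall>x\<in>topspace X. \<forall>y\<in>topspace X. x \<noteq> y \<longrightarrow> (\<exists>g\<in>carrier G. 0 < \<rho> (act g x) (act g y)))"

definition rho_2 :: "('x \<Rightarrow> 'x \<Rightarrow> real) \<Rightarrow> 'd set \<Rightarrow> ('d \<Rightarrow> 'x) \<Rightarrow> ('d \<Rightarrow> 'x) \<Rightarrow> real" where
  "rho_2 \<rho> E \<phi> \<psi> = sqrt ((\<Sum>i\<in>E. (\<rho> (\<phi> i) (\<psi> i))\<^sup>2) / real (card E))"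

definition rho_inf :: "('x \<Rightarrow> 'x \<Rightarrow> real) \<Rightarrow> 'd set \<Rightarrow> ('d \<Rightarrow> 'x) \<Rightarrow> ('d \<Rightarrow> 'x) \<Rightarrow> real" where
  "rho_inf \<rho> E \<phi> \<psi> = Max ((\<lambda>i. \<rho> (\<phi> i) (\<psi> i)) ` E)"

text \<open>Maps from \<open>E\<close> to \<open>X\<close> are extensional functions, so that distinct functions are
  distinct maps.\<close>

definition sofic_Map ::
    "'x topology \<Rightarrow> ('g \<Rightarrow> 'x \<Rightarrow> 'x) \<Rightarrow> ('x \<Rightarrow> 'x \<Rightarrow> real) \<Rightarrow> 'g set \<Rightarrow> real \<Rightarrow>
     'd set \<Rightarrow> ('g \<Rightarrow> 'd \<Rightarrow> 'd) \<Rightarrow> ('d \<Rightarrow> 'x) set" where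
  "sofic_Map X act \<rho> F \<delta> E s =
     {\<phi> \<in> E \<rightarrow>\<^sub>E topspace X. \<forall>f\<in>F. rho_2 \<rho> E (\<lambda>i. \<phi> (s f i)) (\<lambda>i. act f (\<phi> i)) < \<delta>}"

definition separation_number :: "real \<Rightarrow> ('a \<Rightarrow> 'a \<Rightarrow> real) \<Rightarrow> 'a set \<Rightarrow> enat" where
  "separation_number \<kappa> d A =
     Sup {enat (card S) | S. finite S \<and> S \<subseteq> A \<and> (\<forall>x\<in>S. \<forall>y\<in>S. x \<noteq> y \<longrightarrow> \<kappa> \<le> d x y)}"

definition log_enat :: "enat \<Rightarrow> ereal" where
  "log_enat N = (case N of enat n \<Rightarrow> (if n = 0 then -\<infinity> else ereal (ln (real n))) | \<infinity> \<Rightarrow> \<infinity>)"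

definition sofic_entropy_wrt ::
    "('x \<Rightarrow> 'x \<Rightarrow> real) \<Rightarrow> ('g, 'm) monoid_scheme \<Rightarrow> (nat \<Rightarrow> 'd set) \<Rightarrow> (nat \<Rightarrow> 'g \<Rightarrow> 'd \<Rightarrow> 'd) \<Rightarrow>
     'x topology \<Rightarrow> ('g \<Rightarrow> 'x \<Rightarrow> 'x) \<Rightarrow> ereal" where
  "sofic_entropy_wrt \<rho> G D \<sigma> X act =
     (SUP \<kappa>\<in>{0<..}. INF \<delta>\<in>{0<..}. INF F\<in>{F. finite F \<and> F \<subseteq> carrier G}.
        limsup (\<lambda>n. log_enat (separation_number \<kappa> (rho_inf \<rho> (D n))
                                (sofic_Map X act \<rho> F \<delta> (D n) (\<sigma> n)))
                    / ereal (real (card (D n)))))"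

text \<open>The value does not depend on the generating pseudometric, so any one of them may be
  chosen; one exists whenever \<open>X\<close> is metrizable (see below).\<close>

definition top_sofic_entropy ::
    "('g, 'm) monoid_scheme \<Rightarrow> (nat \<Rightarrow> 'd set) \<Rightarrow> (nat \<Rightarrow> 'g \<Rightarrow> 'd \<Rightarrow> 'd) \<Rightarrow>
     'x topology \<Rightarrow> ('g \<Rightarrow> 'x \<Rightarrow> 'x) \<Rightarrow> ereal" where
  "top_sofic_entropy G D \<sigma> X act =
     sofic_entropy_wrt (SOME \<rho>. generating_pseudometric G X act \<rho>) G D \<sigma> X act"

lemma generating_pseudometric_exists:
  assumes "metrizable_space X" and "group G" and "\<And>x. x \<in> topspace X \<Longrightarrow> act \<one>\<^bsub>G\<^esub> x = x"
  shows "\<exists>\<rho>. generating_pseudometric G X act \<rho>"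
proof -
  from assms(1) obtain M d where Md: "Metric_space M d" and X: "X = Metric_space.mtopology M d"
    by (auto simp: metrizable_space_def)
  interpret Metric_space M d by (rule Md)
  have "continuous_map (prod_topology X X) euclideanreal (\<lambda>(x, y). d x y)"
    unfolding X using continuous_map_metric[of "metric (M, d)"] by (simp add: mtopology_of)
  then have "continuous_pseudometric X d"
    using triangle commute by (auto simp: continuous_pseudometric_def X split_beta)
  moreover have "\<exists>g\<in>carrier G. 0 < d (act g x) (act g y)"
    if "x \<in> topspace X" "y \<in> topspace X" "x \<noteq> y" for x y
    using that assms(3)[of x] assms(3)[of y] group.is_monoid[OF assms(2)]
    by (intro bexI[of _ "\<one>\<^bsub>G\<^esub>"]) (auto simp: X monoid.one_closed)
  ultimately show ?thesis
    unfolding generating_pseudometric_def by blast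
qed


section \<open>Simplicial complexes with a group action\<close>

text \<open>\<open>L\<close> is the set of (nonempty) simplices; its vertex set is \<open>\<Union>L\<close>.\<close>

definition abstract_simplicial_complex :: "'v set set \<Rightarrow> bool" where
  "abstract_simplicial_complex L \<longleftrightarrow>
     (\<forall>s\<in>L. finite s \<and> s \<noteq> {} \<and> (\<forall>t. t \<subseteq> s \<and> t \<noteq> {} \<longrightarrow> t \<in> L))"

definition skeleton :: "nat \<Rightarrow> 'v set set \<Rightarrow> 'v set set" where
  "skeleton p L = {s \<in> L. card s \<le> Suc p}"

definition simplicial_action ::
    "('g, 'm) monoid_scheme \<Rightarrow> ('g \<Rightarrow> 'v \<Rightarrow> 'v) \<Rightarrow> 'v set set \<Rightarrow> bool" where
  "simplicial_action G \<alpha> L \<longleftrightarrow>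
     group_action G (\<Union>L) \<alpha> \<and> (\<forall>g\<in>carrier G. \<forall>s\<in>L. \<alpha> g ` s \<in> L)"

text \<open>Freeness on the geometric realization: no nontrivial element preserves a simplex setwise.\<close>

definition free_simplicial_action ::
    "('g, 'm) monoid_scheme \<Rightarrow> ('g \<Rightarrow> 'v \<Rightarrow> 'v) \<Rightarrow> 'v set set \<Rightarrow> bool" where
  "free_simplicial_action G \<alpha> L \<longleftrightarrow>
     simplicial_action G \<alpha> L \<and> (\<forall>g\<in>carrier G. \<forall>s\<in>L. \<alpha> g ` s = s \<longrightarrow> g = \<one>\<^bsub>G\<^esub>)"

definition cocompact ::
    "('g, 'm) monoid_scheme \<Rightarrow> ('g \<Rightarrow> 'v \<Rightarrow> 'v) \<Rightarrow> 'v set set \<Rightarrow> bool" where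
  "cocompact G \<alpha> L \<longleftrightarrow> finite (orbits G L (\<lambda>g s. \<alpha> g ` s))"

definition cocompact_exhaustion ::
    "('g, 'm) monoid_scheme \<Rightarrow> ('g \<Rightarrow> 'v \<Rightarrow> 'v) \<Rightarrow> 'v set set \<Rightarrow> (nat \<Rightarrow> 'v set set) \<Rightarrow> bool" where
  "cocompact_exhaustion G \<alpha> L K \<longleftrightarrow>
     (\<forall>i. abstract_simplicial_complex (K i) \<and>
          (\<forall>g\<in>carrier G. \<forall>s\<in>K i. \<alpha> g ` s \<in> K i) \<and> cocompact G \<alpha> (K i)) \<and>
     incseq K \<and> (\<Union>i. K i) = L"


section \<open>Simplicial cochains\<close>

definition ordered_simplices :: "'v set set \<Rightarrow> nat \<Rightarrow> 'v list set" where
  "ordered_simplices L p = {xs. length xs = Suc p \<and> distinct xs \<and> set xs \<in> L}"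

text \<open>A \<open>p\<close>-cochain is an alternating function on the ordered \<open>p\<close>-simplices, extended by \<open>0\<close> to
  all other lists.\<close>

definition cochains :: "'v set set \<Rightarrow> nat \<Rightarrow> ('v list \<Rightarrow> 'k::comm_ring_1) set" where
  "cochains L p =
     {f. (\<forall>xs. xs \<notin> ordered_simplices L p \<longrightarrow> f xs = 0) \<and>
         (\<forall>xs\<in>ordered_simplices L p. \<forall>\<pi>. \<pi> permutes {..<length xs} \<longrightarrow>
            f (permute_list \<pi> xs) = of_int (sign \<pi>) * f xs)}"

text \<open>The index is the target degree: \<open>coboundary L p\<close> maps \<open>(p - 1)\<close>-cochains to \<open>p\<close>-cochains.\<close>

definition coboundary :: "'v set set \<Rightarrow> nat \<Rightarrow> ('v list \<Rightarrow> 'k::comm_ring_1) \<Rightarrow> 'v list \<Rightarrow> 'k" where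
  "coboundary L p f =
     (\<lambda>xs. if xs \<in> ordered_simplices L p
           then \<Sum>j\<le>p. (-1) ^ j * f (take j xs @ drop (Suc j) xs) else 0)"

text \<open>The kernel of \<open>coboundary L p\<close>, for \<open>p \<ge> 1\<close>.\<close>

definition ker_coboundary :: "'v set set \<Rightarrow> nat \<Rightarrow> ('v list \<Rightarrow> 'k::comm_ring_1) set" where
  "ker_coboundary L p = {f \<in> cochains L (p - 1). coboundary L p f = (\<lambda>xs. 0)}"

definition cochain_action ::
    "('g, 'm) monoid_scheme \<Rightarrow> ('g \<Rightarrow> 'v \<Rightarrow> 'v) \<Rightarrow> 'v set set \<Rightarrow> nat \<Rightarrow>
     'g \<Rightarrow> ('v list \<Rightarrow> 'k::comm_ring_1) \<Rightarrow> 'v list \<Rightarrow> 'k" where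
  "cochain_action G \<alpha> L p g f =
     (\<lambda>xs. if xs \<in> ordered_simplices L p then f (map (\<alpha> (inv\<^bsub>G\<^esub> g)) xs) else 0)"

definition pointwise_topology :: "('a \<Rightarrow> 'b) set \<Rightarrow> ('a \<Rightarrow> 'b) topology" where
  "pointwise_topology A = subtopology (product_topology (\<lambda>_. discrete_topology UNIV) UNIV) A"


section \<open>Square-summable functions and von Neumann dimension\<close>

definition l2_space :: "'a set \<Rightarrow> ('a \<Rightarrow> complex) set" where
  "l2_space S = {f. (\<forall>x. x \<notin> S \<longrightarrow> f x = 0) \<and> (\<lambda>x. (cmod (f x))\<^sup>2) summable_on S}"

definition l2_inner :: "'a set \<Rightarrow> ('a \<Rightarrow> complex) \<Rightarrow> ('a \<Rightarrow> complex) \<Rightarrow> complex" where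
  "l2_inner S f g = (\<Sum>\<^sub>\<infinity>x\<in>S. f x * cnj (g x))"

definition l2_norm :: "'a set \<Rightarrow> ('a \<Rightarrow> complex) \<Rightarrow> real" where
  "l2_norm S f = sqrt (\<Sum>\<^sub>\<infinity>x\<in>S. (cmod (f x))\<^sup>2)"

definition l2_closure :: "'a set \<Rightarrow> ('a \<Rightarrow> complex) set \<Rightarrow> ('a \<Rightarrow> complex) set" where
  "l2_closure S M = {f \<in> l2_space S. \<forall>\<epsilon>>0. \<exists>m\<in>M. l2_norm S (\<lambda>x. f x - m x) < \<epsilon>}"

definition l2_orthogonal :: "'a set \<Rightarrow> ('a \<Rightarrow> complex) set \<Rightarrow> ('a \<Rightarrow> complex) set" where
  "l2_orthogonal S M = {f \<in> l2_space S. \<forall>m\<in>M. l2_inner S f m = 0}"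

text \<open>Orthogonal projection onto a closed subspace \<open>M\<close> of \<open>l2_space S\<close>.\<close>

definition l2_proj :: "'a set \<Rightarrow> ('a \<Rightarrow> complex) set \<Rightarrow> ('a \<Rightarrow> complex) \<Rightarrow> 'a \<Rightarrow> complex" where
  "l2_proj S M f = (THE m. m \<in> M \<and> (\<lambda>x. f x - m x) \<in> l2_orthogonal S M)"

text \<open>Let \<open>G\<close> act freely with finitely many orbits on \<open>S\<close>. A choice of orbit representatives
  identifies \<open>l2_space S\<close> with \<open>\<ell>\<^sup>2(G)\<^sup>n\<close>, \<open>n\<close> the number of orbits, the delta functions at the
  representatives corresponding to the delta functions at the identity in each summand. The
  following is thus the von Neumann dimension (the trace of the orthogonal projection) of a closed
  \<open>G\<close>-invariant subspace \<open>M\<close>; it does not depend on the representatives.\<close>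

definition von_Neumann_dim ::
    "('g, 'm) monoid_scheme \<Rightarrow> ('g \<Rightarrow> 'a \<Rightarrow> 'a) \<Rightarrow> 'a set \<Rightarrow> ('a \<Rightarrow> complex) set \<Rightarrow> real" where
  "von_Neumann_dim G act S M =
     (\<Sum>Q\<in>orbits G S act.
        let e = (\<lambda>x. if x = (SOME s. s \<in> Q) then 1 else 0)
        in Re (l2_inner S (l2_proj S M e) e))"


section \<open>\<open>\<ell>\<^sup>2\<close>-Betti numbers\<close>

text \<open>Square-summability and norms are taken over ordered simplices, on which \<open>G\<close> acts freely as
  well. Each \<open>p\<close>-simplex is thereby counted \<open>(p + 1)!\<close> times, which rescales the usual inner product
  on square-summable \<open>p\<close>-cochains by a constant and affects neither closures nor dimensions.\<close>

definition l2_cochains :: "'v set set \<Rightarrow> nat \<Rightarrow> ('v list \<Rightarrow> complex) set" where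
  "l2_cochains L p = cochains L p \<inter> l2_space (ordered_simplices L p)"

definition l2_cocycles :: "'v set set \<Rightarrow> nat \<Rightarrow> ('v list \<Rightarrow> complex) set" where
  "l2_cocycles L p = {f \<in> l2_cochains L p. coboundary L (Suc p) f = (\<lambda>xs. 0)}"

definition l2_coboundaries :: "'v set set \<Rightarrow> nat \<Rightarrow> ('v list \<Rightarrow> complex) set" where
  "l2_coboundaries L p =
     (if p = 0 then {\<lambda>xs. 0} else coboundary L p ` l2_cochains L (p - 1))"

definition closed_coboundaries :: "'v set set \<Rightarrow> nat \<Rightarrow> ('v list \<Rightarrow> complex) set" where
  "closed_coboundaries L p = l2_closure (ordered_simplices L p) (l2_coboundaries L p)"

definition cohomology_class ::
    "'v set set \<Rightarrow> nat \<Rightarrow> ('v list \<Rightarrow> complex) \<Rightarrow> ('v list \<Rightarrow> complex) set" where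
  "cohomology_class L p z = {\<lambda>xs. z xs + b xs | b. b \<in> closed_coboundaries L p}"

definition reduced_cohomology :: "'v set set \<Rightarrow> nat \<Rightarrow> ('v list \<Rightarrow> complex) set set" where
  "reduced_cohomology L p = cohomology_class L p ` l2_cocycles L p"

text \<open>Restriction to a subcomplex \<open>K\<close>, and the induced map into the reduced cohomology of \<open>K\<close>: a class
  \<open>c\<close> is sent to the class containing the restrictions of all its elements.\<close>

definition restrict_cochain ::
    "'v set set \<Rightarrow> nat \<Rightarrow> ('v list \<Rightarrow> complex) \<Rightarrow> 'v list \<Rightarrow> complex" where
  "restrict_cochain K p f = (\<lambda>xs. if xs \<in> ordered_simplices K p then f xs else 0)"

definition restrict_class ::
    "'v set set \<Rightarrow> nat \<Rightarrow> ('v list \<Rightarrow> complex) set \<Rightarrow> ('v list \<Rightarrow> complex) set" where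
  "restrict_class K p c = (\<Union>z\<in>c. cohomology_class K p (restrict_cochain K p z))"

definition class_dist ::
    "'v set set \<Rightarrow> nat \<Rightarrow> ('v list \<Rightarrow> complex) set \<Rightarrow> ('v list \<Rightarrow> complex) set \<Rightarrow> real" where
  "class_dist L p c c' =
     Inf {l2_norm (ordered_simplices L p) (\<lambda>xs. z xs - z' xs) | z z'. z \<in> c \<and> z' \<in> c'}"

definition cohomology_closure ::
    "'v set set \<Rightarrow> nat \<Rightarrow> ('v list \<Rightarrow> complex) set set \<Rightarrow> ('v list \<Rightarrow> complex) set set" where
  "cohomology_closure L p W =
     {c \<in> reduced_cohomology L p. \<forall>\<epsilon>>0. \<exists>c'\<in>W. class_dist L p c c' < \<epsilon>}"

text \<open>The dimension of a closed \<open>G\<close>-invariant subspace \<open>W\<close> of the reduced cohomology. The quotient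
  Hilbert space \<open>W\<close> is isometric, \<open>G\<close>-equivariantly, to the space of the representatives of its
  classes that are orthogonal to the coboundaries.\<close>

definition cohomology_dim ::
    "('g, 'm) monoid_scheme \<Rightarrow> ('g \<Rightarrow> 'v \<Rightarrow> 'v) \<Rightarrow> 'v set set \<Rightarrow> nat \<Rightarrow>
     ('v list \<Rightarrow> complex) set set \<Rightarrow> real" where
  "cohomology_dim G \<alpha> L p W =
     von_Neumann_dim G (\<lambda>g. map (\<alpha> g)) (ordered_simplices L p)
       (\<Union>W \<inter> l2_orthogonal (ordered_simplices L p) (closed_coboundaries L p))"

definition l2_betti_wrt ::
    "(nat \<Rightarrow> 'v set set) \<Rightarrow> ('g, 'm) monoid_scheme \<Rightarrow> ('g \<Rightarrow> 'v \<Rightarrow> 'v) \<Rightarrow> nat \<Rightarrow> ereal" where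
  "l2_betti_wrt K G \<alpha> p =
     lim (\<lambda>i. lim (\<lambda>j. ereal (cohomology_dim G \<alpha> (K i) p
       (cohomology_closure (K i) p (restrict_class (K i) p ` reduced_cohomology (K j) p)))))"

text \<open>The value does not depend on the exhaustion, so any one of them may be chosen; one exists
  whenever \<open>L\<close> is countable (see below). The terms with \<open>j < i\<close> have no meaning and no influence on
  the inner limit.\<close>

definition l2_betti ::
    "('g, 'm) monoid_scheme \<Rightarrow> ('g \<Rightarrow> 'v \<Rightarrow> 'v) \<Rightarrow> 'v set set \<Rightarrow> nat \<Rightarrow> ereal" where
  "l2_betti G \<alpha> L p = l2_betti_wrt (SOME K. cocompact_exhaustion G \<alpha> L K) G \<alpha> p"

lemma cocompact_exhaustion_exists:
  assumes "group G" and L: "abstract_simplicial_complex L" and act: "simplicial_action G \<alpha> L"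
    and count: "countable L"
  shows "\<exists>K. cocompact_exhaustion G \<alpha> L K"
proof -
  interpret group G by fact
  interpret group_action G "\<Union>L" \<alpha> using act by (simp add: simplicial_action_def)
  have comp: "\<alpha> g ` \<alpha> h ` t = \<alpha> (g \<otimes>\<^bsub>G\<^esub> h) ` t"
    if "g \<in> carrier G" "h \<in> carrier G" "t \<subseteq> \<Union>L" for g h t
    unfolding image_image using that
    by (intro image_cong refl composition_rule[symmetric]) auto
  have one: "\<alpha> \<one>\<^bsub>G\<^esub> ` t = t" if "t \<subseteq> \<Union>L" for t
  proof -
    have "\<alpha> \<one>\<^bsub>G\<^esub> ` t = (\<lambda>x\<in>\<Union>L. x) ` t" by (simp only: id_eq_one)
    also have "\<dots> = (\<lambda>x. x) ` t" using that by (intro image_cong) auto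
    finally show ?thesis by simp
  qed
  have finL: "finite s" and neL: "s \<noteq> {}" and faceL: "t \<subseteq> s \<Longrightarrow> t \<noteq> {} \<Longrightarrow> t \<in> L"
    if "s \<in> L" for s t
    using L that unfolding abstract_simplicial_complex_def by blast+
  have aL: "\<alpha> g ` t \<in> L" if "g \<in> carrier G" "t \<in> L" for g t
    using act that by (simp add: simplicial_action_def)
  define K where "K n = {t \<in> L. \<exists>s\<in>L. to_nat_on L s < n \<and> (\<exists>g\<in>carrier G. t \<subseteq> \<alpha> g ` s)}" for n
  have cplx: "abstract_simplicial_complex (K n)" for n
    unfolding abstract_simplicial_complex_def
  proof (intro ballI conjI allI impI)
    fix s assume s: "s \<in> K n"
    then have "s \<in> L" by (simp add: K_def)
    then show "finite s" "s \<noteq> {}" by (rule finL, rule neL)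
    fix t assume t: "t \<subseteq> s \<and> t \<noteq> {}"
    then have "t \<in> L" using faceL[OF \<open>s \<in> L\<close>] by blast
    then show "t \<in> K n" using s t unfolding K_def mem_Collect_eq by (meson order_trans)
  qed
  have inv: "\<alpha> g ` t \<in> K n" if g: "g \<in> carrier G" and t: "t \<in> K n" for g t n
  proof -
    from t obtain s h where s: "s \<in> L" "to_nat_on L s < n" "h \<in> carrier G" "t \<subseteq> \<alpha> h ` s"
      and tL: "t \<in> L" unfolding K_def by blast
    have "\<alpha> g ` t \<subseteq> \<alpha> g ` \<alpha> h ` s" using s(4) by (rule image_mono)
    also have "\<dots> = \<alpha> (g \<otimes>\<^bsub>G\<^esub> h) ` s" by (rule comp[OF g s(3) Union_upper[OF s(1)]])
    finally show ?thesis
      unfolding K_def mem_Collect_eq using s(1,2) aL[OF g tL] m_closed[OF g s(3)] by meson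
  qed
  have coc: "cocompact G \<alpha> (K n)" for n
  proof -
    define T where "T = (\<Union>s\<in>{s \<in> L. to_nat_on L s < n}. Pow s)"
    have "inj_on (to_nat_on L) {s \<in> L. to_nat_on L s < n}"
      using inj_on_to_nat_on[OF count] by (rule inj_on_subset) auto
    moreover have "finite (to_nat_on L ` {s \<in> L. to_nat_on L s < n})"
      by (rule finite_subset[of _ "{..<n}"]) auto
    ultimately have "finite {s \<in> L. to_nat_on L s < n}" by (rule finite_imageD[rotated])
    then have finT: "finite T"
      unfolding T_def by (auto intro: finL)
    have "orbits G (K n) (\<lambda>g s. \<alpha> g ` s) \<subseteq> orbit G (\<lambda>g s. \<alpha> g ` s) ` T"
    proof
      fix O' assume "O' \<in> orbits G (K n) (\<lambda>g s. \<alpha> g ` s)"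
      then obtain t where t: "t \<in> K n" and O': "O' = orbit G (\<lambda>g s. \<alpha> g ` s) t"
        by (auto simp: orbits_def)
      from t obtain s h where s: "s \<in> L" "to_nat_on L s < n" "h \<in> carrier G" "t \<subseteq> \<alpha> h ` s"
        and tL: "t \<in> L" unfolding K_def by blast
      obtain u where u: "u \<subseteq> s" "t = \<alpha> h ` u" using s(4) by (auto simp: subset_image_iff)
      have uL: "u \<subseteq> \<Union>L" using u s by auto
      have "\<alpha> (inv\<^bsub>G\<^esub> h) ` t = \<alpha> \<one>\<^bsub>G\<^esub> ` u"
        unfolding u(2) l_inv[OF s(3), symmetric] by (rule comp[OF inv_closed[OF s(3)] s(3) uL])
      then have ut: "u = \<alpha> (inv\<^bsub>G\<^esub> h) ` t" using one[OF uL] by simp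
      have tL': "t \<subseteq> \<Union>L" using tL by auto
      have "\<alpha> g ` t \<in> orbit G (\<lambda>g s. \<alpha> g ` s) u" if g: "g \<in> carrier G" for g
      proof -
        have "\<alpha> g ` t = \<alpha> (g \<otimes>\<^bsub>G\<^esub> h) ` u"
          unfolding u(2) by (rule comp[OF g s(3) uL])
        then show ?thesis unfolding orbit_def using m_closed[OF g s(3)] by blast
      qed
      moreover have "\<alpha> g ` u \<in> orbit G (\<lambda>g s. \<alpha> g ` s) t" if g: "g \<in> carrier G" for g
      proof -
        have "\<alpha> g ` u = \<alpha> (g \<otimes>\<^bsub>G\<^esub> inv\<^bsub>G\<^esub> h) ` t"
          unfolding ut by (rule comp[OF g inv_closed[OF s(3)] tL'])
        then show ?thesis unfolding orbit_def using m_closed[OF g inv_closed[OF s(3)]] by blast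
      qed
      ultimately have "orbit G (\<lambda>g s. \<alpha> g ` s) t = orbit G (\<lambda>g s. \<alpha> g ` s) u"
        unfolding orbit_def by blast
      then show "O' \<in> orbit G (\<lambda>g s. \<alpha> g ` s) ` T"
        using O' u s unfolding T_def by blast
    qed
    then show ?thesis
      unfolding cocompact_def using finT by (rule finite_subset[OF _ finite_imageI])
  qed
  have "incseq K" by (rule incseq_SucI) (auto simp: K_def less_Suc_eq)
  moreover have "(\<Union>n. K n) = L"
  proof -
    have "t \<in> K (Suc (to_nat_on L t))" if "t \<in> L" for t
    proof -
      have "t \<subseteq> \<alpha> \<one>\<^bsub>G\<^esub> ` t" using one[of t] that by blast
      then show ?thesis unfolding K_def mem_Collect_eq using that one_closed lessI by meson
    qed
    moreover have "K n \<subseteq> L" for n by (auto simp: K_def)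
    ultimately show ?thesis by blast
  qed
  ultimately show ?thesis
    unfolding cocompact_exhaustion_def using cplx inv coc by blast
qed

end

theory Submission
  imports Defs "Jordan_Normal_Form.Jordan_Normal_Form_Existence"
begin

text \<open>Write \<open>p = Suc q\<close>, let \<open>U\<close> and \<open>V\<close> be sets of
  orbit representatives of the \<open>q\<close>- and \<open>p\<close>-simplices, and let
  \<open>\<kappa>\<close> be the cardinality of the field. In the coordinates given by the
  representatives a \<open>p\<close>-cochain is a function on \<open>G \<times> V\<close>, and its
  coboundary is computed by finitely many integer rules that read the function at translates
  \<open>h g\<close>. A rule makes sense verbatim on \<open>D n \<times> V\<close>, with
  \<open>\<sigma> n h x\<close> in place of \<open>h g\<close>; this gives finite integer matrices
  modelling the coboundaries. Up to a negligible set of points, functions solving the model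
  equations over the finite field are separated approximate orbits. Hence the entropy of the kernel
  of a coboundary is at least \<open>ln \<kappa>\<close> times the limiting normalised dimension of
  the model kernel (\<open>entropy_ge\<close>), whereas the entropy of all \<open>q\<close>-cochains
  is at most \<open>card U * ln \<kappa>\<close> (\<open>entropy_le\<close>).\<close>

text \<open>Let \<open>R\<close> be the limit superior of the normalised rank over the finite field
  of the model \<open>A n\<close> of the first coboundary. Then its kernel has entropy at least
  \<open>(card U - R) * ln \<kappa>\<close>, so it remains to bound the entropy of the second kernel
  from below by \<open>(R + \<beta>) * ln \<kappa>\<close>, \<open>\<beta>\<close> the Betti number:
  the rank of the model \<open>B n\<close> of the second coboundary is to be at most \<open>card V -
  R - \<beta>\<close> per point. Integer vectors independent over some field are independent over
  the complex numbers. There the columns of \<open>A n\<close> (few excepted), the rows of \<open>B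
  n\<close> and the common kernel of \<open>B n\<close> and the transpose of \<open>A n\<close> are
  orthogonal, so their dimensions add up to at most \<open>card V\<close> per point
  (\<open>model_rank_bound\<close>).\<close>

text \<open>The common kernel has asymptotically at least \<open>\<beta>\<close> dimensions per
  point; this is Lueck's approximation argument in the sofic setting
  (\<open>eventually_kernel_dim_ge\<close>). It is the kernel of a positive integer matrix, the
  model Laplacian \<open>\<Delta>\<close>, bounded by a constant \<open>c\<close>. The nonzero
  eigenvalues have product at least \<open>1\<close>, so few of them are small and the normalised
  trace of \<open>(1 - \<Delta> / c)^k\<close> is, for large \<open>k\<close>, nearly the dimension
  of the kernel. That trace is a local quantity and converges to the corresponding trace over the
  group, which is at least \<open>\<beta>\<close> because \<open>(1 - \<Delta> / c)^k\<close> fixes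
  the square-summable harmonic cochains (\<open>harmonic_dim_le_moments\<close>). As only finitely
  many orbits of \<open>(p + 1)\<close>-simplices can be used at a time, all this is done for the
  stages of a cocompact exhaustion.\<close>

section \<open>Independent families and kernels over finite fields\<close>

definition indep_family :: "'y set => 'i set => ('i => 'y => 'f::field) => bool" where
  "indep_family X I a \<longleftrightarrow> (\<forall>c. (\<forall>x\<in>X. (\<Sum>i\<in>I. c i * a i x) = 0) --> (\<forall>i\<in>I. c i = 0))"

lemma indep_familyD:
  "indep_family X I a ==> (\<And>x. x \<in> X ==> (\<Sum>i\<in>I. c i * a i x) = 0) ==> i \<in> I ==> c i = 0"
  unfolding indep_family_def by blast

lemma indep_family_mono:
  assumes "indep_family X I a" "J \<subseteq> I" "finite I"
  shows "indep_family X J a"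
  unfolding indep_family_def
proof (intro allI impI ballI)
  fix c i assume c: "\<forall>x\<in>X. (\<Sum>i\<in>J. c i * a i x) = 0" and i: "i \<in> J"
  have "(\<Sum>i\<in>I. (if i \<in> J then c i else 0) * a i x) = (\<Sum>i\<in>J. c i * a i x)" for x
    using assms by (intro sum.mono_neutral_cong_right) auto
  then have *: "(\<Sum>i\<in>I. (if i \<in> J then c i else 0) * a i x) = 0" if "x \<in> X" for x
    using c that by simp
  have "i \<in> I" using i assms(2) by blast
  from indep_familyD[OF assms(1) * this] have "(if i \<in> J then c i else 0) = 0" .
  then show "c i = 0" using i by simp
qed

lemma indep_family_card_le:
  fixes a :: "'i => 'y => 'f::field"
  assumes "finite X" "finite I" "indep_family X I a"
  shows "card I <= card X"
  using assms
proof (induction X arbitrary: I a rule: finite_induct)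
  case empty
  have "(1::'f) = 0" if "i \<in> I" for i
    using indep_familyD[OF empty(2), of "\<lambda>_. 1"] that by simp
  then show ?case by (cases "I = {}") auto
next
  case (insert x X)
  show ?case
  proof (cases "\<forall>i\<in>I. a i x = 0")
    case True
    have "indep_family X I a"
      using insert.prems(2) True unfolding indep_family_def by simp
    then have "card I <= card X" using insert.IH insert.prems(1) by blast
    then show ?thesis using insert.hyps by simp
  next
    case False
    then obtain j where j: "j \<in> I" "a j x ~= 0" by blast
    have "indep_family X (I - {j}) (\<lambda>i y. a i y - a i x / a j x * a j y)"
      unfolding indep_family_def
    proof (intro allI impI)
      fix c assume c: "\<forall>y\<in>X. (\<Sum>i\<in>I - {j}. c i * (a i y - a i x / a j x * a j y)) = 0"
      define d where "d i = (if i = j then - (\<Sum>i\<in>I - {j}. c i * a i x) / a j x else c i)" for i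
      have split: "(\<Sum>i\<in>I. d i * a i y) = d j * a j y + (\<Sum>i\<in>I - {j}. c i * a i y)" for y
        unfolding sum.remove[OF insert.prems(1) j(1)]
        by (intro arg_cong2[of _ _ _ _ "(+)"] refl sum.cong) (auto simp: d_def)
      have "(\<Sum>i\<in>I. d i * a i y) = 0" if "y \<in> insert x X" for y
      proof (cases "y = x")
        case True
        then show ?thesis unfolding split using j by (simp add: d_def)
      next
        case False
        then have "0 = (\<Sum>i\<in>I - {j}. c i * (a i y - a i x / a j x * a j y))" using c that by simp
        also have "... = (\<Sum>i\<in>I - {j}. c i * a i y) - (\<Sum>i\<in>I - {j}. c i * a i x) / a j x * a j y"
          by (simp add: algebra_simps sum_subtractf sum_distrib_left sum_divide_distrib)
        also have "... = (\<Sum>i\<in>I. d i * a i y)" unfolding split by (simp add: d_def)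
        finally show ?thesis by simp
      qed
      then have "d i = 0" if "i \<in> I" for i using indep_familyD[OF insert.prems(2)] that by blast
      then show "\<forall>i\<in>I - {j}. c i = 0" by (metis DiffE d_def singletonI)
    qed
    then have "card (I - {j}) <= card X" using insert.IH insert.prems(1) by blast
    then show ?thesis using insert.hyps insert.prems(1) j by simp
  qed
qed

text \<open>Eliminating by cross-multiplication stays within the integers, and a pivot that is
  nonzero in the first field is a nonzero integer.\<close>

lemma indep_family_of_int_char_0:
  fixes a :: "'i => 'y => int"
  assumes "finite I" "indep_family X I (\<lambda>i x. of_int (a i x) :: 'k::field)"
  shows "indep_family X I (\<lambda>i x. of_int (a i x) :: 'f::field_char_0)"
  using assms
proof (induction I arbitrary: a rule: finite_induct)
  case empty
  show ?case by (simp add: indep_family_def)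
next
  case (insert j I)
  have sum_j: "(\<Sum>i\<in>insert j I. f i) = f j + (\<Sum>i\<in>I. f i)" for f :: "'i => 'b::comm_monoid_add"
    using insert.hyps by simp
  have ne: "i ~= j" if "i \<in> I" for i using that insert.hyps by auto
  have "\<exists>x\<in>X. (of_int (a j x) :: 'k) ~= 0"
  proof (rule ccontr)
    assume "\<not> (\<exists>x\<in>X. (of_int (a j x) :: 'k) ~= 0)"
    then have z: "\<forall>x\<in>X. (of_int (a j x) :: 'k) = 0" by simp
    have "(\<Sum>i\<in>insert j I. (if i = j then 1 else 0) * (of_int (a i x) :: 'k)) = 0" if "x \<in> X" for x
      using z that ne by (intro sum.neutral) auto
    then have "(if j = j then 1 else 0 :: 'k) = 0"
      by (rule indep_familyD[OF insert.prems, of "\<lambda>i. if i = j then 1 else 0"]) auto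
    then show False by simp
  qed
  then obtain x where x: "x \<in> X" "(of_int (a j x) :: 'k) ~= 0" by (rule bexE)
  define w where "w i y = a j x * a i y - a i x * a j y" for i y
  have w_sum: "(\<Sum>i\<in>I. c i * of_int (w i y)) =
     of_int (a j x) * (\<Sum>i\<in>I. c i * of_int (a i y)) - of_int (a j y) * (\<Sum>i\<in>I. c i * of_int (a i x))"
    for c :: "'i => 'b::field" and y
    unfolding sum_distrib_left sum_subtractf[symmetric]
    by (intro sum.cong refl) (simp add: w_def algebra_simps)
  have "indep_family X I (\<lambda>i x. of_int (w i x) :: 'k)"
    unfolding indep_family_def
  proof (intro allI impI)
    fix c assume c: "\<forall>y\<in>X. (\<Sum>i\<in>I. c i * of_int (w i y) :: 'k) = 0"
    define d where "d i = (if i = j then - (\<Sum>i\<in>I. c i * of_int (a i x)) else c i * of_int (a j x))" for i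
    have "d i = 0" if "i \<in> insert j I" for i
    proof (rule indep_familyD[OF insert.prems _ that])
      fix y assume y: "y \<in> X"
      have "(\<Sum>i\<in>insert j I. d i * of_int (a i y)) = d j * of_int (a j y) + (\<Sum>i\<in>I. c i * of_int (a j x) * of_int (a i y))"
        unfolding sum_j by (intro arg_cong2[of _ _ _ _ "(+)"] refl sum.cong) (auto simp: d_def dest: ne)
      also have "... = (\<Sum>i\<in>I. c i * of_int (w i y))"
        unfolding w_sum by (simp add: d_def sum_distrib_left mult_ac)
      finally show "(\<Sum>i\<in>insert j I. d i * of_int (a i y)) = 0" using c y by simp
    qed
    then have "c i * of_int (a j x) = 0" if "i \<in> I" for i
      using that ne[OF that] by (metis d_def insertI2)
    then show "\<forall>i\<in>I. c i = 0" using x(2) by simp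
  qed
  then have IH: "indep_family X I (\<lambda>i x. of_int (w i x) :: 'f)" by (rule insert.IH)
  show ?case
    unfolding indep_family_def
  proof (intro allI impI)
    fix c assume c: "\<forall>y\<in>X. (\<Sum>i\<in>insert j I. c i * of_int (a i y) :: 'f) = 0"
    then have s: "(\<Sum>i\<in>I. c i * of_int (a i y)) = - (c j * of_int (a j y))" if "y \<in> X" for y
      using that unfolding sum_j by (simp only: add_eq_0_iff)
    have cI: "c i = 0" if "i \<in> I" for i
      by (rule indep_familyD[OF IH _ that]) (simp add: w_sum s x(1))
    have "a j x ~= 0" using x(2) by auto
    moreover have "c j * of_int (a j x) = 0" using s[OF x(1)] cI by simp
    ultimately show "\<forall>i\<in>insert j I. c i = 0" using cI by simp
  qed
qed

lemma exists_spanning_indep_subfamily: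
  fixes a :: "'i => 'y => 'f::field"
  assumes "finite I"
  shows "\<exists>Y\<subseteq>I. indep_family X Y a \<and> (\<forall>i\<in>I. \<exists>c. \<forall>x\<in>X. a i x = (\<Sum>y\<in>Y. c y * a y x))"
  using assms
proof (induction I rule: finite_induct)
  case empty
  show ?case by (auto simp: indep_family_def)
next
  case (insert j I)
  then obtain Y where Y: "Y \<subseteq> I" "indep_family X Y a"
    "\<And>i. i \<in> I ==> \<exists>c. \<forall>x\<in>X. a i x = (\<Sum>y\<in>Y. c y * a y x)" by blast
  show ?case
  proof (cases "\<exists>c. \<forall>x\<in>X. a j x = (\<Sum>y\<in>Y. c y * a y x)")
    case True
    then have "\<exists>c. \<forall>x\<in>X. a i x = (\<Sum>y\<in>Y. c y * a y x)" if "i \<in> insert j I" for i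
      using Y(3) that by (cases "i = j") simp_all
    moreover have "Y \<subseteq> insert j I" using Y(1) by blast
    ultimately show ?thesis using Y(2) by (intro exI[of _ Y]) simp
  next
    case False
    have finY: "finite Y" and jY: "j \<notin> Y" using Y(1) insert.hyps finite_subset by auto
    have "indep_family X (insert j Y) a"
      unfolding indep_family_def
    proof (intro allI impI)
      fix c assume "\<forall>x\<in>X. (\<Sum>i\<in>insert j Y. c i * a i x) = 0"
      then have s: "c j * a j x + (\<Sum>i\<in>Y. c i * a i x) = 0" if "x \<in> X" for x
        using finY jY that by simp
      have cj: "c j = 0"
      proof (rule ccontr)
        assume nz: "c j ~= 0"
        have "a j x = (\<Sum>y\<in>Y. (- c y / c j) * a y x)" if "x \<in> X" for x
        proof -
          have "(\<Sum>y\<in>Y. (- c y / c j) * a y x) = - (\<Sum>i\<in>Y. c i * a i x) / c j"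
            by (simp add: sum_negf sum_divide_distrib)
          also have "(\<Sum>i\<in>Y. c i * a i x) = - (c j * a j x)"
            using s[OF that] by (simp only: add_eq_0_iff)
          also have "- (- (c j * a j x)) / c j = a j x" using nz by simp
          finally show ?thesis by (rule sym)
        qed
        then have "\<forall>x\<in>X. a j x = (\<Sum>y\<in>Y. (- c y / c j) * a y x)" by (rule ballI)
        then have "\<exists>c. \<forall>x\<in>X. a j x = (\<Sum>y\<in>Y. c y * a y x)" by (rule exI[of _ "\<lambda>y. - c y / c j"])
        then show False using False by (rule notE[rotated])
      qed
      have z: "(\<Sum>i\<in>Y. c i * a i x) = 0" if "x \<in> X" for x
        using s[OF that] cj by simp
      have "c i = 0" if "i \<in> Y" for i
        using z that by (rule indep_familyD[OF Y(2)])
      then show "\<forall>i\<in>insert j Y. c i = 0" using cj by simp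
    qed
    moreover have "\<exists>c. \<forall>x\<in>X. a i x = (\<Sum>y\<in>insert j Y. c y * a y x)" if i: "i \<in> insert j I" for i
    proof (cases "i = j")
      case True
      have "(\<Sum>y\<in>Y. (if y = j then 1 else 0) * a y x) = 0" for x
        using jY by (intro sum.neutral) auto
      then have "\<forall>x\<in>X. a i x = (\<Sum>y\<in>insert j Y. (if y = j then 1 else 0) * a y x)"
        using finY jY True by simp
      then show ?thesis by (rule exI[of _ "\<lambda>y. if y = j then 1 else 0"])
    next
      case False
      then have "i \<in> I" using i by simp
      from Y(3)[OF this] obtain c where c: "\<forall>x\<in>X. a i x = (\<Sum>y\<in>Y. c y * a y x)" by (rule exE)
      have "(\<Sum>y\<in>Y. (if y = j then 0 else c y) * a y x) = (\<Sum>y\<in>Y. c y * a y x)" for x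
        using jY by (intro sum.cong) auto
      then have "\<forall>x\<in>X. a i x = (\<Sum>y\<in>insert j Y. (if y = j then 0 else c y) * a y x)"
        using finY jY c by simp
      then show ?thesis by (rule exI[of _ "\<lambda>y. if y = j then 0 else c y"])
    qed
    moreover have "insert j Y \<subseteq> insert j I" using Y(1) by blast
    ultimately show ?thesis by (intro exI[of _ "insert j Y"]) simp
  qed
qed

definition supported_fun :: "'i set => ('i => 'k::zero) set" where
  "supported_fun I = {u. \<forall>i. i \<notin> I --> u i = 0}"

lemma card_supported_fun:
  assumes "finite I"
  shows "card (supported_fun I :: ('i => 'k::{zero,finite}) set) = CARD('k) ^ card I"
    and "finite (supported_fun I :: ('i => 'k) set)"
proof -
  have bij: "bij_betw (\<lambda>u. restrict u I) (supported_fun I) (PiE I (\<lambda>_. UNIV :: 'k set))"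
    by (rule bij_betw_byWitness[where f' = "\<lambda>u i. if i \<in> I then u i else 0"])
       (auto simp: supported_fun_def fun_eq_iff PiE_def extensional_def)
  have "finite (PiE I (\<lambda>_. UNIV :: 'k set))" using assms by (intro finite_PiE) auto
  then show "finite (supported_fun I :: ('i => 'k) set)"
    using bij_betw_finite[OF bij] by simp
  show "card (supported_fun I :: ('i => 'k) set) = CARD('k) ^ card I"
    using bij_betw_same_card[OF bij] assms by (simp add: card_PiE)
qed

text \<open>Each additive functional cuts an additive group down by a factor of at most the size of
  the field.\<close>

lemma card_le_card_common_kernel:
  fixes H :: "('x => 'k::{field,finite}) set" and f :: "'l => ('x => 'k) => 'k"
  assumes "finite H" "finite R"
    and diff: "\<And>u v. u \<in> H ==> v \<in> H ==> (\<lambda>i. u i - v i) \<in> H"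
    and add: "\<And>l u v. l \<in> R ==> u \<in> H ==> v \<in> H ==> f l (\<lambda>i. u i - v i) = f l u - f l v"
  shows "card H <= CARD('k) ^ card R * card {u\<in>H. \<forall>l\<in>R. f l u = 0}"
  using assms(2,4)
proof (induction R rule: finite_induct)
  case empty
  show ?case by simp
next
  case (insert l R)
  define H1 where "H1 = {u\<in>H. \<forall>l\<in>R. f l u = 0}"
  define H2 where "H2 = {u\<in>H. \<forall>l\<in>insert l R. f l u = 0}"
  have fin: "finite H1" "finite H2" using assms(1) by (auto simp: H1_def H2_def)
  have fib: "card {u\<in>H1. f l u = k} <= card H2" for k
  proof (cases "{u\<in>H1. f l u = k} = {}")
    case False
    then obtain v where v: "v \<in> H1" "f l v = k" by blast
    show ?thesis
    proof (rule card_inj_on_le[of "\<lambda>u i. u i - v i"])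
      show "(\<lambda>u i. u i - v i) ` {u \<in> H1. f l u = k} \<subseteq> H2"
        using v insert.prems diff by (auto simp: H1_def H2_def)
    qed (auto simp: inj_on_def fin fun_eq_iff)
  qed (simp only: card.empty)
  have "H1 = (\<Union>k\<in>UNIV. {u\<in>H1. f l u = k})" by auto
  then have "card H1 <= (\<Sum>k\<in>UNIV. card {u\<in>H1. f l u = k})"
    using card_UN_le[of "UNIV::'k set" "\<lambda>k. {u\<in>H1. f l u = k}"] by simp
  also have "... <= CARD('k) * card H2"
    using sum_bounded_above[of "UNIV :: 'k set" "\<lambda>k. card {u\<in>H1. f l u = k}" "card H2"] fib by simp
  finally have *: "card H1 <= CARD('k) * card H2" .
  have "card H <= CARD('k) ^ card R * card H1" unfolding H1_def by (rule insert) (auto intro: insert.prems)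
  also have "... <= CARD('k) ^ card R * (CARD('k) * card H2)" using * by simp
  also have "... = CARD('k) ^ card (insert l R) * card H2" using insert.hyps by simp
  finally show ?case by (simp add: H2_def)
qed

lemma card_kernel_rows:
  fixes b :: "'i => 'y => 'k::{field,finite}"
  assumes "finite X" "finite Y"
    and "\<And>i. i \<in> I ==> \<exists>c. \<forall>x\<in>X. b i x = (\<Sum>y\<in>Y. c y * b y x)"
  shows "CARD('k) ^ card X <= CARD('k) ^ card Y * card {u\<in>supported_fun X. \<forall>i\<in>I. (\<Sum>x\<in>X. b i x * u x) = 0}"
proof -
  define f where "f i u = (\<Sum>x\<in>X. b i x * u x)" for i u
  have "card (supported_fun X :: ('y => 'k) set) <= CARD('k) ^ card Y * card {u\<in>supported_fun X. \<forall>i\<in>Y. f i u = 0}"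
    by (rule card_le_card_common_kernel)
       (use assms card_supported_fun in \<open>auto simp: supported_fun_def f_def algebra_simps sum_subtractf\<close>)
  also have "card {u\<in>supported_fun X. \<forall>i\<in>Y. f i u = 0} <= card {u\<in>supported_fun X. \<forall>i\<in>I. f i u = 0}"
  proof (intro card_mono subsetI)
    show "finite {u\<in>supported_fun X. \<forall>i\<in>I. f i u = 0}"
      by (rule finite_subset[OF _ card_supported_fun(2)[OF assms(1)]]) auto
    fix u assume u: "u \<in> {u\<in>supported_fun X. \<forall>i\<in>Y. f i u = 0}"
    have "f i u = 0" if i: "i \<in> I" for i
    proof -
      obtain c where c: "\<forall>x\<in>X. b i x = (\<Sum>y\<in>Y. c y * b y x)" using assms(3)[OF i] by blast
      have "f i u = (\<Sum>x\<in>X. (\<Sum>y\<in>Y. c y * b y x * u x))" using c by (simp add: f_def sum_distrib_right)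
      also have "... = (\<Sum>y\<in>Y. c y * f y u)"
        by (subst sum.swap) (simp add: f_def sum_distrib_left mult.assoc)
      also have "... = 0" using u by simp
      finally show ?thesis .
    qed
    then show "u \<in> {u\<in>supported_fun X. \<forall>i\<in>I. f i u = 0}" using u by simp
  qed
  finally show ?thesis using card_supported_fun(1)[OF assms(1), where 'k='k] by (simp add: f_def)
qed

lemma card_kernel_columns:
  fixes a :: "'i => 'y => 'k::{field,finite}"
  assumes "finite I" "Y \<subseteq> I"
    and "\<And>i. i \<in> I ==> \<exists>c. \<forall>x\<in>X. a i x = (\<Sum>y\<in>Y. c y * a y x)"
  shows "CARD('k) ^ card I <= CARD('k) ^ card Y * card {u\<in>supported_fun I. \<forall>x\<in>X. (\<Sum>i\<in>I. u i * a i x) = 0}"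
proof -
  define Ker where "Ker = {u\<in>supported_fun I. \<forall>x\<in>X. (\<Sum>i\<in>I. u i * a i x) = 0}"
  have fin: "finite Ker" unfolding Ker_def
    by (rule finite_subset[OF _ card_supported_fun(2)[OF assms(1)]]) auto
  have finY: "finite Y" using assms finite_subset by blast
  obtain c where c: "\<And>i x. i \<in> I ==> x \<in> X ==> a i x = (\<Sum>y\<in>Y. c i y * a y x)"
    using assms(3) by metis
  define ext where "ext w i = (if i \<in> Y then - (\<Sum>j\<in>I - Y. w j * c j i) else w i)" for w :: "'i => 'k" and i
  have "ext w \<in> Ker" if w: "w \<in> supported_fun (I - Y)" for w
  proof -
    have "(\<Sum>i\<in>I. ext w i * a i x) = 0" if x: "x \<in> X" for x
    proof -
      have "(\<Sum>i\<in>I. ext w i * a i x) = (\<Sum>i\<in>I - Y. ext w i * a i x) + (\<Sum>i\<in>Y. ext w i * a i x)"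
        using sum.subset_diff[OF assms(2,1)] by blast
      also have "(\<Sum>i\<in>Y. ext w i * a i x) = - (\<Sum>i\<in>Y. \<Sum>j\<in>I - Y. w j * c j i * a i x)"
        by (simp add: ext_def sum_distrib_right sum_negf)
      also have "(\<Sum>i\<in>Y. \<Sum>j\<in>I - Y. w j * c j i * a i x) = (\<Sum>j\<in>I - Y. w j * a j x)"
        by (subst sum.swap) (auto simp: c x sum_distrib_left mult.assoc intro!: sum.cong)
      also have "(\<Sum>i\<in>I - Y. ext w i * a i x) = (\<Sum>i\<in>I - Y. w i * a i x)"
        by (intro sum.cong) (auto simp: ext_def)
      finally show ?thesis by simp
    qed
    moreover have "ext w \<in> supported_fun I"
      using w assms(2) by (auto simp: supported_fun_def ext_def)
    ultimately show ?thesis by (simp add: Ker_def)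
  qed
  moreover have "inj_on ext (supported_fun (I - Y))"
  proof (rule inj_onI)
    fix w w' assume w: "w \<in> supported_fun (I - Y)" "w' \<in> supported_fun (I - Y)" and eq: "ext w = ext w'"
    show "w = w'"
    proof
      fix i show "w i = w' i"
        using w fun_cong[OF eq, of i] by (cases "i \<in> Y") (auto simp: ext_def supported_fun_def)
    qed
  qed
  ultimately have "card (supported_fun (I - Y) :: ('i => 'k) set) <= card Ker"
    using fin by (intro card_inj_on_le[of ext]) auto
  then have "CARD('k) ^ card Y * CARD('k) ^ card (I - Y) <= CARD('k) ^ card Y * card Ker"
    using assms(1) card_supported_fun(1)[of "I - Y", where 'k='k] by simp
  moreover have "card Y + card (I - Y) = card I"
    using assms finY by (metis card_Diff_subset card_mono le_add_diff_inverse)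
  ultimately show ?thesis by (simp add: Ker_def flip: power_add)
qed

unbundle no vec_syntax

section \<open>Kernels of positive integer matrices\<close>

lemma pow_mat_Suc_left:
  assumes A: "A \<in> carrier_mat n n"
  shows "A ^\<^sub>m Suc l = A * A ^\<^sub>m l"
proof (induction l)
  case (Suc l)
  then have "A ^\<^sub>m Suc (Suc l) = A * A ^\<^sub>m l * A" by simp
  also have "... = A * (A ^\<^sub>m l * A)" using A by (intro assoc_mult_mat[of _ n n _ n _ n]) auto
  finally show ?case by simp
qed (use A in simp)

text \<open>A large power kills the generalised eigenspace of \<open>0\<close>.\<close>

lemma jordan_matrix_pow_zero_column:
  fixes n_as :: "(nat \<times> 'a::field) list"
  assumes "i < sum_list (map fst n_as)" "jordan_matrix n_as $$ (i, i) = 0"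
    "sum_list (map fst n_as) <= r" "j < sum_list (map fst n_as)"
  shows "(jordan_matrix n_as ^\<^sub>m r) $$ (j, i) = 0"
  using assms
proof (induction n_as arbitrary: i j)
  case Nil
  then show ?case by simp
next
  case (Cons na n_as)
  obtain n a where na: "na = (n, a)" by (cases na)
  let ?m = "sum_list (map fst n_as)"
  let ?B = "jordan_block n a" and ?J = "jordan_matrix n_as"
  have pow: "jordan_matrix ((n, a) # n_as) ^\<^sub>m r =
      four_block_mat (?B ^\<^sub>m r) (0\<^sub>m n ?m) (0\<^sub>m ?m n) (?J ^\<^sub>m r)"
    unfolding jordan_matrix_Cons by (rule pow_four_block_mat) auto
  have dims: "dim_row ?J = ?m" "dim_col ?J = ?m" by simp_all
  have powdims: "dim_row (?J ^\<^sub>m r) = ?m" "dim_col (?J ^\<^sub>m r) = ?m" by simp_all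
  show ?case
  proof (cases "i < n")
    case True
    then have "a = 0" using Cons.prems(2) by (simp add: na jordan_matrix_Cons)
    show ?thesis
    proof (cases "j < n")
      case True
      then show ?thesis using \<open>i < n\<close> \<open>a = 0\<close> Cons.prems(3)
        unfolding na pow by (simp add: jordan_block_pow powdims)
    next
      case False
      then show ?thesis using \<open>i < n\<close> Cons.prems by (simp add: na pow powdims)
    qed
  next
    case False
    then have i: "i - n < ?m" "?J $$ (i - n, i - n) = 0" 
      using Cons.prems(1,2) by (simp_all add: na jordan_matrix_Cons)
    show ?thesis
    proof (cases "j < n")
      case True
      then show ?thesis using False Cons.prems by (simp add: na pow powdims)
    next
      case jF: False
      have "(?J ^\<^sub>m r) $$ (j - n, i - n) = 0"
        using Cons.IH[OF i] Cons.prems jF by (simp add: na)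
      then show ?thesis using False jF Cons.prems by (simp add: na pow powdims)
    qed
  qed
qed

lemma upper_triangular_pow_diag:
  fixes A :: "'a::comm_ring_1 mat"
  assumes A: "A \<in> carrier_mat n n" and ut: "\<And>i j. i < n ==> j < i ==> A $$ (i, j) = 0"
  shows "(\<forall>i<n. \<forall>j<i. (A ^\<^sub>m k) $$ (i, j) = 0) \<and> (\<forall>i<n. (A ^\<^sub>m k) $$ (i, i) = (A $$ (i, i)) ^ k)"
proof (induction k)
  case 0
  show ?case using A by auto
next
  case (Suc k)
  have Ak: "A ^\<^sub>m k \<in> carrier_mat n n" using A by simp
  have e: "(A ^\<^sub>m Suc k) $$ (i, j) = (\<Sum>l<n. (A ^\<^sub>m k) $$ (i, l) * A $$ (l, j))" if "i < n" "j < n" for i j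
    using that A Ak by (simp add: scalar_prod_def lessThan_atLeast0)
  have "(A ^\<^sub>m Suc k) $$ (i, j) = 0" if "i < n" "j < i" for i j
  proof -
    have "(A ^\<^sub>m k) $$ (i, l) * A $$ (l, j) = 0" if l: "l < n" for l
      using Suc ut[OF l, of j] \<open>i < n\<close> \<open>j < i\<close> by (cases "l < i") auto
    then show ?thesis using that by (simp only: e) simp
  qed
  moreover have "(A ^\<^sub>m Suc k) $$ (i, i) = (A $$ (i, i)) ^ Suc k" if i: "i < n" for i
  proof -
    have "(A ^\<^sub>m k) $$ (i, l) * A $$ (l, i) = (if l = i then A $$ (i, i) ^ Suc k else 0)" if l: "l < n" for l
      using Suc ut[OF l, of i] i by (cases l i rule: linorder_cases) (auto simp: mult.commute)
    then have "(A ^\<^sub>m Suc k) $$ (i, i) = (\<Sum>l<n. if l = i then A $$ (i, i) ^ Suc k else 0)"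
      using i by (simp only: e) simp
    then show ?thesis using i by simp
  qed
  ultimately show ?case by blast
qed

lemma sum_diag_similar:
  fixes B P Q :: "'a::comm_ring_1 mat"
  assumes "B \<in> carrier_mat n n" "P \<in> carrier_mat n n" "Q \<in> carrier_mat n n" "Q * P = 1\<^sub>m n"
  shows "(\<Sum>i<n. (P * B * Q) $$ (i, i)) = (\<Sum>i<n. B $$ (i, i))"
proof -
  have qp: "(\<Sum>i<n. Q $$ (b, i) * P $$ (i, a)) = (if b = a then 1 else 0)" if "a < n" "b < n" for a b
  proof -
    have "(Q * P) $$ (b, a) = (\<Sum>i<n. Q $$ (b, i) * P $$ (i, a))"
      using that assms(2,3) by (simp add: scalar_prod_def lessThan_atLeast0)
    then show ?thesis using assms(4) that by simp
  qed
  have "P * B * Q = P * (B * Q)" using assms(1-3) by (intro assoc_mult_mat) auto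
  then have "(\<Sum>i<n. (P * B * Q) $$ (i, i)) = (\<Sum>i<n. \<Sum>a<n. P $$ (i, a) * (\<Sum>b<n. B $$ (a, b) * Q $$ (b, i)))"
    using assms(1-3) by (intro sum.cong) (auto simp: scalar_prod_def lessThan_atLeast0)
  also have "... = (\<Sum>i<n. \<Sum>b<n. \<Sum>a<n. P $$ (i, a) * B $$ (a, b) * Q $$ (b, i))"
    unfolding sum_distrib_left mult.assoc by (intro sum.cong refl sum.swap)
  also have "... = (\<Sum>b<n. \<Sum>a<n. \<Sum>i<n. P $$ (i, a) * B $$ (a, b) * Q $$ (b, i))"
    by (subst sum.swap, rule sum.cong[OF refl], rule sum.swap)
  also have "... = (\<Sum>b<n. \<Sum>a<n. B $$ (a, b) * (if b = a then 1 else 0))"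
  proof (intro sum.cong refl)
    fix a b assume "b \<in> {..<n}" "a \<in> {..<n}"
    then have "B $$ (a, b) * (if b = a then 1 else 0) = B $$ (a, b) * (\<Sum>i<n. Q $$ (b, i) * P $$ (i, a))"
      by (simp add: qp)
    then show "(\<Sum>i<n. P $$ (i, a) * B $$ (a, b) * Q $$ (b, i)) = B $$ (a, b) * (if b = a then 1 else 0)"
      by (simp add: sum_distrib_left mult_ac)
  qed
  also have "... = (\<Sum>b<n. B $$ (b, b))"
    by (intro sum.cong) (auto simp: if_distrib[of "\<lambda>x. _ * x"] cong: if_cong)
  finally show ?thesis .
qed

text \<open>A symmetric matrix has no nilpotent part: \<open>A (A w) = 0\<close> gives \<open>A w =
  0\<close> by pairing with \<open>w\<close>.\<close>

lemma hermitian_kernel_pow: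
  fixes S :: "nat => nat => real"
  assumes sym: "\<And>i j. i < n ==> j < n ==> S i j = S j i"
    and v: "v \<in> carrier_vec n" and A_def: "A = mat n n (\<lambda>(i, j). complex_of_real (S i j))"
    and "A ^\<^sub>m Suc k *\<^sub>v v = 0\<^sub>v n"
  shows "A *\<^sub>v v = 0\<^sub>v n"
  using assms(4)
proof (induction k)
  case 0
  then show ?case using A_def by (simp add: left_mult_one_mat[of _ n n])
next
  case (Suc k)
  have A: "A \<in> carrier_mat n n" by (simp add: A_def)
  define w where "w = A ^\<^sub>m k *\<^sub>v v"
  have w: "w \<in> carrier_vec n" unfolding w_def
    using A by (intro mult_mat_vec_carrier[of _ n n] v) simp
  have pw: "A ^\<^sub>m Suc l *\<^sub>v v = A *\<^sub>v (A ^\<^sub>m l *\<^sub>v v)" for l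
  proof -
    show ?thesis unfolding pow_mat_Suc_left[OF A] using A v assoc_mult_mat_vec[of A n n "A ^\<^sub>m l" n v] by simp
  qed
  have AA: "A *\<^sub>v (A *\<^sub>v w) = 0\<^sub>v n" using Suc.prems unfolding w_def by (simp only: pw)
  define y where "y = A *\<^sub>v w"
  have y: "y \<in> carrier_vec n" unfolding y_def using A w by simp
  have yi: "y $ i = (\<Sum>j<n. of_real (S i j) * w $ j)" if "i < n" for i
    using that w unfolding y_def A_def by (simp add: scalar_prod_def lessThan_atLeast0)
  have Ay: "(\<Sum>j<n. of_real (S i j) * y $ j) = 0" if "i < n" for i
  proof -
    have "(A *\<^sub>v y) $ i = (\<Sum>j<n. of_real (S i j) * y $ j)"
      using that y unfolding A_def by (simp add: scalar_prod_def lessThan_atLeast0)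
    then show ?thesis using AA that by (simp add: y_def)
  qed
  have "(\<Sum>i<n. y $ i * cnj (y $ i)) = (\<Sum>i<n. \<Sum>j<n. of_real (S i j) * w $ j * cnj (y $ i))"
    by (intro sum.cong) (auto simp: yi sum_distrib_right)
  also have "... = (\<Sum>j<n. \<Sum>i<n. of_real (S i j) * w $ j * cnj (y $ i))" by (rule sum.swap)
  also have "... = (\<Sum>j<n. w $ j * cnj (\<Sum>i<n. of_real (S j i) * y $ i))"
  proof (intro sum.cong refl)
    fix j assume j: "j \<in> {..<n}"
    show "(\<Sum>i<n. of_real (S i j) * w $ j * cnj (y $ i)) = w $ j * cnj (\<Sum>i<n. of_real (S j i) * y $ i)"
      unfolding cnj_sum sum_distrib_left using j by (intro sum.cong refl) (auto simp: sym[of j])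
  qed
  also have "... = 0" by (intro sum.neutral) (auto simp: Ay)
  finally have "complex_of_real (\<Sum>i<n. (cmod (y $ i))\<^sup>2) = 0"
    by (simp only: of_real_sum complex_norm_square)
  then have "(\<Sum>i<n. (cmod (y $ i))\<^sup>2) = 0" by (simp only: of_real_eq_0_iff)
  then have "y $ i = 0" if "i < n" for i
    using that by (subst (asm) sum_nonneg_eq_0_iff) auto
  then have "y = 0\<^sub>v n" using y by (intro eq_vecI) auto
  then have "A ^\<^sub>m Suc k *\<^sub>v v = 0\<^sub>v n" using pw[of k] by (simp add: y_def w_def)
  then show ?case by (rule Suc.IH)
qed

lemma hermitian_eigenvalue_bounds:
  fixes S :: "nat => nat => real"
  assumes sym: "\<And>i j. i < n ==> j < n ==> S i j = S j i"
    and psd: "\<And>u. 0 <= (\<Sum>i<n. \<Sum>j<n. u i * S i j * u j)"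
    and bd: "\<And>u. (\<Sum>i<n. \<Sum>j<n. u i * S i j * u j) <= C * (\<Sum>i<n. (u i)\<^sup>2)"
    and ev: "eigenvalue (mat n n (\<lambda>(i, j). complex_of_real (S i j))) l"
  obtains r where "l = complex_of_real r" "0 <= r" "r <= C"
proof -
  define A where "A = mat n n (\<lambda>(i, j). complex_of_real (S i j))"
  obtain v where v: "v \<in> carrier_vec n" "v ~= 0\<^sub>v n" "A *\<^sub>v v = l \<cdot>\<^sub>v v"
    using ev unfolding eigenvalue_def eigenvector_def A_def by auto
  have Av: "(\<Sum>j<n. of_real (S i j) * v $ j) = l * v $ i" if "i < n" for i
  proof -
    have "(A *\<^sub>v v) $ i = (\<Sum>j<n. of_real (S i j) * v $ j)"
      using that v(1) unfolding A_def by (simp add: scalar_prod_def lessThan_atLeast0)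
    then show ?thesis using v that by simp
  qed
  define nv where "nv = (\<Sum>i<n. (cmod (v $ i))\<^sup>2)"
  have "\<exists>i<n. v $ i ~= 0"
  proof (rule ccontr)
    assume "\<not> (\<exists>i<n. v $ i ~= 0)"
    then have "v = 0\<^sub>v n" using v(1) by (intro eq_vecI) auto
    then show False using v(2) by simp
  qed
  then obtain i0 where i0: "i0 < n" "v $ i0 ~= 0" by auto
  have nv: "0 < nv" unfolding nv_def
    by (rule sum_pos2[of _ i0]) (use i0 in auto)
  have key: "l * of_real nv = (\<Sum>i<n. \<Sum>j<n. cnj (v $ i) * of_real (S i j) * v $ j)"
  proof -
    have "l * of_real nv = (\<Sum>i<n. cnj (v $ i) * (l * v $ i))"
      unfolding nv_def of_real_sum sum_distrib_left
      by (intro sum.cong refl) (simp only: complex_norm_square mult_ac)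
    also have "... = (\<Sum>i<n. cnj (v $ i) * (\<Sum>j<n. of_real (S i j) * v $ j))"
      by (intro sum.cong) (auto simp: Av)
    finally show ?thesis by (simp add: sum_distrib_left mult.assoc)
  qed
  let ?a = "\<lambda>i. Re (v $ i)" and ?b = "\<lambda>i. Im (v $ i)"
  have re: "Re l * nv = (\<Sum>i<n. \<Sum>j<n. ?a i * S i j * ?a j) + (\<Sum>i<n. \<Sum>j<n. ?b i * S i j * ?b j)"
  proof -
    have "Re l * nv = (\<Sum>i<n. \<Sum>j<n. Re (cnj (v $ i) * of_real (S i j) * v $ j))"
      using arg_cong[OF key, of Re] by (simp only: Re_sum) simp
    also have "... = (\<Sum>i<n. \<Sum>j<n. ?a i * S i j * ?a j + ?b i * S i j * ?b j)"
      by (intro sum.cong refl) simp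
    finally show ?thesis by (simp only: sum.distrib)
  qed
  have "Im l * nv = (\<Sum>i<n. \<Sum>j<n. ?a i * S i j * ?b j) - (\<Sum>i<n. \<Sum>j<n. ?b i * S i j * ?a j)"
  proof -
    have "Im l * nv = (\<Sum>i<n. \<Sum>j<n. Im (cnj (v $ i) * of_real (S i j) * v $ j))"
      using arg_cong[OF key, of Im] by (simp only: Im_sum) simp
    also have "... = (\<Sum>i<n. \<Sum>j<n. ?a i * S i j * ?b j - ?b i * S i j * ?a j)"
      by (intro sum.cong refl) simp
    finally show ?thesis by (simp only: sum_subtractf)
  qed
  also have "(\<Sum>i<n. \<Sum>j<n. ?b i * S i j * ?a j) = (\<Sum>i<n. \<Sum>j<n. ?a i * S i j * ?b j)"
    by (subst sum.swap) (intro sum.cong refl, auto simp: sym mult_ac)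
  finally have im: "Im l = 0" using nv by simp
  have nv2: "nv = (\<Sum>i<n. (?a i)\<^sup>2) + (\<Sum>i<n. (?b i)\<^sup>2)"
    by (simp add: nv_def cmod_power2 sum.distrib)
  have "0 <= Re l * nv" unfolding re using psd[of ?a] psd[of ?b] by (rule add_nonneg_nonneg)
  moreover have "Re l * nv <= C * nv"
    unfolding re unfolding nv2 using add_mono[OF bd[of ?a] bd[of ?b]] by (simp add: algebra_simps)
  ultimately have "0 <= Re l" "Re l <= C" using nv by (simp_all add: zero_le_mult_iff)
  moreover have "l = of_real (Re l)" using im by (simp add: complex_eq_iff)
  ultimately show thesis using that by blast
qed

text \<open>With eigenvalues \<open>r i\<close> in \<open>[0, C]\<close> the trace of \<open>(1 - M
  / C)^k\<close> is the sum of \<open>(1 - r i / C)^k\<close>. Zero eigenvalues contribute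
  \<open>1\<close> each. The others contribute little if they are at least \<open>eps\<close>, and
  those below \<open>eps\<close> are few, since the product of the nonzero eigenvalues is a nonzero
  integer. The kernel vectors are columns of the matrix that brings \<open>M\<close> to Jordan
  form.\<close>

lemma integer_psd_nat_kernel:
  fixes M :: "nat => nat => int"
  assumes sym: "\<And>i j. i < n ==> j < n ==> M i j = M j i"
    and psd: "\<And>u::nat => real. 0 <= (\<Sum>i<n. \<Sum>j<n. u i * of_int (M i j) * u j)"
    and bd: "\<And>u::nat => real. (\<Sum>i<n. \<Sum>j<n. u i * of_int (M i j) * u j) <= C * (\<Sum>i<n. (u i)\<^sup>2)"
    and C: "1 <= C" and eps: "0 < eps" "eps < 1"
  obtains Z :: "nat set" and w :: "nat => nat => complex"
  where "finite Z" "\<And>a i. a \<in> Z ==> i < n ==> (\<Sum>j<n. of_int (M i j) * w a j) = 0"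
    "\<And>c. (\<forall>i<n. (\<Sum>a\<in>Z. c a * w a i) = 0) ==> \<forall>a\<in>Z. c a = 0"
    "Re (\<Sum>i<n. (mat n n (\<lambda>(i, j). complex_of_real ((if i = j then 1 else 0) - of_int (M i j) / C)) ^\<^sub>m k) $$ (i, i))
      - real n * (ln C / ln (C / eps) + (1 - eps / C) ^ k) <= real (card Z)"
proof -
  define A where "A = mat n n (\<lambda>(i, j). complex_of_real (of_int (M i j)))"
  have A: "A \<in> carrier_mat n n" by (simp add: A_def)
  obtain as where "char_poly A = (\<Prod>a\<leftarrow>as. [:- a, 1:])" using char_poly_factorized[OF A] by auto
  from jordan_nf_exists[OF A this] obtain n_as where "jordan_nf A n_as" by auto
  then have "similar_mat A (jordan_matrix n_as)" by (simp add: jordan_nf_def)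
  then obtain P Q where wit: "similar_mat_wit A (jordan_matrix n_as) P Q" unfolding similar_mat_def by auto
  define J where "J = jordan_matrix n_as"
  note W = similar_mat_witD2[OF A wit, folded J_def]
  have PQ: "P * Q = 1\<^sub>m n" and QP: "Q * P = 1\<^sub>m n" and APJQ: "A = P * J * Q"
    and J: "J \<in> carrier_mat n n" and P: "P \<in> carrier_mat n n" and Q: "Q \<in> carrier_mat n n"
    using W by auto
  have n: "sum_list (map fst n_as) = n" using J unfolding J_def carrier_mat_def by simp
  have utJ: "J $$ (i, j) = 0" if "i < n" "j < i" for i j
    using jordan_matrix_upper_triangular[of i n_as j] that by (simp add: J_def n)
  define lam where "lam i = J $$ (i, i)" for i
  have "char_poly A = char_poly J"
    using wit unfolding J_def by (intro char_poly_similar) (auto simp: similar_mat_def)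
  also have "... = (\<Prod>a\<leftarrow>diag_mat J. [:- a, 1:])"
    using J utJ by (intro char_poly_upper_triangular[of J n] upper_triangularI) auto
  also have "diag_mat J = map lam [0..<n]" using J by (simp add: diag_mat_def lam_def)
  also have "(\<Prod>a\<leftarrow>map lam [0..<n]. [:- a, 1:]) = (\<Prod>i<n. [:- lam i, 1:])"
    using prod.distinct_set_conv_list[of "[0..<n]" "\<lambda>i. [:- lam i, 1:]"] by (simp add: o_def lessThan_atLeast0)
  finally have cp: "char_poly A = (\<Prod>i<n. [:- lam i, 1:])" .
  have "\<exists>r. lam i = complex_of_real r \<and> 0 <= r \<and> r <= C" if i: "i < n" for i
  proof -
    have "eigenvalue A (lam i)"
      unfolding eigenvalue_root_char_poly[OF A] cp poly_prod using i by (intro prod_zero) auto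
    then have ev: "eigenvalue (mat n n (\<lambda>(i, j). complex_of_real (real_of_int (M i j)))) (lam i)"
      by (simp add: A_def)
    show ?thesis
      using hermitian_eigenvalue_bounds[of n "\<lambda>i j. real_of_int (M i j)" C "lam i", OF _ psd bd ev] sym by metis
  qed
  then obtain r where r: "\<And>i. i < n ==> lam i = complex_of_real (r i)"
    "\<And>i. i < n ==> 0 <= r i" "\<And>i. i < n ==> r i <= C" by metis
  define Z where "Z = {i. i < n \<and> lam i = 0}"
  define NZ where "NZ = {i. i < n \<and> lam i ~= 0}"
  have ZNZ: "{..<n} = Z \<union> NZ" "Z \<inter> NZ = {}" "finite Z" "finite NZ"
    by (auto simp: Z_def NZ_def)
  have NZpos: "0 < r i" if "i \<in> NZ" for i
    using that r[of i] unfolding NZ_def by (cases "r i = 0") auto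
  \<comment> \<open>The product of the nonzero eigenvalues is, up to sign, a coefficient of the characteristic
      polynomial, hence a nonzero integer.\<close>
  have prod_ge: "1 <= (\<Prod>i\<in>NZ. r i)"
  proof -
    define Mi where "Mi = mat n n (\<lambda>(i, j). M i j)"
    have "A = map_mat of_int Mi" by (rule eq_matI) (auto simp: A_def Mi_def)
    then have "char_poly A = map_poly of_int (char_poly Mi)"
      using of_int_hom.char_poly_hom[of Mi n] by (simp add: Mi_def)
    moreover have "char_poly A = monom 1 (card Z) * (\<Prod>i\<in>NZ. [:- lam i, 1:])"
    proof -
      have "(\<Prod>i\<in>Z. [:- lam i, 1:]) = (\<Prod>i\<in>Z. [:0, 1:])" by (intro prod.cong) (auto simp: Z_def)
      also have "... = monom 1 (card Z)" by (simp add: monom_altdef)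
      finally show ?thesis unfolding cp ZNZ(1) using ZNZ by (simp add: prod.union_disjoint)
    qed
    ultimately have "map_poly of_int (char_poly Mi) = monom 1 (card Z) * (\<Prod>i\<in>NZ. [:- lam i, 1:])" by simp
    then have "coeff (map_poly of_int (char_poly Mi)) (card Z) = coeff (\<Prod>i\<in>NZ. [:- lam i, 1:]) 0"
      by (simp add: coeff_monom_mult)
    then have "complex_of_int (coeff (char_poly Mi) (card Z)) = (\<Prod>i\<in>NZ. - lam i)"
      by (simp add: coeff_map_poly poly_0_coeff_0[symmetric] poly_prod)
    also have "... = (\<Prod>i\<in>NZ. complex_of_real (- r i))" by (intro prod.cong) (auto simp: NZ_def r)
    also have "... = complex_of_real (\<Prod>i\<in>NZ. - r i)" by simp
    finally have "cmod (of_int (coeff (char_poly Mi) (card Z))) = \<bar>\<Prod>i\<in>NZ. - r i\<bar>" by (metis norm_of_real)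
    also have "... = (\<Prod>i\<in>NZ. r i)" using NZpos by (auto simp: abs_prod less_imp_le intro!: prod.cong)
    finally have c: "\<bar>real_of_int (coeff (char_poly Mi) (card Z))\<bar> = (\<Prod>i\<in>NZ. r i)" by simp
    moreover have "0 < (\<Prod>i\<in>NZ. r i)" using NZpos by (intro prod_pos) auto
    ultimately have "coeff (char_poly Mi) (card Z) ~= 0" by auto
    then have "1 <= \<bar>real_of_int (coeff (char_poly Mi) (card Z))\<bar>" by linarith
    then show ?thesis using c by simp
  qed
  have lnC: "0 < ln (C / eps)" "0 <= ln C" using C eps by (simp_all add: field_simps)
  have epsC: "0 < eps / C" "eps / C < 1" using C eps by (simp_all add: field_simps)
  have bound1: "(1 - r i / C) ^ k <= ln (C / r i) / ln (C / eps) + (1 - eps / C) ^ k" if i: "i \<in> NZ" for i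
  proof -
    have ri: "0 < r i" "r i <= C" using NZpos[OF i] r(3)[of i] i by (auto simp: NZ_def)
    have l0: "0 <= ln (C / r i)" using ri C by (simp add: field_simps)
    show ?thesis
    proof (cases "eps <= r i")
      case True
      have "(1 - r i / C) ^ k <= (1 - eps / C) ^ k"
        using True ri C by (intro power_mono) (simp_all add: divide_right_mono)
      moreover have "0 <= ln (C / r i) / ln (C / eps)" using l0 lnC by simp
      ultimately show ?thesis by linarith
    next
      case False
      have "(1 - r i / C) ^ k <= 1" using ri C by (intro power_le_one) (simp_all add: field_simps)
      moreover have "ln (C / eps) <= ln (C / r i)"
        using False ri C eps by (subst ln_le_cancel_iff) (auto simp: divide_left_mono)
      then have "1 <= ln (C / r i) / ln (C / eps)" using lnC by simp
      moreover have "0 <= (1 - eps / C) ^ k" using epsC by simp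
      ultimately show ?thesis by linarith
    qed
  qed
  have sum_ln: "(\<Sum>i\<in>NZ. ln (C / r i)) <= real n * ln C"
  proof -
    have "(\<Sum>i\<in>NZ. ln (C / r i)) = (\<Sum>i\<in>NZ. ln C - ln (r i))"
    proof (intro sum.cong refl)
      fix i assume "i \<in> NZ"
      then show "ln (C / r i) = ln C - ln (r i)" using NZpos[of i] C by (intro ln_divide_pos) auto
    qed
    also have "... = card NZ * ln C - (\<Sum>i\<in>NZ. ln (r i))" by (simp add: sum_subtractf)
    also have "(\<Sum>i\<in>NZ. ln (r i)) = ln (\<Prod>i\<in>NZ. r i)" using NZpos ZNZ(4) by (subst ln_prod) (auto simp: less_imp_neq[symmetric])
    also have "card NZ * ln C - ln (\<Prod>i\<in>NZ. r i) <= card NZ * ln C" using prod_ge by simp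
    also have "... <= real n * ln C"
    proof (intro mult_right_mono)
      have "card NZ <= card {..<n}" by (intro card_mono) (auto simp: NZ_def)
      then show "real (card NZ) <= real n" by simp
    qed (use lnC in simp)
    finally show ?thesis .
  qed
  have trace: "Re (\<Sum>i<n. (mat n n (\<lambda>(i, j). complex_of_real ((if i = j then 1 else 0) - of_int (M i j) / C)) ^\<^sub>m k) $$ (i, i))
     = (\<Sum>i<n. (1 - r i / C) ^ k)"
  proof -
    define T where "T = mat n n (\<lambda>(i, j). complex_of_real ((if i = j then 1 else 0) - of_int (M i j) / C))"
    define B where "B = 1\<^sub>m n - (1 / complex_of_real C) \<cdot>\<^sub>m J"
    have B: "B \<in> carrier_mat n n" using J unfolding B_def by (intro minus_carrier_mat smult_carrier_mat)
    have "P * B * Q = P * Q - (1 / complex_of_real C) \<cdot>\<^sub>m (P * J * Q)"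
    proof -
      have "P * B = P * 1\<^sub>m n - P * ((1 / complex_of_real C) \<cdot>\<^sub>m J)"
        unfolding B_def using P J by (intro mult_minus_distrib_mat[of _ n n _ n]) auto
      also have "... = P - (1 / complex_of_real C) \<cdot>\<^sub>m (P * J)"
        using P J by (simp add: mult_smult_distrib[of _ n n _ n])
      finally have "P * B * Q = P * Q - (1 / complex_of_real C) \<cdot>\<^sub>m (P * J) * Q"
        using P J Q by (simp add: minus_mult_distrib_mat[of _ n n _ _ n])
      then show ?thesis using P J Q by (simp add: mult_smult_assoc_mat[of _ n n _ n])
    qed
    also have "... = T" unfolding PQ APJQ[symmetric]
      by (rule eq_matI) (auto simp: T_def A_def)
    finally have T: "T = P * B * Q" by simp
    have "similar_mat_wit T B P Q"
      unfolding similar_mat_wit_def Let_def using B P Q PQ QP T by (simp add: T_def)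
    then have "T ^\<^sub>m k = P * B ^\<^sub>m k * Q" by (rule similar_mat_wit_pow_id)
    then have "(\<Sum>i<n. (T ^\<^sub>m k) $$ (i, i)) = (\<Sum>i<n. (B ^\<^sub>m k) $$ (i, i))"
      using sum_diag_similar[of "B ^\<^sub>m k" n P Q] B P Q QP by simp
    also have "... = (\<Sum>i<n. complex_of_real ((1 - r i / C) ^ k))"
    proof (intro sum.cong refl)
      fix i assume i: "i \<in> {..<n}"
      have "(B ^\<^sub>m k) $$ (i, i) = (B $$ (i, i)) ^ k"
        using upper_triangular_pow_diag[OF B] utJ i J by (auto simp: B_def)
      also have "B $$ (i, i) = complex_of_real (1 - r i / C)"
        using i J r(1)[of i] by (simp add: B_def lam_def)
      finally show "(B ^\<^sub>m k) $$ (i, i) = complex_of_real ((1 - r i / C) ^ k)" by simp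
    qed
    finally show ?thesis unfolding T_def[symmetric] by (simp flip: of_real_sum)
  qed
  have "(\<Sum>i<n. (1 - r i / C) ^ k) = (\<Sum>i\<in>Z. (1 - r i / C) ^ k) + (\<Sum>i\<in>NZ. (1 - r i / C) ^ k)"
    unfolding ZNZ(1) using ZNZ by (intro sum.union_disjoint) auto
  also have "(\<Sum>i\<in>Z. (1 - r i / C) ^ k) = (\<Sum>i\<in>Z. 1)"
    using r(1) by (intro sum.cong) (auto simp: Z_def)
  also have "(\<Sum>i\<in>NZ. (1 - r i / C) ^ k) <= (\<Sum>i\<in>NZ. ln (C / r i) / ln (C / eps) + (1 - eps / C) ^ k)"
    by (intro sum_mono bound1)
  also have "... = (\<Sum>i\<in>NZ. ln (C / r i)) / ln (C / eps) + card NZ * (1 - eps / C) ^ k"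
    by (simp add: sum.distrib sum_divide_distrib)
  also have "... <= real n * ln C / ln (C / eps) + real n * (1 - eps / C) ^ k"
  proof (intro add_mono divide_right_mono mult_right_mono)
    have "card NZ <= card {..<n}" by (intro card_mono) (auto simp: NZ_def)
    then show "real (card NZ) <= real n" by simp
  qed (use sum_ln lnC epsC in auto)
  finally have final: "(\<Sum>i<n. (1 - r i / C) ^ k) - real n * (ln C / ln (C / eps) + (1 - eps / C) ^ k) <= real (card Z)"
    by (simp add: algebra_simps)
  define w where "w a i = P $$ (i, a)" for a i
  have ker: "(\<Sum>j<n. of_int (M i j) * w a j) = 0" if a: "a \<in> Z" and i: "i < n" for a i
  proof -
    have an: "a < n" using a by (simp add: Z_def)
    have An: "A ^\<^sub>m Suc n = P * J ^\<^sub>m Suc n * Q" unfolding J_def by (rule similar_mat_wit_pow_id[OF wit])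
    have Jc: "J ^\<^sub>m Suc n \<in> carrier_mat n n" using J by (intro pow_carrier_mat)
    have "A ^\<^sub>m Suc n * P = P * J ^\<^sub>m Suc n * (Q * P)"
      unfolding An using P Q Jc by (intro assoc_mult_mat[of _ n n _ n _ n]) auto
    also have "... = P * J ^\<^sub>m Suc n" using P Jc unfolding QP by (intro right_mult_one_mat[of _ n n]) auto
    finally have AP: "A ^\<^sub>m Suc n * P = P * J ^\<^sub>m Suc n" .
    have Jcol: "(J ^\<^sub>m Suc n) $$ (j, a) = 0" if "j < n" for j
      using jordan_matrix_pow_zero_column[of a n_as "Suc n" j] a that an n
      by (simp only: J_def[symmetric] Z_def lam_def mem_Collect_eq)
    have "A ^\<^sub>m Suc n *\<^sub>v col P a = col (A ^\<^sub>m Suc n * P) a"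
      by (rule col_mult2[OF pow_carrier_mat[OF A] P an, symmetric])
    also have "... = P *\<^sub>v col (J ^\<^sub>m Suc n) a" unfolding AP by (rule col_mult2[OF P Jc an])
    also have "col (J ^\<^sub>m Suc n) a = 0\<^sub>v n"
      using carrier_matD[OF Jc] an by (intro eq_vecI) (simp_all add: Jcol del: pow_mat.simps)
    also have "P *\<^sub>v 0\<^sub>v n = 0\<^sub>v n" using P by (intro eq_vecI) (auto simp: scalar_prod_def)
    finally have "A *\<^sub>v col P a = 0\<^sub>v n"
      by (intro hermitian_kernel_pow[of n "\<lambda>i j. of_int (M i j)" "col P a" A n]) (use sym P A_def in auto)
    then have "(A *\<^sub>v col P a) $ i = 0" using i by simp
    moreover have "(A *\<^sub>v col P a) $ i = (\<Sum>j<n. of_int (M i j) * w a j)"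
      using i P an unfolding A_def w_def by (simp add: scalar_prod_def lessThan_atLeast0)
    ultimately show ?thesis by simp
  qed
  have indep: "\<forall>b\<in>Z. c b = 0" if c: "\<forall>i<n. (\<Sum>a\<in>Z. c a * w a i) = 0" for c
  proof
    fix b assume b: "b \<in> Z"
    have bn: "b < n" using b by (simp add: Z_def)
    have qp: "(\<Sum>i<n. Q $$ (b, i) * P $$ (i, a)) = (if b = a then 1 else 0)" if "a \<in> Z" for a
    proof -
      have "(Q * P) $$ (b, a) = (\<Sum>i<n. Q $$ (b, i) * P $$ (i, a))"
        using that bn P Q by (simp add: scalar_prod_def lessThan_atLeast0 Z_def)
      then show ?thesis using QP bn that by (simp add: Z_def)
    qed
    have "0 = (\<Sum>i<n. Q $$ (b, i) * (\<Sum>a\<in>Z. c a * w a i))" using c by simp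
    also have "... = (\<Sum>a\<in>Z. c a * (\<Sum>i<n. Q $$ (b, i) * P $$ (i, a)))"
      unfolding sum_distrib_left w_def by (subst sum.swap) (simp only: mult_ac)
    also have "... = (\<Sum>a\<in>Z. c a * (if b = a then 1 else 0))"
      by (intro sum.cong refl) (simp only: qp)
    also have "... = (\<Sum>a\<in>Z. if a = b then c b else 0)" by (intro sum.cong) auto
    also have "... = c b" using b ZNZ(3) by simp
    finally show "c b = 0" by simp
  qed
  show thesis by (rule that[OF ZNZ(3) ker indep]) (use final trace in simp_all)
qed

definition point_mass :: "'y => 'y => 'a::zero_neq_one" where
  "point_mass y = (\<lambda>z. if z = y then 1 else 0)"

lemma integer_psd_kernel:
  fixes M :: "'y => 'y => int" and T :: "('y => real) => 'y => real"
  assumes fin: "finite X"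
    and sym: "\<And>x y. x \<in> X ==> y \<in> X ==> M x y = M y x"
    and psd: "\<And>u::'y => real. 0 <= (\<Sum>x\<in>X. \<Sum>y\<in>X. u x * of_int (M x y) * u y)"
    and bd: "\<And>u::'y => real. (\<Sum>x\<in>X. \<Sum>y\<in>X. u x * of_int (M x y) * u y) <= C * (\<Sum>x\<in>X. (u x)\<^sup>2)"
    and C: "1 <= C" and eps: "0 < eps" "eps < 1"
    and T: "\<And>u x. x \<in> X ==> T u x = u x - (\<Sum>y\<in>X. of_int (M x y) * u y) / C"
  obtains Z :: "nat set" and w :: "nat => 'y => complex"
  where "finite Z" "\<And>a x. a \<in> Z ==> x \<in> X ==> (\<Sum>y\<in>X. of_int (M x y) * w a y) = 0"
    "indep_family X Z w"
    "(\<Sum>x\<in>X. (T ^^ k) (point_mass x) x) - real (card X) * (ln C / ln (C / eps) + (1 - eps / C) ^ k) <= real (card Z)"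
proof -
  define n where "n = card X"
  obtain h where h: "bij_betw h {..<n} X"
    using ex_bij_betw_nat_finite[OF fin] by (auto simp: n_def lessThan_atLeast0)
  have hX: "h i \<in> X" if "i < n" for i using h that by (auto simp: bij_betw_def)
  have hinj: "h i = h j \<longleftrightarrow> i = j" if "i < n" "j < n" for i j
    using h that by (auto simp: bij_betw_def inj_on_def)
  define g where "g = the_inv_into {..<n} h"
  have gh: "g (h i) = i" if "i < n" for i
    using h that unfolding g_def by (intro the_inv_into_f_f) (auto simp: bij_betw_def)
  have re: "(\<Sum>x\<in>X. f x) = (\<Sum>i<n. f (h i))" for f :: "'y => 'b::comm_monoid_add"
    by (rule sum.reindex_bij_betw[OF h, symmetric])
  define N where "N i j = M (h i) (h j)" for i j
  have u_ext: "\<exists>u'. \<forall>i<n. u' (h i) = u i" for u :: "nat => real"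
    by (rule exI[of _ "u \<circ> g"]) (simp add: gh)
  have Nsym: "N i j = N j i" if "i < n" "j < n" for i j using that sym hX by (simp add: N_def)
  have Npsd: "0 <= (\<Sum>i<n. \<Sum>j<n. u i * of_int (N i j) * u j)" for u :: "nat => real"
    using psd[of "u \<circ> g"] by (simp add: re gh N_def)
  have Nbd: "(\<Sum>i<n. \<Sum>j<n. u i * of_int (N i j) * u j) <= C * (\<Sum>i<n. (u i)\<^sup>2)" for u :: "nat => real"
    using bd[of "u \<circ> g"] by (simp add: re gh N_def)
  define A where "A = mat n n (\<lambda>(i, j). complex_of_real ((if i = j then 1 else 0) - of_int (N i j) / C))"
  have A: "A \<in> carrier_mat n n" by (simp add: A_def)
  have pow: "(A ^\<^sub>m k) $$ (i, j) = complex_of_real ((T ^^ k) (point_mass (h j)) (h i))" if "i < n" "j < n" for i j k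
    using that(1)
  proof (induction k arbitrary: i)
    case 0
    then show ?case using A that(2) by (simp add: point_mass_def hinj)
  next
    case (Suc k)
    define u where "u = (T ^^ k) (point_mass (h j))"
    have Ak: "A ^\<^sub>m k \<in> carrier_mat n n" using A by simp
    have "(A ^\<^sub>m Suc k) $$ (i, j) = (\<Sum>l<n. A $$ (i, l) * (A ^\<^sub>m k) $$ (l, j))"
      unfolding pow_mat_Suc_left[OF A] using Suc.prems that(2) A Ak
      by (simp add: scalar_prod_def lessThan_atLeast0)
    also have "... = (\<Sum>l<n. complex_of_real (((if i = l then 1 else 0) - of_int (N i l) / C) * u (h l)))"
      using Suc by (intro sum.cong refl) (simp add: A_def u_def)
    also have "... = complex_of_real (\<Sum>l<n. (if i = l then u (h l) else 0) - of_int (N i l) / C * u (h l))"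
      unfolding of_real_sum by (intro sum.cong refl) (simp add: left_diff_distrib)
    also have "(\<Sum>l<n. (if i = l then u (h l) else 0) - of_int (N i l) / C * u (h l)) = T u (h i)"
      using Suc.prems by (simp add: T hX sum_subtractf re N_def sum_divide_distrib)
    finally show ?case by (simp add: u_def)
  qed
  have tr: "Re (\<Sum>i<n. (A ^\<^sub>m k) $$ (i, i)) = (\<Sum>x\<in>X. (T ^^ k) (point_mass x) x)"
    by (simp add: re pow)
  show thesis
  proof (rule integer_psd_nat_kernel[OF Nsym Npsd Nbd C eps, of k, folded A_def])
    fix Z :: "nat set" and w :: "nat => nat => complex"
    assume Z: "finite Z" "\<And>a i. a \<in> Z ==> i < n ==> (\<Sum>j<n. of_int (N i j) * w a j) = 0"
      "\<And>c. (\<forall>i<n. (\<Sum>a\<in>Z. c a * w a i) = 0) ==> \<forall>a\<in>Z. c a = 0"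
      "Re (\<Sum>i<n. (A ^\<^sub>m k) $$ (i, i)) - real n * (ln C / ln (C / eps) + (1 - eps / C) ^ k) <= real (card Z)"
    show thesis
    proof (rule that[of Z "\<lambda>a. w a \<circ> g"])
      show "finite Z" by (rule Z)
      show "(\<Sum>y\<in>X. of_int (M x y) * (w a \<circ> g) y) = 0" if "a \<in> Z" "x \<in> X" for a x
      proof -
        obtain i where "i < n" "x = h i" using h \<open>x \<in> X\<close> by (auto simp: bij_betw_def)
        then show ?thesis using Z(2)[OF \<open>a \<in> Z\<close>, of i] by (simp add: re gh N_def)
      qed
      show "indep_family X Z (\<lambda>a. w a \<circ> g)"
        unfolding indep_family_def
      proof (intro allI impI)
        fix c assume c: "\<forall>x\<in>X. (\<Sum>a\<in>Z. c a * (w a \<circ> g) x) = 0"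
        have "\<forall>i<n. (\<Sum>a\<in>Z. c a * w a i) = 0"
          using c hX gh by (metis (no_types, lifting) comp_apply sum.cong)
        then show "\<forall>a\<in>Z. c a = 0" by (rule Z(3))
      qed
      show "(\<Sum>x\<in>X. (T ^^ k) (point_mass x) x) - real (card X) * (ln C / ln (C / eps) + (1 - eps / C) ^ k) <= real (card Z)"
        using Z(4) tr by (simp add: n_def)
    qed
  qed
qed

section \<open>Local rules and their Laplacians\<close>

text \<open>A rule is a list of terms \<open>(c, h, v)\<close>: coefficient, shift and coordinate.
  The map \<open>s\<close> lets the shifts act on points, either by left multiplication on the group
  or through \<open>\<sigma> n\<close> on a finite model.\<close>

definition rule_eval :: "('g => 'x => 'x) => (int \<times> 'g \<times> 'v) list => ('x \<times> 'v => 'k::comm_ring_1) => 'x => 'k" where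
  "rule_eval s r u x = (\<Sum>(c, h, v)\<leftarrow>r. of_int c * u (s h x, v))"

lemma rule_eval_cong:
  assumes "\<And>c h v. (c, h, v) \<in> set r ==> u (s h x, v) = u' (s' h x', v)"
  shows "rule_eval s r u x = rule_eval s' r u' x'"
  unfolding rule_eval_def
  by (intro arg_cong[of _ _ sum_list] map_cong refl) (use assms in auto)

lemma rule_eval_nonzeroE:
  assumes "rule_eval s r u x ~= 0"
  obtains c h v where "(c, h, v) \<in> set r" "u (s h x, v) ~= 0"
proof -
  have "rule_eval s r u x = 0" if "\<And>c h v. (c, h, v) \<in> set r ==> u (s h x, v) = 0"
    using that
  proof (induction r)
    case (Cons t r)
    obtain c h v where t: "t = (c, h, v)" by (cases t)
    have "rule_eval s r u x = 0" by (rule Cons.IH) (use Cons.prems in auto)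
    then show ?case using Cons.prems[of c h v] by (simp add: t rule_eval_def)
  qed (simp add: rule_eval_def)
  then show thesis using assms that by metis
qed

text \<open>The transpose of a rule; \<open>s'\<close> has to invert \<open>s\<close>.\<close>

definition rule_adj :: "('g => 'x => 'x) => (int \<times> 'g \<times> 'v) list => ('x => 'k::comm_ring_1) => 'x \<times> 'v => 'k" where
  "rule_adj s' r g y = (\<Sum>(c, h, v)\<leftarrow>r. if v = snd y then of_int c * g (s' h (fst y)) else 0)"

text \<open>A bound for the Laplacian of the rules, by the Cauchy-Schwarz inequality in each rule.
  The summand \<open>1\<close> keeps it positive.\<close>

definition rule_bound :: "(int \<times> 'g \<times> 'v) list set => real" where
  "rule_bound W = 1 + (\<Sum>r\<in>W. real (length r) * (\<Sum>(c, h, v)\<leftarrow>r. (of_int c)\<^sup>2))"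

definition finite_supp :: "('a => 'k::zero) => bool" where
  "finite_supp u \<longleftrightarrow> finite {y. u y ~= 0}"

text \<open>Summing over the support of the first argument keeps this a finite sum when only that
  argument is finitely supported.\<close>

definition pairing :: "('a => 'k::comm_ring_1) => ('a => 'k) => 'k" where
  "pairing u w = (\<Sum>y | u y ~= 0. u y * w y)"

lemma pairing_eq:
  assumes "finite A" "\<And>y. u y ~= 0 ==> w y ~= 0 ==> y \<in> A" "finite_supp u"
  shows "pairing u w = (\<Sum>y\<in>A. u y * w y)"
proof -
  have "pairing u w = (\<Sum>y\<in>{y. u y ~= 0} \<inter> A. u y * w y)"
    unfolding pairing_def using assms unfolding finite_supp_def
    by (intro sum.mono_neutral_right) (auto dest: mult_not_zero)
  also have "... = (\<Sum>y\<in>A. u y * w y)"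
    using assms(1) by (intro sum.mono_neutral_left) auto
  finally show ?thesis .
qed

lemma pairing_commute:
  assumes "finite_supp u" "finite_supp w"
  shows "pairing u w = pairing w u"
proof -
  have f: "finite ({y. u y ~= 0} \<union> {y. w y ~= 0})" using assms by (simp add: finite_supp_def)
  show ?thesis
    using pairing_eq[OF f _ assms(1), of w] pairing_eq[OF f _ assms(2), of u] by (simp add: mult.commute)
qed

lemma sum_list_cauchy_schwarz:
  "(\<Sum>x\<leftarrow>xs. f x :: real)\<^sup>2 <= real (length xs) * (\<Sum>x\<leftarrow>xs. (f x)\<^sup>2)"
proof -
  have e: "(\<Sum>x\<leftarrow>xs. g x) = (\<Sum>i<length xs. g (xs ! i))" for g :: "_ => real"
    by (simp add: sum_list_sum_nth lessThan_atLeast0)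
  show ?thesis
    using sum_squared_le_sum_of_squares[of "\<lambda>i. f (xs ! i)" "{..<length xs}"]
    by (simp add: e mult.commute)
qed

lemma pairing_rule_eval_term:
  fixes w :: "'x \<times> 'v => 'k::comm_ring_1"
  assumes "finite A" "A \<subseteq> \<Omega> \<times> UNIV" "finite B" "B \<subseteq> \<Omega>"
    and s: "\<And>x. x \<in> \<Omega> ==> s h x \<in> \<Omega> \<and> s' h (s h x) = x"
    and s': "\<And>x. x \<in> \<Omega> ==> s' h x \<in> \<Omega> \<and> s h (s' h x) = x"
    and AB: "\<And>x. x \<in> \<Omega> ==> w (s h x, v) ~= 0 ==> g x ~= 0 ==> x \<in> B \<and> (s h x, v) \<in> A"
  shows "(\<Sum>x\<in>B. w (s h x, v) * g x) = (\<Sum>y\<in>A. w y * (if v = snd y then g (s' h (fst y)) else 0))"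
proof -
  define B' where "B' = {x\<in>B. (s h x, v) \<in> A}"
  have "(\<Sum>x\<in>B. w (s h x, v) * g x) = (\<Sum>x\<in>B'. w (s h x, v) * g x)"
  proof (rule sum.mono_neutral_right)
    show "\<forall>i\<in>B - B'. w (s h i, v) * g i = 0"
    proof
      fix i assume i: "i \<in> B - B'"
      then have "i \<in> \<Omega>" using assms(4) by auto
      show "w (s h i, v) * g i = 0"
      proof (rule ccontr)
        assume "w (s h i, v) * g i ~= 0"
        then have "w (s h i, v) ~= 0" "g i ~= 0" by (auto dest: mult_not_zero)
        from AB[OF \<open>i \<in> \<Omega>\<close> this] show False using i by (simp add: B'_def)
      qed
    qed
  qed (use assms in \<open>auto simp: B'_def\<close>)
  also have "... = (\<Sum>y\<in>(\<lambda>x. (s h x, v)) ` B'. w y * (if v = snd y then g (s' h (fst y)) else 0))"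
  proof (subst sum.reindex)
    show "inj_on (\<lambda>x. (s h x, v)) B'"
    proof (rule inj_onI)
      fix x y assume "x \<in> B'" "y \<in> B'" and eq: "(s h x, v) = (s h y, v)"
      then have "x \<in> \<Omega>" "y \<in> \<Omega>" using assms(4) by (auto simp: B'_def)
      then have "s' h (s h x) = x" "s' h (s h y) = y" using s by blast+
      then show "x = y" using eq by (metis prod.inject)
    qed
    show "(\<Sum>x\<in>B'. w (s h x, v) * g x) = sum ((\<lambda>y. w y * (if v = snd y then g (s' h (fst y)) else 0)) \<circ> (\<lambda>x. (s h x, v))) B'"
    proof (intro sum.cong refl)
      fix x assume "x \<in> B'"
      then have "x \<in> \<Omega>" using assms(4) by (auto simp: B'_def)
      then show "w (s h x, v) * g x = ((\<lambda>y. w y * (if v = snd y then g (s' h (fst y)) else 0)) \<circ> (\<lambda>x. (s h x, v))) x"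
        using s[of x] by simp
    qed
  qed
  also have "... = (\<Sum>y\<in>A. w y * (if v = snd y then g (s' h (fst y)) else 0))"
  proof (rule sum.mono_neutral_left)
    show "\<forall>y\<in>A - (\<lambda>x. (s h x, v)) ` B'. w y * (if v = snd y then g (s' h (fst y)) else 0) = 0"
    proof
      fix y assume y: "y \<in> A - (\<lambda>x. (s h x, v)) ` B'"
      obtain a b where ab: "y = (a, b)" by (cases y)
      have a: "a \<in> \<Omega>" using y ab assms(2) by auto
      have "w y = 0 \<or> g (s' h a) = 0" if "v = b"
      proof (rule ccontr)
        assume "\<not> (w y = 0 \<or> g (s' h a) = 0)"
        then have "s' h a \<in> B \<and> (a, v) \<in> A"
          using AB[of "s' h a"] s'[OF a] ab that by auto
        then have "y \<in> (\<lambda>x. (s h x, v)) ` B'"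
          using s'[OF a] ab that unfolding B'_def by (intro image_eqI[of _ _ "s' h a"]) auto
        then show False using y by simp
      qed
      then show "w y * (if v = snd y then g (s' h (fst y)) else 0) = 0" using ab by auto
    qed
  qed (use assms in \<open>auto simp: B'_def\<close>)
  finally show ?thesis .
qed

lemma sum_rule_eval_mult:
  fixes w :: "'x \<times> 'v => 'k::comm_ring_1"
  assumes "finite A" "A \<subseteq> \<Omega> \<times> UNIV" "finite B" "B \<subseteq> \<Omega>"
    and s: "\<And>c h v x. (c, h, v) \<in> set r ==> x \<in> \<Omega> ==> s h x \<in> \<Omega> \<and> s' h (s h x) = x"
    and s': "\<And>c h v x. (c, h, v) \<in> set r ==> x \<in> \<Omega> ==> s' h x \<in> \<Omega> \<and> s h (s' h x) = x"
    and AB: "\<And>c h v x. (c, h, v) \<in> set r ==> x \<in> \<Omega> ==> w (s h x, v) ~= 0 ==> g x ~= 0 ==> x \<in> B \<and> (s h x, v) \<in> A"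
  shows "(\<Sum>x\<in>B. rule_eval s r w x * g x) = (\<Sum>y\<in>A. w y * rule_adj s' r g y)"
  using s s' AB
proof (induction r)
  case Nil
  show ?case by (simp add: rule_eval_def rule_adj_def)
next
  case (Cons t r)
  obtain c h v where t: "t = (c, h, v)" by (cases t)
  have IH: "(\<Sum>x\<in>B. rule_eval s r w x * g x) = (\<Sum>y\<in>A. w y * rule_adj s' r g y)"
    by (rule Cons.IH) (use Cons.prems in \<open>meson list.set_intros(2)\<close>)+
  have th: "(c, h, v) \<in> set (t # r)" by (simp add: t)
  have 1: "(\<Sum>x\<in>B. w (s h x, v) * g x) = (\<Sum>y\<in>A. w y * (if v = snd y then g (s' h (fst y)) else 0))"
  proof (rule pairing_rule_eval_term[where \<Omega> = \<Omega>, OF assms(1-4)])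
    fix x assume x: "x \<in> \<Omega>"
    show "s h x \<in> \<Omega> \<and> s' h (s h x) = x" by (rule Cons.prems(1)[OF th x])
    show "s' h x \<in> \<Omega> \<and> s h (s' h x) = x" by (rule Cons.prems(2)[OF th x])
    assume "w (s h x, v) ~= 0" "g x ~= 0"
    then show "x \<in> B \<and> (s h x, v) \<in> A" by (rule Cons.prems(3)[OF th x])
  qed
  have "(\<Sum>x\<in>B. rule_eval s (t # r) w x * g x)
      = of_int c * (\<Sum>x\<in>B. w (s h x, v) * g x) + (\<Sum>x\<in>B. rule_eval s r w x * g x)"
    by (simp add: rule_eval_def t distrib_right sum.distrib sum_distrib_left mult.assoc)
  also have "... = (\<Sum>y\<in>A. w y * rule_adj s' (t # r) g y)"
    unfolding 1 IH sum_distrib_left sum.distrib[symmetric]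
    by (intro sum.cong refl) (simp add: rule_adj_def t algebra_simps)
  finally show ?case .
qed

text \<open>Group and finite models alike: the shifts occurring in the rules act by permutations of
  \<open>\<Omega>\<close>.\<close>

locale perm_system =
  fixes \<Omega> :: "'x set" and V :: "'v set" and s s' :: "'g => 'x => 'x"
    and W :: "(int \<times> 'g \<times> 'v) list set"
  assumes finV: "finite V" and finW: "finite W"
    and s: "r \<in> W ==> (c, h, v) \<in> set r ==> x \<in> \<Omega> ==> s h x \<in> \<Omega> \<and> s' h (s h x) = x"
    and s': "r \<in> W ==> (c, h, v) \<in> set r ==> x \<in> \<Omega> ==> s' h x \<in> \<Omega> \<and> s h (s' h x) = x"
    and WV: "r \<in> W ==> (c, h, v) \<in> set r ==> v \<in> V"
begin

definition rv :: "(int \<times> 'g \<times> 'v) list => ('x \<times> 'v => 'k::comm_ring_1) => 'x => 'k" where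
  "rv r u x = (if x \<in> \<Omega> then rule_eval s r u x else 0)"

definition Lap :: "('x \<times> 'v => 'k::comm_ring_1) => 'x \<times> 'v => 'k" where
  "Lap u y = (if y \<in> \<Omega> \<times> V then \<Sum>r\<in>W. rule_adj s' r (rv r u) y else 0)"

definition Contr :: "('x \<times> 'v => real) => 'x \<times> 'v => real" where
  "Contr u y = (if y \<in> \<Omega> \<times> V then u y - Lap u y / rule_bound W else 0)"

definition energy :: "('x \<times> 'v => 'k::comm_ring_1) => ('x \<times> 'v => 'k) => 'k" where
  "energy w u = (\<Sum>r\<in>W. pairing (rv r w) (rv r u))"

definition FS :: "('x \<times> 'v => 'k::zero) set" where
  "FS = {u. finite_supp u \<and> (\<forall>y. y \<notin> \<Omega> \<times> V --> u y = 0)}"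

lemma bound_pos: "1 <= rule_bound W"
  unfolding rule_bound_def by (auto intro!: sum_nonneg mult_nonneg_nonneg sum_list_nonneg)

lemma finite_supp_rv:
  assumes "u \<in> FS" "r \<in> W"
  shows "finite_supp (rv r u)"
proof -
  have "{x. rv r u x ~= 0} \<subseteq> (\<Union>(c, h, v)\<in>set r. (\<lambda>y. s' h (fst y)) ` {y. u y ~= 0})"
  proof
    fix x assume x: "x \<in> {x. rv r u x ~= 0}"
    then have xo: "x \<in> \<Omega>" and ne: "rule_eval s r u x ~= 0" by (auto simp: rv_def split: if_splits)
    then obtain c h v where c: "(c, h, v) \<in> set r" "u (s h x, v) ~= 0"
      using rule_eval_nonzeroE by metis
    have "x = s' h (fst (s h x, v))" using s[OF assms(2) c(1) xo] by simp
    then show "x \<in> (\<Union>(c, h, v)\<in>set r. (\<lambda>y. s' h (fst y)) ` {y. u y ~= 0})"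
      using c by (intro UN_I[OF c(1)]) (auto intro!: image_eqI[of _ _ "(s h x, v)"])
  qed
  moreover have "finite ..." using assms(1) by (auto simp: FS_def finite_supp_def)
  ultimately show ?thesis unfolding finite_supp_def by (rule finite_subset)
qed

lemma pairing_Lap:
  assumes w: "w \<in> FS"
  shows "pairing w (Lap u) = energy w u"
proof -
  define A where "A = {y. w y ~= 0}"
  have A: "finite A" "A \<subseteq> \<Omega> \<times> V" using w by (auto simp: FS_def finite_supp_def A_def)
  have "pairing w (Lap u) = (\<Sum>y\<in>A. w y * (\<Sum>r\<in>W. rule_adj s' r (rv r u) y))"
    unfolding pairing_def A_def[symmetric] using A by (intro sum.cong refl) (auto simp: Lap_def)
  also have "... = (\<Sum>r\<in>W. \<Sum>y\<in>A. w y * rule_adj s' r (rv r u) y)"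
    unfolding sum_distrib_left by (rule sum.swap)
  also have "... = (\<Sum>r\<in>W. pairing (rv r w) (rv r u))"
  proof (intro sum.cong refl)
    fix r assume r: "r \<in> W"
    define B where "B = (\<Union>(c, h, v)\<in>set r. (\<lambda>y. s' h (fst y)) ` A)"
    have B: "finite B" "B \<subseteq> \<Omega>" using A s'[OF r] by (auto simp: B_def)
    have "(\<Sum>x\<in>B. rule_eval s r w x * rv r u x) = (\<Sum>y\<in>A. w y * rule_adj s' r (rv r u) y)"
    proof (rule sum_rule_eval_mult[where \<Omega> = \<Omega>])
      fix c h v x assume c: "(c, h, v) \<in> set r" and x: "x \<in> \<Omega>" and ne: "w (s h x, v) ~= 0"
      then have "(s h x, v) \<in> A" by (simp add: A_def)
      moreover have "x = s' h (fst (s h x, v))" using s[OF r c x] by simp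
      ultimately show "x \<in> B \<and> (s h x, v) \<in> A"
        unfolding B_def using c by (intro conjI UN_I[OF c]) (auto intro!: image_eqI[of _ _ "(s h x, v)"])
    qed (use A B s[OF r] s'[OF r] in auto)
    moreover have "pairing (rv r w) (rv r u) = (\<Sum>x\<in>B. rv r w x * rv r u x)"
    proof (rule pairing_eq[OF B(1) _ finite_supp_rv[OF w r]])
      fix x assume ne: "rv r w x ~= 0"
      then have x: "x \<in> \<Omega>" and "rule_eval s r w x ~= 0" by (auto simp: rv_def split: if_splits)
      then obtain c h v where c: "(c, h, v) \<in> set r" "w (s h x, v) ~= 0"
        using rule_eval_nonzeroE by metis
      then have "(s h x, v) \<in> A" by (simp add: A_def)
      have "x = s' h (fst (s h x, v))" using s[OF r c(1) x] by simp
      then show "x \<in> B" unfolding B_def using c \<open>(s h x, v) \<in> A\<close>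
        by (intro UN_I[OF c(1)]) (auto intro!: image_eqI[of _ _ "(s h x, v)"])
    qed
    moreover have "(\<Sum>x\<in>B. rv r w x * rv r u x) = (\<Sum>x\<in>B. rule_eval s r w x * rv r u x)"
      using B by (intro sum.cong) (auto simp: rv_def)
    ultimately show "(\<Sum>y\<in>A. w y * rule_adj s' r (rv r u) y) = pairing (rv r w) (rv r u)" by simp
  qed
  finally show ?thesis by (simp add: energy_def)
qed

lemma energy_commute: "u \<in> FS ==> w \<in> FS ==> energy u w = energy w u"
  unfolding energy_def by (intro sum.cong refl pairing_commute finite_supp_rv)

lemma energy_nonneg: "0 <= energy u (u :: _ => real)"
  unfolding energy_def pairing_def by (intro sum_nonneg) auto

lemma energy_le:
  fixes u :: "'x \<times> 'v => real"
  assumes u: "u \<in> FS"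
  shows "energy u u <= rule_bound W * pairing u u"
proof -
  have pos: "0 <= pairing u u" unfolding pairing_def by (intro sum_nonneg) auto
  have "pairing (rv r u) (rv r u) <= real (length r) * (\<Sum>(c, h, v)\<leftarrow>r. (of_int c)\<^sup>2) * pairing u u" if r: "r \<in> W" for r
  proof -
    define B where "B = {x. rv r u x ~= 0}"
    have B: "finite B" using finite_supp_rv[OF u r] by (simp add: finite_supp_def B_def)
    have BO: "B \<subseteq> \<Omega>" by (auto simp: B_def rv_def split: if_splits)
    have t: "(\<Sum>x\<in>B. (u (s h x, v))\<^sup>2) <= pairing u u" if c: "(c, h, v) \<in> set r" for c h v
    proof -
      have inj: "inj_on (\<lambda>x. (s h x, v)) B"
      proof (rule inj_onI)
        fix x y assume "x \<in> B" "y \<in> B" and eq: "(s h x, v) = (s h y, v)"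
        then have "x \<in> \<Omega>" "y \<in> \<Omega>" using BO by auto
        then have "s' h (s h x) = x" "s' h (s h y) = y" using s[OF r c] by blast+
        then show "x = y" using eq by (metis prod.inject)
      qed
      have "(\<Sum>x\<in>B. (u (s h x, v))\<^sup>2) = (\<Sum>y\<in>(\<lambda>x. (s h x, v)) ` B. (u y)\<^sup>2)"
        using inj by (simp add: sum.reindex)
      also have "... <= (\<Sum>y\<in>(\<lambda>x. (s h x, v)) ` B \<union> {y. u y ~= 0}. (u y)\<^sup>2)"
        using B u by (intro sum_mono2) (auto simp: FS_def finite_supp_def)
      also have "... = pairing u u"
      proof -
        have u': "finite_supp u" using u by (simp add: FS_def)
        then have "finite ((\<lambda>x. (s h x, v)) ` B \<union> {y. u y ~= 0})" using B by (simp add: finite_supp_def)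
        from pairing_eq[OF this _ u', of u] show ?thesis by (simp add: power2_eq_square)
      qed
      finally show ?thesis .
    qed
    have "pairing (rv r u) (rv r u) = (\<Sum>x\<in>B. (rule_eval s r u x)\<^sup>2)"
      unfolding pairing_def B_def[symmetric] using BO by (intro sum.cong) (auto simp: rv_def power2_eq_square)
    also have "... <= (\<Sum>x\<in>B. real (length r) * (\<Sum>(c, h, v)\<leftarrow>r. (of_int c)\<^sup>2 * (u (s h x, v))\<^sup>2))"
    proof (intro sum_mono)
      fix x
      show "(rule_eval s r u x)\<^sup>2 <= real (length r) * (\<Sum>(c, h, v)\<leftarrow>r. (of_int c)\<^sup>2 * (u (s h x, v))\<^sup>2)"
        unfolding rule_eval_def
        by (rule order_trans[OF sum_list_cauchy_schwarz]) (simp add: case_prod_unfold power_mult_distrib)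
    qed
    also have "... = real (length r) * (\<Sum>(c, h, v)\<leftarrow>r. (of_int c)\<^sup>2 * (\<Sum>x\<in>B. (u (s h x, v))\<^sup>2))"
    proof -
      have "(\<Sum>x\<in>B. \<Sum>(c, h, v)\<leftarrow>l. (of_int c)\<^sup>2 * (u (s h x, v))\<^sup>2) = (\<Sum>(c, h, v)\<leftarrow>l. (of_int c)\<^sup>2 * (\<Sum>x\<in>B. (u (s h x, v))\<^sup>2))"
        for l :: "(int \<times> 'g \<times> 'v) list"
        by (induction l) (auto simp: sum.distrib sum_distrib_left)
      then show ?thesis by (simp add: sum_distrib_left[symmetric])
    qed
    also have "... <= real (length r) * (\<Sum>(c, h, v)\<leftarrow>r. (of_int c)\<^sup>2 * pairing u u)"
      using t by (intro mult_left_mono sum_list_mono) (auto intro!: mult_left_mono)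
    also have "(\<Sum>(c, h, v)\<leftarrow>r. (of_int c)\<^sup>2 * pairing u u) = (\<Sum>(c, h, v)\<leftarrow>r. (of_int c)\<^sup>2) * pairing u u"
      by (simp add: case_prod_unfold sum_list_mult_const)
    finally show ?thesis by (simp add: mult.assoc)
  qed
  then have "energy u u <= (\<Sum>r\<in>W. real (length r) * (\<Sum>(c, h, v)\<leftarrow>r. (of_int c)\<^sup>2) * pairing u u)"
    unfolding energy_def by (intro sum_mono)
  also have "... <= rule_bound W * pairing u u"
    unfolding rule_bound_def distrib_right sum_distrib_right using pos by simp
  finally show ?thesis .
qed

lemma FS_diff: "u \<in> FS ==> w \<in> FS ==> (\<lambda>y. u y - w y) \<in> (FS :: ('x \<times> 'v => real) set)"
  unfolding FS_def finite_supp_def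
  by (auto intro: finite_subset[of _ "{y. u y ~= 0} \<union> {y. w y ~= 0}"])

lemma pairing_add_scale:
  fixes u :: "'a => real"
  assumes "finite_supp u"
  shows "pairing u (\<lambda>y. f y - g y) = pairing u f - pairing u g"
    and "pairing u (\<lambda>y. f y / a) = pairing u f / a"
  using assms by (simp_all add: pairing_def algebra_simps sum_subtractf sum_divide_distrib)

lemma finite_supp_Lap:
  assumes u: "u \<in> (FS :: ('x \<times> 'v => real) set)"
  shows "Lap u \<in> FS"
proof -
  have "{y. Lap u y ~= 0} \<subseteq> (\<Union>r\<in>W. (\<Union>(c, h, v)\<in>set r. (\<lambda>x. (s h x, v)) ` {x. rv r u x ~= 0}))"
  proof
    fix y assume "y \<in> {y. Lap u y ~= 0}"
    then have y: "y \<in> \<Omega> \<times> V" and "(\<Sum>r\<in>W. rule_adj s' r (rv r u) y) ~= 0"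
      by (auto simp: Lap_def split: if_splits)
    then obtain r where r: "r \<in> W" "rule_adj s' r (rv r u) y ~= 0" by (meson sum.neutral)
    have "\<exists>t\<in>set r. (case t of (c, h, v) => v = snd y \<and> rv r u (s' h (fst y)) ~= 0)"
    proof (rule ccontr)
      assume n: "\<not> ?thesis"
      have "rule_adj s' l (rv r u) y = 0" if "set l \<subseteq> set r" for l
        using that n by (induction l) (auto simp: rule_adj_def)
      then show False using r(2) by simp
    qed
    then obtain c h v where c: "(c, h, v) \<in> set r" "v = snd y" "rv r u (s' h (fst y)) ~= 0" by auto
    have "y = (s h (s' h (fst y)), v)" using s'[OF r(1) c(1), of "fst y"] y c(2) by (cases y) auto
    then show "y \<in> (\<Union>r\<in>W. (\<Union>(c, h, v)\<in>set r. (\<lambda>x. (s h x, v)) ` {x. rv r u x ~= 0}))"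
      using c(3) by (intro UN_I[OF r(1)] UN_I[OF c(1)]) auto
  qed
  moreover have "finite (\<Union>r\<in>W. (\<Union>(c, h, v)\<in>set r. (\<lambda>x. (s h x, v)) ` {x. rv r u x ~= 0}))"
    using finW finite_supp_rv[OF u] by (auto simp: finite_supp_def)
  ultimately have "finite_supp (Lap u)" unfolding finite_supp_def by (rule finite_subset)
  then show ?thesis by (auto simp: FS_def Lap_def)
qed

lemma Contr_eq: "u \<in> FS ==> Contr u = (\<lambda>y. u y - Lap u y / rule_bound W)"
  by (auto simp: Contr_def FS_def Lap_def fun_eq_iff)

lemma Contr_FS:
  assumes "u \<in> FS"
  shows "Contr u \<in> FS"
proof -
  have "(\<lambda>y. Lap u y / rule_bound W) \<in> FS"
    using finite_supp_Lap[OF assms] by (auto simp: FS_def finite_supp_def intro: finite_subset[rotated])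
  then show ?thesis unfolding Contr_eq[OF assms] by (rule FS_diff[OF assms])
qed

lemma Contr_pow_FS: "u \<in> FS ==> (Contr ^^ k) u \<in> FS"
  by (induction k) (auto intro: Contr_FS)

lemma FS_supp: "u \<in> FS ==> finite_supp u" by (simp add: FS_def)

lemma pairing_Contr:
  assumes "w \<in> FS" "u \<in> FS"
  shows "pairing w (Contr u) = pairing w u - energy w u / rule_bound W"
  using assms by (simp add: Contr_eq pairing_add_scale FS_supp pairing_Lap)

lemma pairing_Contr_commute:
  assumes "w \<in> FS" "u \<in> FS"
  shows "pairing w (Contr u) = pairing (Contr w) u"
proof -
  have "pairing (Contr w) u = pairing u (Contr w)"
    using assms by (intro pairing_commute FS_supp Contr_FS)
  then show ?thesis
    using assms by (simp add: pairing_Contr energy_commute[of u w] pairing_commute[OF FS_supp FS_supp, of u w])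
qed

lemma pairing_Contr_bounds:
  assumes "u \<in> FS"
  shows "0 <= pairing u (Contr u)" "pairing u (Contr u) <= pairing u u"
proof -
  have "energy u u / rule_bound W <= pairing u u"
    using energy_le[OF assms] bound_pos by (simp add: field_simps)
  then show "0 <= pairing u (Contr u)" using assms by (simp add: pairing_Contr)
  have "0 <= energy u u / rule_bound W" using energy_nonneg[of u] bound_pos by simp
  then show "pairing u (Contr u) <= pairing u u" using assms by (simp add: pairing_Contr)
qed

lemma point_mass_FS: "y \<in> \<Omega> \<times> V ==> (point_mass y :: _ => real) \<in> FS"
  by (auto simp: FS_def finite_supp_def point_mass_def)

lemma pairing_point_mass: "pairing (point_mass y :: _ => 'k::comm_ring_1) f = f y"
proof -
  have "{z. (point_mass y z :: 'k) ~= 0} = {y}" by (auto simp: point_mass_def)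
  then show ?thesis by (simp add: pairing_def point_mass_def)
qed

text \<open>For the group, the sum of the moments over \<open>V\<close> at the identity is the von
  Neumann trace of the power of the contraction.\<close>

definition moment :: "'x \<times> 'v => nat => real" where
  "moment y k = (Contr ^^ k) (point_mass y) y"

lemma pairing_iterates:
  assumes y: "y \<in> \<Omega> \<times> V"
  shows "pairing ((Contr ^^ j) (point_mass y)) ((Contr ^^ k) (point_mass y)) = moment y (j + k)"
proof (induction j arbitrary: k)
  case 0
  show ?case by (simp add: moment_def pairing_point_mass)
next
  case (Suc j)
  have "pairing ((Contr ^^ Suc j) (point_mass y)) ((Contr ^^ k) (point_mass y))
      = pairing ((Contr ^^ j) (point_mass y)) ((Contr ^^ Suc k) (point_mass y))"
    using pairing_Contr_commute[OF Contr_pow_FS Contr_pow_FS, OF point_mass_FS[OF y] point_mass_FS[OF y], of j k] by simp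
  then show ?case using Suc[of "Suc k"] by simp
qed

lemma moment_nonneg:
  assumes y: "y \<in> \<Omega> \<times> V"
  shows "0 <= moment y k"
proof (cases "even k")
  case True
  then obtain j where "k = j + j" by (metis evenE mult_2)
  then have "moment y k = pairing ((Contr ^^ j) (point_mass y)) ((Contr ^^ j) (point_mass y))"
    using pairing_iterates[OF y] by simp
  then show ?thesis by (simp add: pairing_def sum_nonneg)
next
  case False
  then obtain j where "k = j + Suc j" by (metis oddE mult_2 add_Suc_right Suc_eq_plus1)
  then have "moment y k = pairing ((Contr ^^ j) (point_mass y)) (Contr ((Contr ^^ j) (point_mass y)))"
    using pairing_iterates[OF y, of j "Suc j"] by simp
  then show ?thesis using pairing_Contr_bounds(1)[OF Contr_pow_FS[OF point_mass_FS[OF y]]] by simp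
qed

lemma moment_Suc_le:
  assumes y: "y \<in> \<Omega> \<times> V"
  shows "moment y (Suc k) <= moment y k"
proof (cases "even k")
  case True
  then obtain j where k: "k = j + j" by (metis evenE mult_2)
  then show ?thesis
    using pairing_Contr_bounds(2)[OF Contr_pow_FS[OF point_mass_FS[OF y]], of j]
      pairing_iterates[OF y, of j "Suc j"] pairing_iterates[OF y, of j j] by simp
next
  case False
  then obtain j where k: "k = j + Suc j" by (metis oddE mult_2 add_Suc_right Suc_eq_plus1)
  \<comment> \<open>With \<open>T\<close> the contraction, \<open>T - T^2 = T (1 - T) T + (1 - T) T (1 - T)\<close> is positive.\<close>
  define z where "z i = (Contr ^^ i) (point_mass y)" for i
  have zF: "z i \<in> FS" for i unfolding z_def by (rule Contr_pow_FS[OF point_mass_FS[OF y]])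
  have zS: "Contr (z i) = z (Suc i)" for i by (simp add: z_def)
  have zz: "pairing (z i) (z l) = moment y (i + l)" for i l unfolding z_def by (rule pairing_iterates[OF y])
  define w where "w = (\<lambda>x. z j x - z (Suc j) x)"
  have wF: "w \<in> FS" unfolding w_def by (intro FS_diff zF)
  have wz: "pairing w (z i) = moment y (i + j) - moment y (i + Suc j)" for i
  proof -
    have "pairing w (z i) = pairing (z i) w" by (intro pairing_commute FS_supp wF zF)
    also have "... = pairing (z i) (z j) - pairing (z i) (z (Suc j))"
      unfolding w_def by (rule pairing_add_scale(1)[OF FS_supp[OF zF]])
    finally show ?thesis by (simp add: zz)
  qed
  have Cz: "pairing w (Contr w) = pairing w (z (Suc j)) - pairing w (z (Suc (Suc j)))"
  proof -
    have "pairing w (Contr w) = pairing (Contr w) w" by (rule pairing_Contr_commute[OF wF wF])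
    also have "... = pairing (Contr w) (z j) - pairing (Contr w) (z (Suc j))"
      by (subst (2) w_def, rule pairing_add_scale(1)[OF FS_supp[OF Contr_FS[OF wF]]])
    finally show ?thesis by (simp add: pairing_Contr_commute[symmetric, OF wF zF] zS)
  qed
  have "0 <= pairing w (Contr w)" by (rule pairing_Contr_bounds(1)[OF wF])
  moreover have "pairing (z (Suc j)) (Contr (z (Suc j))) <= pairing (z (Suc j)) (z (Suc j))"
    by (rule pairing_Contr_bounds(2)[OF zF])
  ultimately show ?thesis unfolding Cz zS by (simp add: wz zz k)
qed

lemma moment_antimono: "y \<in> \<Omega> \<times> V ==> j <= k ==> moment y k <= moment y j"
  using lift_Suc_antimono_le[of "moment y" j k] moment_Suc_le by blast

lemma moment_0: "moment y 0 = 1"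
  by (simp add: moment_def point_mass_def)

end

lemma rule_eval_point_mass:
  fixes u :: "'x \<times> 'v => 'k::comm_ring_1"
  assumes "finite X" "\<And>c h v. (c, h, v) \<in> set r ==> (s h x, v) \<in> X"
  shows "rule_eval s r u x = (\<Sum>y\<in>X. of_int (rule_eval s r (point_mass y) x) * u y)"
  using assms(2)
proof (induction r)
  case Nil
  show ?case by (simp add: rule_eval_def)
next
  case (Cons t r)
  obtain c h v where t: "t = (c, h, v)" by (cases t)
  have IH: "rule_eval s r u x = (\<Sum>y\<in>X. of_int (rule_eval s r (point_mass y) x) * u y)"
    by (rule Cons.IH) (use Cons.prems in auto)
  have inX: "(s h x, v) \<in> X" using Cons.prems[of c h v] by (simp add: t)
  have "(\<Sum>y\<in>X. of_int (rule_eval s (t # r) (point_mass y) x) * u y)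
      = (\<Sum>y\<in>X. (if (s h x, v) = y then of_int c * u y else 0) + of_int (rule_eval s r (point_mass y) x) * u y)"
    by (intro sum.cong refl) (auto simp: rule_eval_def t point_mass_def distrib_right)
  also have "... = of_int c * u (s h x, v) + rule_eval s r u x"
    using inX assms(1) by (simp add: sum.distrib IH)
  finally show ?case by (simp add: rule_eval_def t)
qed

lemma sum_rotate3:
  "(\<Sum>a\<in>A. \<Sum>b\<in>B. \<Sum>c\<in>C. f a b c) = (\<Sum>c\<in>C. \<Sum>a\<in>A. \<Sum>b\<in>B. f a b c)"
proof -
  have "(\<Sum>a\<in>A. \<Sum>b\<in>B. \<Sum>c\<in>C. f a b c) = (\<Sum>a\<in>A. \<Sum>c\<in>C. \<Sum>b\<in>B. f a b c)"
    by (intro sum.cong refl sum.swap)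
  also have "... = (\<Sum>c\<in>C. \<Sum>a\<in>A. \<Sum>b\<in>B. f a b c)" by (rule sum.swap)
  finally show ?thesis .
qed

context perm_system
begin

lemma Lap_finite:
  fixes u :: "'x \<times> 'v => real"
  assumes fin: "finite \<Omega>" and y: "y \<in> \<Omega> \<times> V"
  shows "Lap u y = (\<Sum>y'\<in>\<Omega> \<times> V. of_int (\<Sum>r\<in>W. \<Sum>x\<in>\<Omega>. rule_eval s r (point_mass y) x * rule_eval s r (point_mass y') x) * u y')"
proof -
  have finX: "finite (\<Omega> \<times> V)" using fin finV by simp
  have pm: "rule_eval s r (point_mass y) x = real_of_int (rule_eval s r (point_mass y) x)" for r x
    by (induction r) (auto simp: rule_eval_def point_mass_def)
  have "rule_adj s' r (rv r u) y = (\<Sum>x\<in>\<Omega>. rule_eval s r (point_mass y) x * rv r u x)" if r: "r \<in> W" for r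
  proof -
    have "(\<Sum>x\<in>\<Omega>. rule_eval s r (point_mass y) x * rv r u x)
        = (\<Sum>z\<in>\<Omega> \<times> V. point_mass y z * rule_adj s' r (rv r u) z)"
      by (rule sum_rule_eval_mult[where \<Omega> = \<Omega>]) (use fin finX s[OF r] s'[OF r] WV[OF r] in auto)
    also have "... = (\<Sum>z\<in>\<Omega> \<times> V. if z = y then rule_adj s' r (rv r u) z else 0)"
      by (intro sum.cong) (auto simp: point_mass_def)
    also have "... = rule_adj s' r (rv r u) y" using finX y by simp
    finally show ?thesis by simp
  qed
  then have "Lap u y = (\<Sum>r\<in>W. \<Sum>x\<in>\<Omega>. rule_eval s r (point_mass y) x * rv r u x)"
    using y by (simp add: Lap_def)
  also have "... = (\<Sum>r\<in>W. \<Sum>x\<in>\<Omega>. \<Sum>y'\<in>\<Omega> \<times> V. of_int (rule_eval s r (point_mass y) x * rule_eval s r (point_mass y') x) * u y')"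
  proof (intro sum.cong refl)
    fix r x assume r: "r \<in> W" and x: "x \<in> \<Omega>"
    have "rv r u x = (\<Sum>y'\<in>\<Omega> \<times> V. of_int (rule_eval s r (point_mass y') x) * u y')"
      using rule_eval_point_mass[OF finX, of r s x u] s[OF r _ x] WV[OF r] x by (auto simp: rv_def)
    then show "rule_eval s r (point_mass y) x * rv r u x = (\<Sum>y'\<in>\<Omega> \<times> V. of_int (rule_eval s r (point_mass y) x * rule_eval s r (point_mass y') x) * u y')"
      by (simp add: pm sum_distrib_left mult.assoc)
  qed
  also have "... = (\<Sum>y'\<in>\<Omega> \<times> V. \<Sum>r\<in>W. \<Sum>x\<in>\<Omega>. of_int (rule_eval s r (point_mass y) x * rule_eval s r (point_mass y') x) * u y')"
    by (rule sum_rotate3)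
  finally show ?thesis by (simp add: sum_distrib_right)
qed

text \<open>The matrix of the Laplacian is integral and positive, and its kernel is the common
  kernel of the rules.\<close>

lemma kernel_dim_ge:
  assumes fin: "finite \<Omega>" and eps: "0 < eps" "eps < 1"
  obtains Z :: "nat set" and w :: "nat => 'x \<times> 'v => complex"
  where "finite Z" "\<And>a r x. a \<in> Z ==> r \<in> W ==> x \<in> \<Omega> ==> rule_eval s r (w a) x = 0"
    "indep_family (\<Omega> \<times> V) Z w"
    "(\<Sum>y\<in>\<Omega> \<times> V. moment y k) - real (card (\<Omega> \<times> V)) *
      (ln (rule_bound W) / ln (rule_bound W / eps) + (1 - eps / rule_bound W) ^ k) <= real (card Z)"
proof -
  define X where "X = \<Omega> \<times> V"
  have finX: "finite X" using fin finV by (simp add: X_def)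
  define M :: "'x \<times> 'v => 'x \<times> 'v => int"
    where "M y y' = (\<Sum>r\<in>W. \<Sum>x\<in>\<Omega>. rule_eval s r (point_mass y) x * rule_eval s r (point_mass y') x)" for y y'
  have ev: "rule_eval s r u x = (\<Sum>y\<in>X. of_int (rule_eval s r (point_mass y) x) * u y)"
    if "r \<in> W" "x \<in> \<Omega>" for r x and u :: "'x \<times> 'v => 'k::comm_ring_1"
    using rule_eval_point_mass[OF finX, of r s x u] s[OF that(1) _ that(2)] WV[OF that(1)] by (auto simp: X_def)
  have quad: "(\<Sum>y\<in>X. \<Sum>y'\<in>X. f y * of_int (M y y') * u y')
      = (\<Sum>r\<in>W. \<Sum>x\<in>\<Omega>. rule_eval s r f x * rule_eval s r u x)"
    for f u :: "'x \<times> 'v => 'k::comm_ring_1"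
  proof -
    let ?R = "\<lambda>r x y. of_int (rule_eval s r (point_mass y) x) :: 'k"
    have "(\<Sum>r\<in>W. \<Sum>x\<in>\<Omega>. rule_eval s r f x * rule_eval s r u x)
        = (\<Sum>r\<in>W. \<Sum>x\<in>\<Omega>. \<Sum>y\<in>X. \<Sum>y'\<in>X. ?R r x y * f y * (?R r x y' * u y'))"
    proof (intro sum.cong refl)
      fix r x assume r: "r \<in> W" and x: "x \<in> \<Omega>"
      show "rule_eval s r f x * rule_eval s r u x = (\<Sum>y\<in>X. \<Sum>y'\<in>X. ?R r x y * f y * (?R r x y' * u y'))"
        by (subst ev[OF r x, of f], subst ev[OF r x, of u], rule sum_product)
    qed
    also have "... = (\<Sum>r\<in>W. \<Sum>y\<in>X. \<Sum>y'\<in>X. \<Sum>x\<in>\<Omega>. ?R r x y * f y * (?R r x y' * u y'))"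
      by (intro sum.cong refl, subst sum.swap, rule sum.cong[OF refl], rule sum.swap)
    also have "... = (\<Sum>y\<in>X. \<Sum>y'\<in>X. \<Sum>r\<in>W. \<Sum>x\<in>\<Omega>. ?R r x y * f y * (?R r x y' * u y'))"
      by (subst sum.swap, rule sum.cong[OF refl], rule sum.swap)
    also have "... = (\<Sum>y\<in>X. \<Sum>y'\<in>X. f y * of_int (M y y') * u y')"
      by (intro sum.cong refl) (simp add: M_def sum_distrib_left sum_distrib_right mult_ac)
    finally show ?thesis by simp
  qed
  have sym: "M x y = M y x" for x y by (simp add: M_def mult.commute)
  have psd: "0 <= (\<Sum>x\<in>X. \<Sum>y\<in>X. u x * of_int (M x y) * u y)" for u :: "_ => real"
    unfolding quad by (intro sum_nonneg) auto
  have bd: "(\<Sum>x\<in>X. \<Sum>y\<in>X. u x * of_int (M x y) * u y) <= rule_bound W * (\<Sum>x\<in>X. (u x)\<^sup>2)" for u :: "_ => real"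
  proof -
    define u' where "u' y = (if y \<in> X then u y else 0)" for y
    have u'F: "u' \<in> FS" using finX by (auto simp: FS_def finite_supp_def u'_def X_def)
    have fs: "finite_supp (rv r u')" for r
      unfolding finite_supp_def by (rule finite_subset[OF _ fin]) (auto simp: rv_def)
    have "(\<Sum>x\<in>X. \<Sum>y\<in>X. u x * of_int (M x y) * u y) = (\<Sum>x\<in>X. \<Sum>y\<in>X. u' x * of_int (M x y) * u' y)"
      by (intro sum.cong refl) (auto simp: u'_def)
    also have "... = energy u' u'"
      unfolding quad energy_def
    proof (intro sum.cong refl)
      fix r
      have "pairing (rv r u') (rv r u') = (\<Sum>x\<in>\<Omega>. rv r u' x * rv r u' x)"
        by (rule pairing_eq[OF fin _ fs]) (auto simp: rv_def split: if_splits)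
      then show "(\<Sum>x\<in>\<Omega>. rule_eval s r u' x * rule_eval s r u' x) = pairing (rv r u') (rv r u')"
        by (simp add: rv_def)
    qed
    also have "... <= rule_bound W * pairing u' u'" by (rule energy_le[OF u'F])
    also have "pairing u' u' = (\<Sum>x\<in>X. u' x * u' x)"
      by (rule pairing_eq[OF finX _ FS_supp[OF u'F]]) (auto simp: u'_def split: if_splits)
    also have "... = (\<Sum>x\<in>X. (u x)\<^sup>2)" by (intro sum.cong refl) (simp add: u'_def power2_eq_square)
    finally show ?thesis .
  qed
  have T: "Contr u x = u x - (\<Sum>y\<in>X. of_int (M x y) * u y) / rule_bound W" if "x \<in> X" for u x
    using that Lap_finite[OF fin, of x u] unfolding Contr_def X_def M_def by simp
  show thesis
  proof (rule integer_psd_kernel[OF finX sym psd bd bound_pos eps T, of k])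
    fix Z :: "nat set" and w :: "nat => 'x \<times> 'v => complex"
    assume Z: "finite Z" "\<And>a x. a \<in> Z ==> x \<in> X ==> (\<Sum>y\<in>X. of_int (M x y) * w a y) = 0"
      "indep_family X Z w"
      "(\<Sum>x\<in>X. (Contr ^^ k) (point_mass x) x) - real (card X) *
        (ln (rule_bound W) / ln (rule_bound W / eps) + (1 - eps / rule_bound W) ^ k) <= real (card Z)"
    have ker: "rule_eval s r (w a) x = 0" if a: "a \<in> Z" and r: "r \<in> W" and x: "x \<in> \<Omega>" for a r x
    proof -
      let ?f = "\<lambda>y. cnj (w a y)"
      have cnj: "rule_eval s r ?f x = cnj (rule_eval s r (w a) x)" for r x
        by (induction r) (auto simp: rule_eval_def)
      have "0 = (\<Sum>y\<in>X. \<Sum>y'\<in>X. ?f y * of_int (M y y') * w a y')"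
        using Z(2)[OF a] by (simp add: mult.assoc flip: sum_distrib_left)
      also have "... = (\<Sum>r\<in>W. \<Sum>x\<in>\<Omega>. cnj (rule_eval s r (w a) x) * rule_eval s r (w a) x)"
        unfolding quad cnj ..
      also have "... = complex_of_real (\<Sum>r\<in>W. \<Sum>x\<in>\<Omega>. (cmod (rule_eval s r (w a) x))\<^sup>2)"
        unfolding of_real_sum complex_norm_square by (simp add: mult.commute)
      finally have "complex_of_real (\<Sum>r\<in>W. \<Sum>x\<in>\<Omega>. (cmod (rule_eval s r (w a) x))\<^sup>2) = 0"
        by (rule HOL.sym)
      then have "(\<Sum>r\<in>W. \<Sum>x\<in>\<Omega>. (cmod (rule_eval s r (w a) x))\<^sup>2) = 0"
        by (simp only: of_real_eq_0_iff)
      then have "(\<Sum>x\<in>\<Omega>. (cmod (rule_eval s r (w a) x))\<^sup>2) = 0"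
        using r finW by (subst (asm) sum_nonneg_eq_0_iff) (auto intro: sum_nonneg)
      then have "(cmod (rule_eval s r (w a) x))\<^sup>2 = 0"
        using x fin by (subst (asm) sum_nonneg_eq_0_iff) auto
      then show ?thesis by simp
    qed
    show thesis
    proof (rule that[of Z w])
      show "finite Z" by (rule Z)
      show "rule_eval s r (w a) x = 0" if "a \<in> Z" "r \<in> W" "x \<in> \<Omega>" for a r x
        by (rule ker[OF that])
      show "indep_family (\<Omega> \<times> V) Z w" using Z(3) by (simp only: X_def)
      show "(\<Sum>y\<in>\<Omega> \<times> V. moment y k) - real (card (\<Omega> \<times> V)) *
          (ln (rule_bound W) / ln (rule_bound W / eps) + (1 - eps / rule_bound W) ^ k) <= real (card Z)"
        using Z(4) by (simp only: X_def moment_def)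
    qed
  qed
qed

end

section \<open>Kernel dimensions along a sofic approximation\<close>

locale sofic = group G for G :: "('g, 'm) monoid_scheme" (structure) +
  fixes D :: "nat => 'd set" and \<sigma> :: "nat => 'g => 'd => 'd"
  assumes sofic: "sofic_approximation G D \<sigma>"
begin

definition mult_good :: "nat => ('g \<times> 'g) set => 'd set" where
  "mult_good n P = {i \<in> D n. \<forall>(g, h)\<in>P. \<sigma> n g (\<sigma> n h i) = \<sigma> n (g \<otimes> h) i}"

definition free_good :: "nat => 'g set => 'd set" where
  "free_good n F = {i \<in> D n. \<forall>g\<in>F. \<sigma> n g i ~= i}"

lemma fin_D: "finite (D n)" and bij_\<sigma>: "g \<in> carrier G ==> bij_betw (\<sigma> n g) (D n) (D n)"
  and \<sigma>_one: "i \<in> D n ==> \<sigma> n \<one> i = i"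
  using sofic unfolding sofic_approximation_def by auto

lemma card_D_at_top: "filterlim (\<lambda>n. card (D n)) at_top sequentially"
  using sofic unfolding sofic_approximation_def by auto

lemma eventually_D_pos: "eventually (\<lambda>n. 0 < card (D n)) sequentially"
  using card_D_at_top unfolding filterlim_at_top by (rule allE[of _ 1]) (auto elim: eventually_mono)

lemma \<sigma>_in: "g \<in> carrier G ==> i \<in> D n ==> \<sigma> n g i \<in> D n"
  using bij_\<sigma>[of g n] by (auto simp: bij_betw_def)

lemma complement_density:
  assumes "(\<lambda>n. real (card (S n)) / real (card (D n))) \<longlonglongrightarrow> 1" "\<And>n. S n \<subseteq> D n" "0 < e"
  shows "eventually (\<lambda>n. real (card (D n - S n)) <= e * real (card (D n))) sequentially"
proof -
  have "eventually (\<lambda>n. 1 - e < real (card (S n)) / real (card (D n))) sequentially"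
    using assms(1,3) by (intro order_tendstoD(1)) auto
  then show ?thesis
    using eventually_D_pos
  proof eventually_elim
    case (elim n)
    have "real (card (D n - S n)) = real (card (D n)) - real (card (S n))"
      using assms(2)[of n] fin_D[of n] by (simp add: card_Diff_subset finite_subset card_mono of_nat_diff)
    moreover have "(1 - e) * real (card (D n)) < real (card (S n))" using elim by (simp add: field_simps)
    ultimately show ?case by (simp add: algebra_simps)
  qed
qed

lemma eventually_finite_inter:
  assumes "finite I" "0 < e"
    and "\<And>j e. j \<in> I ==> 0 < e ==> eventually (\<lambda>n. real (card (D n - S j n)) <= e * real (card (D n))) sequentially"
  shows "eventually (\<lambda>n. real (card (D n - {i\<in>D n. \<forall>j\<in>I. i \<in> S j n})) <= e * real (card (D n))) sequentially"
  using assms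
proof (induction I arbitrary: e rule: finite_induct)
  case empty
  have "D n - {i \<in> D n. \<forall>j\<in>{}. i \<in> S j n} = {}" for n by auto
  then show ?case using empty by simp
next
  case (insert j I)
  have "eventually (\<lambda>n. real (card (D n - {i\<in>D n. \<forall>j\<in>I. i \<in> S j n})) <= (e / 2) * real (card (D n))) sequentially"
    by (rule insert.IH) (use insert.prems in auto)
  moreover have "eventually (\<lambda>n. real (card (D n - S j n)) <= (e / 2) * real (card (D n))) sequentially"
    by (rule insert.prems) (use insert.prems in auto)
  ultimately show ?case
  proof eventually_elim
    case (elim n)
    have "D n - {i \<in> D n. \<forall>j\<in>insert j I. i \<in> S j n} = (D n - {i\<in>D n. \<forall>j\<in>I. i \<in> S j n}) \<union> (D n - S j n)"
      by auto
    then have "card (D n - {i \<in> D n. \<forall>j\<in>insert j I. i \<in> S j n})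
        <= card (D n - {i\<in>D n. \<forall>j\<in>I. i \<in> S j n}) + card (D n - S j n)"
      by (simp only: card_Un_le)
    from of_nat_mono[OF this, where 'a = real]
    have "real (card (D n - {i \<in> D n. \<forall>j\<in>insert j I. i \<in> S j n}))
        <= real (card (D n - {i\<in>D n. \<forall>j\<in>I. i \<in> S j n})) + real (card (D n - S j n))"
      by simp
    then show ?case using elim by simp
  qed
qed

lemma eventually_mult_good:
  assumes "finite P" "P \<subseteq> carrier G \<times> carrier G" "0 < e"
  shows "eventually (\<lambda>n. real (card (D n - mult_good n P)) <= e * real (card (D n))) sequentially"
proof -
  define S where "S = (\<lambda>(g, h) n. {i \<in> D n. \<sigma> n g (\<sigma> n h i) = \<sigma> n (g \<otimes> h) i})"
  have "eventually (\<lambda>n. real (card (D n - S j n)) <= e * real (card (D n))) sequentially" if "j \<in> P" "0 < e" for j e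
  proof (rule complement_density)
    obtain g h where j: "j = (g, h)" by (cases j)
    then have "g \<in> carrier G" "h \<in> carrier G" using that(1) assms(2) by auto
    with j show "(\<lambda>n. real (card (S j n)) / real (card (D n))) \<longlonglongrightarrow> 1"
      using sofic unfolding sofic_approximation_def S_def by auto
  qed (use that in \<open>auto simp: S_def split: prod.splits\<close>)
  from eventually_finite_inter[OF assms(1,3), of S, OF this]
  have "eventually (\<lambda>n. real (card (D n - {i\<in>D n. \<forall>j\<in>P. i \<in> S j n})) <= e * real (card (D n))) sequentially" by blast
  moreover have "{i\<in>D n. \<forall>j\<in>P. i \<in> S j n} = mult_good n P" for n
    by (auto simp: S_def mult_good_def)
  ultimately show ?thesis by simp
qed

lemma eventually_free_good:
  assumes "finite F" "F \<subseteq> carrier G - {\<one>}" "0 < e"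
  shows "eventually (\<lambda>n. real (card (D n - free_good n F)) <= e * real (card (D n))) sequentially"
proof -
  define S where "S = (\<lambda>g n. {i \<in> D n. \<sigma> n g i ~= i})"
  have "eventually (\<lambda>n. real (card (D n - S j n)) <= e * real (card (D n))) sequentially" if "j \<in> F" "0 < e" for j e
  proof (rule complement_density)
    show "(\<lambda>n. real (card (S j n)) / real (card (D n))) \<longlonglongrightarrow> 1"
      using sofic assms(2) that(1) unfolding sofic_approximation_def S_def by auto
  qed (use that in \<open>auto simp: S_def\<close>)
  from eventually_finite_inter[OF assms(1,3), of S, OF this]
  have "eventually (\<lambda>n. real (card (D n - {i\<in>D n. \<forall>j\<in>F. i \<in> S j n})) <= e * real (card (D n))) sequentially" by blast
  moreover have "{i\<in>D n. \<forall>j\<in>F. i \<in> S j n} = free_good n F" for n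
    by (auto simp: S_def free_good_def)
  ultimately show ?thesis by simp
qed

end

locale sofic_rules = sofic G D \<sigma>
  for G :: "('g, 'm) monoid_scheme" (structure) and D :: "nat => 'd set" and \<sigma> :: "nat => 'g => 'd => 'd" +
  fixes V :: "'v set" and W :: "(int \<times> 'g \<times> 'v) list set"
  assumes finV: "finite V" and finW: "finite W"
    and WG: "r \<in> W ==> (c, h, v) \<in> set r ==> h \<in> carrier G"
    and WV: "r \<in> W ==> (c, h, v) \<in> set r ==> v \<in> V"
begin

sublocale grp: perm_system "carrier G" V "(\<otimes>)" "\<lambda>h x. inv h \<otimes> x" W
proof
  fix r c h v x assume r: "r \<in> W" "(c, h, v) \<in> set r" and x: "x \<in> carrier G"
  have h: "h \<in> carrier G" by (rule WG[OF r])
  show "h \<otimes> x \<in> carrier G \<and> inv h \<otimes> (h \<otimes> x) = x" using h x by (simp add: m_assoc[symmetric])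
  show "inv h \<otimes> x \<in> carrier G \<and> h \<otimes> (inv h \<otimes> x) = x" using h x by (simp add: m_assoc[symmetric])
qed (use finV finW WV in auto)

abbreviation "\<tau> n h \<equiv> inv_into (D n) (\<sigma> n h)"

lemma \<tau>_\<sigma>: "h \<in> carrier G ==> i \<in> D n ==> \<tau> n h (\<sigma> n h i) = i"
  using bij_\<sigma>[of h n] by (auto simp: bij_betw_def intro: inv_into_f_f)

lemma model: "perm_system (D n) V (\<sigma> n) (\<tau> n) W"
proof
  fix r c h v x assume r: "r \<in> W" "(c, h, v) \<in> set r" and x: "x \<in> D n"
  have h: "h \<in> carrier G" by (rule WG[OF r])
  show "\<sigma> n h x \<in> D n \<and> \<tau> n h (\<sigma> n h x) = x" using \<sigma>_in[OF h x] \<tau>_\<sigma>[OF h x] by simp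
  show "\<tau> n h x \<in> D n \<and> \<sigma> n h (\<tau> n h x) = x"
    using bij_\<sigma>[OF h, of n] x by (auto simp: bij_betw_def inv_into_into f_inv_into_f)
qed (use finV finW WV in auto)

text \<open>The window seen from the point \<open>i\<close> of the model, transported to the group.
  Where \<open>\<sigma> n\<close> is multiplicative and free, transport commutes with the
  contraction.\<close>

definition pull :: "nat => 'd => ('d \<times> 'v => 'k) => 'g \<times> 'v => 'k" where
  "pull n i u = (\<lambda>(g, v). u (\<sigma> n g i, v))"

definition shifts :: "'g set" where
  "shifts = (\<Union>r\<in>W. (\<lambda>(c, h, v). h) ` set r)"

text \<open>The elements whose values the contraction reads when it is evaluated on
  \<open>\<Gamma>\<close>.\<close>

definition nbhd :: "'g set => 'g set" where
  "nbhd \<Gamma> = \<Gamma> \<union> (\<lambda>(h', h, g). h' \<otimes> (inv h \<otimes> g)) ` (shifts \<times> shifts \<times> \<Gamma>)"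

definition nbhd_pairs :: "'g set => ('g \<times> 'g) set" where
  "nbhd_pairs \<Gamma> = (\<lambda>(h', h, g). (h', inv h \<otimes> g)) ` (shifts \<times> shifts \<times> \<Gamma>)"

lemma shifts_fin: "finite shifts" and shifts_G: "shifts \<subseteq> carrier G"
  and shiftsI: "r \<in> W ==> (c, h, v) \<in> set r ==> h \<in> shifts"
proof -
  show "finite shifts" unfolding shifts_def using finW by auto
  show "shifts \<subseteq> carrier G" unfolding shifts_def using WG by auto
  show "r \<in> W ==> (c, h, v) \<in> set r ==> h \<in> shifts" unfolding shifts_def by force
qed

lemma nbhd: "finite \<Gamma> ==> \<Gamma> \<subseteq> carrier G ==> finite (nbhd \<Gamma>) \<and> nbhd \<Gamma> \<subseteq> carrier G"
  unfolding nbhd_def using shifts_fin shifts_G by (auto simp: subset_iff)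

lemma nbhd_pairs: "finite \<Gamma> ==> \<Gamma> \<subseteq> carrier G ==> finite (nbhd_pairs \<Gamma>) \<and> nbhd_pairs \<Gamma> \<subseteq> carrier G \<times> carrier G"
  unfolding nbhd_pairs_def using shifts_fin shifts_G by auto

lemma rule_adj_cong:
  assumes "\<And>c h v. (c, h, v) \<in> set r ==> v = snd y ==> g (s h (fst y)) = g' (s' h (fst y'))" "snd y = snd y'"
  shows "rule_adj s r g y = rule_adj s' r g' y'"
  unfolding rule_adj_def
  by (intro arg_cong[of _ _ sum_list] map_cong refl) (use assms in auto)

lemma Contr_local:
  assumes eq: "\<And>g v. g \<in> nbhd \<Gamma> ==> v \<in> V ==> u (g, v) = u' (g, v)"
    and g: "g \<in> \<Gamma>" "g \<in> carrier G" and v: "v \<in> V"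
  shows "grp.Contr u (g, v) = grp.Contr u' (g, v)"
proof -
  have "rule_adj (\<lambda>h x. inv h \<otimes> x) r (grp.rv r u) (g, v) = rule_adj (\<lambda>h x. inv h \<otimes> x) r (grp.rv r u') (g, v)"
    if r: "r \<in> W" for r
  proof (rule rule_adj_cong)
    fix c h v' assume h: "(c, h, v') \<in> set r"
    have "rule_eval (\<otimes>) r u (inv h \<otimes> g) = rule_eval (\<otimes>) r u' (inv h \<otimes> g)"
    proof (rule rule_eval_cong)
      fix c' h' v'' assume h': "(c', h', v'') \<in> set r"
      have "h' \<otimes> (inv h \<otimes> g) \<in> nbhd \<Gamma>"
        unfolding nbhd_def using shiftsI[OF r h] shiftsI[OF r h'] g by force
      then show "u (h' \<otimes> (inv h \<otimes> g), v'') = u' (h' \<otimes> (inv h \<otimes> g), v'')"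
        using eq WV[OF r h'] by blast
    qed
    then show "grp.rv r u (inv h \<otimes> fst (g, v)) = grp.rv r u' (inv h \<otimes> fst (g, v))"
      by (simp add: grp.rv_def)
  qed simp
  then have "grp.Lap u (g, v) = grp.Lap u' (g, v)"
    unfolding grp.Lap_def by (simp cong: sum.cong)
  moreover have "u (g, v) = u' (g, v)" using eq[of g v] g v by (simp add: nbhd_def)
  ultimately show ?thesis by (simp add: grp.Contr_def)
qed

lemma Contr_pow_local:
  assumes "\<And>g v. g \<in> (nbhd ^^ k) \<Gamma> ==> v \<in> V ==> u (g, v) = u' (g, v)"
    and "finite \<Gamma>" "\<Gamma> \<subseteq> carrier G" "g \<in> \<Gamma>" "v \<in> V"
  shows "(grp.Contr ^^ k) u (g, v) = (grp.Contr ^^ k) u' (g, v)"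
  using assms
proof (induction k arbitrary: \<Gamma> g v)
  case 0
  then show ?case by simp
next
  case (Suc k)
  have "(grp.Contr ^^ k) u (g', v') = (grp.Contr ^^ k) u' (g', v')" if "g' \<in> nbhd \<Gamma>" "v' \<in> V" for g' v'
  proof (rule Suc.IH[of "nbhd \<Gamma>"])
    show "finite (nbhd \<Gamma>)" "nbhd \<Gamma> \<subseteq> carrier G" using nbhd[OF Suc.prems(2,3)] by auto
    show "u (g, v) = u' (g, v)" if "g \<in> (nbhd ^^ k) (nbhd \<Gamma>)" "v \<in> V" for g v
      using Suc.prems(1)[of g v] that by (simp add: funpow_swap1)
  qed (use that in auto)
  then have "grp.Contr ((grp.Contr ^^ k) u) (g, v) = grp.Contr ((grp.Contr ^^ k) u') (g, v)"
    using Suc.prems by (intro Contr_local[of \<Gamma>]) auto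
  then show ?case by simp
qed

lemma Contr_pull:
  assumes i: "i \<in> mult_good n (nbhd_pairs \<Gamma>)" and \<Gamma>: "\<Gamma> \<subseteq> carrier G" and g: "g \<in> \<Gamma>" and v: "v \<in> V"
  shows "grp.Contr (pull n i u) (g, v) = perm_system.Contr (D n) V (\<sigma> n) (\<tau> n) W u (\<sigma> n g i, v)"
proof -
  interpret m: perm_system "D n" V "\<sigma> n" "\<tau> n" W by (rule model)
  have gG: "g \<in> carrier G" and iD: "i \<in> D n" using \<Gamma> g i by (auto simp: mult_good_def)
  have good: "\<sigma> n h' (\<sigma> n (inv h \<otimes> g) i) = \<sigma> n (h' \<otimes> (inv h \<otimes> g)) i" if "h \<in> shifts" "h' \<in> shifts" for h h'
  proof -
    have "(h', inv h \<otimes> g) \<in> nbhd_pairs \<Gamma>" unfolding nbhd_pairs_def using that g by force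
    then show ?thesis using i by (auto simp: mult_good_def)
  qed
  have "rule_adj (\<lambda>h x. inv h \<otimes> x) r (grp.rv r (pull n i u)) (g, v) = rule_adj (\<tau> n) r (m.rv r u) (\<sigma> n g i, v)"
    if r: "r \<in> W" for r
  proof (rule rule_adj_cong)
    fix c h v' assume h: "(c, h, v') \<in> set r"
    have hG: "h \<in> carrier G" by (rule WG[OF r h])
    have xG: "inv h \<otimes> g \<in> carrier G" using hG gG by simp
    have "\<sigma> n h (\<sigma> n (inv h \<otimes> g) i) = \<sigma> n g i"
      using good[OF shiftsI[OF r h] shiftsI[OF r h]] hG gG by (simp add: m_assoc[symmetric])
    then have \<tau>: "\<tau> n h (\<sigma> n g i) = \<sigma> n (inv h \<otimes> g) i"
      using \<tau>_\<sigma>[OF hG \<sigma>_in[OF xG iD]] by simp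
    have "rule_eval (\<otimes>) r (pull n i u) (inv h \<otimes> g) = rule_eval (\<sigma> n) r u (\<sigma> n (inv h \<otimes> g) i)"
    proof (rule rule_eval_cong)
      fix c' h' v'' assume h': "(c', h', v'') \<in> set r"
      show "pull n i u (h' \<otimes> (inv h \<otimes> g), v'') = u (\<sigma> n h' (\<sigma> n (inv h \<otimes> g) i), v'')"
        using good[OF shiftsI[OF r h] shiftsI[OF r h']] by (simp add: pull_def)
    qed
    then show "grp.rv r (pull n i u) (inv h \<otimes> fst (g, v)) = m.rv r u (\<tau> n h (fst (\<sigma> n g i, v)))"
      using xG \<sigma>_in[OF xG iD] by (simp add: grp.rv_def m.rv_def \<tau>)
  qed simp
  then have "grp.Lap (pull n i u) (g, v) = m.Lap u (\<sigma> n g i, v)"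
    using gG v \<sigma>_in[OF gG iD] unfolding grp.Lap_def m.Lap_def by (simp cong: sum.cong)
  then show ?thesis
    using gG v \<sigma>_in[OF gG iD] unfolding grp.Contr_def m.Contr_def by (simp add: pull_def)
qed

primrec pow_pairs :: "nat => 'g set => ('g \<times> 'g) set" where
  "pow_pairs 0 \<Gamma> = {}"
| "pow_pairs (Suc k) \<Gamma> = nbhd_pairs \<Gamma> \<union> pow_pairs k (nbhd \<Gamma>)"

lemma pow_pairs: "finite \<Gamma> ==> \<Gamma> \<subseteq> carrier G ==> finite (pow_pairs k \<Gamma>) \<and> pow_pairs k \<Gamma> \<subseteq> carrier G \<times> carrier G"
proof (induction k arbitrary: \<Gamma>)
  case (Suc k)
  then show ?case using nbhd[OF Suc.prems] nbhd_pairs[OF Suc.prems] Suc.IH[of "nbhd \<Gamma>"] by simp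
qed simp

lemma Contr_pow_pull:
  assumes "i \<in> mult_good n (pow_pairs k \<Gamma>)" "finite \<Gamma>" "\<Gamma> \<subseteq> carrier G" "g \<in> \<Gamma>" "v \<in> V"
  shows "(grp.Contr ^^ k) (pull n i u) (g, v) = (perm_system.Contr (D n) V (\<sigma> n) (\<tau> n) W ^^ k) u (\<sigma> n g i, v)"
  using assms
proof (induction k arbitrary: \<Gamma> g v)
  case 0
  then show ?case by (simp add: pull_def)
next
  case (Suc k)
  interpret m: perm_system "D n" V "\<sigma> n" "\<tau> n" W by (rule model)
  have i1: "i \<in> mult_good n (nbhd_pairs \<Gamma>)" and i2: "i \<in> mult_good n (pow_pairs k (nbhd \<Gamma>))"
    using Suc.prems(1) by (auto simp: mult_good_def)
  have gG: "g \<in> carrier G" using Suc.prems by auto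
  have "(grp.Contr ^^ k) (pull n i u) (g', v') = pull n i ((m.Contr ^^ k) u) (g', v')"
    if "g' \<in> nbhd \<Gamma>" "v' \<in> V" for g' v'
  proof -
    have "(grp.Contr ^^ k) (pull n i u) (g', v') = (m.Contr ^^ k) u (\<sigma> n g' i, v')"
      using nbhd[OF Suc.prems(2,3)] that by (intro Suc.IH[OF i2]) auto
    then show ?thesis by (simp add: pull_def)
  qed
  then have "grp.Contr ((grp.Contr ^^ k) (pull n i u)) (g, v) = grp.Contr (pull n i ((m.Contr ^^ k) u)) (g, v)"
    using Suc.prems gG by (intro Contr_local[of \<Gamma>]) auto
  also have "... = m.Contr ((m.Contr ^^ k) u) (\<sigma> n g i, v)"
    by (rule Contr_pull[OF i1 Suc.prems(3,4,5)])
  finally show ?case by simp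
qed

text \<open>Moments are local, so at good points they agree with those of the group.\<close>

lemma moment_model:
  assumes i: "i \<in> mult_good n (pow_pairs k {\<one>})" "i \<in> free_good n ((nbhd ^^ k) {\<one>} - {\<one>})" and v: "v \<in> V"
  shows "perm_system.moment (D n) V (\<sigma> n) (\<tau> n) W (i, v) k = grp.moment (\<one>, v) k"
proof -
  interpret m: perm_system "D n" V "\<sigma> n" "\<tau> n" W by (rule model)
  have iD: "i \<in> D n" using i by (simp add: mult_good_def)
  have "m.moment (i, v) k = (m.Contr ^^ k) (point_mass (i, v)) (\<sigma> n \<one> i, v)"
    by (simp add: m.moment_def \<sigma>_one[OF iD])
  also have "... = (grp.Contr ^^ k) (pull n i (point_mass (i, v))) (\<one>, v)"
    by (rule Contr_pow_pull[OF i(1), symmetric]) (use v in auto)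
  also have "... = (grp.Contr ^^ k) (point_mass (\<one>, v)) (\<one>, v)"
  proof (rule Contr_pow_local[of k "{\<one>}"])
    fix g v' assume g: "g \<in> (nbhd ^^ k) {\<one>}"
    have "\<sigma> n g i = i \<longleftrightarrow> g = \<one>" using i(2) g \<sigma>_one[OF iD] by (auto simp: free_good_def)
    then show "pull n i (point_mass (i, v)) (g, v') = point_mass (\<one>, v) (g, v')"
      by (simp add: pull_def point_mass_def)
  qed (use v in auto)
  finally show ?thesis by (simp add: grp.moment_def)
qed

definition translate :: "'g => ('g \<times> 'v => real) => 'g \<times> 'v => real" where
  "translate g u y = (if y \<in> carrier G \<times> V then u (fst y \<otimes> g, snd y) else 0)"

lemma Contr_translate:
  assumes g: "g \<in> carrier G"
  shows "grp.Contr (translate g u) = translate g (grp.Contr u)"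
proof
  fix y :: "'g \<times> 'v"
  obtain x v where y: "y = (x, v)" by (cases y)
  show "grp.Contr (translate g u) y = translate g (grp.Contr u) y"
  proof (cases "x \<in> carrier G \<and> v \<in> V")
    case True
    then have x: "x \<in> carrier G" and v: "v \<in> V" by auto
    have "rule_adj (\<lambda>h x. inv h \<otimes> x) r (grp.rv r (translate g u)) (x, v) = rule_adj (\<lambda>h x. inv h \<otimes> x) r (grp.rv r u) (x \<otimes> g, v)"
      if r: "r \<in> W" for r
    proof (rule rule_adj_cong)
      fix c h v' assume h: "(c, h, v') \<in> set r"
      have hG: "h \<in> carrier G" by (rule WG[OF r h])
      have "rule_eval (\<otimes>) r (translate g u) (inv h \<otimes> x) = rule_eval (\<otimes>) r u (inv h \<otimes> (x \<otimes> g))"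
      proof (rule rule_eval_cong)
        fix c' h' v'' assume h': "(c', h', v'') \<in> set r"
        have h'G: "h' \<in> carrier G" by (rule WG[OF r h'])
        show "translate g u (h' \<otimes> (inv h \<otimes> x), v'') = u (h' \<otimes> (inv h \<otimes> (x \<otimes> g)), v'')"
          using hG h'G x g WV[OF r h'] by (simp add: translate_def m_assoc)
      qed
      then show "grp.rv r (translate g u) (inv h \<otimes> fst (x, v)) = grp.rv r u (inv h \<otimes> fst (x \<otimes> g, v))"
        using hG x g by (simp add: grp.rv_def)
    qed simp
    then have "grp.Lap (translate g u) (x, v) = grp.Lap u (x \<otimes> g, v)"
      using x v g unfolding grp.Lap_def by (simp cong: sum.cong)
    then show ?thesis using x v g by (simp add: y grp.Contr_def translate_def)
  next
    case False
    then show ?thesis by (auto simp: y grp.Contr_def translate_def)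
  qed
qed

lemma moment_translate:
  assumes g: "g \<in> carrier G" and v: "v \<in> V"
  shows "grp.moment (g, v) k = grp.moment (\<one>, v) k"
proof -
  have "translate g (point_mass (g, v)) = point_mass (\<one>, v)"
    using g v by (auto simp: translate_def point_mass_def fun_eq_iff)
  moreover have "(grp.Contr ^^ k) (translate g u) = translate g ((grp.Contr ^^ k) u)" for u
    by (induction k) (auto simp: Contr_translate[OF g])
  ultimately have "(grp.Contr ^^ k) (point_mass (\<one>, v)) (\<one>, v) = translate g ((grp.Contr ^^ k) (point_mass (g, v))) (\<one>, v)"
    by metis
  then show ?thesis using g v by (simp add: translate_def grp.moment_def)
qed

text \<open>The exponent \<open>k\<close> and the cutoff are chosen first, making the error in
  \<open>integer_psd_kernel\<close> small; then almost all points of a good model have the moments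
  of the group.\<close>

theorem eventually_kernel_dim_ge:
  assumes d: "\<And>k. d <= (\<Sum>v\<in>V. grp.moment (\<one>, v) k)" and eps: "0 < eps"
  shows "eventually (\<lambda>n. \<exists>(Z :: nat set) (w :: nat => 'd \<times> 'v => complex). finite Z \<and>
      (\<forall>a\<in>Z. \<forall>r\<in>W. \<forall>x\<in>D n. rule_eval (\<sigma> n) r (w a) x = 0) \<and>
      indep_family (D n \<times> V) Z w \<and> (d - eps) * real (card (D n)) <= real (card Z)) sequentially"
proof -
  define C where "C = rule_bound W"
  have C: "1 <= C" unfolding C_def by (rule grp.bound_pos)
  define N where "N = real (card V)"
  have N: "0 <= N" by (simp add: N_def)
  define X where "X = 1 + 3 * N * ln C / eps"
  have X: "1 <= X" using C N eps by (simp add: X_def)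
  define e where "e = exp (- X)"
  have e: "0 < e" "e < 1" using X by (auto simp: e_def)
  have eC: "0 < e / C" "e / C < 1" using e C by (auto simp: field_simps)
  have l1: "N * (ln C / ln (C / e)) <= eps / 3"
  proof -
    have "ln (C / e) = ln C + X" using C e by (simp add: ln_div e_def)
    moreover have "0 <= ln C" using C by simp
    ultimately have "ln C / ln (C / e) <= ln C / X" using X by (intro divide_left_mono) auto
    then have "N * (ln C / ln (C / e)) <= N * (ln C / X)" using N by (rule mult_left_mono)
    also have "... <= eps / 3"
    proof -
      have "3 * N * ln C <= eps * X" using eps by (simp add: X_def field_simps)
      then show ?thesis using X by (simp add: field_simps)
    qed
    finally show ?thesis .
  qed
  obtain k where k: "N * (1 - e / C) ^ k <= eps / 3"
  proof -
    have "(\<lambda>k. N * (1 - e / C) ^ k) \<longlonglongrightarrow> N * 0"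
      using eC by (intro tendsto_mult tendsto_const LIMSEQ_power_zero) auto
    then have "eventually (\<lambda>k. N * (1 - e / C) ^ k < eps / 3) sequentially"
      using eps by (intro order_tendstoD(2)) auto
    then obtain k where "N * (1 - e / C) ^ k < eps / 3" by (auto simp: eventually_sequentially)
    then show thesis using that[of k] by simp
  qed
  define eps' where "eps' = eps / (6 * (N + 1))"
  have eps': "0 < eps'" "2 * (eps' * N) <= eps / 3" using eps N by (auto simp: eps'_def field_simps)
  have one: "finite {\<one>}" "{\<one>} \<subseteq> carrier G" by auto
  have nb: "finite ((nbhd ^^ k) {\<one>}) \<and> (nbhd ^^ k) {\<one>} \<subseteq> carrier G" for k
    by (induction k) (use nbhd in auto)
  define P where "P = pow_pairs k {\<one>}"
  define F where "F = (nbhd ^^ k) {\<one>} - {\<one>}"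
  have P: "finite P" "P \<subseteq> carrier G \<times> carrier G" using pow_pairs[OF one, of k] by (auto simp: P_def)
  have F: "finite F" "F \<subseteq> carrier G - {\<one>}" using nb[of k] by (auto simp: F_def)
  show ?thesis
    using eventually_mult_good[OF P eps'(1)] eventually_free_good[OF F eps'(1)]
  proof eventually_elim
    case (elim n)
    interpret m: perm_system "D n" V "\<sigma> n" "\<tau> n" W by (rule model)
    let ?d = "real (card (D n))"
    define good where "good = mult_good n P \<inter> free_good n F"
    have goodD: "good \<subseteq> D n" by (auto simp: good_def mult_good_def)
    have fg: "finite good" using goodD fin_D finite_subset by blast
    have cg: "?d - 2 * eps' * ?d <= real (card good)"
    proof -
      have "D n = good \<union> ((D n - mult_good n P) \<union> (D n - free_good n F))" using goodD by (auto simp: good_def)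
      then have "card (D n) <= card good + (card (D n - mult_good n P) + card (D n - free_good n F))"
        by (metis (no_types, lifting) card_Un_le add_left_mono order_trans)
      then show ?thesis using elim by linarith
    qed
    have tau_le: "(\<Sum>v\<in>V. grp.moment (\<one>, v) k) <= N"
    proof -
      have "(\<Sum>v\<in>V. grp.moment (\<one>, v) k) <= (\<Sum>v\<in>V. 1)"
        using grp.moment_antimono[of "(\<one>, _)" 0 k] grp.moment_0 by (intro sum_mono) auto
      then show ?thesis by (simp add: N_def)
    qed
    have tau0: "0 <= (\<Sum>v\<in>V. grp.moment (\<one>, v) k)"
      using grp.moment_nonneg by (intro sum_nonneg) auto
    have "(d - eps / 3) * ?d <= ((\<Sum>v\<in>V. grp.moment (\<one>, v) k) - 2 * (eps' * N)) * ?d"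
      using d[of k] eps'(2) by (intro mult_right_mono) auto
    also have "... <= (\<Sum>v\<in>V. grp.moment (\<one>, v) k) * ?d - 2 * eps' * ?d * (\<Sum>v\<in>V. grp.moment (\<one>, v) k)"
    proof -
      have "2 * eps' * ?d * (\<Sum>v\<in>V. grp.moment (\<one>, v) k) <= 2 * eps' * ?d * N"
        using tau_le eps'(1) by (intro mult_left_mono) auto
      then show ?thesis by (simp add: algebra_simps)
    qed
    also have "... = (?d - 2 * eps' * ?d) * (\<Sum>v\<in>V. grp.moment (\<one>, v) k)" by (simp add: algebra_simps)
    also have "... <= real (card good) * (\<Sum>v\<in>V. grp.moment (\<one>, v) k)"
      using cg tau0 by (rule mult_right_mono)
    also have "... = (\<Sum>i\<in>good. \<Sum>v\<in>V. m.moment (i, v) k)"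
    proof -
      have "(\<Sum>v\<in>V. m.moment (i, v) k) = (\<Sum>v\<in>V. grp.moment (\<one>, v) k)" if "i \<in> good" for i
        using that by (intro sum.cong refl moment_model) (auto simp: good_def P_def F_def)
      then show ?thesis by simp
    qed
    also have "... <= (\<Sum>i\<in>D n. \<Sum>v\<in>V. m.moment (i, v) k)"
      using fin_D goodD m.moment_nonneg by (intro sum_mono2 sum_nonneg) auto
    also have "... = (\<Sum>y\<in>D n \<times> V. m.moment y k)" by (simp add: sum.cartesian_product)
    finally have tr: "(d - eps / 3) * ?d <= (\<Sum>y\<in>D n \<times> V. m.moment y k)" .
    show ?case
    proof (rule m.kernel_dim_ge[OF fin_D e, of k])
      fix Z :: "nat set" and w :: "nat => 'd \<times> 'v => complex"
      assume Z: "finite Z" "\<And>a r x. a \<in> Z ==> r \<in> W ==> x \<in> D n ==> rule_eval (\<sigma> n) r (w a) x = 0"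
        "indep_family (D n \<times> V) Z w"
        "(\<Sum>y\<in>D n \<times> V. m.moment y k) - real (card (D n \<times> V)) *
          (ln (rule_bound W) / ln (rule_bound W / e) + (1 - e / rule_bound W) ^ k) <= real (card Z)"
      have "real (card (D n \<times> V)) * (ln C / ln (C / e) + (1 - e / C) ^ k)
          = ?d * (N * (ln C / ln (C / e)) + N * (1 - e / C) ^ k)"
        by (simp add: card_cartesian_product N_def algebra_simps)
      also have "... <= ?d * (eps / 3 + eps / 3)"
        using l1 k by (intro mult_left_mono add_mono) auto
      finally have loss: "real (card (D n \<times> V)) * (ln C / ln (C / e) + (1 - e / C) ^ k) <= ?d * (eps / 3 + eps / 3)" .
      have "(d - eps) * ?d = (d - eps / 3) * ?d - ?d * (eps / 3 + eps / 3)" by (simp add: algebra_simps)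
      also have "... <= real (card Z)" using tr loss Z(4)[folded C_def] by linarith
      finally show ?case using Z(1-3) by (intro exI[of _ Z] exI[of _ w]) simp
    qed
  qed
qed

end

section \<open>Coded actions\<close>

abbreviation discrete_product :: "('a => 'k) topology" where
  "discrete_product \<equiv> product_topology (\<lambda>_. discrete_topology UNIV) UNIV"

text \<open>Cylinder conditions on finitely many coordinates are open.\<close>

lemma openin_finitely_determined:
  fixes S :: "('a => 'k) set"
  assumes "finite A" "\<And>u u'. u \<in> S ==> (\<And>a. a \<in> A ==> u a = u' a) ==> u' \<in> S"
  shows "openin discrete_product S"
  unfolding openin_product_topology_alt
proof
  fix x assume x: "x \<in> S"
  define U where "U i = (if i \<in> A then {x i} else UNIV)" for i
  have "finite {i \<in> UNIV. U i ~= topspace (discrete_topology UNIV)}"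
    by (rule finite_subset[OF _ assms(1)]) (auto simp: U_def)
  moreover have "x \<in> Pi\<^sub>E UNIV U" by (auto simp: U_def)
  moreover have "Pi\<^sub>E UNIV U \<subseteq> S"
  proof
    fix y assume y: "y \<in> Pi\<^sub>E UNIV U"
    have "x a = y a" if "a \<in> A" for a
    proof -
      have "y a \<in> U a" using y by (auto simp: PiE_def Pi_def)
      then show ?thesis using that by (simp add: U_def)
    qed
    then show "y \<in> S" using assms(2)[OF x] by blast
  qed
  ultimately show "\<exists>U. finite {i \<in> UNIV. U i ~= topspace (discrete_topology UNIV)} \<and>
      (\<forall>i\<in>UNIV. openin (discrete_topology UNIV) (U i)) \<and> x \<in> Pi\<^sub>E UNIV U \<and> Pi\<^sub>E UNIV U \<subseteq> S"
    by (intro exI[of _ U]) simp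
qed

lemma openin_discrete_product_window:
  fixes S :: "('a => 'k) set"
  assumes "openin discrete_product S" "x \<in> S"
  obtains A where "finite A" "\<And>y. (\<And>a. a \<in> A ==> x a = y a) ==> y \<in> S"
proof -
  obtain U where U: "finite {i \<in> UNIV. U i ~= topspace (discrete_topology (UNIV :: 'k set))}"
    "x \<in> Pi\<^sub>E UNIV U" "Pi\<^sub>E UNIV U \<subseteq> S"
    using assms unfolding openin_product_topology_alt by metis
  show thesis
  proof (rule that[of "{i. U i ~= UNIV}"])
    show "finite {i. U i ~= UNIV}" using U(1) by simp
    fix y assume y: "\<And>a. a \<in> {i. U i ~= UNIV} ==> x a = y a"
    have "y a \<in> U a" for a
    proof (cases "U a = UNIV")
      case False
      then have "x a = y a" using y by blast
      moreover have "x a \<in> U a" using U(2) by (auto simp: PiE_def Pi_def)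
      ultimately show ?thesis by simp
    qed simp
    then have "y \<in> Pi\<^sub>E UNIV U" by auto
    then show "y \<in> S" using U(3) by blast
  qed
qed

lemma compact_discrete_product: "compact_space (discrete_product :: ('a => 'k::finite) topology)"
  by (auto simp: compact_space_product_topology compact_space_discrete_topology)

lemma compactin_finite_subcover:
  assumes "compactin T K" "\<And>x. x \<in> I ==> openin T (c x)" "K \<subseteq> (\<Union>x\<in>I. c x)"
  obtains S where "finite S" "S \<subseteq> I" "K \<subseteq> (\<Union>x\<in>S. c x)"
proof -
  have "\<forall>U\<in>c ` I. openin T U" using assms(2) by blast
  then obtain \<F> where F: "finite \<F>" "\<F> \<subseteq> c ` I" "K \<subseteq> \<Union>\<F>"
    using assms(1,3) unfolding compactin_def by blast
  then obtain S where "S \<subseteq> I" "finite S" "\<F> = c ` S" by (meson finite_subset_image)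
  then show thesis using that[of S] F(3) by blast
qed

text \<open>Compactness: if the violation of finitely supported conditions covers a finitely
  determined set, finitely many conditions suffice.\<close>

lemma finite_rule_cover:
  fixes viol :: "'e => ('a => 'k::finite) set" and N :: "('a => 'k) set"
  assumes A: "finite A" "\<And>u u'. u \<in> N ==> (\<And>a. a \<in> A ==> u a = u' a) ==> u' \<in> N"
    and B: "\<And>e. e \<in> E ==> finite (B e)"
      "\<And>e u u'. e \<in> E ==> u \<in> viol e ==> (\<And>a. a \<in> B e ==> u a = u' a) ==> u' \<in> viol e"
    and cover: "N \<subseteq> (\<Union>e\<in>E. viol e)"
  obtains E0 where "finite E0" "E0 \<subseteq> E" "N \<subseteq> (\<Union>e\<in>E0. viol e)"
proof -
  have "openin discrete_product (UNIV - N)"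
    by (rule openin_finitely_determined[OF A(1)]) (use A(2) in \<open>metis Diff_iff UNIV_I\<close>)
  then have "closedin discrete_product N"
    by (simp add: closedin_def)
  then have "compactin discrete_product N"
    by (rule closedin_compact_space[OF compact_discrete_product])
  then show thesis
  proof (rule compactin_finite_subcover[OF _ _ cover])
    fix e assume e: "e \<in> E"
    show "openin discrete_product (viol e)"
      by (rule openin_finitely_determined[OF B(1)[OF e]]) (rule B(2)[OF e])
  qed (rule that)
qed

text \<open>A closed invariant set \<open>X\<close> of functions on which the action is a shift in
  the coordinates \<open>cd g v\<close>. The last condition says that these coordinates determine an
  element of \<open>X\<close>.\<close>

locale coded_action = sofic G D \<sigma>
  for G :: "('g, 'm) monoid_scheme" (structure) and D :: "nat => 'd set" and \<sigma> :: "nat => 'g => 'd => 'd" +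
  fixes X :: "('a => 'k::{field,finite}) set" and act :: "'g => ('a => 'k) => 'a => 'k"
    and cd :: "'g => 'v => 'a" and V :: "'v set"
  assumes finV: "finite V"
    and X_ne: "X ~= {}"
    and X_closed: "closedin discrete_product X"
    and act_in: "g \<in> carrier G ==> f \<in> X ==> act g f \<in> X"
    and act_coord: "g \<in> carrier G ==> h \<in> carrier G ==> v \<in> V ==> f \<in> X ==> act h f (cd g v) = f (cd (g \<otimes> h) v)"
    and determined: "(\<exists>g\<in>carrier G. \<exists>v\<in>V. \<forall>f\<in>X. \<forall>f'\<in>X. f (cd g v) = f' (cd g v) --> f a = f' a) \<or>
      (\<forall>f\<in>X. \<forall>f'\<in>X. f a = f' a)"
begin

definition agree :: "'g set => ('a => 'k) => ('a => 'k) => bool" where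
  "agree \<Gamma> f f' \<longleftrightarrow> (\<forall>g\<in>\<Gamma>. \<forall>v\<in>V. f (cd g v) = f' (cd g v))"

abbreviation "XT \<equiv> pointwise_topology X"

lemma topspace_XT: "topspace XT = X"
  by (simp add: pointwise_topology_def)

lemma compact_XT: "compact_space XT"
  unfolding pointwise_topology_def
  by (intro compact_space_subtopology closedin_compact_space[OF compact_discrete_product X_closed])

lemma window:
  assumes "finite A"
  obtains \<Gamma> where "finite \<Gamma>" "\<Gamma> \<subseteq> carrier G"
    "\<And>f f' a. f \<in> X ==> f' \<in> X ==> agree \<Gamma> f f' ==> a \<in> A ==> f a = f' a"
proof -
  have "\<exists>\<Gamma>. finite \<Gamma> \<and> \<Gamma> \<subseteq> carrier G \<and> (\<forall>f\<in>X. \<forall>f'\<in>X. agree \<Gamma> f f' --> f a = f' a)" for a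
    using determined[of a]
  proof
    assume "\<exists>g\<in>carrier G. \<exists>v\<in>V. \<forall>f\<in>X. \<forall>f'\<in>X. f (cd g v) = f' (cd g v) --> f a = f' a"
    then obtain g v where "g \<in> carrier G" "v \<in> V" "\<forall>f\<in>X. \<forall>f'\<in>X. f (cd g v) = f' (cd g v) --> f a = f' a"
      by auto
    then show ?thesis by (intro exI[of _ "{g}"]) (simp add: agree_def)
  next
    assume "\<forall>f\<in>X. \<forall>f'\<in>X. f a = f' a"
    then show ?thesis by (intro exI[of _ "{}"]) simp
  qed
  then obtain W where W: "\<And>a. finite (W a)" "\<And>a. W a \<subseteq> carrier G"
    "\<And>a f f'. f \<in> X ==> f' \<in> X ==> agree (W a) f f' ==> f a = f' a"
    by metis
  show thesis
  proof (rule that[of "\<Union>a\<in>A. W a"])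
    show "finite (\<Union>a\<in>A. W a)" using assms W(1) by simp
    show "(\<Union>a\<in>A. W a) \<subseteq> carrier G" using W(2) by auto
    fix f f' a assume f: "f \<in> X" "f' \<in> X" and ag: "agree (\<Union>a\<in>A. W a) f f'" and a: "a \<in> A"
    have "agree (W a) f f'" using ag a by (auto simp: agree_def)
    then show "f a = f' a" by (rule W(3)[OF f])
  qed
qed

lemma X_eqI:
  assumes "f \<in> X" "f' \<in> X" "\<And>g v. g \<in> carrier G ==> v \<in> V ==> f (cd g v) = f' (cd g v)"
  shows "f = f'"
proof
  fix a
  show "f a = f' a" using determined[of a] assms by blast
qed

lemma act_act:
  assumes "g \<in> carrier G" "h \<in> carrier G" "f \<in> X"
  shows "act g (act h f) = act (g \<otimes> h) f"
  by (rule X_eqI) (use assms in \<open>simp_all add: act_in act_coord m_assoc\<close>)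

lemma openin_XT_finitely_determined:
  assumes "finite \<Gamma>" "S \<subseteq> X" "\<And>f f'. f \<in> S ==> f' \<in> X ==> agree \<Gamma> f f' ==> f' \<in> S"
  shows "openin XT S"
proof -
  define A where "A = (\<lambda>(g, v). cd g v) ` (\<Gamma> \<times> V)"
  define S' where "S' = {u. \<exists>f\<in>S. \<forall>a\<in>A. f a = u a}"
  have "openin discrete_product S'"
  proof (rule openin_finitely_determined)
    show "finite A" using assms(1) finV by (simp add: A_def)
    show "u' \<in> S'" if "u \<in> S'" "\<And>a. a \<in> A ==> u a = u' a" for u u'
      using that unfolding S'_def by auto
  qed
  moreover have "S = S' \<inter> X"
  proof (intro equalityI subsetI)
    fix u assume "u \<in> S' \<inter> X"
    then obtain f where f: "f \<in> S" "\<forall>a\<in>A. f a = u a" "u \<in> X" by (auto simp: S'_def)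
    then have "agree \<Gamma> f u" by (auto simp: agree_def A_def)
    then show "u \<in> S" using assms(3) f by blast
  qed (use assms(2) in \<open>auto simp: S'_def\<close>)
  ultimately show ?thesis
    unfolding pointwise_topology_def openin_subtopology by blast
qed

lemma openin_XT_window:
  assumes "openin XT S" "f \<in> S"
  obtains \<Gamma> where "finite \<Gamma>" "\<Gamma> \<subseteq> carrier G" "\<And>f'. f' \<in> X ==> agree \<Gamma> f f' ==> f' \<in> S"
proof -
  obtain T where T: "openin discrete_product T" "S = T \<inter> X"
    using assms(1) unfolding pointwise_topology_def openin_subtopology by auto
  then have "f \<in> T" "f \<in> X" using assms(2) by auto
  obtain A where A: "finite A" "\<And>y. (\<And>a. a \<in> A ==> f a = y a) ==> y \<in> T"
    using openin_discrete_product_window[OF T(1) \<open>f \<in> T\<close>] by metis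
  obtain \<Gamma> where G: "finite \<Gamma>" "\<Gamma> \<subseteq> carrier G"
    "\<And>f f' a. f \<in> X ==> f' \<in> X ==> agree \<Gamma> f f' ==> a \<in> A ==> f a = f' a"
    using window[OF A(1)] by metis
  show thesis
  proof (rule that[OF G(1,2)])
    fix f' assume f': "f' \<in> X" "agree \<Gamma> f f'"
    have "f' \<in> T" by (rule A(2)) (rule G(3)[OF \<open>f \<in> X\<close> f'])
    then show "f' \<in> S" using T(2) f' by simp
  qed
qed

context
  fixes \<rho> assumes \<rho>: "generating_pseudometric G XT act \<rho>"
begin

lemma \<rho>_cont: "continuous_map (prod_topology XT XT) euclideanreal (\<lambda>(x, y). \<rho> x y)"
  and \<rho>_self: "f \<in> X ==> \<rho> f f = 0"
  and \<rho>_sym: "f \<in> X ==> f' \<in> X ==> \<rho> f f' = \<rho> f' f"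
  and \<rho>_nonneg: "f \<in> X ==> f' \<in> X ==> 0 <= \<rho> f f'"
  and \<rho>_tri: "f \<in> X ==> f' \<in> X ==> f'' \<in> X ==> \<rho> f f'' <= \<rho> f f' + \<rho> f' f''"
  and \<rho>_gen: "f \<in> X ==> f' \<in> X ==> f ~= f' ==> \<exists>g\<in>carrier G. 0 < \<rho> (act g f) (act g f')"
  using \<rho> unfolding generating_pseudometric_def continuous_pseudometric_def topspace_XT by blast+

lemma \<rho>_uniform:
  assumes "0 < eps"
  obtains \<Gamma> where "finite \<Gamma>" "\<Gamma> \<subseteq> carrier G"
    "\<And>f f'. f \<in> X ==> f' \<in> X ==> agree \<Gamma> f f' ==> \<rho> f f' < eps"
proof -
  have "\<exists>\<Gamma>. finite \<Gamma> \<and> \<Gamma> \<subseteq> carrier G \<and> (\<forall>f'\<in>X. agree \<Gamma> f f' --> \<rho> f f' < eps / 2)" if f: "f \<in> X" for f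
  proof -
    have "continuous_map XT (prod_topology XT XT) (\<lambda>f'. (f, f'))"
      using f topspace_XT by (auto intro!: continuous_map_pairedI simp: continuous_map_const)
    from continuous_map_compose[OF this \<rho>_cont]
    have "continuous_map XT euclideanreal (\<lambda>f'. \<rho> f f')" by (simp add: o_def)
    from openin_continuous_map_preimage[OF this, of "{..<eps / 2}"]
    have o: "openin XT {f' \<in> X. \<rho> f f' < eps / 2}" by (simp add: topspace_XT)
    show ?thesis
      by (rule openin_XT_window[OF o, of f]) (use f \<rho>_self[OF f] assms in auto)
  qed
  then obtain W where W: "\<And>f. f \<in> X ==> finite (W f)" "\<And>f. f \<in> X ==> W f \<subseteq> carrier G"
    "\<And>f f'. f \<in> X ==> f' \<in> X ==> agree (W f) f f' ==> \<rho> f f' < eps / 2"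
    by metis
  define cyl where "cyl f = {f' \<in> X. agree (W f) f f'}" for f
  have "openin XT (cyl f)" if "f \<in> X" for f
    by (rule openin_XT_finitely_determined[OF W(1)[OF that]]) (auto simp: cyl_def agree_def)
  moreover have "X \<subseteq> (\<Union>f\<in>X. cyl f)" by (auto simp: cyl_def agree_def)
  moreover have "compactin XT X" using compact_XT unfolding compact_space_def topspace_XT .
  ultimately obtain S where S: "finite S" "S \<subseteq> X" and cov: "X \<subseteq> (\<Union>f\<in>S. cyl f)"
    using compactin_finite_subcover[of XT X X cyl] by metis
  show thesis
  proof (rule that[of "\<Union>f\<in>S. W f"])
    show "finite (\<Union>f\<in>S. W f)" using S W(1) by auto
    show "(\<Union>f\<in>S. W f) \<subseteq> carrier G" using S W(2) by blast
    fix f f' assume f: "f \<in> X" "f' \<in> X" and ag: "agree (\<Union>f\<in>S. W f) f f'"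
    obtain s where s: "s \<in> S" "f \<in> cyl s" using cov f by blast
    have sX: "s \<in> X" using s S by auto
    have a1: "agree (W s) s f" using s by (simp add: cyl_def)
    have a2: "agree (W s) s f'" using a1 ag s(1) by (simp add: agree_def)
    have "\<rho> f f' <= \<rho> f s + \<rho> s f'" by (rule \<rho>_tri[OF f(1) sX f(2)])
    also have "\<rho> f s = \<rho> s f" by (rule \<rho>_sym[OF f(1) sX])
    also have "\<rho> s f + \<rho> s f' < eps" using W(3)[OF sX f(1) a1] W(3)[OF sX f(2) a2] by simp
    finally show "\<rho> f f' < eps" .
  qed
qed

lemma \<rho>_bounded:
  obtains B where "0 <= B" "\<And>f f'. f \<in> X ==> f' \<in> X ==> \<rho> f f' <= B"
proof -
  have "compactin (prod_topology XT XT) (X \<times> X)"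
    using compact_XT unfolding compact_space_def topspace_XT by (simp add: compactin_Times)
  from image_compactin[OF this \<rho>_cont] have "compact ((\<lambda>(x, y). \<rho> x y) ` (X \<times> X))" by simp
  then have "bounded ((\<lambda>(x, y). \<rho> x y) ` (X \<times> X))" by (rule compact_imp_bounded)
  then obtain B where B: "\<forall>x\<in>(\<lambda>(x, y). \<rho> x y) ` (X \<times> X). norm x <= B" unfolding bounded_iff by auto
  show thesis
  proof (rule that[of "max B 0"])
    fix f f' assume "f \<in> X" "f' \<in> X"
    then have "norm (\<rho> f f') <= B" using B by auto
    then show "\<rho> f f' <= max B 0" by simp
  qed simp
qed

lemma \<rho>_separates:
  obtains F \<eta> where "finite F" "F \<subseteq> carrier G" "0 < (\<eta>::real)"
    "\<And>f f'. f \<in> X ==> f' \<in> X ==> \<not> agree {\<one>} f f' ==> \<exists>g\<in>F. \<eta> <= \<rho> (act g f) (act g f')"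
proof -
  \<comment> \<open>Each pair has a window on which its behaviour persists; finitely many windows suffice.\<close>
  define ok where "ok p \<Gamma> g r \<longleftrightarrow> finite \<Gamma> \<and> \<Gamma> \<subseteq> carrier G \<and> g \<in> carrier G \<and> 0 < (r::real) \<and>
      (\<forall>h\<in>X. \<forall>h'\<in>X. agree \<Gamma> (fst p) h --> agree \<Gamma> (snd p) h' --> \<not> agree {\<one>} h h' --> r <= \<rho> (act g h) (act g h'))" for p \<Gamma> g r
  have "\<exists>\<Gamma> g r. ok p \<Gamma> g r" if p: "p \<in> X \<times> X" for p
  proof -
    obtain f f' where ff: "p = (f, f')" "f \<in> X" "f' \<in> X" using p by auto
    show ?thesis
    proof (cases "agree {\<one>} f f'")
      case True
      have "ok p {\<one>} \<one> 1" using True by (auto simp: ok_def ff agree_def)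
      then show ?thesis by blast
    next
      case False
      then have "f ~= f'" by (auto simp: agree_def)
      then obtain g where g: "g \<in> carrier G" "0 < \<rho> (act g f) (act g f')" using \<rho>_gen ff by blast
      define r where "r = \<rho> (act g f) (act g f') / 3"
      have r: "0 < r" using g by (simp add: r_def)
      obtain \<Gamma> where \<Gamma>: "finite \<Gamma>" "\<Gamma> \<subseteq> carrier G" "\<And>f f'. f \<in> X ==> f' \<in> X ==> agree \<Gamma> f f' ==> \<rho> f f' < r"
        using \<rho>_uniform[OF r] by metis
      have tr: "\<rho> (act g f) (act g h) < r" if "f \<in> X" "h \<in> X" "agree ((\<lambda>x. x \<otimes> g) ` \<Gamma>) f h" for f h
      proof (rule \<Gamma>(3))
        show "act g f \<in> X" "act g h \<in> X" using that g act_in by auto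
        show "agree \<Gamma> (act g f) (act g h)"
          using that g \<Gamma>(2) by (auto simp: agree_def act_coord subset_iff)
      qed
      have "ok p ((\<lambda>x. x \<otimes> g) ` \<Gamma>) g r"
        unfolding ok_def ff fst_conv snd_conv
      proof (intro conjI ballI impI)
        fix h h' assume h: "h \<in> X" "h' \<in> X" and "agree ((\<lambda>x. x \<otimes> g) ` \<Gamma>) f h" "agree ((\<lambda>x. x \<otimes> g) ` \<Gamma>) f' h'"
        then have "\<rho> (act g f) (act g h) < r" "\<rho> (act g f') (act g h') < r" using tr ff by auto
        moreover have A: "act g f \<in> X" "act g f' \<in> X" "act g h \<in> X" "act g h' \<in> X" using h ff g act_in by auto
        moreover have "\<rho> (act g f) (act g f') <= \<rho> (act g f) (act g h) + \<rho> (act g h) (act g f')"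
          by (rule \<rho>_tri) (use A in auto)
        moreover have "\<rho> (act g h) (act g f') <= \<rho> (act g h) (act g h') + \<rho> (act g h') (act g f')"
          by (rule \<rho>_tri) (use A in auto)
        moreover have "\<rho> (act g h') (act g f') = \<rho> (act g f') (act g h')" by (rule \<rho>_sym) (use A in auto)
        ultimately show "r <= \<rho> (act g h) (act g h')" by (simp add: r_def)
      qed (use \<Gamma> g r in auto)
      then show ?thesis by blast
    qed
  qed
  then obtain W gg rr where ok: "\<And>p. p \<in> X \<times> X ==> ok p (W p) (gg p) (rr p)" by metis
  define cyl where "cyl p = {h \<in> X. agree (W p) (fst p) h} \<times> {h \<in> X. agree (W p) (snd p) h}" for p
  have op: "openin (prod_topology XT XT) (cyl p)" if "p \<in> X \<times> X" for p
  proof -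
    have "finite (W p)" using ok[OF that] by (simp add: ok_def)
    then have "openin XT {h \<in> X. agree (W p) f h}" for f
      by (rule openin_XT_finitely_determined) (auto simp: agree_def)
    then show ?thesis unfolding cyl_def by (simp add: openin_prod_Times_iff)
  qed
  have cpt: "compactin (prod_topology XT XT) (X \<times> X)"
    using compact_XT unfolding compact_space_def topspace_XT by (simp add: compactin_Times)
  have "X \<times> X \<subseteq> (\<Union>p\<in>X \<times> X. cyl p)"
  proof
    fix p assume p: "p \<in> X \<times> X"
    moreover from this have "p \<in> cyl p" by (auto simp: cyl_def agree_def)
    ultimately show "p \<in> (\<Union>p\<in>X \<times> X. cyl p)" by (rule UN_I)
  qed
  from compactin_finite_subcover[OF cpt op this]
  obtain S where S: "finite S" "S \<subseteq> X \<times> X" and cov: "X \<times> X \<subseteq> (\<Union>p\<in>S. cyl p)" by metis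
  have "S ~= {}" using cov X_ne by auto
  define \<eta> where "\<eta> = Min (rr ` S)"
  have rr: "0 < rr p" if "p \<in> S" for p using ok[of p] that S(2) by (auto simp: ok_def)
  show thesis
  proof (rule that[of "gg ` S" \<eta>])
    show "finite (gg ` S)" using S by simp
    show "gg ` S \<subseteq> carrier G" using ok S(2) by (auto simp: ok_def)
    show "0 < \<eta>" unfolding \<eta>_def using S \<open>S ~= {}\<close> rr by auto
    fix f f' assume f: "f \<in> X" "f' \<in> X" and na: "\<not> agree {\<one>} f f'"
    obtain p where p: "p \<in> S" "(f, f') \<in> cyl p" using cov f by blast
    have "rr p <= \<rho> (act (gg p) f) (act (gg p) f')"
      using ok[of p] p S(2) f na unfolding ok_def cyl_def by auto
    moreover have "\<eta> <= rr p" unfolding \<eta>_def using S p by auto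
    ultimately show "\<exists>g\<in>gg ` S. \<eta> <= \<rho> (act g f) (act g f')" using p by (intro bexI[of _ "gg p"]) auto
  qed
qed

end

lemma generating_pseudometric_ex: "\<exists>\<rho>. generating_pseudometric G XT act \<rho>"
proof -
  define \<rho> :: "('a => 'k) => ('a => 'k) => real"
    where "\<rho> x y = (\<Sum>v\<in>V. if x (cd \<one> v) = y (cd \<one> v) then 0 else 1)" for x y
  have "continuous_map (prod_topology XT XT) euclideanreal (\<lambda>(x, y). \<rho> x y)"
  proof -
    have "continuous_map (prod_topology XT XT) euclideanreal
        (\<lambda>p. if fst p (cd \<one> v) = snd p (cd \<one> v) then 0 else 1 :: real)" if v: "v \<in> V" for v
      unfolding continuous_map_def
    proof (intro conjI allI impI)
      fix U :: "real set"
      let ?P = "{p \<in> topspace (prod_topology XT XT). (if fst p (cd \<one> v) = snd p (cd \<one> v) then 0 else 1) \<in> U}"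
      have nb: "\<exists>A B. openin XT A \<and> openin XT B \<and> p \<in> A \<times> B \<and> A \<times> B \<subseteq> ?P" if p: "p \<in> ?P" for p
      proof -
        define A where "A = {h \<in> X. h (cd \<one> v) = fst p (cd \<one> v)}"
        define B where "B = {h \<in> X. h (cd \<one> v) = snd p (cd \<one> v)}"
        have "openin XT A" "openin XT B"
          unfolding A_def B_def
          by (rule openin_XT_finitely_determined[of "{\<one>}"]; use v in \<open>auto simp: agree_def\<close>)+
        moreover have "p \<in> A \<times> B" using p by (auto simp: A_def B_def topspace_XT)
        moreover have "A \<times> B \<subseteq> ?P" using p by (auto simp: A_def B_def topspace_XT)
        ultimately show ?thesis by blast
      qed
      show "openin (prod_topology XT XT) ?P"
        unfolding openin_prod_topology_alt
      proof (intro allI impI)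
        fix x y assume "(x, y) \<in> ?P"
        from nb[OF this] obtain A B where "openin XT A" "openin XT B" "(x, y) \<in> A \<times> B" "A \<times> B \<subseteq> ?P"
          by (elim exE conjE)
        then show "\<exists>A B. openin XT A \<and> openin XT B \<and> x \<in> A \<and> y \<in> B \<and> A \<times> B \<subseteq> ?P"
          by (intro exI[of _ A] exI[of _ B] conjI) (simp_all only: mem_Sigma_iff)
      qed
    qed auto
    then have "continuous_map (prod_topology XT XT) euclideanreal
        (\<lambda>p. \<Sum>v\<in>V. if fst p (cd \<one> v) = snd p (cd \<one> v) then 0 else 1 :: real)"
      using finV by (intro continuous_map_sum) auto
    then show ?thesis by (simp add: \<rho>_def case_prod_unfold)
  qed
  moreover have "\<rho> x z <= \<rho> x y + \<rho> y z" for x y z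
    unfolding \<rho>_def sum.distrib[symmetric] by (intro sum_mono) auto
  moreover have "\<rho> x y = \<rho> y x" for x y unfolding \<rho>_def by (intro sum.cong) auto
  moreover have "0 <= \<rho> x y" for x y unfolding \<rho>_def by (intro sum_nonneg) auto
  moreover have "\<rho> x x = 0" for x by (simp add: \<rho>_def)
  moreover have "\<exists>g\<in>carrier G. 0 < \<rho> (act g x) (act g y)" if xy: "x \<in> X" "y \<in> X" "x ~= y" for x y
  proof -
    obtain g v where gv: "g \<in> carrier G" "v \<in> V" "x (cd g v) ~= y (cd g v)" using X_eqI xy by blast
    have "0 < \<rho> (act g x) (act g y)"
      unfolding \<rho>_def by (rule sum_pos2[OF finV gv(2)]) (use gv xy in \<open>auto simp: act_coord\<close>)
    then show ?thesis using gv by blast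
  qed
  ultimately have "generating_pseudometric G XT act \<rho>"
    unfolding generating_pseudometric_def continuous_pseudometric_def topspace_XT by blast
  then show ?thesis by blast
qed

end

section \<open>Entropy of coded actions\<close>

lemma separation_number_ge:
  assumes "finite S" "S \<subseteq> A" "\<And>x y. x \<in> S ==> y \<in> S ==> x ~= y ==> \<kappa> <= d x y"
  shows "enat (card S) <= separation_number \<kappa> d A"
  unfolding separation_number_def
  by (intro Sup_upper CollectI exI[of _ S] conjI refl) (use assms in auto)

lemma le_LimsupI:
  fixes X :: "_ => ereal"
  assumes "\<And>y. y < C ==> frequently (\<lambda>x. y < X x) F"
  shows "C <= Limsup F X"
proof (rule ccontr)
  assume "\<not> C <= Limsup F X"
  then have "Limsup F X < C" by (simp only: not_le)
  from dense[OF this] obtain y where y: "Limsup F X < y" "y < C" by (elim exE conjE)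
  have "eventually (\<lambda>x. X x < y) F" by (rule Limsup_lessD[OF y(1)])
  from frequently_ex[OF frequently_eventually_frequently[OF assms[OF y(2)] this]]
  obtain x where "y < X x" "X x < y" by (elim exE conjE)
  then show False by (rule less_asym)
qed

lemma separation_number_le:
  assumes "\<And>S. finite S ==> S \<subseteq> A ==> (\<And>x y. x \<in> S ==> y \<in> S ==> x ~= y ==> \<kappa> <= d x y) ==> card S <= N"
  shows "separation_number \<kappa> d A <= enat N"
  unfolding separation_number_def
proof (rule Sup_least)
  fix x
  assume "x \<in> {enat (card S) |S. finite S \<and> S \<subseteq> A \<and> (\<forall>x\<in>S. \<forall>y\<in>S. x ~= y --> \<kappa> <= d x y)}"
  then obtain S where S: "x = enat (card S)" "finite S" "S \<subseteq> A" "\<forall>x\<in>S. \<forall>y\<in>S. x ~= y --> \<kappa> <= d x y"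
    unfolding mem_Collect_eq by (elim exE conjE)
  have "card S <= N" by (rule assms[OF S(2,3)]) (rule S(4)[rule_format])
  then show "x <= enat N" by (simp add: S(1))
qed

lemma log_enat_mono_ge:
  assumes "enat m <= N" "0 < m"
  shows "ereal (ln (real m)) <= log_enat N"
  using assms by (cases N) (auto simp: log_enat_def)

lemma log_enat_le:
  assumes "N <= enat m" "0 < m"
  shows "log_enat N <= ereal (ln (real m))"
  using assms by (cases N) (auto simp: log_enat_def)

lemma card_image_vimage_le:
  assumes "finite B" "inj_on f A"
  shows "card {i\<in>A. f i \<in> B} <= card B"
  by (rule card_inj_on_le[of f]) (use assms in \<open>auto intro: inj_on_subset\<close>)

context coded_action
begin

text \<open>Vanishing on \<open>Bad\<close> makes up for the points where the model does not see the
  group: there the value carries no information.\<close>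

definition model_solutions :: "nat => (int \<times> 'g \<times> 'v) list set => 'd set => ('d \<times> 'v => 'k) set" where
  "model_solutions n R Bad = {u. (\<forall>r\<in>R. \<forall>x\<in>D n. rule_eval (\<sigma> n) r u x = 0) \<and>
     (\<forall>y. y \<notin> (D n - Bad) \<times> V --> u y = 0)}"

lemma card_translated_bad_le:
  assumes "finite F" "F \<subseteq> carrier G" "S \<subseteq> D n"
  shows "card {i \<in> D n. \<exists>f\<in>F. \<sigma> n f i \<notin> S} <= card F * card (D n - S)"
proof -
  have "{i \<in> D n. \<exists>f\<in>F. \<sigma> n f i \<notin> S} = (\<Union>f\<in>F. {i \<in> D n. \<sigma> n f i \<in> D n - S})"
    using assms(2) \<sigma>_in by blast
  also have "card ... <= (\<Sum>f\<in>F. card {i \<in> D n. \<sigma> n f i \<in> D n - S})"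
    by (rule card_UN_le[OF assms(1)])
  also have "... <= (\<Sum>f\<in>F. card (D n - S))"
  proof (intro sum_mono card_image_vimage_le)
    fix f assume "f \<in> F"
    then show "inj_on (\<sigma> n f) (D n)" using bij_\<sigma>[of f n] assms(2) by (auto simp: bij_betw_def)
  qed (use fin_D in auto)
  finally show ?thesis by simp
qed

context
  fixes Rl :: "(int \<times> 'g \<times> 'v) list set"
  assumes RlG: "r \<in> Rl ==> (c, h, v) \<in> set r ==> h \<in> carrier G \<and> v \<in> V"
    and Rl_ext: "(\<And>r g. r \<in> Rl ==> g \<in> carrier G ==> rule_eval (\<otimes>) r u g = 0) ==>
      \<exists>f\<in>X. \<forall>g\<in>carrier G. \<forall>v\<in>V. f (cd g v) = u (g, v)"
begin

text \<open>By compactness, finitely many instances of the rules guarantee that a window extends to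
  an element of \<open>X\<close>.\<close>

lemma local_extension:
  assumes "finite \<Gamma>" "\<Gamma> \<subseteq> carrier G"
  obtains E where "finite E" "E \<subseteq> Rl \<times> carrier G"
    "\<And>u. (\<And>r g. (r, g) \<in> E ==> rule_eval (\<otimes>) r u g = 0) ==>
      \<exists>f\<in>X. \<forall>g\<in>\<Gamma>. \<forall>v\<in>V. f (cd g v) = u (g, v)"
proof -
  define N where "N = {u. \<not> (\<exists>f\<in>X. \<forall>g\<in>\<Gamma>. \<forall>v\<in>V. f (cd g v) = u (g, v))}"
  define B where "B = (\<lambda>(r, g). (\<lambda>(c::int, h, v::'v). (h \<otimes> g, v)) ` set r)"
  define viol :: "(int \<times> 'g \<times> 'v) list \<times> 'g => ('g \<times> 'v => 'k) set"
    where "viol = (\<lambda>(r, g). {u. rule_eval (\<otimes>) r u g ~= 0})"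
  have "\<exists>E0. finite E0 \<and> E0 \<subseteq> Rl \<times> carrier G \<and> N \<subseteq> (\<Union>e\<in>E0. viol e)"
  proof (rule finite_rule_cover[of "\<Gamma> \<times> V" N "Rl \<times> carrier G" B viol])
    show "finite (\<Gamma> \<times> V)" using assms finV by simp
    show "u' \<in> N" if "u \<in> N" "\<And>a. a \<in> \<Gamma> \<times> V ==> u a = u' a" for u u'
      using that unfolding N_def by auto
    show "finite (B e)" if "e \<in> Rl \<times> carrier G" for e by (auto simp: B_def split: prod.splits)
    show "u' \<in> viol e" if "e \<in> Rl \<times> carrier G" "u \<in> viol e" "\<And>a. a \<in> B e ==> u a = u' a" for e u u'
    proof -
      obtain r g where e: "e = (r, g)" by (cases e)
      have "u (h \<otimes> g, v) = u' (h \<otimes> g, v)" if "(c, h, v) \<in> set r" for c h v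
        by (rule \<open>\<And>a. a \<in> B e ==> u a = u' a\<close>) (use that in \<open>force simp: B_def e\<close>)
      then have "map (\<lambda>(c, h, v). of_int c * u (h \<otimes> g, v)) r = map (\<lambda>(c, h, v). of_int c * u' (h \<otimes> g, v)) r"
        by (intro map_cong refl) auto
      then have "rule_eval (\<otimes>) r u g = rule_eval (\<otimes>) r u' g"
        by (simp only: rule_eval_def)
      then show ?thesis using that(2) by (simp add: viol_def e)
    qed
    show "N \<subseteq> (\<Union>e\<in>Rl \<times> carrier G. viol e)"
    proof
      fix u assume u: "u \<in> N"
      show "u \<in> (\<Union>e\<in>Rl \<times> carrier G. viol e)"
      proof (rule ccontr)
        assume "u \<notin> (\<Union>e\<in>Rl \<times> carrier G. viol e)"
        then have "rule_eval (\<otimes>) r u g = 0" if "r \<in> Rl" "g \<in> carrier G" for r g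
          using that by (auto simp: viol_def)
        from Rl_ext[OF this] obtain f where "f \<in> X" "\<forall>g\<in>carrier G. \<forall>v\<in>V. f (cd g v) = u (g, v)"
          by blast
        then show False using u assms(2) unfolding N_def by blast
      qed
    qed
  qed blast
  then obtain E where E: "finite E" "E \<subseteq> Rl \<times> carrier G" "N \<subseteq> (\<Union>e\<in>E. viol e)" by auto
  show thesis
  proof (rule that[OF E(1,2)])
    fix u :: "'g \<times> 'v => 'k"
    assume "\<And>r g. (r, g) \<in> E ==> rule_eval (\<otimes>) r u g = 0"
    then have "u \<notin> (\<Union>e\<in>E. viol e)" by (auto simp: viol_def)
    then have "u \<notin> N" using E(3) by blast
    then show "\<exists>f\<in>X. \<forall>g\<in>\<Gamma>. \<forall>v\<in>V. f (cd g v) = u (g, v)" by (simp add: N_def)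
  qed
qed

text \<open>A solution \<open>u\<close> of the model equations gives a map to \<open>X\<close>: to a
  good point \<open>i\<close> it assigns an element of \<open>X\<close> that shows the values of
  \<open>u\<close> around \<open>i\<close>. It is almost equivariant, and different solutions are
  separated by a fixed distance.\<close>

lemma separated_models:
  assumes \<rho>: "generating_pseudometric G XT act \<rho>"
  shows "\<exists>\<kappa>::real. 0 < \<kappa> \<and> (\<forall>F \<delta>. finite F --> F \<subseteq> carrier G --> 0 < \<delta> -->
      (\<exists>R0. finite R0 \<and> R0 \<subseteq> Rl \<and> (\<forall>eps>0. eventually (\<lambda>n. \<exists>Bad\<subseteq>D n. real (card Bad) <= eps * real (card (D n)) \<and>
        enat (card (model_solutions n R0 Bad)) \<le>
          separation_number \<kappa> (rho_inf \<rho> (D n)) (sofic_Map XT act \<rho> F \<delta> (D n) (\<sigma> n))) sequentially)))"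
proof -
  note \<rho>_props = \<rho>_self[OF \<rho>] \<rho>_sym[OF \<rho>] \<rho>_nonneg[OF \<rho>] \<rho>_tri[OF \<rho>]
  obtain F0 \<eta> where F0: "finite F0" "F0 \<subseteq> carrier G" "0 < (\<eta>::real)"
    "\<And>f f'. f \<in> X ==> f' \<in> X ==> \<not> agree {\<one>} f f' ==> \<exists>g\<in>F0. \<eta> <= \<rho> (act g f) (act g f')"
    using \<rho>_separates[OF \<rho>] by metis
  obtain B where B: "0 <= B" "\<And>f f'. f \<in> X ==> f' \<in> X ==> \<rho> f f' <= B"
    using \<rho>_bounded[OF \<rho>] by metis
  have "\<exists>R0. finite R0 \<and> R0 \<subseteq> Rl \<and> (\<forall>eps>0. eventually (\<lambda>n. \<exists>Bad\<subseteq>D n. real (card Bad) <= eps * real (card (D n)) \<and>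
        enat (card (model_solutions n R0 Bad)) \<le>
          separation_number (\<eta> / 3) (rho_inf \<rho> (D n)) (sofic_Map XT act \<rho> F \<delta> (D n) (\<sigma> n))) sequentially)"
    if F: "finite F" "F \<subseteq> carrier G" and \<delta>: "0 < \<delta>" for F \<delta>
  proof -
    define e1 where "e1 = min (\<delta> / 2) (\<eta> / 3)"
    have e1: "0 < e1" "e1 <= \<delta> / 2" "e1 <= \<eta> / 3" using \<delta> F0(3) by (auto simp: e1_def)
    obtain \<Gamma>0 where \<Gamma>0: "finite \<Gamma>0" "\<Gamma>0 \<subseteq> carrier G"
      "\<And>f f'. f \<in> X ==> f' \<in> X ==> agree \<Gamma>0 f f' ==> \<rho> f f' < e1"
      using \<rho>_uniform[OF \<rho> e1(1)] by metis
    define F' where "F' = F \<union> F0"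
    have F': "finite F'" "F' \<subseteq> carrier G" using F F0 by (auto simp: F'_def)
    define \<Gamma>1 where "\<Gamma>1 = insert \<one> (\<Gamma>0 \<union> (\<lambda>(g, f). g \<otimes> f) ` (\<Gamma>0 \<times> F'))"
    have \<Gamma>1: "finite \<Gamma>1" "\<Gamma>1 \<subseteq> carrier G" using \<Gamma>0 F' by (auto simp: \<Gamma>1_def subset_iff)
    obtain E where E: "finite E" "E \<subseteq> Rl \<times> carrier G"
      "\<And>u. (\<And>r g. (r, g) \<in> E ==> rule_eval (\<otimes>) r u g = 0) ==>
        \<exists>f\<in>X. \<forall>g\<in>\<Gamma>1. \<forall>v\<in>V. f (cd g v) = u (g, v)"
      using local_extension[OF \<Gamma>1] by metis
    define R0 where "R0 = fst ` E"
    have R0: "finite R0" "R0 \<subseteq> Rl" using E by (auto simp: R0_def)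
    define P where "P = \<Gamma>0 \<times> F' \<union> (\<Union>(r, g)\<in>E. (\<lambda>(c, h, v). (h, g)) ` set r)"
    have "finite P" unfolding P_def using \<Gamma>0(1) F'(1) E(1) by auto
    moreover have "P \<subseteq> carrier G \<times> carrier G"
    proof
      fix p assume "p \<in> P"
      then consider "p \<in> \<Gamma>0 \<times> F'" | r g c h v where "(r, g) \<in> E" "(c, h, v) \<in> set r" "p = (h, g)"
        unfolding P_def by auto
      then show "p \<in> carrier G \<times> carrier G"
      proof cases
        case 1
        then show ?thesis using \<Gamma>0(2) F'(2) by auto
      next
        case (2 r g c h v)
        then have "r \<in> Rl" "g \<in> carrier G" using E(2) by auto
        then show ?thesis using 2 RlG[of r c h v] by simp
      qed
    qed
    ultimately have P: "finite P" "P \<subseteq> carrier G \<times> carrier G" .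
    have "eventually (\<lambda>n. \<exists>Bad\<subseteq>D n. real (card Bad) <= eps * real (card (D n)) \<and>
        enat (card (model_solutions n R0 Bad)) \<le>
          separation_number (\<eta> / 3) (rho_inf \<rho> (D n)) (sofic_Map XT act \<rho> F \<delta> (D n) (\<sigma> n))) sequentially"
      if eps: "0 < eps" for eps
    proof -
      define e2 where "e2 = min eps (\<delta>\<^sup>2 / (2 * (B\<^sup>2 + 1)))"
      have B2: "0 < B\<^sup>2 + 1" using zero_le_power2[of B] by linarith
      have e2: "0 < e2" "e2 <= eps" "e2 * B\<^sup>2 <= \<delta>\<^sup>2 / 2"
      proof -
        show "0 < e2" "e2 <= eps" using eps \<delta> B2 by (auto simp: e2_def)
        have "e2 * B\<^sup>2 <= \<delta>\<^sup>2 / (2 * (B\<^sup>2 + 1)) * (B\<^sup>2 + 1)"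
          using \<open>0 < e2\<close> \<delta> by (intro mult_mono) (auto simp: e2_def)
        also have "... = \<delta>\<^sup>2 / 2" using B2 by (simp add: field_simps)
        finally show "e2 * B\<^sup>2 <= \<delta>\<^sup>2 / 2" .
      qed
      define e3 where "e3 = e2 / (1 + real (card F'))"
      have e3: "0 < e3" using e2 by (simp add: e3_def)
      show ?thesis
        using eventually_mult_good[OF P e3] eventually_D_pos
      proof eventually_elim
        case (elim n)
        let ?d = "real (card (D n))"
        define M where "M = mult_good n P"
        have MD: "M \<subseteq> D n" by (auto simp: M_def mult_good_def)
        define Bad where "Bad = (D n - M) \<union> {i \<in> D n. \<exists>f\<in>F'. \<sigma> n f i \<notin> M}"
        have BadD: "Bad \<subseteq> D n" by (auto simp: Bad_def)
        have finBad: "finite Bad" using BadD fin_D finite_subset by blast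
        have cBad: "real (card Bad) <= e2 * ?d"
        proof -
          have "card Bad <= card (D n - M) + card F' * card (D n - M)"
            unfolding Bad_def using card_translated_bad_le[OF F' MD]
            by (intro order_trans[OF card_Un_le] add_left_mono)
          also have "... = (1 + card F') * card (D n - M)" by (simp add: algebra_simps)
          finally have "real (card Bad) <= real ((1 + card F') * card (D n - M))"
            by (rule of_nat_mono)
          also have "... = (1 + real (card F')) * real (card (D n - M))" by (simp add: distrib_right)
          also have "... <= (1 + real (card F')) * (e3 * ?d)"
            using elim(1) by (intro mult_left_mono) (auto simp: M_def)
          also have "... = e2 * ?d" by (simp add: e3_def)
          finally show ?thesis .
        qed
        define H where "H = model_solutions n R0 Bad"
        define good_ext where "good_ext u i f \<longleftrightarrow> f \<in> X \<and> (\<forall>g\<in>\<Gamma>1. \<forall>v\<in>V. f (cd g v) = u (\<sigma> n g i, v))" for u i f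
        have ext: "\<exists>f. good_ext u i f" if u: "u \<in> H" and i: "i \<in> M" for u i
        proof -
          have iD: "i \<in> D n" using i MD by auto
          have "rule_eval (\<otimes>) r (\<lambda>(g, v). u (\<sigma> n g i, v)) g = 0" if e: "(r, g) \<in> E" for r g
          proof -
            have gG: "g \<in> carrier G" using e E(2) by auto
            have "u (\<sigma> n (h \<otimes> g) i, v) = u (\<sigma> n h (\<sigma> n g i), v)" if "(c, h, v) \<in> set r" for c h v
            proof -
              have "(h, g) \<in> P" unfolding P_def using that e by force
              then show ?thesis using i by (auto simp: M_def mult_good_def)
            qed
            then have "map (\<lambda>(c, h, v). of_int c * (case (h \<otimes> g, v) of (g, v) => u (\<sigma> n g i, v))) r
                = map (\<lambda>(c, h, v). of_int c * u (\<sigma> n h (\<sigma> n g i), v)) r"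
              by (intro map_cong refl) auto
            then have "rule_eval (\<otimes>) r (\<lambda>(g, v). u (\<sigma> n g i, v)) g = rule_eval (\<sigma> n) r u (\<sigma> n g i)"
              by (simp only: rule_eval_def)
            moreover have "r \<in> R0" using e by (force simp: R0_def)
            ultimately show ?thesis using u \<sigma>_in[OF gG iD] by (simp add: H_def model_solutions_def)
          qed
          from E(3)[OF this] show ?thesis by (auto simp: good_ext_def)
        qed
        obtain x0 where x0: "x0 \<in> X" using X_ne by blast
        define \<Phi> where "\<Phi> u = (\<lambda>i\<in>D n. if i \<in> M then SOME f. good_ext u i f else x0)" for u
        have \<Phi>M: "good_ext u i (\<Phi> u i)" if "u \<in> H" "i \<in> M" for u i
          using someI_ex[OF ext[OF that]] that MD by (auto simp: \<Phi>_def)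
        have \<Phi>X: "\<Phi> u i \<in> X" if "u \<in> H" "i \<in> D n" for u i
          using \<Phi>M[of u i] that x0 by (cases "i \<in> M") (auto simp: good_ext_def \<Phi>_def)
        have close: "\<rho> (\<Phi> u (\<sigma> n f i)) (act f (\<Phi> u i)) < e1" if u: "u \<in> H" and i: "i \<in> D n - Bad" and f: "f \<in> F'" for u i f
        proof -
          have fG: "f \<in> carrier G" using f F' by auto
          have iD: "i \<in> D n" and iM: "i \<in> M" and fM: "\<sigma> n f i \<in> M" using i f by (auto simp: Bad_def)
          have fD: "\<sigma> n f i \<in> D n" by (rule \<sigma>_in[OF fG iD])
          show ?thesis
          proof (rule \<Gamma>0(3))
            show "\<Phi> u (\<sigma> n f i) \<in> X" by (rule \<Phi>X[OF u fD])
            show "act f (\<Phi> u i) \<in> X" by (rule act_in[OF fG \<Phi>X[OF u iD]])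
            show "agree \<Gamma>0 (\<Phi> u (\<sigma> n f i)) (act f (\<Phi> u i))"
              unfolding agree_def
            proof (intro ballI)
              fix g v assume g: "g \<in> \<Gamma>0" and v: "v \<in> V"
              have gG: "g \<in> carrier G" using g \<Gamma>0 by auto
              have "g \<in> \<Gamma>1" using g by (simp add: \<Gamma>1_def)
              then have "\<Phi> u (\<sigma> n f i) (cd g v) = u (\<sigma> n g (\<sigma> n f i), v)"
                using \<Phi>M[OF u fM] v by (simp add: good_ext_def)
              also have "\<sigma> n g (\<sigma> n f i) = \<sigma> n (g \<otimes> f) i"
                using iM g f by (auto simp: M_def mult_good_def P_def)
              also have "u (\<sigma> n (g \<otimes> f) i, v) = \<Phi> u i (cd (g \<otimes> f) v)"
              proof -
                have "g \<otimes> f \<in> \<Gamma>1" unfolding \<Gamma>1_def using g f by force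
                then show ?thesis using \<Phi>M[OF u iM] v by (simp add: good_ext_def)
              qed
              also have "... = act f (\<Phi> u i) (cd g v)"
                by (rule act_coord[OF gG fG v \<Phi>X[OF u iD], symmetric])
              finally show "\<Phi> u (\<sigma> n f i) (cd g v) = act f (\<Phi> u i) (cd g v)" .
            qed
          qed
        qed
        have inMap: "\<Phi> u \<in> sofic_Map XT act \<rho> F \<delta> (D n) (\<sigma> n)" if u: "u \<in> H" for u
          unfolding sofic_Map_def topspace_XT
        proof (intro CollectI conjI ballI)
          show "\<Phi> u \<in> D n \<rightarrow>\<^sub>E X" using \<Phi>X[OF u] by (auto simp: \<Phi>_def)
          fix f assume f: "f \<in> F"
          have fG: "f \<in> carrier G" and fF': "f \<in> F'" using f F by (auto simp: F'_def)
          let ?t = "\<lambda>i. (\<rho> (\<Phi> u (\<sigma> n f i)) (act f (\<Phi> u i)))\<^sup>2"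
          have r0: "0 <= \<rho> (\<Phi> u (\<sigma> n f i)) (act f (\<Phi> u i))" "\<rho> (\<Phi> u (\<sigma> n f i)) (act f (\<Phi> u i)) <= B" if "i \<in> D n" for i
            using \<rho>_props(3) B(2) \<Phi>X[OF u] act_in[OF fG] \<sigma>_in[OF fG that] that by auto
          have "(\<Sum>i\<in>D n. ?t i) = (\<Sum>i\<in>D n - Bad. ?t i) + (\<Sum>i\<in>Bad. ?t i)"
            by (rule sum.subset_diff[OF BadD fin_D])
          also have "(\<Sum>i\<in>D n - Bad. ?t i) <= (\<Sum>i\<in>D n - Bad. (\<delta> / 2)\<^sup>2)"
          proof (intro sum_mono power_mono)
            fix i assume i: "i \<in> D n - Bad"
            show "\<rho> (\<Phi> u (\<sigma> n f i)) (act f (\<Phi> u i)) <= \<delta> / 2"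
              using close[OF u i fF'] e1(2) by linarith
          qed (use r0 in auto)
          also have "(\<Sum>i\<in>D n - Bad. (\<delta> / 2)\<^sup>2) <= ?d * (\<delta>\<^sup>2 / 4)"
          proof -
            have "card (D n - Bad) <= card (D n)" using fin_D by (intro card_mono) auto
            then have "real (card (D n - Bad)) * (\<delta>\<^sup>2 / 4) <= ?d * (\<delta>\<^sup>2 / 4)" by (intro mult_right_mono) auto
            then show ?thesis by (simp add: power_divide)
          qed
          also have "(\<Sum>i\<in>Bad. ?t i) <= (\<Sum>i\<in>Bad. B\<^sup>2)"
            using r0 BadD by (intro sum_mono power_mono) auto
          also have "(\<Sum>i\<in>Bad. B\<^sup>2) <= e2 * ?d * B\<^sup>2"
            using cBad by (simp add: mult_right_mono)
          also have "e2 * ?d * B\<^sup>2 <= ?d * (\<delta>\<^sup>2 / 2)"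
            using mult_left_mono[OF e2(3), of ?d] by (simp add: mult_ac)
          finally have "(\<Sum>i\<in>D n. ?t i) <= ?d * (3 / 4 * \<delta>\<^sup>2)" by (simp add: algebra_simps)
          also have "... < ?d * \<delta>\<^sup>2" using elim(2) \<delta> by simp
          finally have "(\<Sum>i\<in>D n. ?t i) / ?d < \<delta>\<^sup>2" using elim(2) by (simp add: field_simps)
          then show "rho_2 \<rho> (D n) (\<lambda>i. \<Phi> u (\<sigma> n f i)) (\<lambda>i. act f (\<Phi> u i)) < \<delta>"
            unfolding rho_2_def using \<delta> by (intro real_less_lsqrt) (auto intro!: divide_nonneg_nonneg sum_nonneg)
        qed
        have sep: "\<exists>j\<in>D n. \<eta> / 3 <= \<rho> (\<Phi> u j) (\<Phi> u' j)" if u: "u \<in> H" "u' \<in> H" "u ~= u'" for u u'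
        proof -
          have "\<exists>y. u y ~= u' y"
          proof (rule ccontr)
            assume "\<not> (\<exists>y. u y ~= u' y)"
            then have "u = u'" by (intro HOL.ext) (simp only: not_ex not_not)
            then show False using u(3) by simp
          qed
          then obtain y where y: "u y ~= u' y" by (elim exE)
          obtain i v where iv: "y = (i, v)" by (cases y)
          have "y \<in> (D n - Bad) \<times> V"
          proof (rule ccontr)
            assume "y \<notin> (D n - Bad) \<times> V"
            then have "u y = 0" "u' y = 0"
              using u(1,2) unfolding H_def model_solutions_def mem_Collect_eq by blast+
            then show False using y by simp
          qed
          then have i: "i \<in> D n - Bad" and v: "v \<in> V" using iv by auto
          have iD: "i \<in> D n" and iM: "i \<in> M" using i by (auto simp: Bad_def)
          have \<Phi>1: "\<Phi> w i (cd \<one> v) = w (i, v)" if "w \<in> H" for w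
            using \<Phi>M[OF that iM] v \<sigma>_one[OF iD] by (simp add: good_ext_def \<Gamma>1_def)
          have "\<not> agree {\<one>} (\<Phi> u i) (\<Phi> u' i)"
          proof
            assume "agree {\<one>} (\<Phi> u i) (\<Phi> u' i)"
            then have "\<Phi> u i (cd \<one> v) = \<Phi> u' i (cd \<one> v)" using v by (simp add: agree_def)
            then show False using \<Phi>1[OF u(1)] \<Phi>1[OF u(2)] y iv by simp
          qed
          then obtain f where f: "f \<in> F0" "\<eta> <= \<rho> (act f (\<Phi> u i)) (act f (\<Phi> u' i))"
            using F0(4)[OF \<Phi>X[OF u(1) iD] \<Phi>X[OF u(2) iD]] by blast
          have fG: "f \<in> carrier G" and fF': "f \<in> F'" using f F0 by (auto simp: F'_def)
          define j where "j = \<sigma> n f i"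
          have jD: "j \<in> D n" unfolding j_def by (rule \<sigma>_in[OF fG iD])
          define a b a' b' where "a = act f (\<Phi> u i)" and "b = \<Phi> u j" and "a' = act f (\<Phi> u' i)" and "b' = \<Phi> u' j"
          have X: "a \<in> X" "b \<in> X" "a' \<in> X" "b' \<in> X"
            using \<Phi>X u iD jD act_in[OF fG] by (auto simp: a_def b_def a'_def b'_def)
          have "\<rho> b a < e1" "\<rho> b' a' < e1"
            using close[OF u(1) i fF'] close[OF u(2) i fF'] by (auto simp: a_def b_def a'_def b'_def j_def)
          moreover have "\<rho> a a' <= \<rho> a b + \<rho> b a'" by (rule \<rho>_props(4)) (use X in auto)
          moreover have "\<rho> b a' <= \<rho> b b' + \<rho> b' a'" by (rule \<rho>_props(4)) (use X in auto)
          moreover have "\<rho> a b = \<rho> b a" by (rule \<rho>_props(2)) (use X in auto)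
          ultimately have "\<eta> / 3 <= \<rho> b b'" using f(2) e1(3) unfolding a_def[symmetric] a'_def[symmetric] by linarith
          then show ?thesis using jD by (auto simp: b_def b'_def)
        qed
        have finH: "finite H"
        proof (rule finite_subset[OF _ card_supported_fun(2)])
          show "H \<subseteq> supported_fun (D n \<times> V)" by (auto simp: H_def model_solutions_def supported_fun_def)
          show "finite (D n \<times> V)" using fin_D finV by simp
        qed
        have "inj_on \<Phi> H"
        proof (rule inj_onI, rule ccontr)
          fix u u' assume u: "u \<in> H" "u' \<in> H" "\<Phi> u = \<Phi> u'" "u ~= u'"
          obtain j where j: "j \<in> D n" "\<eta> / 3 <= \<rho> (\<Phi> u j) (\<Phi> u' j)" using sep[OF u(1,2,4)] by blast
          then show False using u(3) \<rho>_props(1)[OF \<Phi>X[OF u(1) j(1)]] F0(3) by simp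
        qed
        then have "card H = card (\<Phi> ` H)" by (simp add: card_image)
        moreover have "enat (card (\<Phi> ` H)) <= separation_number (\<eta> / 3) (rho_inf \<rho> (D n)) (sofic_Map XT act \<rho> F \<delta> (D n) (\<sigma> n))"
        proof (rule separation_number_ge)
          show "finite (\<Phi> ` H)" using finH by simp
          show "\<Phi> ` H \<subseteq> sofic_Map XT act \<rho> F \<delta> (D n) (\<sigma> n)" using inMap by auto
          fix x y assume "x \<in> \<Phi> ` H" "y \<in> \<Phi> ` H" "x ~= y"
          then obtain u u' where u: "u \<in> H" "u' \<in> H" "u ~= u'" "x = \<Phi> u" "y = \<Phi> u'" by auto
          obtain j where j: "j \<in> D n" "\<eta> / 3 <= \<rho> (\<Phi> u j) (\<Phi> u' j)" using sep[OF u(1-3)] by blast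
          have "\<rho> (\<Phi> u j) (\<Phi> u' j) <= rho_inf \<rho> (D n) x y"
            unfolding rho_inf_def u(4,5) using j fin_D by (intro Max_ge) auto
          then show "\<eta> / 3 <= rho_inf \<rho> (D n) x y" using j by linarith
        qed
        ultimately have "enat (card (model_solutions n R0 Bad)) \<le>
            separation_number (\<eta> / 3) (rho_inf \<rho> (D n)) (sofic_Map XT act \<rho> F \<delta> (D n) (\<sigma> n))"
          by (simp add: H_def)
        moreover have "real (card Bad) <= eps * ?d"
          using cBad e2(2) by (meson mult_right_mono of_nat_0_le_iff order_trans)
        ultimately show ?case using BadD by (intro exI[of _ Bad]) simp
      qed
    qed
    then show ?thesis using R0 by (intro exI[of _ R0]) simp
  qed
  then show ?thesis using F0(3) by (intro exI[of _ "\<eta> / 3"] conjI allI impI) simp_all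
qed

theorem entropy_ge:
  assumes "\<And>R0 \<theta>. finite R0 ==> R0 \<subseteq> Rl ==> 0 < \<theta> ==> \<exists>eps>0. frequently (\<lambda>n. \<forall>Bad\<subseteq>D n.
      real (card Bad) <= eps * real (card (D n)) -->
      exp ((c - \<theta>) * real (card (D n))) <= real (card (model_solutions n R0 Bad))) sequentially"
  shows "ereal c <= top_sofic_entropy G D \<sigma> XT act"
proof -
  define \<rho> where "\<rho> = (SOME \<rho>. generating_pseudometric G XT act \<rho>)"
  have \<rho>: "generating_pseudometric G XT act \<rho>"
    unfolding \<rho>_def by (rule someI_ex[OF generating_pseudometric_ex])
  obtain \<kappa> :: real where \<kappa>: "0 < \<kappa>"
    "\<forall>F \<delta>. finite F --> F \<subseteq> carrier G --> 0 < \<delta> -->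
      (\<exists>R0. finite R0 \<and> R0 \<subseteq> Rl \<and> (\<forall>eps>0. eventually (\<lambda>n. \<exists>Bad\<subseteq>D n. real (card Bad) <= eps * real (card (D n)) \<and>
        enat (card (model_solutions n R0 Bad)) \<le>
          separation_number \<kappa> (rho_inf \<rho> (D n)) (sofic_Map XT act \<rho> F \<delta> (D n) (\<sigma> n))) sequentially))"
    using separated_models[OF \<rho>] by (elim exE conjE)
  let ?sep = "\<lambda>F \<delta> n. separation_number \<kappa> (rho_inf \<rho> (D n)) (sofic_Map XT act \<rho> F \<delta> (D n) (\<sigma> n))"
  have "ereal c <= limsup (\<lambda>n. log_enat (?sep F \<delta> n) / ereal (real (card (D n))))"
    if F: "finite F" "F \<subseteq> carrier G" and \<delta>: "0 < \<delta>" for F \<delta>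
  proof (rule le_LimsupI)
    fix y assume "y < ereal c"
    then obtain c' where c': "y < ereal c'" "c' < c" using ereal_dense2[of y "ereal c"] by auto
    define \<theta> where "\<theta> = c - c'"
    have \<theta>: "0 < \<theta>" using c' by (simp add: \<theta>_def)
    obtain R0 where R0: "finite R0" "R0 \<subseteq> Rl" "\<forall>eps>0. eventually (\<lambda>n. \<exists>Bad\<subseteq>D n.
        real (card Bad) <= eps * real (card (D n)) \<and> enat (card (model_solutions n R0 Bad)) <= ?sep F \<delta> n) sequentially"
      using \<kappa>(2)[rule_format, OF F \<delta>] by (elim exE conjE)
    obtain eps where eps: "0 < eps" "frequently (\<lambda>n. \<forall>Bad\<subseteq>D n. real (card Bad) <= eps * real (card (D n)) -->
        exp ((c - \<theta>) * real (card (D n))) <= real (card (model_solutions n R0 Bad))) sequentially"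
      using assms[OF R0(1,2) \<theta>] by auto
    have "eventually (\<lambda>n. (\<exists>Bad\<subseteq>D n. real (card Bad) <= eps * real (card (D n)) \<and>
        enat (card (model_solutions n R0 Bad)) <= ?sep F \<delta> n) \<and> 0 < card (D n)) sequentially"
      using R0(3)[rule_format, OF eps(1)] eventually_D_pos by (rule eventually_conj)
    from frequently_eventually_frequently[OF eps(2) this]
    show "frequently (\<lambda>n. y < log_enat (?sep F \<delta> n) / ereal (real (card (D n)))) sequentially"
    proof (rule frequently_elim1)
      fix n assume n: "(\<forall>Bad\<subseteq>D n. real (card Bad) <= eps * real (card (D n)) -->
          exp ((c - \<theta>) * real (card (D n))) <= real (card (model_solutions n R0 Bad))) \<and>
        (\<exists>Bad\<subseteq>D n. real (card Bad) <= eps * real (card (D n)) \<and>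
          enat (card (model_solutions n R0 Bad)) <= ?sep F \<delta> n) \<and> 0 < card (D n)"
      then obtain Bad where Bad: "enat (card (model_solutions n R0 Bad)) <= ?sep F \<delta> n"
        "exp ((c - \<theta>) * real (card (D n))) <= real (card (model_solutions n R0 Bad))" and d: "0 < card (D n)" by auto
      let ?m = "card (model_solutions n R0 Bad)"
      have "0 < exp ((c - \<theta>) * real (card (D n)))" by simp
      then have m: "0 < real ?m" using Bad(2) by linarith
      have "(c - \<theta>) * real (card (D n)) <= ln (real ?m)" using Bad(2) m by (simp add: ln_ge_iff)
      then have "ereal ((c - \<theta>) * real (card (D n))) <= ereal (ln (real ?m))" by simp
      also have "... <= log_enat (?sep F \<delta> n)" by (rule log_enat_mono_ge[OF Bad(1)]) (use m in simp)
      finally have "ereal ((c - \<theta>) * real (card (D n))) / ereal (real (card (D n))) <= log_enat (?sep F \<delta> n) / ereal (real (card (D n)))"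
        using d by (intro ereal_divide_right_mono) auto
      moreover have "ereal ((c - \<theta>) * real (card (D n))) / ereal (real (card (D n))) = ereal c'" using d by (simp add: \<theta>_def)
      ultimately show "y < log_enat (?sep F \<delta> n) / ereal (real (card (D n)))" using c'(1) by simp
    qed
  qed
  then have "ereal c <= (INF \<delta>\<in>{0<..}. INF F\<in>{F. finite F \<and> F \<subseteq> carrier G}.
      limsup (\<lambda>n. log_enat (?sep F \<delta> n) / ereal (real (card (D n)))))"
    by (intro INF_greatest) auto
  also have "... <= sofic_entropy_wrt \<rho> G D \<sigma> XT act"
    unfolding sofic_entropy_wrt_def by (rule SUP_upper) (use \<kappa>(1) in simp)
  finally show ?thesis unfolding top_sofic_entropy_def \<rho>_def .
qed

end

end

text \<open>A Chernoff bound: every label other than \<open>None\<close> is weighted by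
  \<open>t\<close>.\<close>

lemma card_sparse_labellings:
  fixes Pt :: "'p set" and t m :: real
  assumes "finite E" "finite Pt" "0 < t" "t <= 1"
  shows "real (card {q \<in> E \<rightarrow>\<^sub>E insert None (Some ` Pt). real (card {i\<in>E. q i ~= None}) <= m})
    <= t powr (- m) * (1 + t * card Pt) ^ card E"
proof -
  define Q where "Q = {q \<in> E \<rightarrow>\<^sub>E insert None (Some ` Pt). real (card {i\<in>E. q i ~= None}) <= m}"
  define w where "w x = (case x of None => 1 | Some _ => t)" for x :: "'p option"
  have w0: "0 <= w x" for x using assms by (auto simp: w_def split: option.splits)
  have finP: "finite (E \<rightarrow>\<^sub>E insert None (Some ` Pt))" using assms by (intro finite_PiE) auto
  have ge: "t powr m <= (\<Prod>i\<in>E. w (q i))" if q: "q \<in> Q" for q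
  proof -
    define c where "c = card {i\<in>E. q i ~= None}"
    have "(\<Prod>i\<in>E. w (q i)) = (\<Prod>i\<in>{i\<in>E. q i ~= None}. w (q i))"
      using assms(1) by (intro prod.mono_neutral_right) (auto simp: w_def)
    also have "... = (\<Prod>i\<in>{i\<in>E. q i ~= None}. t)" by (intro prod.cong) (auto simp: w_def)
    also have "... = t powr real c" using assms(3) by (simp add: c_def powr_realpow)
    finally have e: "(\<Prod>i\<in>E. w (q i)) = t powr real c" .
    have "real c <= m" using q by (simp add: Q_def c_def)
    then show ?thesis unfolding e using assms(3,4) by (intro powr_mono') auto
  qed
  have "real (card Q) * t powr m = (\<Sum>q\<in>Q. t powr m)" by simp
  also have "... <= (\<Sum>q\<in>Q. \<Prod>i\<in>E. w (q i))" by (intro sum_mono ge)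
  also have "... <= (\<Sum>q\<in>E \<rightarrow>\<^sub>E insert None (Some ` Pt). \<Prod>i\<in>E. w (q i))"
    by (intro sum_mono2 finP prod_nonneg) (auto simp: Q_def w0)
  also have "... = (\<Prod>i\<in>E. \<Sum>x\<in>insert None (Some ` Pt). w x)"
    by (rule prod_sum_PiE[symmetric]) (use assms in auto)
  also have "(\<Sum>x\<in>insert None (Some ` Pt). w x) = 1 + t * card Pt"
    using assms(2) by (simp add: w_def sum.reindex)
  finally have "real (card Q) * t powr m <= (1 + t * card Pt) ^ card E" by simp
  moreover have "t powr (- m) * t powr m = 1" using assms(3) by (simp flip: powr_add)
  ultimately have "real (card Q) * t powr m * t powr (-m) <= (1 + t * card Pt) ^ card E * t powr (-m)"
    by (intro mult_right_mono) auto
  moreover have "real (card Q) * t powr m * t powr (- m) = real (card Q)"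
    using \<open>t powr (- m) * t powr m = 1\<close> by (simp add: mult.assoc mult.commute[of "t powr m"])
  ultimately show ?thesis unfolding Q_def[symmetric] by (simp only: mult.commute[of "t powr (- m)"])
qed

context coded_action
begin

text \<open>An almost equivariant map is determined, up to small distance, by its values in the
  coordinates at the identity, except at few points; the windows at those points are recorded
  separately at negligible cost.\<close>

lemma separation_number_bound:
  assumes \<rho>: "generating_pseudometric G XT act \<rho>" and \<kappa>: "0 < \<kappa>" and \<theta>: "0 < (\<theta>::real)"
  shows "\<exists>\<delta>>0. \<exists>F. finite F \<and> F \<subseteq> carrier G \<and> eventually (\<lambda>n. 0 < card (D n) \<and>
    (\<forall>S. finite S --> S \<subseteq> sofic_Map XT act \<rho> F \<delta> (D n) (\<sigma> n) -->
      (\<forall>x\<in>S. \<forall>y\<in>S. x ~= y --> \<kappa> <= rho_inf \<rho> (D n) x y) -->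
      real (card S) <= exp ((card V * ln CARD('k) + \<theta>) * real (card (D n))))) sequentially"
proof -
  note \<rho>_props = \<rho>_self[OF \<rho>] \<rho>_sym[OF \<rho>] \<rho>_nonneg[OF \<rho>] \<rho>_tri[OF \<rho>]
  obtain \<Gamma> where \<Gamma>: "finite \<Gamma>" "\<Gamma> \<subseteq> carrier G"
    "\<And>f f'. f \<in> X ==> f' \<in> X ==> agree \<Gamma> f f' ==> \<rho> f f' < \<kappa>"
    using \<rho>_uniform[OF \<rho> \<kappa>] by metis
  obtain F0 \<eta> where F0: "finite F0" "F0 \<subseteq> carrier G" "0 < (\<eta>::real)"
    "\<And>f f'. f \<in> X ==> f' \<in> X ==> \<not> agree {\<one>} f f' ==> \<exists>g\<in>F0. \<eta> <= \<rho> (act g f) (act g f')"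
    using \<rho>_separates[OF \<rho>] by metis
  define F where "F = F0 \<union> (\<lambda>(g, f). g \<otimes> f) ` (F0 \<times> \<Gamma>)"
  have F: "finite F" "F \<subseteq> carrier G" using F0(1,2) \<Gamma>(1,2) by (auto simp: F_def subset_iff)
  define P where "P = F0 \<times> \<Gamma>"
  have P: "finite P" "P \<subseteq> carrier G \<times> carrier G" using F0(1,2) \<Gamma>(1,2) by (auto simp: P_def)
  define Pt where "Pt = (\<Gamma> \<times> V \<rightarrow>\<^sub>E (UNIV :: 'k set))"
  have finPt: "finite Pt" using \<Gamma>(1) finV by (simp add: Pt_def finite_PiE)
  define np where "np = real (card Pt)"
  \<comment> \<open>A small weight \<open>t\<close> for the exceptional points, then a small admissible proportion of them.\<close>
  define t where "t = min 1 (\<theta> / (2 * (np + 1)))"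
  have np: "0 <= np" by (simp add: np_def)
  have t: "0 < t" "t <= 1" "t * np <= \<theta> / 2"
  proof -
    show "0 < t" "t <= 1" using \<theta> np by (auto simp: t_def)
    have "t * np <= \<theta> / (2 * (np + 1)) * (np + 1)" using \<theta> np by (intro mult_mono) (auto simp: t_def)
    also have "... = \<theta> / 2"
    proof -
      have "np + 1 ~= 0" using np by linarith
      then show ?thesis by (simp add: field_simps)
    qed
    finally show "t * np <= \<theta> / 2" .
  qed
  define L where "L = 1 + ln (1 / t)"
  have L: "1 <= L" using t by (simp add: L_def)
  define e where "e = \<theta> / (2 * L)"
  have e: "0 < e" using \<theta> L by (simp add: e_def)
  define m where "m = 1 + real (card \<Gamma> + 1) * real (card F)"
  have m: "1 <= m" by (simp add: m_def)
  define e1 where "e1 = e / (2 * m)"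
  have e1: "0 < e1" using e m by (simp add: e1_def)
  define \<delta> where "\<delta> = \<eta> / 2 * sqrt e1"
  have \<delta>: "0 < \<delta>" using F0(3) e1 by (simp add: \<delta>_def)
  have \<delta>2: "\<delta>\<^sup>2 = (\<eta> / 2)\<^sup>2 * e1" unfolding \<delta>_def power_mult_distrib using e1 by simp
  have "eventually (\<lambda>n. 0 < card (D n) \<and>
    (\<forall>S. finite S --> S \<subseteq> sofic_Map XT act \<rho> F \<delta> (D n) (\<sigma> n) -->
      (\<forall>x\<in>S. \<forall>y\<in>S. x ~= y --> \<kappa> <= rho_inf \<rho> (D n) x y) -->
      real (card S) <= exp ((card V * ln CARD('k) + \<theta>) * real (card (D n))))) sequentially"
    using eventually_mult_good[OF P e1] eventually_D_pos
  proof eventually_elim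
    case (elim n)
    let ?d = "real (card (D n))"
    have dpos: "0 < ?d" using elim(2) by simp
    define M where "M = mult_good n P"
    have MD: "M \<subseteq> D n" by (auto simp: M_def mult_good_def)
    show ?case
    proof (intro conjI allI impI)
      show "0 < card (D n)" by (rule elim(2))
      fix S assume S: "finite S" "S \<subseteq> sofic_Map XT act \<rho> F \<delta> (D n) (\<sigma> n)"
        and sep: "\<forall>x\<in>S. \<forall>y\<in>S. x ~= y --> \<kappa> <= rho_inf \<rho> (D n) x y"
      have SX: "\<phi> i \<in> X" if "\<phi> \<in> S" "i \<in> D n" for \<phi> i
        using that S(2) by (auto simp: sofic_Map_def topspace_XT)
      \<comment> \<open>Points where \<open>\<phi>\<close> is nearly equivariant with respect to all of \<open>F\<close>.\<close>
      define near where "near \<phi> = {i \<in> D n. \<forall>f\<in>F. \<rho> (\<phi> (\<sigma> n f i)) (act f (\<phi> i)) < \<eta> / 2}" for \<phi>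
      have nearD: "near \<phi> \<subseteq> D n" for \<phi> by (auto simp: near_def)
      have near: "real (card (D n - near \<phi>)) <= real (card F) * (e1 * ?d)" if \<phi>: "\<phi> \<in> S" for \<phi>
      proof -
        have one: "real (card {i \<in> D n. \<eta> / 2 <= \<rho> (\<phi> (\<sigma> n f i)) (act f (\<phi> i))}) <= e1 * ?d" if f: "f \<in> F" for f
        proof -
          let ?B = "{i \<in> D n. \<eta> / 2 <= \<rho> (\<phi> (\<sigma> n f i)) (act f (\<phi> i))}"
          let ?t = "\<lambda>i. (\<rho> (\<phi> (\<sigma> n f i)) (act f (\<phi> i)))\<^sup>2"
          have "rho_2 \<rho> (D n) (\<lambda>i. \<phi> (\<sigma> n f i)) (\<lambda>i. act f (\<phi> i)) < \<delta>"
            using S(2) \<phi> f by (auto simp: sofic_Map_def)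
          then have "sqrt ((\<Sum>i\<in>D n. ?t i) / ?d) <= \<delta>" by (simp add: rho_2_def)
          then have "(\<Sum>i\<in>D n. ?t i) / ?d <= \<delta>\<^sup>2" by (rule sqrt_le_D)
          then have s: "(\<Sum>i\<in>D n. ?t i) <= \<delta>\<^sup>2 * ?d" using dpos by (simp add: field_simps)
          have "real (card ?B) * (\<eta> / 2)\<^sup>2 = (\<Sum>i\<in>?B. (\<eta> / 2)\<^sup>2)" by simp
          also have "... <= (\<Sum>i\<in>?B. ?t i)" using F0(3) by (intro sum_mono power_mono) auto
          also have "... <= (\<Sum>i\<in>D n. ?t i)" using fin_D by (intro sum_mono2) auto
          also have "... <= (\<eta> / 2)\<^sup>2 * (e1 * ?d)" using s by (simp add: \<delta>2 mult.assoc)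
          finally have "(\<eta> / 2)\<^sup>2 * real (card ?B) <= (\<eta> / 2)\<^sup>2 * (e1 * ?d)" by (simp only: mult.commute)
          moreover have "0 < (\<eta> / 2)\<^sup>2" using F0(3) by simp
          ultimately show ?thesis by (rule mult_left_le_imp_le)
        qed
        have un: "D n - near \<phi> = (\<Union>f\<in>F. {i \<in> D n. \<eta> / 2 <= \<rho> (\<phi> (\<sigma> n f i)) (act f (\<phi> i))})"
        proof (rule Set.set_eqI)
          fix i
          show "i \<in> D n - near \<phi> \<longleftrightarrow> i \<in> (\<Union>f\<in>F. {i \<in> D n. \<eta> / 2 <= \<rho> (\<phi> (\<sigma> n f i)) (act f (\<phi> i))})"
            unfolding near_def by (simp add: not_less) blast
        qed
        have "card (D n - near \<phi>) <= (\<Sum>f\<in>F. card {i \<in> D n. \<eta> / 2 <= \<rho> (\<phi> (\<sigma> n f i)) (act f (\<phi> i))})"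
          unfolding un by (rule card_UN_le[OF F(1)])
        then have "real (card (D n - near \<phi>)) <= (\<Sum>f\<in>F. real (card {i \<in> D n. \<eta> / 2 <= \<rho> (\<phi> (\<sigma> n f i)) (act f (\<phi> i))}))"
          by (simp only: of_nat_sum[symmetric] of_nat_le_iff)
        also have "... <= (\<Sum>f\<in>F. e1 * ?d)" by (intro sum_mono one)
        finally show ?thesis by simp
      qed
      define Bad where "Bad \<phi> = (D n - M) \<union> (D n - near \<phi>) \<union> {i \<in> D n. \<exists>f\<in>\<Gamma>. \<sigma> n f i \<notin> near \<phi>}" for \<phi>
      have BadD: "Bad \<phi> \<subseteq> D n" for \<phi> by (auto simp: Bad_def)
      have cBad: "real (card (Bad \<phi>)) <= e * ?d" if \<phi>: "\<phi> \<in> S" for \<phi>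
      proof -
        have "card (Bad \<phi>) <= card (D n - M) + card (D n - near \<phi>) + card {i \<in> D n. \<exists>f\<in>\<Gamma>. \<sigma> n f i \<notin> near \<phi>}"
          unfolding Bad_def by (intro order_trans[OF card_Un_le] add_right_mono card_Un_le)
        also have "... <= card (D n - M) + card (D n - near \<phi>) + card \<Gamma> * card (D n - near \<phi>)"
          using card_translated_bad_le[OF \<Gamma>(1,2) nearD] by (intro add_left_mono)
        finally have "real (card (Bad \<phi>)) <= real (card (D n - M) + card (D n - near \<phi>) + card \<Gamma> * card (D n - near \<phi>))"
          by (rule of_nat_mono)
        also have "... = real (card (D n - M)) + real (card \<Gamma> + 1) * real (card (D n - near \<phi>))"
          by (simp add: algebra_simps)
        also have "... <= e1 * ?d + real (card \<Gamma> + 1) * (real (card F) * (e1 * ?d))"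
          using elim(1) near[OF \<phi>] by (intro add_mono mult_left_mono) (auto simp: M_def)
        also have "... = (1 + real (card \<Gamma> + 1) * real (card F)) * (e1 * ?d)" by (simp add: algebra_simps)
        also have "... <= (2 * m) * (e1 * ?d)"
          using e1 by (intro mult_right_mono) (auto simp: m_def)
        also have "... = e * ?d" using m by (simp add: e1_def)
        finally show ?thesis .
      qed
      have decode: "\<phi> i (cd f v) = \<phi> (\<sigma> n f i) (cd \<one> v)" if \<phi>: "\<phi> \<in> S" and i: "i \<in> D n - Bad \<phi>" and f: "f \<in> \<Gamma>" and v: "v \<in> V" for \<phi> i f v
      proof -
        have iD: "i \<in> D n" and iM: "i \<in> M" and in1: "i \<in> near \<phi>" and in2: "\<sigma> n f i \<in> near \<phi>"
          using i f by (auto simp: Bad_def)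
        have fG: "f \<in> carrier G" using f \<Gamma>(2) by auto
        have jD: "\<sigma> n f i \<in> D n" by (rule \<sigma>_in[OF fG iD])
        have X: "act f (\<phi> i) \<in> X" "\<phi> (\<sigma> n f i) \<in> X"
          using act_in[OF fG] SX[OF \<phi>] iD jD by auto
        have "agree {\<one>} (act f (\<phi> i)) (\<phi> (\<sigma> n f i))"
        proof (rule ccontr)
          assume "\<not> agree {\<one>} (act f (\<phi> i)) (\<phi> (\<sigma> n f i))"
          then obtain g where g: "g \<in> F0" "\<eta> <= \<rho> (act g (act f (\<phi> i))) (act g (\<phi> (\<sigma> n f i)))"
            using F0(4)[OF X] by blast
          have gG: "g \<in> carrier G" and gF: "g \<in> F" using g(1) F0(2) by (auto simp: F_def)
          have gfF: "g \<otimes> f \<in> F" unfolding F_def using g(1) f by force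
          define a b c where "a = act g (act f (\<phi> i))" and "b = \<phi> (\<sigma> n (g \<otimes> f) i)" and "c = act g (\<phi> (\<sigma> n f i))"
          have aX: "a \<in> X" unfolding a_def by (rule act_in[OF gG X(1)])
          have cX: "c \<in> X" unfolding c_def by (rule act_in[OF gG X(2)])
          have bX: "b \<in> X" unfolding b_def by (rule SX[OF \<phi> \<sigma>_in[OF m_closed[OF gG fG] iD]])
          have "\<rho> b a < \<eta> / 2"
            using in1 gfF act_act[OF gG fG SX[OF \<phi> iD]] by (auto simp: near_def a_def b_def)
          moreover have "\<rho> b c < \<eta> / 2"
          proof -
            have "\<sigma> n g (\<sigma> n f i) = \<sigma> n (g \<otimes> f) i"
              using iM g(1) f by (auto simp: M_def mult_good_def P_def)
            moreover have "\<rho> (\<phi> (\<sigma> n g (\<sigma> n f i))) (act g (\<phi> (\<sigma> n f i))) < \<eta> / 2"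
              using in2 gF by (auto simp: near_def)
            ultimately show ?thesis by (simp add: b_def c_def)
          qed
          moreover have "\<rho> a c <= \<rho> a b + \<rho> b c" by (rule \<rho>_props(4)[OF aX bX cX])
          moreover have "\<rho> a b = \<rho> b a" by (rule \<rho>_props(2)[OF aX bX])
          ultimately show False using g(2) unfolding a_def[symmetric] c_def[symmetric] by linarith
        qed
        then have "act f (\<phi> i) (cd \<one> v) = \<phi> (\<sigma> n f i) (cd \<one> v)" using v by (simp add: agree_def)
        then show ?thesis using act_coord[OF one_closed fG v SX[OF \<phi> iD]] fG by simp
      qed
      define code1 where "code1 \<phi> = (\<lambda>(i, v)\<in>D n \<times> V. \<phi> i (cd \<one> v))" for \<phi> :: "'d => 'a => 'k"
      define code2 where "code2 \<phi> = (\<lambda>i\<in>D n. if i \<in> Bad \<phi> then Some (\<lambda>(g, v)\<in>\<Gamma> \<times> V. \<phi> i (cd g v)) else None)" for \<phi> :: "'d => 'a => 'k"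
      define Q where "Q = {q \<in> D n \<rightarrow>\<^sub>E insert None (Some ` Pt). real (card {i\<in>D n. q i ~= None}) <= e * ?d}"
      have finQ: "finite Q"
        unfolding Q_def using fin_D finPt by (intro finite_subset[OF _ finite_PiE[of "D n" "\<lambda>_. insert None (Some ` Pt)"]]) auto
      have inj: "inj_on (\<lambda>\<phi>. (code1 \<phi>, code2 \<phi>)) S"
      proof (rule inj_onI, rule ccontr)
        fix \<phi> \<psi> assume \<phi>: "\<phi> \<in> S" and \<psi>: "\<psi> \<in> S" and eq: "(code1 \<phi>, code2 \<phi>) = (code1 \<psi>, code2 \<psi>)" and ne: "\<phi> ~= \<psi>"
        have q1: "code1 \<phi> = code1 \<psi>" and q2: "code2 \<phi> = code2 \<psi>" using eq by simp_all
        have c1: "\<phi> i (cd \<one> v) = \<psi> i (cd \<one> v)" if "i \<in> D n" "v \<in> V" for i v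
          using fun_cong[OF q1, of "(i, v)"] that by (simp add: code1_def)
        have c2: "(if i \<in> Bad \<phi> then Some (\<lambda>(g, v)\<in>\<Gamma> \<times> V. \<phi> i (cd g v)) else None)
            = (if i \<in> Bad \<psi> then Some (\<lambda>(g, v)\<in>\<Gamma> \<times> V. \<psi> i (cd g v)) else None)" if "i \<in> D n" for i
          using fun_cong[OF q2, of i] that by (simp add: code2_def)
        have "\<rho> (\<phi> i) (\<psi> i) < \<kappa>" if i: "i \<in> D n" for i
        proof (rule \<Gamma>(3)[OF SX[OF \<phi> i] SX[OF \<psi> i]])
          show "agree \<Gamma> (\<phi> i) (\<psi> i)"
            unfolding agree_def
          proof (intro ballI)
            fix g v assume g: "g \<in> \<Gamma>" and v: "v \<in> V"
            have gG: "g \<in> carrier G" using g \<Gamma>(2) by auto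
            show "\<phi> i (cd g v) = \<psi> i (cd g v)"
            proof (cases "i \<in> Bad \<phi>")
              case True
              then have "i \<in> Bad \<psi>" and r: "(\<lambda>(g, v)\<in>\<Gamma> \<times> V. \<phi> i (cd g v)) = (\<lambda>(g, v)\<in>\<Gamma> \<times> V. \<psi> i (cd g v))"
                using c2[OF i] by (auto split: if_splits)
              show ?thesis using fun_cong[OF r, of "(g, v)"] g v by simp
            next
              case False
              then have "i \<notin> Bad \<psi>" using c2[OF i] by (auto split: if_splits)
              then show ?thesis
                using False decode[OF \<phi> _ g v, of i] decode[OF \<psi> _ g v, of i] c1[OF \<sigma>_in[OF gG i] v] i by simp
            qed
          qed
        qed
        then have "rho_inf \<rho> (D n) \<phi> \<psi> < \<kappa>"
          unfolding rho_inf_def using fin_D elim(2) by (subst Max_less_iff) auto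
        then show False using sep \<phi> \<psi> ne by fastforce
      qed
      have "(\<lambda>\<phi>. (code1 \<phi>, code2 \<phi>)) ` S \<subseteq> (D n \<times> V \<rightarrow>\<^sub>E UNIV) \<times> Q"
      proof
        fix c assume "c \<in> (\<lambda>\<phi>. (code1 \<phi>, code2 \<phi>)) ` S"
        then obtain \<phi> where \<phi>: "\<phi> \<in> S" "c = (code1 \<phi>, code2 \<phi>)" by auto
        have "{i \<in> D n. code2 \<phi> i ~= None} = Bad \<phi>" using BadD by (auto simp: code2_def)
        then have "code2 \<phi> \<in> Q" using cBad[OF \<phi>(1)] by (auto simp: Q_def code2_def Pt_def)
        moreover have "code1 \<phi> \<in> D n \<times> V \<rightarrow>\<^sub>E UNIV" by (auto simp: code1_def)
        ultimately show "c \<in> (D n \<times> V \<rightarrow>\<^sub>E UNIV) \<times> Q" using \<phi>(2) by simp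
      qed
      then have "card S <= card ((D n \<times> V \<rightarrow>\<^sub>E (UNIV :: 'k set)) \<times> Q)"
        using inj finQ fin_D finV by (intro card_inj_on_le[OF inj]) (auto intro!: finite_PiE)
      also have "... = CARD('k) ^ (card (D n) * card V) * card Q"
        using fin_D finV by (simp add: card_cartesian_product card_PiE)
      finally have "real (card S) <= real (CARD('k) ^ (card (D n) * card V) * card Q)" by (rule of_nat_mono)
      also have "... = exp (card V * ln CARD('k) * ?d) * real (card Q)"
      proof -
        have "0 < CARD('k)" by simp
        then have "real (CARD('k)) ^ (card (D n) * card V) = exp (real (card (D n) * card V) * ln CARD('k))"
          by (subst exp_of_nat_mult) simp
        then show ?thesis by (simp add: mult_ac)
      qed
      also have "... <= exp (card V * ln CARD('k) * ?d) * exp (\<theta> * ?d)"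
      proof (intro mult_left_mono)
        have "real (card Q) <= t powr (- (e * ?d)) * (1 + t * card Pt) ^ card (D n)"
          unfolding Q_def by (rule card_sparse_labellings[OF fin_D finPt t(1,2)])
        also have "... <= exp (\<theta> / 2 * ?d) * exp (\<theta> / 2 * ?d)"
        proof (intro mult_mono)
          have "t powr (- (e * ?d)) = exp (e * ln (1 / t) * ?d)"
            using t(1) by (simp add: powr_def ln_div mult_ac)
          also have "e * ln (1 / t) <= e * L" using e by (simp add: L_def)
          also have "e * L = \<theta> / 2" using L by (simp add: e_def)
          finally show "t powr (- (e * ?d)) <= exp (\<theta> / 2 * ?d)" by (simp add: mult_right_mono)
          have "(1 + t * card Pt) ^ card (D n) <= exp (t * card Pt) ^ card (D n)"
            using t(1) by (intro power_mono) auto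
          also have "... = exp (t * np * ?d)" by (simp add: np_def exp_of_nat_mult[symmetric] mult_ac)
          also have "... <= exp (\<theta> / 2 * ?d)" using mult_right_mono[OF t(3), of ?d] by simp
          finally show "(1 + t * card Pt) ^ card (D n) <= exp (\<theta> / 2 * ?d)" .
        qed (use t in auto)
        also have "... = exp (\<theta> * ?d)" by (simp flip: exp_add)
        finally show "real (card Q) <= exp (\<theta> * ?d)" .
      qed simp
      also have "... = exp ((card V * ln CARD('k) + \<theta>) * ?d)" by (simp add: distrib_right flip: exp_add)
      finally show "real (card S) <= exp ((card V * ln CARD('k) + \<theta>) * ?d)" .
    qed
  qed
  then show ?thesis using \<delta> F by (intro exI[of _ \<delta>] conjI exI[of _ F])
qed

theorem entropy_le:
  "top_sofic_entropy G D \<sigma> XT act <= ereal (card V * ln CARD('k))"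
proof -
  define c where "c = card V * ln CARD('k)"
  define \<rho> where "\<rho> = (SOME \<rho>. generating_pseudometric G XT act \<rho>)"
  have \<rho>: "generating_pseudometric G XT act \<rho>"
    unfolding \<rho>_def by (rule someI_ex[OF generating_pseudometric_ex])
  let ?sep = "\<lambda>\<kappa> F \<delta> n. separation_number \<kappa> (rho_inf \<rho> (D n)) (sofic_Map XT act \<rho> F \<delta> (D n) (\<sigma> n))"
  have "sofic_entropy_wrt \<rho> G D \<sigma> XT act <= ereal c"
    unfolding sofic_entropy_wrt_def
  proof (rule SUP_least)
    fix \<kappa> :: real assume "\<kappa> \<in> {0<..}"
    then have \<kappa>: "0 < \<kappa>" by simp
    show "(INF \<delta>\<in>{0<..}. INF F\<in>{F. finite F \<and> F \<subseteq> carrier G}.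
        limsup (\<lambda>n. log_enat (?sep \<kappa> F \<delta> n) / ereal (real (card (D n))))) <= ereal c"
    proof (rule ereal_le_epsilon2)
      fix \<theta> :: real assume \<theta>: "0 < \<theta>"
      obtain \<delta> F where \<delta>: "0 < \<delta>" and F: "finite F" "F \<subseteq> carrier G" and ev: "eventually (\<lambda>n. 0 < card (D n) \<and>
        (\<forall>S. finite S --> S \<subseteq> sofic_Map XT act \<rho> F \<delta> (D n) (\<sigma> n) -->
          (\<forall>x\<in>S. \<forall>y\<in>S. x ~= y --> \<kappa> <= rho_inf \<rho> (D n) x y) -->
          real (card S) <= exp ((c + \<theta>) * real (card (D n))))) sequentially"
        using separation_number_bound[OF \<rho> \<kappa> \<theta>, folded c_def] by (elim exE conjE)
      have "eventually (\<lambda>n. log_enat (?sep \<kappa> F \<delta> n) / ereal (real (card (D n))) <= ereal (c + \<theta>)) sequentially"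
        using ev
      proof eventually_elim
        case (elim n)
        let ?N = "nat \<lfloor>exp ((c + \<theta>) * real (card (D n)))\<rfloor>"
        have c0: "0 <= c" by (simp add: c_def)
        have ge1: "1 <= exp ((c + \<theta>) * real (card (D n)))" using c0 \<theta> by simp
        then have N: "0 < ?N" by linarith
        have "?sep \<kappa> F \<delta> n <= enat ?N"
        proof (rule separation_number_le)
          fix S assume "finite S" "S \<subseteq> sofic_Map XT act \<rho> F \<delta> (D n) (\<sigma> n)"
            "\<And>x y. x \<in> S ==> y \<in> S ==> x ~= y ==> \<kappa> <= rho_inf \<rho> (D n) x y"
          then have "real (card S) <= exp ((c + \<theta>) * real (card (D n)))" using elim by simp
          then show "card S <= ?N" by (simp add: le_nat_floor)
        qed
        from log_enat_le[OF this N]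
        have "log_enat (?sep \<kappa> F \<delta> n) <= ereal (ln (real ?N))" .
        also have "ln (real ?N) <= ln (exp ((c + \<theta>) * real (card (D n))))"
          using N by (subst ln_le_cancel_iff) (auto intro: of_nat_floor)
        finally have "log_enat (?sep \<kappa> F \<delta> n) <= ereal ((c + \<theta>) * real (card (D n)))" by simp
        then have "log_enat (?sep \<kappa> F \<delta> n) / ereal (real (card (D n))) <= ereal ((c + \<theta>) * real (card (D n))) / ereal (real (card (D n)))"
          using elim by (intro ereal_divide_right_mono) auto
        also have "... = ereal (c + \<theta>)" using elim by simp
        finally show ?case .
      qed
      then have "limsup (\<lambda>n. log_enat (?sep \<kappa> F \<delta> n) / ereal (real (card (D n)))) <= ereal (c + \<theta>)"
        by (rule Limsup_bounded)
      then have "(INF F\<in>{F. finite F \<and> F \<subseteq> carrier G}. limsup (\<lambda>n. log_enat (?sep \<kappa> F \<delta> n) / ereal (real (card (D n))))) <= ereal (c + \<theta>)"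
        using F by (intro INF_lower2[of F]) auto
      then have "(INF \<delta>\<in>{0<..}. INF F\<in>{F. finite F \<and> F \<subseteq> carrier G}.
        limsup (\<lambda>n. log_enat (?sep \<kappa> F \<delta> n) / ereal (real (card (D n))))) <= ereal (c + \<theta>)"
        using \<delta> by (intro INF_lower2[of \<delta>]) auto
      then show "(INF \<delta>\<in>{0<..}. INF F\<in>{F. finite F \<and> F \<subseteq> carrier G}.
        limsup (\<lambda>n. log_enat (?sep \<kappa> F \<delta> n) / ereal (real (card (D n))))) <= ereal c + ereal \<theta>" by simp
    qed
  qed
  then show ?thesis unfolding top_sofic_entropy_def \<rho>_def c_def .
qed

end

section \<open>Simplicial cochains in coordinates\<close>

definition face :: "nat => 'v list => 'v list" where
  "face j xs = take j xs @ drop (Suc j) xs"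

lemma length_face: "j < length xs ==> length (face j xs) = length xs - 1"
  by (auto simp: face_def)

lemma nth_face: "j < length xs ==> k < length xs - 1 ==> face j xs ! k = xs ! (if k < j then k else Suc k)"
  by (auto simp: face_def nth_append min_def)

lemma face_map: "face j (map f xs) = map f (face j xs)"
  by (simp add: face_def take_map drop_map)

lemma face_ordered_simplices:
  assumes "abstract_simplicial_complex L" "xs \<in> ordered_simplices L (Suc q)" "j <= Suc q"
  shows "face j xs \<in> ordered_simplices L q"
proof -
  have len: "length xs = Suc (Suc q)" "distinct xs" "set xs \<in> L"
    using assms(2) by (auto simp: ordered_simplices_def)
  have "length (face j xs) = Suc q" using len assms(3) by (simp add: length_face)
  moreover have "distinct (face j xs)"
    using len(2) by (simp add: face_def set_take_disj_set_drop_if_distinct)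
  moreover have "set (face j xs) \<subseteq> set xs" by (auto simp: face_def dest: in_set_takeD in_set_dropD)
  moreover have "set (face j xs) ~= {}" using calculation(1) by (cases "face j xs") auto
  moreover have "\<And>t. t \<subseteq> set xs ==> t ~= {} ==> t \<in> L"
    using assms(1) len(3) unfolding abstract_simplicial_complex_def by blast
  ultimately show ?thesis unfolding ordered_simplices_def by blast
qed

lemma coboundary_face:
  "coboundary L q f xs = (if xs \<in> ordered_simplices L q then \<Sum>j\<le>q. (-1) ^ j * f (face j xs) else 0)"
  by (simp add: coboundary_def face_def)

lemma permute_ordered_simplices:
  assumes "xs \<in> ordered_simplices L q" "\<pi> permutes {..<length xs}"
  shows "permute_list \<pi> xs \<in> ordered_simplices L q"
  using assms unfolding ordered_simplices_def by (simp add: set_permute_list distinct_permute_list)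

lemma cochainsD:
  assumes "f \<in> cochains L q"
  shows "xs \<notin> ordered_simplices L q ==> f xs = 0"
    and "xs \<in> ordered_simplices L q ==> \<pi> permutes {..<length xs} ==> f (permute_list \<pi> xs) = of_int (sign \<pi>) * f xs"
  using assms by (auto simp: cochains_def)

text \<open>Adjacent transpositions generate the symmetric group.\<close>

lemma alternating_of_adjacent:
  fixes F :: "'v list => 'k::comm_ring_1"
  assumes adj: "\<And>xs i. xs \<in> ordered_simplices L q ==> Suc i <= q ==>
      F (permute_list (Transposition.transpose i (Suc i)) xs) = - F xs"
    and \<pi>: "\<pi> permutes {..q}" and xs: "xs \<in> ordered_simplices L q"
  shows "F (permute_list \<pi> xs) = of_int (sign \<pi>) * F xs"
proof -
  define Q where "Q p \<longleftrightarrow> p permutes {..q} \<and> (\<forall>xs\<in>ordered_simplices L q. F (permute_list p xs) = of_int (sign p) * F xs)" for p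
  have len: "length xs = Suc q" if "xs \<in> ordered_simplices L q" for xs
    using that by (simp add: ordered_simplices_def)
  have set: "{..q} = {..<length xs}" if "xs \<in> ordered_simplices L q" for xs
    using len[OF that] by auto
  have Q_id: "Q id" by (simp add: Q_def permutes_id sign_id)
  have Q_comp: "Q (p \<circ> p')" if p: "Q p" and p': "Q p'" for p p'
    unfolding Q_def
  proof (intro conjI ballI)
    show pp: "p \<circ> p' permutes {..q}" using p p' by (simp add: Q_def permutes_compose)
    fix xs assume xs: "xs \<in> ordered_simplices L q"
    have P: "p permutes {..<length xs}" and P': "p' permutes {..<length xs}" using p p' set[OF xs] by (simp_all add: Q_def)
    have "permute_list (p \<circ> p') xs = permute_list p' (permute_list p xs)"
      by (rule permute_list_compose[OF P'])
    then have "F (permute_list (p \<circ> p') xs) = of_int (sign p') * (of_int (sign p) * F xs)"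
      using p p' permute_ordered_simplices[OF xs P] xs by (simp add: Q_def)
    moreover have "sign (p \<circ> p') = sign p * sign p'"
      using P P' by (intro sign_compose) (auto simp: permutation_permutes)
    ultimately show "F (permute_list (p \<circ> p') xs) = of_int (sign (p \<circ> p')) * F xs" by (simp add: mult_ac)
  qed
  have Q_adj: "Q (Transposition.transpose i (Suc i))" if "Suc i <= q" for i
    unfolding Q_def
  proof (intro conjI ballI)
    show "Transposition.transpose i (Suc i) permutes {..q}" using that by (intro permutes_swap_id) auto
    fix xs assume "xs \<in> ordered_simplices L q"
    then show "F (permute_list (Transposition.transpose i (Suc i)) xs) = of_int (sign (Transposition.transpose i (Suc i))) * F xs"
      using adj that by (simp add: sign_swap_id)
  qed
  have Q_swap: "Q (Transposition.transpose a (a + d))" if "a + d <= q" for a d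
    using that
  proof (induction d)
    case 0
    then show ?case using Q_id by (simp add: id_def)
  next
    case (Suc d)
    show ?case
    proof (cases "d = 0")
      case True
      then show ?thesis using Q_adj[of a] Suc.prems by simp
    next
      case False
      let ?t = "Transposition.transpose (a + d) (Suc (a + d))"
      have "Transposition.transpose a (a + Suc d) = ?t \<circ> Transposition.transpose a (a + d) \<circ> ?t"
        using False by (auto simp: fun_eq_iff Transposition.transpose_def)
      moreover have "Q (?t \<circ> Transposition.transpose a (a + d) \<circ> ?t)"
        using Suc Q_adj[of "a + d"] by (intro Q_comp) auto
      ultimately show ?thesis by (simp only:)
    qed
  qed
  have Q_transp: "Q (Transposition.transpose a b)" if "a <= q" "b <= q" for a b
  proof (cases "a <= b")
    case True
    then show ?thesis using Q_swap[of a "b - a"] that by simp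
  next
    case False
    then show ?thesis using Q_swap[of b "a - b"] that by (simp add: transpose_commute)
  qed
  have "Q \<pi>"
    using \<pi> finite_atMost[of q]
  proof (induction rule: permutes_induct)
    show "Q id" by (rule Q_id)
    fix a b p assume "a \<in> {..q}" "b \<in> {..q}" "Q p"
    then show "Q (Transposition.transpose a b \<circ> p)" using Q_transp by (intro Q_comp) auto
  qed
  then show ?thesis using xs by (simp add: Q_def)
qed

lemma coboundary_in_cochains:
  fixes f :: "'v list => 'k::comm_ring_1"
  assumes L: "abstract_simplicial_complex L" and f: "f \<in> cochains L q"
  shows "coboundary L (Suc q) f \<in> cochains L (Suc q)"
proof -
  have adj: "coboundary L (Suc q) f (permute_list (Transposition.transpose i (Suc i)) xs) = - coboundary L (Suc q) f xs"
    if xs: "xs \<in> ordered_simplices L (Suc q)" and i: "Suc i <= Suc q" for xs i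
  proof -
    let ?\<tau> = "Transposition.transpose i (Suc i)"
    define ys where "ys = permute_list ?\<tau> xs"
    have len: "length xs = Suc (Suc q)" using xs by (simp add: ordered_simplices_def)
    have \<tau>: "?\<tau> permutes {..<length xs}" using i len by (intro permutes_swap_id) auto
    have ysS: "ys \<in> ordered_simplices L (Suc q)" unfolding ys_def by (rule permute_ordered_simplices[OF xs \<tau>])
    have leny: "length ys = Suc (Suc q)" by (simp add: ys_def len)
    have ynth: "ys ! k = xs ! ?\<tau> k" if "k < Suc (Suc q)" for k
      using permute_list_nth[OF \<tau>, of k] that len by (simp add: ys_def)
    have key: "(-1) ^ ?\<tau> j * f (face (?\<tau> j) ys) = - ((-1) ^ j * f (face j xs))" if j: "j <= Suc q" for j
    proof (cases "j = i \<or> j = Suc i")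
      case True
      have "?\<tau> j <= Suc q" using True i by (auto simp: Transposition.transpose_def)
      have "face (?\<tau> j) ys = face j xs"
      proof (rule nth_equalityI)
        show "length (face (?\<tau> j) ys) = length (face j xs)" using \<open>?\<tau> j <= Suc q\<close> j by (simp add: length_face len leny)
        fix k assume "k < length (face (?\<tau> j) ys)"
        then have k: "k < Suc q" using \<open>?\<tau> j <= Suc q\<close> by (simp add: length_face leny)
        show "face (?\<tau> j) ys ! k = face j xs ! k"
          using \<open>?\<tau> j <= Suc q\<close> j k True ynth[of k] ynth[of "Suc k"]
          by (auto simp: nth_face len leny Transposition.transpose_def)
      qed
      moreover have "(-1) ^ ?\<tau> j = - ((-1) ^ j :: 'k)" using True by auto
      ultimately show ?thesis by simp
    next
      case False
      then have \<tau>j: "?\<tau> j = j" by (auto simp: Transposition.transpose_def)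
      define i' where "i' = (if j < i then i - 1 else i)"
      have i': "Suc i' <= q" using False i j by (auto simp: i'_def)
      let ?\<tau>' = "Transposition.transpose i' (Suc i')"
      have fS: "face j xs \<in> ordered_simplices L q" by (rule face_ordered_simplices[OF L xs j])
      have lf: "length (face j xs) = Suc q" using j by (simp add: length_face len)
      have \<tau>': "?\<tau>' permutes {..<length (face j xs)}" using i' lf by (intro permutes_swap_id) auto
      have "face j ys = permute_list ?\<tau>' (face j xs)"
      proof (rule nth_equalityI)
        show "length (face j ys) = length (permute_list ?\<tau>' (face j xs))" using j by (simp add: length_face len leny)
        fix k assume "k < length (face j ys)"
        then have k: "k < Suc q" using j by (simp add: length_face leny)
        have "?\<tau>' k < Suc q" using k i' by (auto simp: Transposition.transpose_def)
        have "permute_list ?\<tau>' (face j xs) ! k = face j xs ! ?\<tau>' k"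
          using k lf by (intro permute_list_nth[OF \<tau>']) simp
        also have "... = xs ! (if ?\<tau>' k < j then ?\<tau>' k else Suc (?\<tau>' k))"
          using j \<open>?\<tau>' k < Suc q\<close> by (simp add: nth_face len)
        also have "(if ?\<tau>' k < j then ?\<tau>' k else Suc (?\<tau>' k)) = ?\<tau> (if k < j then k else Suc k)"
          using False by (auto simp: Transposition.transpose_def i'_def split: if_splits)
        also have "xs ! ... = face j ys ! k" using j k by (simp add: nth_face leny ynth)
        finally show "face j ys ! k = permute_list ?\<tau>' (face j xs) ! k" by simp
      qed
      then have "f (face j ys) = - f (face j xs)"
        using cochainsD(2)[OF f fS \<tau>'] by (simp add: sign_swap_id)
      then show ?thesis by (simp add: \<tau>j)
    qed
    have "coboundary L (Suc q) f ys = (\<Sum>j\<le>Suc q. (-1) ^ j * f (face j ys))"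
      using ysS by (simp only: coboundary_face if_True)
    also have "... = (\<Sum>j\<le>Suc q. (-1) ^ ?\<tau> j * f (face (?\<tau> j) ys))"
    proof -
      have "?\<tau> permutes {..Suc q}" using i by (intro permutes_swap_id) auto
      from sum.permute[OF this, of "\<lambda>j. (-1) ^ j * f (face j ys)"] show ?thesis by (simp add: o_def)
    qed
    also have "... = (\<Sum>j\<le>Suc q. - ((-1) ^ j * f (face j xs)))"
      by (intro sum.cong refl key) simp
    also have "... = - coboundary L (Suc q) f xs"
      using xs by (simp only: coboundary_face if_True sum_negf)
    finally show ?thesis by (simp add: ys_def)
  qed
  show ?thesis
    unfolding cochains_def
  proof (intro CollectI conjI allI impI ballI)
    fix xs \<pi> assume xs: "xs \<in> ordered_simplices L (Suc q)" and \<pi>: "\<pi> permutes {..<length xs}"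
    have "{..<length xs} = {..Suc q}" using xs by (auto simp: ordered_simplices_def)
    then show "coboundary L (Suc q) f (permute_list \<pi> xs) = of_int (sign \<pi>) * coboundary L (Suc q) f xs"
      using adj \<pi> xs by (intro alternating_of_adjacent[of L "Suc q"]) auto
  qed (simp add: coboundary_face)
qed

lemma face_face:
  assumes "i < j" "j < length xs" "2 <= length xs"
  shows "face i (face j xs) = face (j - 1) (face i xs)"
proof (rule nth_equalityI)
  show "length (face i (face j xs)) = length (face (j - 1) (face i xs))"
    using assms by (simp add: length_face)
  fix k assume "k < length (face i (face j xs))"
  then have k: "k < length xs - 2" using assms by (simp add: length_face)
  show "face i (face j xs) ! k = face (j - 1) (face i xs) ! k"
    using assms k by (auto simp: nth_face length_face)
qed

lemma coboundary_coboundary: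
  fixes f :: "'v list => 'k::comm_ring_1"
  assumes L: "abstract_simplicial_complex L"
  shows "coboundary L (Suc (Suc q)) (coboundary L (Suc q) f) = (\<lambda>xs. 0)"
proof
  fix xs
  show "coboundary L (Suc (Suc q)) (coboundary L (Suc q) f) xs = 0"
  proof (cases "xs \<in> ordered_simplices L (Suc (Suc q))")
    case True
    have len: "length xs = Suc (Suc (Suc q))" using True by (simp add: ordered_simplices_def)
    define N where "N = Suc (Suc q)"
    define g where "g = (\<lambda>(j, i). (-1) ^ (i + j) * f (face i (face j xs)))"
    define A where "A = {(j, i). i < j \<and> j <= N}"
    define B where "B = {(j, i). j <= i \<and> i < N}"
    have fin: "finite A" "finite B"
      by (rule finite_subset[of _ "{..N} \<times> {..N}"]; auto simp: A_def B_def)+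
    have "coboundary L (Suc (Suc q)) (coboundary L (Suc q) f) xs = (\<Sum>j\<le>N. (-1) ^ j * coboundary L (Suc q) f (face j xs))"
      using True by (simp only: coboundary_face[of L "Suc (Suc q)"] if_True N_def)
    also have "... = (\<Sum>j\<le>N. \<Sum>i<N. g (j, i))"
    proof (intro sum.cong refl)
      fix j assume "j \<in> {..N}"
      then have "face j xs \<in> ordered_simplices L (Suc q)" by (intro face_ordered_simplices[OF L True]) (simp add: N_def)
      then have "(-1) ^ j * coboundary L (Suc q) f (face j xs) = (\<Sum>i\<le>Suc q. (-1) ^ j * ((-1) ^ i * f (face i (face j xs))))"
        by (simp only: coboundary_face if_True sum_distrib_left)
      also have "{..Suc q} = {..<N}" by (auto simp: N_def)
      finally show "(-1) ^ j * coboundary L (Suc q) f (face j xs) = (\<Sum>i<N. g (j, i))"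
        by (simp add: g_def power_add mult_ac)
    qed
    also have "... = sum g ({..N} \<times> {..<N})" by (simp add: sum.cartesian_product)
    also have "{..N} \<times> {..<N} = A \<union> B" by (auto simp: A_def B_def)
    also have "sum g (A \<union> B) = sum g A + sum g B"
      by (rule sum.union_disjoint[OF fin]) (auto simp: A_def B_def)
    also have "sum g A = sum (\<lambda>x. - g x) B"
    proof (rule sum.reindex_bij_witness[where i = "\<lambda>(j, i). (Suc i, j)" and j = "\<lambda>(j, i). (i, j - 1)"])
      fix a assume a: "a \<in> A"
      obtain j i where ji: "a = (j, i)" "i < j" "j <= N" using a by (auto simp: A_def)
      show "(case case a of (j, i) => (i, j - 1) of (j, i) => (Suc i, j)) = a" using ji by simp
      show "(case a of (j, i) => (i, j - 1)) \<in> B" using ji by (auto simp: B_def)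
      have e: "face i (face j xs) = face (j - 1) (face i xs)" using ji len by (intro face_face) (auto simp: N_def)
      have "(-1) ^ (i + j) = - ((-1) ^ (j - 1 + i) :: 'k)"
        using ji(2) by (cases j) (auto simp: add.commute)
      then show "- g (case a of (j, i) => (i, j - 1)) = g a" using e ji(1) by (simp add: g_def)
    next
      fix b assume b: "b \<in> B"
      then show "(case case b of (j, i) => (Suc i, j) of (j, i) => (i, j - 1)) = b"
        "(case b of (j, i) => (Suc i, j)) \<in> A" by (auto simp: A_def B_def)
    qed
    finally show ?thesis by (simp add: sum_negf)
  qed (simp add: coboundary_face)
qed

lemma closedin_finitely_refuted:
  fixes X :: "('a => 'k) set"
  assumes "\<And>f. f \<notin> X ==> \<exists>A. finite A \<and> (\<forall>f'. (\<forall>a\<in>A. f a = f' a) --> f' \<notin> X)"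
  shows "closedin discrete_product X"
proof -
  have "openin discrete_product (UNIV - X)"
  proof (subst openin_subopen, intro ballI)
    fix f assume "f \<in> UNIV - X"
    then obtain A where A: "finite A" "\<forall>f'. (\<forall>a\<in>A. f a = f' a) --> f' \<notin> X" using assms by blast
    have "openin discrete_product {f'. \<forall>a\<in>A. f a = f' a}"
      by (rule openin_finitely_determined[OF A(1)]) auto
    then show "\<exists>T. openin discrete_product T \<and> f \<in> T \<and> T \<subseteq> UNIV - X"
      using A(2) by (intro exI[of _ "{f'. \<forall>a\<in>A. f a = f' a}"]) auto
  qed
  then show ?thesis by (simp add: closedin_def)
qed

lemma closedin_cochains: "closedin discrete_product (cochains L q :: ('v list => 'k::comm_ring_1) set)"
proof (rule closedin_finitely_refuted)
  fix f :: "'v list => 'k" assume "f \<notin> cochains L q"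
  then consider xs where "xs \<notin> ordered_simplices L q" "f xs ~= 0"
    | xs \<pi> where "xs \<in> ordered_simplices L q" "\<pi> permutes {..<length xs}" "f (permute_list \<pi> xs) ~= of_int (sign \<pi>) * f xs"
    unfolding cochains_def by blast
  then show "\<exists>A. finite A \<and> (\<forall>f'. (\<forall>a\<in>A. f a = f' a) --> f' \<notin> cochains L q)"
  proof cases
    case (1 xs)
    then show ?thesis by (intro exI[of _ "{xs}"]) (auto dest: cochainsD(1))
  next
    case (2 xs \<pi>)
    then show ?thesis
      by (intro exI[of _ "{xs, permute_list \<pi> xs}"]) (auto dest: cochainsD(2)[of _ L q xs \<pi>])
  qed
qed

lemma closedin_ker_coboundary:
  "closedin discrete_product (ker_coboundary L (Suc q) :: ('v list => 'k::comm_ring_1) set)"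
proof -
  have "closedin discrete_product {f :: 'v list => 'k. coboundary L (Suc q) f = (\<lambda>xs. 0)}"
  proof (rule closedin_finitely_refuted)
    fix f :: "'v list => 'k" assume "f \<notin> {f. coboundary L (Suc q) f = (\<lambda>xs. 0)}"
    then obtain xs where xs: "coboundary L (Suc q) f xs ~= 0" by auto
    have loc: "coboundary L (Suc q) f' xs = coboundary L (Suc q) f xs" if "\<forall>a\<in>(\<lambda>j. face j xs) ` {..Suc q}. f a = f' a" for f'
      using that by (simp only: coboundary_face) auto
    have "f' \<notin> {f. coboundary L (Suc q) f = (\<lambda>xs. 0)}" if "\<forall>a\<in>(\<lambda>j. face j xs) ` {..Suc q}. f a = f' a" for f'
    proof
      assume "f' \<in> {f. coboundary L (Suc q) f = (\<lambda>xs. 0)}"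
      then have "coboundary L (Suc q) f' xs = 0" by simp
      then show False using loc[OF that] xs by simp
    qed
    then show "\<exists>A. finite A \<and> (\<forall>f'. (\<forall>a\<in>A. f a = f' a) --> f' \<notin> {f. coboundary L (Suc q) f = (\<lambda>xs. 0)})"
      by (intro exI[of _ "(\<lambda>j. face j xs) ` {..Suc q}"] conjI allI impI) simp_all
  qed
  from closedin_Int[OF closedin_cochains this]
  have "closedin discrete_product (cochains L q \<inter> {f :: 'v list => 'k. coboundary L (Suc q) f = (\<lambda>xs. 0)})" .
  also have "cochains L q \<inter> {f :: 'v list => 'k. coboundary L (Suc q) f = (\<lambda>xs. 0)} = ker_coboundary L (Suc q)"
    by (auto simp: ker_coboundary_def)
  finally show ?thesis .
qed

locale free_complex = group G for G :: "('g, 'm) monoid_scheme" (structure) +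
  fixes L :: "'v set set" and \<alpha> :: "'g => 'v => 'v"
  assumes L: "abstract_simplicial_complex L" and free: "free_simplicial_action G \<alpha> L"
begin

abbreviation "simplices \<equiv> ordered_simplices L"

lemma \<alpha>_action: "group_action G (\<Union>L) \<alpha>"
  using free by (simp add: free_simplicial_action_def simplicial_action_def)

lemma \<alpha>_mult: "g \<in> carrier G ==> h \<in> carrier G ==> x \<in> \<Union>L ==> \<alpha> (g \<otimes> h) x = \<alpha> g (\<alpha> h x)"
  by (rule group_action.composition_rule[OF \<alpha>_action])

lemma \<alpha>_one: "x \<in> \<Union>L ==> \<alpha> \<one> x = x"
  using group_action.id_eq_one[OF \<alpha>_action] by (metis restrict_apply')

lemma \<alpha>_inj: "g \<in> carrier G ==> inj_on (\<alpha> g) (\<Union>L)"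
  by (rule group_action.inj_prop[OF \<alpha>_action])

lemma \<alpha>_L: "g \<in> carrier G ==> s \<in> L ==> \<alpha> g ` s \<in> L"
  using free by (simp add: free_simplicial_action_def simplicial_action_def)

lemma \<alpha>_image_mult: "g \<in> carrier G ==> h \<in> carrier G ==> s \<in> L ==> \<alpha> g ` \<alpha> h ` s = \<alpha> (g \<otimes> h) ` s"
  unfolding image_image by (intro image_cong refl \<alpha>_mult[symmetric]) auto

lemma \<alpha>_image_one: "s \<in> L ==> \<alpha> \<one> ` s = s"
proof -
  assume "s \<in> L"
  then have "\<alpha> \<one> ` s = (\<lambda>x. x) ` s" by (intro image_cong refl \<alpha>_one) auto
  then show ?thesis by simp
qed

lemma \<alpha>_free:
  assumes "g \<in> carrier G" "h \<in> carrier G" "s \<in> L" "\<alpha> g ` s = \<alpha> h ` s"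
  shows "g = h"
proof -
  have "\<alpha> (inv h \<otimes> g) ` s = \<alpha> (inv h) ` \<alpha> h ` s"
    using assms by (simp flip: \<alpha>_image_mult)
  also have "... = s" using assms(2,3) by (simp add: \<alpha>_image_mult \<alpha>_image_one)
  finally have "inv h \<otimes> g = \<one>"
    using free assms(1-3) unfolding free_simplicial_action_def by blast
  then show ?thesis using assms(1,2) by (metis inv_closed inv_equality inv_inv)
qed

lemma map_\<alpha>_mult:
  assumes "g \<in> carrier G" "h \<in> carrier G" "set xs \<in> L"
  shows "map (\<alpha> g) (map (\<alpha> h) xs) = map (\<alpha> (g \<otimes> h)) xs"
  unfolding map_map o_def using assms by (intro map_cong refl \<alpha>_mult[symmetric]) auto

lemma map_\<alpha>_one: "set xs \<in> L ==> map (\<alpha> \<one>) xs = xs"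
  by (rule map_idI) (use \<alpha>_one in auto)

lemma map_\<alpha>_simplices:
  assumes "g \<in> carrier G" "xs \<in> simplices q"
  shows "map (\<alpha> g) xs \<in> simplices q"
proof -
  have xs: "length xs = Suc q" "distinct xs" "set xs \<in> L" using assms(2) by (auto simp: ordered_simplices_def)
  have "inj_on (\<alpha> g) (set xs)" by (rule inj_on_subset[OF \<alpha>_inj[OF assms(1)]]) (use xs in auto)
  then show ?thesis using xs \<alpha>_L[OF assms(1) xs(3)] by (simp add: ordered_simplices_def distinct_map)
qed

abbreviation "sorbit \<equiv> orbit G (\<lambda>g s. \<alpha> g ` s)"

lemma sorbit_self: "s \<in> L ==> s \<in> sorbit s"
  unfolding orbit_def using \<alpha>_image_one by force

lemma sorbit_eq:
  assumes "s \<in> L" "t \<in> sorbit s"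
  shows "sorbit t = sorbit s" "t \<in> L"
proof -
  obtain g where g: "g \<in> carrier G" "t = \<alpha> g ` s" using assms(2) by (auto simp: orbit_def)
  show tL: "t \<in> L" using g assms(1) by (simp add: \<alpha>_L)
  have s: "s = \<alpha> (inv g) ` t" using g assms(1) by (simp add: \<alpha>_image_mult \<alpha>_image_one)
  have 1: "\<alpha> h ` t \<in> sorbit s" if "h \<in> carrier G" for h
    using that g assms(1) by (auto simp: orbit_def \<alpha>_image_mult)
  have 2: "\<alpha> h ` s \<in> sorbit t" if h: "h \<in> carrier G" for h
  proof -
    have "\<alpha> h ` s = \<alpha> (h \<otimes> inv g) ` t"
      by (subst s, rule \<alpha>_image_mult) (use h g tL in auto)
    then show ?thesis using h g unfolding orbit_def by blast
  qed
  show "sorbit t = sorbit s"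
    using 1 2 unfolding orbit_def by blast
qed

text \<open>An arbitrary ordering of an arbitrary simplex of the orbit; one ordered simplex for each
  orbit of unordered ones.\<close>

definition orbit_rep :: "nat => 'v set set => 'v list" where
  "orbit_rep q Q = (SOME xs. xs \<in> simplices q \<and> set xs \<in> Q)"

definition reps :: "nat => 'v list set" where
  "reps q = orbit_rep q ` (\<lambda>xs. sorbit (set xs)) ` simplices q"

text \<open>The inverse makes translation by \<open>h\<close> act on coordinates by right
  multiplication, so that rules read \<open>h \<otimes> g\<close>.\<close>

definition cd :: "'g => 'v list => 'v list" where
  "cd g v = map (\<alpha> (inv g)) v"

lemma orbit_rep:
  assumes "xs \<in> simplices q"
  shows "orbit_rep q (sorbit (set xs)) \<in> simplices q \<and> set (orbit_rep q (sorbit (set xs))) \<in> sorbit (set xs)"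
  unfolding orbit_rep_def
  by (rule someI[of _ xs]) (use assms sorbit_self in \<open>auto simp: ordered_simplices_def\<close>)

lemma reps_simplices: "v \<in> reps q ==> v \<in> simplices q"
  unfolding reps_def using orbit_rep by auto

lemma simplexD: "xs \<in> simplices q ==> set xs \<in> L \<and> distinct xs \<and> length xs = Suc q"
  by (simp add: ordered_simplices_def)

lemma cd_simplices: "g \<in> carrier G ==> v \<in> simplices q ==> cd g v \<in> simplices q"
  unfolding cd_def by (simp add: map_\<alpha>_simplices)

lemma reps_cover:
  assumes "xs \<in> simplices q"
  shows "\<exists>g\<in>carrier G. \<exists>v\<in>reps q. set (cd g v) = set xs"
proof -
  define v where "v = orbit_rep q (sorbit (set xs))"
  have v: "v \<in> reps q" unfolding v_def reps_def using assms by blast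
  obtain g where g: "g \<in> carrier G" "set v = \<alpha> g ` set xs"
    using orbit_rep[OF assms] by (auto simp: v_def orbit_def)
  have "set (cd g v) = \<alpha> (inv g) ` \<alpha> g ` set xs" by (simp add: cd_def g(2))
  also have "... = set xs" using g simplexD[OF assms] by (simp add: \<alpha>_image_mult \<alpha>_image_one)
  finally show ?thesis using g v by blast
qed

lemma reps_unique:
  assumes "g \<in> carrier G" "g' \<in> carrier G" "v \<in> reps q" "v' \<in> reps q" "set (cd g v) = set (cd g' v')"
  shows "g = g' \<and> v = v'"
proof -
  obtain xs where xs: "xs \<in> simplices q" "v = orbit_rep q (sorbit (set xs))" using assms(3) by (auto simp: reps_def)
  obtain xs' where xs': "xs' \<in> simplices q" "v' = orbit_rep q (sorbit (set xs'))" using assms(4) by (auto simp: reps_def)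
  have vL: "set v \<in> L" "set v' \<in> L" using reps_simplices[OF assms(3)] reps_simplices[OF assms(4)] simplexD by auto
  have o: "sorbit (set v) = sorbit (set xs)" "sorbit (set v') = sorbit (set xs')"
    using orbit_rep[OF xs(1)] orbit_rep[OF xs'(1)] sorbit_eq(1) simplexD[OF xs(1)] simplexD[OF xs'(1)] xs(2) xs'(2) by auto
  have "set (cd g v) \<in> sorbit (set v)" "set (cd g' v') \<in> sorbit (set v')"
    using assms(1,2) by (auto simp: cd_def orbit_def)
  then have "sorbit (set v) = sorbit (set v')"
    using sorbit_eq(1)[OF vL(1)] sorbit_eq(1)[OF vL(2)] assms(5) by metis
  then have vv: "v = v'" using o xs(2) xs'(2) by simp
  have "\<alpha> (inv g) ` set v = \<alpha> (inv g') ` set v" using assms(5) vv by (simp add: cd_def)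
  then have "inv g = inv g'" using \<alpha>_free[OF _ _ vL(1)] assms(1,2) by simp
  then show ?thesis using vv assms(1,2) by (metis inv_inv)
qed

text \<open>The coordinate of the underlying simplex; \<open>prm\<close> is then the permutation
  relating its ordering to that of the representative.\<close>

definition cof :: "nat => 'v list => 'g \<times> 'v list" where
  "cof q xs = (SOME p. fst p \<in> carrier G \<and> snd p \<in> reps q \<and> set (cd (fst p) (snd p)) = set xs)"

definition prm :: "nat => 'v list => nat => nat" where
  "prm q xs = (SOME \<pi>. \<pi> permutes {..<Suc q} \<and> permute_list \<pi> (cd (fst (cof q xs)) (snd (cof q xs))) = xs)"

lemma cof:
  assumes "xs \<in> simplices q"
  shows "fst (cof q xs) \<in> carrier G" "snd (cof q xs) \<in> reps q" "set (cd (fst (cof q xs)) (snd (cof q xs))) = set xs"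
proof -
  have "\<exists>p. fst p \<in> carrier G \<and> snd p \<in> reps q \<and> set (cd (fst p) (snd p)) = set xs"
    using reps_cover[OF assms] by auto
  from someI_ex[OF this] show "fst (cof q xs) \<in> carrier G" "snd (cof q xs) \<in> reps q" "set (cd (fst (cof q xs)) (snd (cof q xs))) = set xs"
    unfolding cof_def by auto
qed

lemma cof_eqI:
  assumes "xs \<in> simplices q" "g \<in> carrier G" "v \<in> reps q" "set (cd g v) = set xs"
  shows "cof q xs = (g, v)"
  using reps_unique[OF cof(1)[OF assms(1)] assms(2) cof(2)[OF assms(1)] assms(3)] cof(3)[OF assms(1)] assms(4)
  by (simp add: prod_eq_iff)

lemma prm:
  assumes "xs \<in> simplices q"
  shows "prm q xs permutes {..<Suc q}" "permute_list (prm q xs) (cd (fst (cof q xs)) (snd (cof q xs))) = xs"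
proof -
  let ?c = "cd (fst (cof q xs)) (snd (cof q xs))"
  have c: "?c \<in> simplices q" by (rule cd_simplices[OF cof(1)[OF assms] reps_simplices[OF cof(2)[OF assms]]])
  have "mset xs = mset ?c"
    using simplexD[OF assms] simplexD[OF c] cof(3)[OF assms] by (metis set_eq_iff_mset_eq_distinct)
  then obtain p where "p permutes {..<length ?c}" "permute_list p ?c = xs" by (rule mset_eq_permutation)
  then have "\<exists>\<pi>. \<pi> permutes {..<Suc q} \<and> permute_list \<pi> ?c = xs" using simplexD[OF c] by auto
  from someI_ex[OF this] show "prm q xs permutes {..<Suc q}" "permute_list (prm q xs) ?c = xs"
    unfolding prm_def by auto
qed

lemma permute_list_inj:
  assumes "distinct c" "p permutes {..<length c}" "p' permutes {..<length c}" "permute_list p c = permute_list p' c"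
  shows "p = p'"
proof
  fix i
  show "p i = p' i"
  proof (cases "i < length c")
    case True
    then have "c ! p i = c ! p' i" using assms(2-4) by (metis permute_list_nth)
    moreover have "p i < length c" "p' i < length c"
      using True assms(2,3) permutes_in_image by (metis lessThan_iff)+
    ultimately show ?thesis using assms(1) nth_eq_iff_index_eq by blast
  next
    case False
    then show ?thesis using assms(2,3) by (metis lessThan_iff permutes_not_in)
  qed
qed

definition orientation :: "nat => 'v list => int" where
  "orientation q xs = sign (prm q xs)"

lemma cochain_decode:
  assumes "f \<in> cochains L q" "xs \<in> simplices q"
  shows "f xs = of_int (orientation q xs) * f (cd (fst (cof q xs)) (snd (cof q xs)))"
proof -
  let ?c = "cd (fst (cof q xs)) (snd (cof q xs))"
  have c: "?c \<in> simplices q" by (rule cd_simplices[OF cof(1)[OF assms(2)] reps_simplices[OF cof(2)[OF assms(2)]]])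
  have "f (permute_list (prm q xs) ?c) = of_int (sign (prm q xs)) * f ?c"
    by (rule cochainsD(2)[OF assms(1) c]) (use prm[OF assms(2)] simplexD[OF c] in simp)
  then show ?thesis using prm(2)[OF assms(2)] by (simp add: orientation_def)
qed

lemma prm_permute:
  assumes xs: "xs \<in> simplices q" and \<pi>: "\<pi> permutes {..<Suc q}"
  shows "cof q (permute_list \<pi> xs) = cof q xs" "orientation q (permute_list \<pi> xs) = sign \<pi> * orientation q xs"
proof -
  let ?c = "cd (fst (cof q xs)) (snd (cof q xs))"
  have c: "?c \<in> simplices q" by (rule cd_simplices[OF cof(1)[OF xs] reps_simplices[OF cof(2)[OF xs]]])
  have \<pi>': "\<pi> permutes {..<length xs}" using \<pi> simplexD[OF xs] by simp
  have ys: "permute_list \<pi> xs \<in> simplices q" by (rule permute_ordered_simplices[OF xs \<pi>'])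
  have "set (permute_list \<pi> xs) = set xs" using \<pi>' by simp
  then show e: "cof q (permute_list \<pi> xs) = cof q xs"
    using cof[OF xs] by (intro cof_eqI[OF ys, of "fst (cof q xs)" "snd (cof q xs)", unfolded prod.collapse]) auto
  have lc: "length ?c = Suc q" using simplexD[OF c] by simp
  have "permute_list (prm q xs \<circ> \<pi>) ?c = permute_list \<pi> xs"
    using permute_list_compose[of \<pi> ?c "prm q xs"] \<pi> lc prm(2)[OF xs] by simp
  then have "permute_list (prm q (permute_list \<pi> xs)) ?c = permute_list (prm q xs \<circ> \<pi>) ?c"
    using prm(2)[OF ys] e by simp
  moreover have "prm q xs \<circ> \<pi> permutes {..<Suc q}" using prm(1)[OF xs] \<pi> by (simp add: permutes_compose)
  ultimately have "prm q (permute_list \<pi> xs) = prm q xs \<circ> \<pi>"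
    using permute_list_inj[of ?c] simplexD[OF c] prm(1)[OF ys] lc by simp
  moreover have "sign (prm q xs \<circ> \<pi>) = sign (prm q xs) * sign \<pi>"
    using prm(1)[OF xs] \<pi> by (intro sign_compose) (auto simp: permutation_permutes)
  ultimately show "orientation q (permute_list \<pi> xs) = sign \<pi> * orientation q xs" by (simp add: orientation_def)
qed

text \<open>The alternating cochain with given coordinates.\<close>

definition lift :: "nat => ('g \<times> 'v list => 'k::comm_ring_1) => 'v list => 'k" where
  "lift q u xs = (if xs \<in> simplices q then of_int (orientation q xs) * u (cof q xs) else 0)"

lemma lift_in_cochains: "lift q u \<in> cochains L q"
  unfolding cochains_def
proof (intro CollectI conjI allI impI ballI)
  fix xs \<pi> assume xs: "xs \<in> simplices q" and \<pi>: "\<pi> permutes {..<length xs}"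
  have \<pi>': "\<pi> permutes {..<Suc q}" using \<pi> simplexD[OF xs] by simp
  show "lift q u (permute_list \<pi> xs) = of_int (sign \<pi>) * lift q u xs"
    using xs permute_ordered_simplices[OF xs \<pi>] prm_permute[OF xs \<pi>'] by (simp add: lift_def mult.assoc)
qed (simp add: lift_def)

lemma cof_cd:
  assumes "g \<in> carrier G" "v \<in> reps q"
  shows "cof q (cd g v) = (g, v)" "orientation q (cd g v) = 1"
proof -
  have c: "cd g v \<in> simplices q" by (rule cd_simplices[OF assms(1) reps_simplices[OF assms(2)]])
  show e: "cof q (cd g v) = (g, v)" by (rule cof_eqI[OF c assms]) simp
  have "permute_list (prm q (cd g v)) (cd g v) = permute_list id (cd g v)" using prm(2)[OF c] e by simp
  then have "prm q (cd g v) = id"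
    using permute_list_inj[of "cd g v"] simplexD[OF c] prm(1)[OF c] permutes_id by metis
  then show "orientation q (cd g v) = 1" by (simp add: orientation_def sign_id)
qed

lemma lift_cd:
  assumes "g \<in> carrier G" "v \<in> reps q"
  shows "lift q u (cd g v) = u (g, v)"
  using cof_cd[OF assms] cd_simplices[OF assms(1) reps_simplices[OF assms(2)]] by (simp add: lift_def)

definition coords :: "('v list => 'k) => 'g \<times> 'v list => 'k" where
  "coords f = (\<lambda>(g, v). f (cd g v))"

text \<open>The coboundary at \<open>t\<close> in coordinates.\<close>

definition face_rule :: "nat => 'v list => (int \<times> 'g \<times> 'v list) list" where
  "face_rule q t = map (\<lambda>j. ((-1) ^ j * orientation q (face j t), cof q (face j t))) [0..<Suc (Suc q)]"

lemma face_rule_elems: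
  assumes "t \<in> simplices (Suc q)" "(c, h, v) \<in> set (face_rule q t)"
  shows "h \<in> carrier G" "v \<in> reps q"
proof -
  from assms(2) obtain j where j: "j \<in> set [0..<Suc (Suc q)]"
    and chv: "(c, h, v) = ((-1) ^ j * orientation q (face j t), cof q (face j t))"
    unfolding face_rule_def set_map by (elim imageE)
  have "j <= Suc q" using j by auto
  moreover have "(h, v) = cof q (face j t)" using chv by simp
  ultimately show "h \<in> carrier G" "v \<in> reps q"
    using cof[OF face_ordered_simplices[OF L assms(1), of j]] by (metis fst_conv snd_conv)+
qed

lemma cd_cd:
  assumes "g \<in> carrier G" "h \<in> carrier G" "v \<in> simplices q"
  shows "map (\<alpha> (inv g)) (cd h v) = cd (h \<otimes> g) v"
  unfolding cd_def using assms simplexD[OF assms(3)] by (simp add: map_\<alpha>_mult inv_mult_group del: map_map)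

lemma face_rule_eval:
  fixes f :: "'v list => 'k::comm_ring_1"
  assumes f: "f \<in> cochains L q" and t: "t \<in> simplices (Suc q)" and g: "g \<in> carrier G"
  shows "rule_eval (\<otimes>) (face_rule q t) (coords f) g = coboundary L (Suc q) f (cd g t)"
proof -
  have fterm: "f (face j (cd g t)) = of_int (orientation q (face j t)) * coords f (fst (cof q (face j t)) \<otimes> g, snd (cof q (face j t)))"
    if j: "j <= Suc q" for j
  proof -
    let ?x = "face j t"
    have x: "?x \<in> simplices q" by (rule face_ordered_simplices[OF L t j])
    define h v where "h = fst (cof q ?x)" and "v = snd (cof q ?x)"
    have h: "h \<in> carrier G" and v: "v \<in> reps q" using cof[OF x] by (auto simp: h_def v_def)
    have c: "cd h v \<in> simplices q" by (rule cd_simplices[OF h reps_simplices[OF v]])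
    have p: "prm q ?x permutes {..<length (cd h v)}" using prm(1)[OF x] simplexD[OF c] by simp
    have "face j (cd g t) = map (\<alpha> (inv g)) ?x" by (simp add: cd_def face_map)
    also have "?x = permute_list (prm q ?x) (cd h v)" using prm(2)[OF x] by (simp add: h_def v_def)
    also have "map (\<alpha> (inv g)) (permute_list (prm q ?x) (cd h v)) = permute_list (prm q ?x) (map (\<alpha> (inv g)) (cd h v))"
      by (rule permute_list_map[OF p, symmetric])
    also have "map (\<alpha> (inv g)) (cd h v) = cd (h \<otimes> g) v" by (rule cd_cd[OF g h reps_simplices[OF v]])
    finally have e: "face j (cd g t) = permute_list (prm q ?x) (cd (h \<otimes> g) v)" .
    have c': "cd (h \<otimes> g) v \<in> simplices q" using h g by (intro cd_simplices reps_simplices[OF v]) simp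
    have "f (face j (cd g t)) = of_int (sign (prm q ?x)) * f (cd (h \<otimes> g) v)"
      unfolding e by (rule cochainsD(2)[OF f c']) (use prm(1)[OF x] simplexD[OF c'] in simp)
    then show ?thesis by (simp add: orientation_def coords_def h_def v_def)
  qed
  have "coboundary L (Suc q) f (cd g t) = (\<Sum>j\<le>Suc q. (-1) ^ j * f (face j (cd g t)))"
    using cd_simplices[OF g t] by (simp only: coboundary_face if_True)
  also have "... = (\<Sum>j\<le>Suc q. of_int ((-1) ^ j * orientation q (face j t)) * coords f (fst (cof q (face j t)) \<otimes> g, snd (cof q (face j t))))"
    by (intro sum.cong refl) (simp add: fterm mult.assoc)
  also have "{..Suc q} = {0..<Suc (Suc q)}" by auto
  also have "(\<Sum>j = 0..<Suc (Suc q). of_int ((-1) ^ j * orientation q (face j t)) * coords f (fst (cof q (face j t)) \<otimes> g, snd (cof q (face j t))))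
      = rule_eval (\<otimes>) (face_rule q t) (coords f) g"
    unfolding rule_eval_def face_rule_def map_map
    by (simp only: sum_set_upt_conv_sum_list_nat[symmetric] set_upt o_def case_prod_beta fst_conv snd_conv)
  finally show ?thesis by simp
qed

lemma coboundary_subcomplex_zero_iff:
  fixes f :: "'v list => 'k::comm_ring_1"
  assumes f: "f \<in> cochains L q" and K: "K \<subseteq> L" "\<And>g s. g \<in> carrier G ==> s \<in> K ==> \<alpha> g ` s \<in> K"
  shows "coboundary K (Suc q) f = (\<lambda>xs. 0) \<longleftrightarrow>
    (\<forall>t\<in>{t \<in> reps (Suc q). set t \<in> K}. \<forall>g\<in>carrier G. rule_eval (\<otimes>) (face_rule q t) (coords f) g = 0)"
proof -
  have KL: "coboundary K (Suc q) f xs = coboundary L (Suc q) f xs" if "xs \<in> ordered_simplices K (Suc q)" for xs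
  proof -
    have "xs \<in> simplices (Suc q)" using that K(1) by (auto simp: ordered_simplices_def)
    then show ?thesis using that by (simp only: coboundary_face if_True)
  qed
  have S: "cd g t \<in> ordered_simplices K (Suc q)" if "t \<in> reps (Suc q)" "set t \<in> K" "g \<in> carrier G" for g t
    using cd_simplices[OF that(3) reps_simplices[OF that(1)]] K(2)[OF _ that(2), of "inv g"] that(3)
    by (auto simp: ordered_simplices_def cd_def)
  show ?thesis
  proof
    assume z: "coboundary K (Suc q) f = (\<lambda>xs. 0)"
    show "\<forall>t\<in>{t \<in> reps (Suc q). set t \<in> K}. \<forall>g\<in>carrier G. rule_eval (\<otimes>) (face_rule q t) (coords f) g = 0"
      using KL[OF S] z face_rule_eval[OF f reps_simplices] by (metis (no_types, lifting) mem_Collect_eq)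
  next
    assume r: "\<forall>t\<in>{t \<in> reps (Suc q). set t \<in> K}. \<forall>g\<in>carrier G. rule_eval (\<otimes>) (face_rule q t) (coords f) g = 0"
    show "coboundary K (Suc q) f = (\<lambda>xs. 0)"
    proof
      fix xs
      show "coboundary K (Suc q) f xs = 0"
      proof (cases "xs \<in> ordered_simplices K (Suc q)")
        case True
        then have xs: "xs \<in> simplices (Suc q)" using K(1) by (auto simp: ordered_simplices_def)
        define g t where "g = fst (cof (Suc q) xs)" and "t = snd (cof (Suc q) xs)"
        have g: "g \<in> carrier G" and t: "t \<in> reps (Suc q)" and e: "set (cd g t) = set xs"
          using cof[OF xs] by (auto simp: g_def t_def)
        have tL: "set t \<in> L" using simplexD[OF reps_simplices[OF t]] by simp
        have "set t = \<alpha> g ` set (cd g t)" using g tL by (simp add: cd_def \<alpha>_image_mult \<alpha>_image_one)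
        also have "... \<in> K" unfolding e using True K(2)[OF g] by (simp add: ordered_simplices_def)
        finally have tK: "set t \<in> K" .
        have "coboundary L (Suc q) f (cd g t) = 0"
          using r t tK g face_rule_eval[OF f reps_simplices[OF t] g] by simp
        then have "coboundary L (Suc q) f xs = 0"
          using cochain_decode[OF coboundary_in_cochains[OF L f] xs] by (simp add: g_def t_def)
        then show ?thesis using KL[OF True] by simp
      qed (simp add: coboundary_face)
    qed
  qed
qed

lemma rule_eval_coords_lift:
  assumes t: "t \<in> simplices (Suc q)" and g: "g \<in> carrier G"
  shows "rule_eval (\<otimes>) (face_rule q t) (coords (lift q u)) g = rule_eval (\<otimes>) (face_rule q t) u g"
  unfolding rule_eval_def
proof (intro arg_cong[of _ _ sum_list] map_cong refl)
  fix x assume x: "x \<in> set (face_rule q t)"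
  obtain c h v where chv: "x = (c, h, v)" by (cases x)
  have "h \<in> carrier G" "v \<in> reps q" using face_rule_elems[OF t] x chv by auto
  then have "coords (lift q u) (h \<otimes> g, v) = u (h \<otimes> g, v)" using g by (simp add: coords_def lift_cd)
  then show "(case x of (c, h, v) => of_int c * coords (lift q u) (h \<otimes> g, v)) = (case x of (c, h, v) => of_int c * u (h \<otimes> g, v))"
    by (simp add: chv)
qed

lemma cochain_action_simps:
  assumes g: "g \<in> carrier G" and f: "f \<in> cochains L q"
  shows "cochain_action G \<alpha> L q g f \<in> cochains L q"
    and "h \<in> carrier G ==> v \<in> simplices q ==> cochain_action G \<alpha> L q g f (cd h v) = f (cd (h \<otimes> g) v)"
    and "coboundary L (Suc q) (cochain_action G \<alpha> L q g f) = cochain_action G \<alpha> L (Suc q) g (coboundary L (Suc q) f)"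
proof -
  have ig: "inv g \<in> carrier G" using g by simp
  show "cochain_action G \<alpha> L q g f \<in> cochains L q"
    unfolding cochains_def
  proof (intro CollectI conjI allI impI ballI)
    fix xs \<pi> assume xs: "xs \<in> simplices q" and \<pi>: "\<pi> permutes {..<length xs}"
    have "f (permute_list \<pi> (map (\<alpha> (inv g)) xs)) = of_int (sign \<pi>) * f (map (\<alpha> (inv g)) xs)"
      using \<pi> by (intro cochainsD(2)[OF f map_\<alpha>_simplices[OF ig xs]]) simp
    then show "cochain_action G \<alpha> L q g f (permute_list \<pi> xs) = of_int (sign \<pi>) * cochain_action G \<alpha> L q g f xs"
      using xs permute_ordered_simplices[OF xs \<pi>] by (simp add: cochain_action_def permute_list_map[OF \<pi>])
  qed (simp add: cochain_action_def)
  show "cochain_action G \<alpha> L q g f (cd h v) = f (cd (h \<otimes> g) v)" if "h \<in> carrier G" "v \<in> simplices q"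
    using cd_simplices[OF that] cd_cd[OF g that] by (simp add: cochain_action_def)
  show "coboundary L (Suc q) (cochain_action G \<alpha> L q g f) = cochain_action G \<alpha> L (Suc q) g (coboundary L (Suc q) f)"
  proof
    fix xs
    show "coboundary L (Suc q) (cochain_action G \<alpha> L q g f) xs = cochain_action G \<alpha> L (Suc q) g (coboundary L (Suc q) f) xs"
    proof (cases "xs \<in> simplices (Suc q)")
      case True
      have "cochain_action G \<alpha> L q g f (face j xs) = f (face j (map (\<alpha> (inv g)) xs))" if "j <= Suc q" for j
        using face_ordered_simplices[OF L True that] by (simp add: cochain_action_def face_map)
      then show ?thesis
        using True map_\<alpha>_simplices[OF ig True] by (simp only: coboundary_face cochain_action_def if_True) (intro sum.cong refl, simp add: cochain_action_def)
    qed (simp add: coboundary_face cochain_action_def)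
  qed
qed

lemma zero_cochain: "(\<lambda>xs. 0) \<in> cochains L q"
  by (simp add: cochains_def)

lemma coded_cochains:
  assumes "sofic_approximation G D \<sigma>" "finite (reps q)"
  shows "coded_action G D \<sigma> (cochains L q :: ('v list => 'k::{field,finite}) set) (cochain_action G \<alpha> L q) cd (reps q)"
proof (unfold_locales)
  show "sofic_approximation G D \<sigma>" "finite (reps q)" by (fact assms)+
  show "(cochains L q :: ('v list => 'k) set) ~= {}" using zero_cochain by blast
  show "closedin discrete_product (cochains L q :: ('v list => 'k) set)" by (rule closedin_cochains)
  show "cochain_action G \<alpha> L q g f \<in> cochains L q" if "g \<in> carrier G" "f \<in> cochains L q" for g and f :: "'v list => 'k"
    by (rule cochain_action_simps(1)[OF that])
  show "cochain_action G \<alpha> L q h f (cd g v) = f (cd (g \<otimes> h) v)"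
    if "g \<in> carrier G" "h \<in> carrier G" "v \<in> reps q" "f \<in> cochains L q" for g h v and f :: "'v list => 'k"
    using that by (intro cochain_action_simps(2) reps_simplices) auto
  show "(\<exists>g\<in>carrier G. \<exists>v\<in>reps q. \<forall>f\<in>cochains L q. \<forall>f'\<in>cochains L q. f (cd g v) = f' (cd g v) --> f a = (f' a :: 'k)) \<or>
      (\<forall>f\<in>cochains L q. \<forall>f'\<in>cochains L q. f a = (f' a :: 'k))" for a
  proof (cases "a \<in> simplices q")
    case True
    show ?thesis
    proof (intro disjI1 bexI ballI impI)
      fix f f' :: "'v list => 'k" assume "f \<in> cochains L q" "f' \<in> cochains L q"
        and "f (cd (fst (cof q a)) (snd (cof q a))) = f' (cd (fst (cof q a)) (snd (cof q a)))"
      then show "f a = f' a" using cochain_decode[of f q a] cochain_decode[of f' q a] True by simp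
    qed (use cof[OF True] in auto)
  next
    case False
    have z: "f a = 0" if "f \<in> cochains L q" for f :: "'v list => 'k"
      using cochainsD(1)[OF that False] .
    show ?thesis
    proof (intro disjI2 ballI)
      fix f f' :: "'v list => 'k" assume "f \<in> cochains L q" "f' \<in> cochains L q"
      from z[OF this(1)] z[OF this(2)] show "f a = f' a" by (simp only:)
    qed
  qed
qed

lemma coded_ker_coboundary:
  assumes "sofic_approximation G D \<sigma>" "finite (reps q)"
  shows "coded_action G D \<sigma> (ker_coboundary L (Suc q) :: ('v list => 'k::{field,finite}) set) (cochain_action G \<alpha> L q) cd (reps q)"
proof -
  interpret c: coded_action G D \<sigma> "cochains L q :: ('v list => 'k) set" "cochain_action G \<alpha> L q" cd "reps q"
    by (rule coded_cochains[OF assms])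
  have sub: "ker_coboundary L (Suc q) \<subseteq> (cochains L q :: ('v list => 'k) set)" by (auto simp: ker_coboundary_def)
  show ?thesis
  proof (unfold_locales)
    have "coboundary L (Suc q) (\<lambda>xs. 0 :: 'k) = (\<lambda>xs. 0)" by (simp add: coboundary_face fun_eq_iff)
    then show "(ker_coboundary L (Suc q) :: ('v list => 'k) set) ~= {}" using zero_cochain by (auto simp: ker_coboundary_def)
    show "closedin discrete_product (ker_coboundary L (Suc q) :: ('v list => 'k) set)" by (rule closedin_ker_coboundary)
    show "cochain_action G \<alpha> L q g f \<in> ker_coboundary L (Suc q)" if "g \<in> carrier G" "f \<in> ker_coboundary L (Suc q)" for g and f :: "'v list => 'k"
      using that cochain_action_simps(1,3)[OF that(1), of f q] by (auto simp: ker_coboundary_def cochain_action_def fun_eq_iff)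
    show "cochain_action G \<alpha> L q h f (cd g v) = f (cd (g \<otimes> h) v)"
      if "g \<in> carrier G" "h \<in> carrier G" "v \<in> reps q" "f \<in> ker_coboundary L (Suc q)" for g h v and f :: "'v list => 'k"
      using that sub by (intro c.act_coord) auto
    show "(\<exists>g\<in>carrier G. \<exists>v\<in>reps q. \<forall>f\<in>ker_coboundary L (Suc q). \<forall>f'\<in>ker_coboundary L (Suc q). f (cd g v) = f' (cd g v) --> f a = (f' a :: 'k)) \<or>
      (\<forall>f\<in>ker_coboundary L (Suc q). \<forall>f'\<in>ker_coboundary L (Suc q). f a = (f' a :: 'k))" for a
      using c.determined[of a] sub by (meson subset_iff)
  qed (use assms in auto)
qed

lemma ker_coboundary_extension:
  fixes u :: "'g \<times> 'v list => 'k::{field,finite}"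
  assumes "\<And>r g. r \<in> face_rule q ` reps (Suc q) ==> g \<in> carrier G ==> rule_eval (\<otimes>) r u g = 0"
  shows "\<exists>f\<in>ker_coboundary L (Suc q). \<forall>g\<in>carrier G. \<forall>v\<in>reps q. f (cd g v) = u (g, v)"
proof (intro bexI ballI)
  show "lift q u (cd g v) = u (g, v)" if "g \<in> carrier G" "v \<in> reps q" for g v by (rule lift_cd[OF that])
  have "coboundary L (Suc q) (lift q u) = (\<lambda>xs. 0)"
    using assms rule_eval_coords_lift[OF reps_simplices, where u = u] \<alpha>_L
    by (subst coboundary_subcomplex_zero_iff[OF lift_in_cochains]) auto
  then show "lift q u \<in> ker_coboundary L (Suc q)" by (simp add: ker_coboundary_def lift_in_cochains)
qed

lemma finite_reps:
  assumes "finite (orbits G K (\<lambda>g s. \<alpha> g ` s))"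
  shows "finite {t \<in> reps q. set t \<in> K}"
proof -
  have "{t \<in> reps q. set t \<in> K} \<subseteq> orbit_rep q ` orbits G K (\<lambda>g s. \<alpha> g ` s)"
  proof
    fix t assume t: "t \<in> {t \<in> reps q. set t \<in> K}"
    then obtain xs where xs: "xs \<in> simplices q" "t = orbit_rep q (sorbit (set xs))" by (auto simp: reps_def)
    have "sorbit (set t) = sorbit (set xs)"
      using orbit_rep[OF xs(1)] sorbit_eq(1) simplexD[OF xs(1)] xs(2) by auto
    then have "t = orbit_rep q (sorbit (set t))" using xs by simp
    moreover have "sorbit (set t) \<in> orbits G K (\<lambda>g s. \<alpha> g ` s)" using t by (auto simp: orbits_def)
    ultimately show "t \<in> orbit_rep q ` orbits G K (\<lambda>g s. \<alpha> g ` s)" by blast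
  qed
  then show ?thesis using assms by (meson finite_imageI finite_subset)
qed

end

section \<open>Square-summable functions\<close>

abbreviation cmod_L2 :: "('a => complex) => 'a set => real" where
  "cmod_L2 f F \<equiv> L2_set (\<lambda>x. cmod (f x)) F"

lemma l2_norm_nonneg: "0 <= l2_norm S f"
  unfolding l2_norm_def by (simp add: infsum_nonneg)

lemma cmod_L2_le_norm:
  assumes "f \<in> l2_space S" "finite F" "F \<subseteq> S"
  shows "cmod_L2 f F <= l2_norm S f"
  unfolding l2_norm_def L2_set_def
  using assms by (intro real_sqrt_le_mono finite_sum_le_infsum) (auto simp: l2_space_def)

lemma l2_spaceI:
  assumes "\<And>x. x \<notin> S ==> f x = 0" and b: "\<And>F. finite F ==> F \<subseteq> S ==> cmod_L2 f F <= B"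
  shows "f \<in> l2_space S" "l2_norm S f <= B"
proof -
  have B: "0 <= B" using b[of "{}"] by simp
  have sq: "(\<Sum>x\<in>F. (cmod (f x))\<^sup>2) <= B\<^sup>2" if "finite F" "F \<subseteq> S" for F
    using b[OF that] unfolding L2_set_def by (simp add: sqrt_le_D)
  then have s: "(\<lambda>x. (cmod (f x))\<^sup>2) summable_on S"
    by (intro nonneg_bdd_above_summable_on bdd_aboveI2[where M = "B\<^sup>2"]) auto
  then show "f \<in> l2_space S" using assms(1) by (simp add: l2_space_def)
  show "l2_norm S f <= B"
    unfolding l2_norm_def using infsum_le_finite_sums[OF s sq] B by (intro real_le_lsqrt) (auto simp: infsum_nonneg)
qed

lemma l2_space_zero_outside: "f \<in> l2_space S ==> x \<notin> S ==> f x = 0"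
  by (simp add: l2_space_def)

lemma cmod_le_l2_norm: "f \<in> l2_space S ==> cmod (f x) <= l2_norm S f"
  using cmod_L2_le_norm[of f S "{x}"] l2_norm_nonneg[of S f] by (cases "x \<in> S") (auto simp: L2_set_def l2_space_zero_outside)

lemma l2_norm_zero_imp: "f \<in> l2_space S ==> l2_norm S f = 0 ==> f x = 0"
  using cmod_le_l2_norm[of f S x] by simp

lemma l2_space_add:
  assumes f: "f \<in> l2_space S" and g: "g \<in> l2_space S"
  shows "(\<lambda>x. f x + g x) \<in> l2_space S" "l2_norm S (\<lambda>x. f x + g x) <= l2_norm S f + l2_norm S g"
proof -
  have b: "cmod_L2 (\<lambda>x. f x + g x) F <= l2_norm S f + l2_norm S g" if F: "finite F" "F \<subseteq> S" for F
  proof -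
    have "cmod_L2 (\<lambda>x. f x + g x) F <= L2_set (\<lambda>x. cmod (f x) + cmod (g x)) F"
      by (intro L2_set_mono norm_triangle_ineq) simp
    also have "... <= cmod_L2 f F + cmod_L2 g F" by (rule L2_set_triangle_ineq)
    finally show ?thesis using cmod_L2_le_norm[OF f F] cmod_L2_le_norm[OF g F] by simp
  qed
  show "(\<lambda>x. f x + g x) \<in> l2_space S" "l2_norm S (\<lambda>x. f x + g x) <= l2_norm S f + l2_norm S g"
    by (rule l2_spaceI[where B = "l2_norm S f + l2_norm S g"]; use f g b in \<open>simp add: l2_space_zero_outside\<close>)+
qed

lemma l2_space_scale:
  assumes f: "f \<in> l2_space S"
  shows "(\<lambda>x. c * f x) \<in> l2_space S" "l2_norm S (\<lambda>x. c * f x) <= cmod c * l2_norm S f"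
proof -
  have b: "cmod_L2 (\<lambda>x. c * f x) F <= cmod c * l2_norm S f" if F: "finite F" "F \<subseteq> S" for F
    using cmod_L2_le_norm[OF f F] by (simp add: norm_mult L2_set_right_distrib[symmetric] mult_left_mono)
  show "(\<lambda>x. c * f x) \<in> l2_space S" "l2_norm S (\<lambda>x. c * f x) <= cmod c * l2_norm S f"
    by (rule l2_spaceI[where B = "cmod c * l2_norm S f"]; use f b in \<open>simp add: l2_space_zero_outside\<close>)+
qed

lemma l2_space_diff:
  assumes f: "f \<in> l2_space S" and g: "g \<in> l2_space S"
  shows "(\<lambda>x. f x - g x) \<in> l2_space S" "l2_norm S (\<lambda>x. f x - g x) <= l2_norm S f + l2_norm S g"
proof -
  have e: "(\<lambda>x. f x - g x) = (\<lambda>x. f x + (- 1) * g x)" by auto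
  show "(\<lambda>x. f x - g x) \<in> l2_space S" "l2_norm S (\<lambda>x. f x - g x) <= l2_norm S f + l2_norm S g"
    unfolding e using l2_space_add[OF f l2_space_scale(1)[OF g, of "-1"]] l2_space_scale(2)[OF g, of "-1"] by auto
qed

lemma l2_norm_diff_commute: "l2_norm S (\<lambda>x. f x - g x) = l2_norm S (\<lambda>x. g x - f x)"
  by (simp add: l2_norm_def norm_minus_commute)

lemma l2_space_finite_support:
  assumes "finite {x. f x ~= 0}" "\<And>x. x \<notin> S ==> f x = 0"
  shows "f \<in> l2_space S"
proof -
  have "cmod_L2 f F <= cmod_L2 f {x. f x ~= 0}" if F: "finite F" for F
  proof -
    have "cmod_L2 f F = cmod_L2 f (F \<inter> {x. f x ~= 0})"
      unfolding L2_set_def using F by (intro arg_cong[of _ _ sqrt] sum.mono_neutral_right) auto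
    also have "... <= cmod_L2 f {x. f x ~= 0}"
      unfolding L2_set_def using assms(1) by (intro real_sqrt_le_mono sum_mono2) auto
    finally show ?thesis .
  qed
  then show ?thesis using assms(2) by (intro l2_spaceI(1)) auto
qed

lemma l2_inner_abs_summable:
  assumes f: "f \<in> l2_space S" and g: "g \<in> l2_space S"
  shows "(\<lambda>x. cmod (f x * cnj (g x))) summable_on S" "cmod (l2_inner S f g) <= l2_norm S f * l2_norm S g"
proof -
  have b: "(\<Sum>x\<in>F. cmod (f x * cnj (g x))) <= l2_norm S f * l2_norm S g" if F: "finite F" "F \<subseteq> S" for F
  proof -
    have "(\<Sum>x\<in>F. cmod (f x * cnj (g x))) = (\<Sum>x\<in>F. \<bar>cmod (f x)\<bar> * \<bar>cmod (g x)\<bar>)" by (simp add: norm_mult)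
    also have "... <= cmod_L2 f F * cmod_L2 g F" by (rule L2_set_mult_ineq)
    also have "... <= l2_norm S f * l2_norm S g"
      using cmod_L2_le_norm[OF f F] cmod_L2_le_norm[OF g F] by (intro mult_mono) (auto simp: l2_norm_nonneg)
    finally show ?thesis .
  qed
  show s: "(\<lambda>x. cmod (f x * cnj (g x))) summable_on S"
    using b by (intro nonneg_bdd_above_summable_on bdd_aboveI2[where M = "l2_norm S f * l2_norm S g"]) auto
  have "cmod (l2_inner S f g) <= (\<Sum>\<^sub>\<infinity>x\<in>S. cmod (f x * cnj (g x)))"
    unfolding l2_inner_def by (rule norm_infsum_bound[OF s])
  also have "... <= l2_norm S f * l2_norm S g" by (rule infsum_le_finite_sums[OF s b])
  finally show "cmod (l2_inner S f g) <= l2_norm S f * l2_norm S g" .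
qed

lemmas l2_inner_summable = abs_summable_summable[OF l2_inner_abs_summable(1)]
lemmas l2_cauchy_schwarz = l2_inner_abs_summable(2)

lemma l2_inner_add:
  assumes "f \<in> l2_space S" "f' \<in> l2_space S" "g \<in> l2_space S"
  shows "l2_inner S (\<lambda>x. f x + f' x) g = l2_inner S f g + l2_inner S f' g"
  unfolding l2_inner_def distrib_right by (intro infsum_add l2_inner_summable assms)

lemma l2_inner_scale: "l2_inner S (\<lambda>x. c * f x) g = c * l2_inner S f g"
  unfolding l2_inner_def by (simp add: infsum_cmult_right' mult.assoc)

lemma l2_inner_diff:
  assumes "f \<in> l2_space S" "f' \<in> l2_space S" "g \<in> l2_space S"
  shows "l2_inner S (\<lambda>x. f x - f' x) g = l2_inner S f g - l2_inner S f' g"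
  using l2_inner_add[OF assms(1) l2_space_scale(1)[OF assms(2), of "-1"] assms(3)] l2_inner_scale[of S "-1" f' g] by simp

lemma l2_inner_cnj: "l2_inner S g f = cnj (l2_inner S f g)"
  unfolding l2_inner_def infsum_cnj[symmetric] by (simp add: mult.commute)

lemma l2_inner_self:
  assumes "f \<in> l2_space S"
  shows "l2_inner S f f = of_real ((l2_norm S f)\<^sup>2)"
proof -
  have s: "(\<lambda>x. (cmod (f x))\<^sup>2) summable_on S" using assms by (simp add: l2_space_def)
  have "l2_inner S f f = (\<Sum>\<^sub>\<infinity>x\<in>S. of_real ((cmod (f x))\<^sup>2))"
    unfolding l2_inner_def by (intro infsum_cong complex_norm_square[symmetric])
  also have "... = of_real (\<Sum>\<^sub>\<infinity>x\<in>S. (cmod (f x))\<^sup>2)"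
    by (rule infsumI[OF has_sum_of_real[OF has_sum_infsum[OF s]]])
  also have "(\<Sum>\<^sub>\<infinity>x\<in>S. (cmod (f x))\<^sup>2) = (l2_norm S f)\<^sup>2" unfolding l2_norm_def by (simp add: infsum_nonneg)
  finally show ?thesis .
qed

lemma l2_inner_finite_support:
  assumes "finite A" "A \<subseteq> S" "\<And>x. x \<in> S - A ==> f x * cnj (g x) = 0"
  shows "l2_inner S f g = (\<Sum>x\<in>A. f x * cnj (g x))"
proof -
  have "l2_inner S f g = infsum (\<lambda>x. f x * cnj (g x)) A"
    unfolding l2_inner_def by (rule infsum_cong_neutral) (use assms in auto)
  then show ?thesis using assms(1) by simp
qed

lemma l2_norm_sq_add_scale:
  assumes f: "f \<in> l2_space S" and g: "g \<in> l2_space S"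
  shows "(l2_norm S (\<lambda>x. f x + c * g x))\<^sup>2 = (l2_norm S f)\<^sup>2 + 2 * Re (cnj c * l2_inner S f g) + (cmod c)\<^sup>2 * (l2_norm S g)\<^sup>2"
proof -
  note cg = l2_space_scale(1)[OF g, of c]
  note s = l2_space_add(1)[OF f cg]
  have e: "l2_inner S h (\<lambda>x. f x + c * g x) = cnj (l2_inner S f h) + cnj c * cnj (l2_inner S g h)" if h: "h \<in> l2_space S" for h
  proof -
    have "l2_inner S h (\<lambda>x. f x + c * g x) = cnj (l2_inner S (\<lambda>x. f x + c * g x) h)" by (rule l2_inner_cnj)
    also have "... = cnj (l2_inner S f h + c * l2_inner S g h)" unfolding l2_inner_add[OF f cg h] l2_inner_scale ..
    finally show ?thesis by simp
  qed
  have e1: "l2_inner S f (\<lambda>x. f x + c * g x) = l2_inner S f f + cnj c * l2_inner S f g"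
    unfolding e[OF f] l2_inner_cnj[of S f f, symmetric] l2_inner_cnj[of S f g, symmetric] ..
  have e2: "l2_inner S g (\<lambda>x. f x + c * g x) = cnj (l2_inner S f g) + cnj c * l2_inner S g g"
    unfolding e[OF g] l2_inner_cnj[of S g g, symmetric] ..
  have "of_real ((l2_norm S (\<lambda>x. f x + c * g x))\<^sup>2) = l2_inner S f f + cnj c * l2_inner S f g + c * (cnj (l2_inner S f g) + cnj c * l2_inner S g g)"
    unfolding l2_inner_self[OF s, symmetric] l2_inner_add[OF f cg s] l2_inner_scale e1 e2 ..
  then have "(l2_norm S (\<lambda>x. f x + c * g x))\<^sup>2 = Re (l2_inner S f f + cnj c * l2_inner S f g + c * (cnj (l2_inner S f g) + cnj c * l2_inner S g g))"
    by (metis Re_complex_of_real)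
  also have "... = (l2_norm S f)\<^sup>2 + 2 * Re (cnj c * l2_inner S f g) + (cmod c)\<^sup>2 * (l2_norm S g)\<^sup>2"
    unfolding l2_inner_self[OF f] l2_inner_self[OF g] cmod_power2[of c]
    by (simp add: algebra_simps power2_eq_square)
  finally show ?thesis .
qed

lemma l2_complete:
  fixes z :: "nat => 'a => complex"
  assumes z: "\<And>k. z k \<in> l2_space S"
    and cauchy: "\<And>eps. 0 < eps ==> \<exists>N. \<forall>j\<ge>N. \<forall>k\<ge>N. l2_norm S (\<lambda>x. z j x - z k x) < eps"
  shows "\<exists>y\<in>l2_space S. (\<lambda>k. l2_norm S (\<lambda>x. z k x - y x)) \<longlonglongrightarrow> 0"
proof -
  have "Cauchy (\<lambda>k. z k x)" for x
  proof (rule metric_CauchyI)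
    fix e :: real assume "0 < e"
    then obtain N where N: "\<forall>j\<ge>N. \<forall>k\<ge>N. l2_norm S (\<lambda>x. z j x - z k x) < e" using cauchy by blast
    have "dist (z j x) (z k x) < e" if "j \<ge> N" "k \<ge> N" for j k
    proof -
      have "cmod (z j x - z k x) <= l2_norm S (\<lambda>x. z j x - z k x)"
        by (rule cmod_le_l2_norm[OF l2_space_diff(1)[OF z z]])
      also have "... < e" using N that by blast
      finally show ?thesis by (simp add: dist_norm)
    qed
    then show "\<exists>M. \<forall>m\<ge>M. \<forall>n\<ge>M. dist (z m x) (z n x) < e" by blast
  qed
  then have lim: "(\<lambda>k. z k x) \<longlonglongrightarrow> lim (\<lambda>k. z k x)" for x
    by (simp add: Cauchy_convergent_iff convergent_LIMSEQ_iff)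
  define y where "y = (\<lambda>x. lim (\<lambda>k. z k x))"
  have y0: "y x = 0" if "x \<notin> S" for x
  proof -
    have "(\<lambda>k. z k x) = (\<lambda>k. 0)" using l2_space_zero_outside[OF z that] by auto
    then show ?thesis using LIMSEQ_unique[OF lim[of x], of 0] by (simp add: y_def)
  qed
  have key: "(\<lambda>x. z j x - y x) \<in> l2_space S \<and> l2_norm S (\<lambda>x. z j x - y x) <= eps"
    if N: "\<forall>j\<ge>N. \<forall>k\<ge>N. l2_norm S (\<lambda>x. z j x - z k x) < eps" and j: "j \<ge> N" for N j eps
  proof -
    have b: "cmod_L2 (\<lambda>x. z j x - y x) F <= eps" if F: "finite F" "F \<subseteq> S" for F
    proof (rule LIMSEQ_le_const2)
      show "(\<lambda>k. cmod_L2 (\<lambda>x. z j x - z k x) F) \<longlonglongrightarrow> cmod_L2 (\<lambda>x. z j x - y x) F"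
        unfolding L2_set_def y_def by (intro tendsto_intros lim)
      show "\<exists>N. \<forall>k\<ge>N. cmod_L2 (\<lambda>x. z j x - z k x) F <= eps"
        using cmod_L2_le_norm[OF l2_space_diff(1)[OF z z] F] N j by (intro exI[of _ N]) (meson less_imp_le order_trans)
    qed
    show ?thesis
      using l2_spaceI[of S "\<lambda>x. z j x - y x" eps, OF _ b] y0 l2_space_zero_outside[OF z] by auto
  qed
  obtain N where N: "\<forall>j\<ge>N. \<forall>k\<ge>N. l2_norm S (\<lambda>x. z j x - z k x) < 1" using cauchy[of 1] by auto
  have "(\<lambda>x. z N x - (z N x - y x)) \<in> l2_space S"
    using key[OF N order_refl] by (rule l2_space_diff(1)[OF z conjunct1])
  then have "y \<in> l2_space S" by simp
  moreover have "(\<lambda>k. l2_norm S (\<lambda>x. z k x - y x)) \<longlonglongrightarrow> 0"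
  proof (rule LIMSEQ_I)
    fix r :: real assume "0 < r"
    then obtain N where N: "\<forall>j\<ge>N. \<forall>k\<ge>N. l2_norm S (\<lambda>x. z j x - z k x) < r / 2" using cauchy[of "r / 2"] by auto
    have "norm (l2_norm S (\<lambda>x. z j x - y x) - 0) < r" if "j \<ge> N" for j
      using key[OF N that] \<open>0 < r\<close> l2_norm_nonneg[of S "\<lambda>x. z j x - y x"] by auto
    then show "\<exists>no. \<forall>n\<ge>no. norm (l2_norm S (\<lambda>x. z n x - y x) - 0) < r" by blast
  qed
  ultimately show ?thesis by blast
qed

definition l2_closed_subspace :: "'a set => ('a => complex) set => bool" where
  "l2_closed_subspace S M \<longleftrightarrow> M \<subseteq> l2_space S \<and> (\<lambda>x. 0) \<in> M \<and>
     (\<forall>f\<in>M. \<forall>g\<in>M. \<forall>c. (\<lambda>x. f x + c * g x) \<in> M) \<and> l2_closure S M \<subseteq> M"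

text \<open>The nearest point of a closed subspace.\<close>

lemma l2_projection_exists:
  assumes M: "l2_closed_subspace S M" and e: "e \<in> l2_space S"
  shows "\<exists>m\<in>M. (\<lambda>x. e x - m x) \<in> l2_orthogonal S M"
proof -
  define nr where "nr m = (l2_norm S (\<lambda>x. e x - m x))\<^sup>2" for m
  define d where "d = Inf (nr ` M)"
  have sub: "M \<subseteq> l2_space S" and z: "(\<lambda>x. 0) \<in> M" and cl: "l2_closure S M \<subseteq> M"
    and lin: "\<And>f g c. f \<in> M ==> g \<in> M ==> (\<lambda>x. f x + c * g x) \<in> M"
    using M unfolding l2_closed_subspace_def by auto
  have bdd: "bdd_below (nr ` M)" by (rule bdd_belowI2[of _ 0]) (simp add: nr_def)
  have dle: "d <= nr m" if "m \<in> M" for m unfolding d_def using bdd that by (rule cINF_lower)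
  have "\<exists>m\<in>M. nr m < d + 1 / real (Suc k)" for k
    using cINF_less_iff[OF _ bdd, of "d + 1 / real (Suc k)"] z unfolding d_def by (metis empty_iff less_add_same_cancel1 of_nat_0_less_iff zero_less_Suc zero_less_divide_1_iff)
  then obtain m where m: "\<And>k. m k \<in> M" "\<And>k. nr (m k) < d + 1 / real (Suc k)" by metis
  have mS: "m k \<in> l2_space S" for k using m(1) sub by blast
  have em: "(\<lambda>x. e x - m k x) \<in> l2_space S" for k by (rule l2_space_diff(1)[OF e mS])
  \<comment> \<open>By the parallelogram law two near-minimisers are close to each other.\<close>
  have par: "(l2_norm S (\<lambda>x. m j x - m k x))\<^sup>2 <= 2 * (1 / real (Suc j)) + 2 * (1 / real (Suc k))" for j k
  proof -
    define f g where "f = (\<lambda>x. e x - m k x)" and "g = (\<lambda>x. e x - m j x)"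
    have fg: "f \<in> l2_space S" "g \<in> l2_space S" using em by (auto simp: f_def g_def)
    have A: "(l2_norm S (\<lambda>x. f x + (-1) * g x))\<^sup>2 = (l2_norm S f)\<^sup>2 - 2 * Re (l2_inner S f g) + (l2_norm S g)\<^sup>2"
      using l2_norm_sq_add_scale[OF fg, of "-1"] by simp
    have B: "(l2_norm S (\<lambda>x. f x + 1 * g x))\<^sup>2 = (l2_norm S f)\<^sup>2 + 2 * Re (l2_inner S f g) + (l2_norm S g)\<^sup>2"
      using l2_norm_sq_add_scale[OF fg, of 1] by simp
    define h where "h = (\<lambda>x. (1/2) * (m k x + 1 * m j x))"
    have "h \<in> M"
      unfolding h_def using lin[OF z lin[OF m(1) m(1)], of "1/2" k 1 j] by simp
    have s: "(\<lambda>x. e x - h x) \<in> l2_space S" using \<open>h \<in> M\<close> sub by (intro l2_space_diff(1)[OF e]) auto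
    have "(\<lambda>x. f x + 1 * g x) = (\<lambda>x. (e x - h x) + 1 * (e x - h x))" by (auto simp: f_def g_def h_def field_simps)
    then have C: "(l2_norm S (\<lambda>x. f x + 1 * g x))\<^sup>2 = 4 * nr h"
      using l2_norm_sq_add_scale[OF s s, of 1] l2_inner_self[OF s] by (simp add: nr_def)
    have "4 * d <= 4 * nr h" using dle[OF \<open>h \<in> M\<close>] by simp
    moreover have "(\<lambda>x. f x + (-1) * g x) = (\<lambda>x. m j x - m k x)" by (auto simp: f_def g_def)
    moreover have "(l2_norm S f)\<^sup>2 < d + 1 / real (Suc k)" "(l2_norm S g)\<^sup>2 < d + 1 / real (Suc j)"
      using m(2) by (auto simp: nr_def f_def g_def)
    ultimately show ?thesis using A B C by (simp only:)
  qed
  have cauchy: "\<exists>N. \<forall>j\<ge>N. \<forall>k\<ge>N. l2_norm S (\<lambda>x. m j x - m k x) < eps" if eps: "0 < eps" for eps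
  proof -
    obtain N where N: "inverse (real (Suc N)) < eps\<^sup>2 / 4" using reals_Archimedean[of "eps\<^sup>2 / 4"] eps by auto
    have "l2_norm S (\<lambda>x. m j x - m k x) < eps" if "j \<ge> N" "k \<ge> N" for j k
    proof -
      have "1 / real (Suc j) <= inverse (real (Suc N))" "1 / real (Suc k) <= inverse (real (Suc N))"
        using that by (auto simp: inverse_eq_divide frac_le)
      then have "(l2_norm S (\<lambda>x. m j x - m k x))\<^sup>2 < eps\<^sup>2" using par[of j k] N by simp
      then show ?thesis using eps by (simp add: power2_less_imp_less)
    qed
    then show ?thesis by blast
  qed
  obtain y where y: "y \<in> l2_space S" "(\<lambda>k. l2_norm S (\<lambda>x. m k x - y x)) \<longlonglongrightarrow> 0"
    using l2_complete[OF mS cauchy] by blast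
  have yM: "y \<in> M"
  proof (rule subsetD[OF cl])
    show "y \<in> l2_closure S M"
      unfolding l2_closure_def
    proof (intro CollectI conjI allI impI y(1))
      fix eps :: real assume "0 < eps"
      then obtain k where "l2_norm S (\<lambda>x. m k x - y x) < eps"
        using order_tendstoD(2)[OF y(2)] by (metis (no_types, lifting) eventually_sequentially order_refl)
      then show "\<exists>n\<in>M. l2_norm S (\<lambda>x. y x - n x) < eps" using m(1) l2_norm_diff_commute[of S y "m k"] by metis
    qed
  qed
  have eyS: "(\<lambda>x. e x - y x) \<in> l2_space S" by (rule l2_space_diff(1)[OF e y(1)])
  have nry: "nr y <= d"
  proof -
    have tri: "l2_norm S (\<lambda>x. e x - y x) <= sqrt (d + 1 / real (Suc k)) + l2_norm S (\<lambda>x. m k x - y x)" for k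
    proof -
      have "l2_norm S (\<lambda>x. (e x - m k x) + (m k x - y x)) <= l2_norm S (\<lambda>x. e x - m k x) + l2_norm S (\<lambda>x. m k x - y x)"
        by (rule l2_space_add(2)[OF em l2_space_diff(1)[OF mS y(1)]])
      moreover have "l2_norm S (\<lambda>x. e x - m k x) <= sqrt (d + 1 / real (Suc k))"
        using m(2)[of k] by (intro real_le_rsqrt) (simp add: nr_def)
      ultimately show ?thesis by simp
    qed
    have "(\<lambda>k. sqrt (d + 1 / real (Suc k)) + l2_norm S (\<lambda>x. m k x - y x)) \<longlonglongrightarrow> sqrt (d + 0) + 0"
      by (intro tendsto_intros y(2) LIMSEQ_Suc[OF lim_1_over_n])
    then have "l2_norm S (\<lambda>x. e x - y x) <= sqrt d" using tri by (intro LIMSEQ_le_const) auto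
    moreover have "0 <= d" unfolding d_def using z by (intro cINF_greatest) (auto simp: nr_def)
    ultimately show ?thesis unfolding nr_def by (metis l2_norm_nonneg power_mono real_sqrt_pow2)
  qed
  have "l2_inner S (\<lambda>x. e x - y x) n = 0" if n: "n \<in> M" for n
  proof -
    define c where "c = l2_inner S (\<lambda>x. e x - y x) n"
    have nS: "n \<in> l2_space S" using n sub by blast
    have le: "0 <= 2 * Re (cnj t * c) + (cmod t)\<^sup>2 * (l2_norm S n)\<^sup>2" for t
    proof -
      have "(\<lambda>x. y x + (- t) * n x) \<in> M" by (rule lin[OF yM n])
      from order_trans[OF nry dle[OF this]] have "nr y <= nr (\<lambda>x. y x + (- t) * n x)" .
      moreover have "(\<lambda>x. e x - (y x + (- t) * n x)) = (\<lambda>x. (e x - y x) + t * n x)" by (auto simp: algebra_simps)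
      ultimately show ?thesis using l2_norm_sq_add_scale[OF eyS nS, of t] by (simp add: nr_def c_def)
    qed
    \<comment> \<open>Moving from \<open>y\<close> in the direction of \<open>c * n\<close> does not bring it closer to \<open>e\<close>.\<close>
    have le': "0 <= (cmod c)\<^sup>2 * (- 2 * r + r\<^sup>2 * (l2_norm S n)\<^sup>2)" for r :: real
    proof -
      have "cnj (- of_real r * c) * c = - of_real r * (c * cnj c)" by simp
      also have "... = of_real (- r * (cmod c)\<^sup>2)" unfolding complex_norm_square[symmetric] by simp
      finally have "Re (cnj (- of_real r * c) * c) = - r * (cmod c)\<^sup>2" by (simp only: Re_complex_of_real)
      moreover have "(cmod (- of_real r * c))\<^sup>2 = r\<^sup>2 * (cmod c)\<^sup>2" by (simp add: norm_mult power_mult_distrib)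
      ultimately show ?thesis using le[of "- of_real r * c"] by (simp add: algebra_simps)
    qed
    define b where "b = (l2_norm S n)\<^sup>2 + 1"
    have b: "1 <= b" by (simp add: b_def)
    have "- 2 * (1/b) + (1/b)\<^sup>2 * (l2_norm S n)\<^sup>2 < 0"
    proof -
      have "(1/b)\<^sup>2 * (l2_norm S n)\<^sup>2 <= (1/b)\<^sup>2 * b" by (intro mult_left_mono) (auto simp: b_def)
      also have "... = 1 / b" using b by (simp add: power2_eq_square)
      finally have "(1/b)\<^sup>2 * (l2_norm S n)\<^sup>2 <= 1 / b" .
      moreover have "0 < 1 / b" using b by simp
      ultimately show ?thesis by linarith
    qed
    then have "(cmod c)\<^sup>2 <= 0" using le'[of "1/b"] by (meson mult_pos_neg not_less)
    then show ?thesis by (simp add: c_def)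
  qed
  then show ?thesis using yM eyS unfolding l2_orthogonal_def by blast
qed

lemma l2_proj:
  assumes M: "l2_closed_subspace S M" and e: "e \<in> l2_space S"
  shows "l2_proj S M e \<in> M" "(\<lambda>x. e x - l2_proj S M e x) \<in> l2_orthogonal S M"
proof -
  have sub: "M \<subseteq> l2_space S" and lin: "\<And>f g c. f \<in> M ==> g \<in> M ==> (\<lambda>x. f x + c * g x) \<in> M"
    using M unfolding l2_closed_subspace_def by auto
  have "\<exists>!m. m \<in> M \<and> (\<lambda>x. e x - m x) \<in> l2_orthogonal S M"
  proof (rule ex_ex1I)
    show "\<exists>m. m \<in> M \<and> (\<lambda>x. e x - m x) \<in> l2_orthogonal S M" using l2_projection_exists[OF M e] by blast
    fix m n assume m: "m \<in> M \<and> (\<lambda>x. e x - m x) \<in> l2_orthogonal S M" and n: "n \<in> M \<and> (\<lambda>x. e x - n x) \<in> l2_orthogonal S M"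
    have d: "(\<lambda>x. m x - n x) \<in> M" using lin[of m n "-1"] m n by simp
    have o: "(\<lambda>x. e x - m x) \<in> l2_space S" "(\<lambda>x. e x - n x) \<in> l2_space S"
      "l2_inner S (\<lambda>x. e x - m x) (\<lambda>x. m x - n x) = 0" "l2_inner S (\<lambda>x. e x - n x) (\<lambda>x. m x - n x) = 0"
      using m n d by (auto simp: l2_orthogonal_def)
    have dS: "(\<lambda>x. m x - n x) \<in> l2_space S" using d sub by blast
    have "l2_inner S (\<lambda>x. (e x - n x) - (e x - m x)) (\<lambda>x. m x - n x) = 0"
      using l2_inner_diff[OF o(2,1) dS] o(3,4) by simp
    moreover have "(\<lambda>x. (e x - n x) - (e x - m x)) = (\<lambda>x. m x - n x)" by auto
    ultimately have "l2_norm S (\<lambda>x. m x - n x) = 0" using l2_inner_self[OF dS] by simp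
    then show "m = n" using l2_norm_zero_imp[OF dS] by (auto simp: fun_eq_iff)
  qed
  from theI'[OF this] show "l2_proj S M e \<in> M" "(\<lambda>x. e x - l2_proj S M e x) \<in> l2_orthogonal S M"
    unfolding l2_proj_def by auto
qed

lemma l2_proj_inner:
  assumes M: "l2_closed_subspace S M" and e: "e \<in> l2_space S" and n: "n \<in> M"
  shows "l2_inner S e n = l2_inner S (l2_proj S M e) n"
proof -
  have sub: "M \<subseteq> l2_space S" using M unfolding l2_closed_subspace_def by auto
  have "l2_inner S (\<lambda>x. e x - l2_proj S M e x) n = 0" using l2_proj(2)[OF M e] n by (simp add: l2_orthogonal_def)
  then show ?thesis using l2_inner_diff[OF e subsetD[OF sub l2_proj(1)[OF M e]] subsetD[OF sub n]] by simp
qed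

lemma l2_proj_point_mass:
  assumes M: "l2_closed_subspace S M" and s: "s \<in> S"
  defines "m \<equiv> l2_proj S M (point_mass s)"
  shows "m \<in> M" "m s = of_real ((l2_norm S m)\<^sup>2)" "l2_inner S m (point_mass s) = m s"
proof -
  have sub: "M \<subseteq> l2_space S" using M unfolding l2_closed_subspace_def by auto
  have e: "(point_mass s :: _ => complex) \<in> l2_space S"
    using s by (intro l2_space_finite_support) (auto simp: point_mass_def)
  show mM: "m \<in> M" unfolding m_def by (rule l2_proj(1)[OF M e])
  show i: "l2_inner S m (point_mass s) = m s"
    using s by (subst l2_inner_finite_support[of "{s}"]) (auto simp: point_mass_def)
  have "l2_inner S (point_mass s) m = l2_inner S m m"
    using l2_proj_inner[OF M e mM] by (simp add: m_def)
  then have "cnj (m s) = of_real ((l2_norm S m)\<^sup>2)"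
    using l2_inner_cnj[of S "point_mass s" m] i l2_inner_self[OF subsetD[OF sub mM]] by simp
  then show "m s = of_real ((l2_norm S m)\<^sup>2)" by (metis complex_cnj_cnj complex_cnj_complex_of_real)
qed

text \<open>The diagonal entry of a projection is the squared norm of the projected point mass, and
  projecting further decreases norms.\<close>

lemma l2_proj_mono:
  assumes M: "l2_closed_subspace S M" and M': "l2_closed_subspace S M'" and sub: "M' \<subseteq> M" and s: "s \<in> S"
  shows "Re (l2_proj S M' (point_mass s) s) <= Re (l2_proj S M (point_mass s) s)"
proof -
  define m m' where "m = l2_proj S M (point_mass s)" and "m' = l2_proj S M' (point_mass s)"
  note p = l2_proj_point_mass[OF M s, folded m_def] and p' = l2_proj_point_mass[OF M' s, folded m'_def]
  have e: "(point_mass s :: _ => complex) \<in> l2_space S"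
    using s by (intro l2_space_finite_support) (auto simp: point_mass_def)
  have S: "m \<in> l2_space S" "m' \<in> l2_space S" using p(1) p'(1) M M' by (auto simp: l2_closed_subspace_def)
  have "m' \<in> M" using p'(1) sub by blast
  from l2_proj_inner[OF M e this] l2_proj_inner[OF M' e p'(1)] have "l2_inner S m m' = of_real ((l2_norm S m')\<^sup>2)"
    using l2_inner_self[OF S(2)] by (simp add: m_def m'_def)
  then have "(l2_norm S m')\<^sup>2 <= l2_norm S m * l2_norm S m'"
    using l2_cauchy_schwarz[OF S] by (simp add: norm_power)
  then have "l2_norm S m' <= l2_norm S m"
    using l2_norm_nonneg[of S m'] l2_norm_nonneg[of S m] by (cases "l2_norm S m' = 0") (auto simp: power2_eq_square)
  then have "(l2_norm S m')\<^sup>2 <= (l2_norm S m)\<^sup>2" by (rule power_mono[OF _ l2_norm_nonneg])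
  then show ?thesis using p(2) p'(2) by (simp add: m_def m'_def)
qed

lemma von_Neumann_dim_alt:
  assumes M: "l2_closed_subspace S M" and Q: "\<And>Q. Q \<in> orbits G S act ==> Q ~= {} \<and> Q \<subseteq> S"
  shows "von_Neumann_dim G act S M = (\<Sum>Q\<in>orbits G S act. Re (l2_proj S M (point_mass (SOME s. s \<in> Q)) (SOME s. s \<in> Q)))"
  unfolding von_Neumann_dim_def
proof (intro sum.cong refl)
  fix Q assume "Q \<in> orbits G S act"
  from Q[OF this] have s: "(SOME s. s \<in> Q) \<in> S" by (metis some_in_eq subset_iff)
  from l2_proj_point_mass(3)[OF M this]
  show "(let e = \<lambda>x. if x = (SOME s. s \<in> Q) then 1 else 0 in Re (l2_inner S (l2_proj S M e) e)) =
      Re (l2_proj S M (point_mass (SOME s. s \<in> Q)) (SOME s. s \<in> Q))"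
    unfolding Let_def by (simp add: point_mass_def)
qed

lemma l2_space_sum:
  assumes "finite J" "\<And>j. j \<in> J ==> h j \<in> l2_space S"
  shows "(\<lambda>x. \<Sum>j\<in>J. h j x) \<in> l2_space S"
  using assms
proof (induction J)
  case empty
  show ?case by (simp add: l2_space_def)
next
  case (insert j J)
  then show ?case using l2_space_add(1)[of "h j" S "\<lambda>x. \<Sum>j\<in>J. h j x"] by simp
qed

lemma l2_closure_sequence:
  assumes f: "f \<in> l2_closure S M" and M: "M \<subseteq> l2_space S"
  shows "\<exists>m. (\<forall>k. m k \<in> M) \<and> (\<forall>x. (\<lambda>k. m k x) \<longlonglongrightarrow> f x) \<and>
    (\<forall>b\<in>l2_space S. (\<lambda>k. l2_inner S (m k) b) \<longlonglongrightarrow> l2_inner S f b)"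
proof -
  have fS: "f \<in> l2_space S" using f by (simp add: l2_closure_def)
  have "\<exists>m\<in>M. l2_norm S (\<lambda>x. m x - f x) < 1 / real (Suc k)" for k
  proof -
    have "0 < 1 / real (Suc k)" by simp
    then obtain m where "m \<in> M" "l2_norm S (\<lambda>x. f x - m x) < 1 / real (Suc k)"
      using f unfolding l2_closure_def by blast
    then show ?thesis by (intro bexI[of _ m]) (simp only: l2_norm_diff_commute[of S m f])
  qed
  then obtain m where m: "\<And>k. m k \<in> M" "\<And>k. l2_norm S (\<lambda>x. m k x - f x) < 1 / real (Suc k)" by metis
  have dS: "(\<lambda>x. m k x - f x) \<in> l2_space S" for k using m(1) M by (intro l2_space_diff(1) fS) auto
  have lim: "(\<lambda>k. c * (1 / real (Suc k))) \<longlonglongrightarrow> 0" for c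
    using tendsto_mult_left[OF LIMSEQ_Suc[OF lim_1_over_n], of c] by simp
  have "(\<lambda>k. m k x) \<longlonglongrightarrow> f x" for x
  proof (rule Lim_transform_bound[of "\<lambda>k. m k x - f x", THEN LIM_zero_cancel])
    show "(\<lambda>k. 1 * (1 / real (Suc k))) \<longlonglongrightarrow> 0" by (rule lim)
    have "cmod (m k x - f x) <= 1 / real (Suc k)" for k
      using cmod_le_l2_norm[OF dS, of k x] m(2)[of k] by linarith
    then show "\<forall>\<^sub>F k in sequentially. norm (m k x - f x) <= norm (1 * (1 / real (Suc k)))" by simp
  qed
  moreover have "(\<lambda>k. l2_inner S (m k) b) \<longlonglongrightarrow> l2_inner S f b" if b: "b \<in> l2_space S" for b
  proof (rule Lim_transform_bound[of "\<lambda>k. l2_inner S (m k) b - l2_inner S f b", THEN LIM_zero_cancel])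
    show "(\<lambda>k. l2_norm S b * (1 / real (Suc k))) \<longlonglongrightarrow> 0" by (rule lim)
    have "cmod (l2_inner S (m k) b - l2_inner S f b) <= l2_norm S b * (1 / real (Suc k))" for k
    proof -
      have "l2_inner S (m k) b - l2_inner S f b = l2_inner S (\<lambda>x. m k x - f x) b"
        using m(1) M by (intro l2_inner_diff[symmetric] fS b) auto
      then have "cmod (l2_inner S (m k) b - l2_inner S f b) <= l2_norm S (\<lambda>x. m k x - f x) * l2_norm S b"
        using l2_cauchy_schwarz[OF dS b] by simp
      also have "... <= (1 / real (Suc k)) * l2_norm S b"
        using m(2)[of k] by (intro mult_right_mono l2_norm_nonneg) simp
      finally show ?thesis by (simp add: mult.commute)
    qed
    then show "\<forall>\<^sub>F k in sequentially. norm (l2_inner S (m k) b - l2_inner S f b) <= norm (l2_norm S b * (1 / real (Suc k)))"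
      unfolding real_norm_def by (intro always_eventually allI order_trans[OF _ abs_ge_self])
  qed
  ultimately show ?thesis using m(1) by blast
qed

context perm_system
begin

lemma pairing_Contr_kernel:
  fixes H :: "'x \<times> 'v => real"
  assumes u: "u \<in> FS" and H: "\<And>r x. r \<in> W ==> x \<in> \<Omega> ==> rule_eval s r H x = 0"
  shows "pairing (Contr u) H = pairing u H"
proof -
  define B where "B r = {x. rv r u x ~= 0}" for r
  define A where "A = {y. Lap u y ~= 0} \<union> (\<Union>r\<in>W. \<Union>(c, h, v)\<in>set r. (\<lambda>x. (s h x, v)) ` B r)"
  have B: "finite (B r)" "B r \<subseteq> \<Omega>" if "r \<in> W" for r
    using finite_supp_rv[OF u that] by (auto simp: B_def finite_supp_def rv_def split: if_splits)
  have finA: "finite A" using finW B FS_supp[OF finite_supp_Lap[OF u]] by (auto simp: A_def finite_supp_def)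
  have AO: "A \<subseteq> \<Omega> \<times> V"
  proof
    fix y assume "y \<in> A"
    then consider "Lap u y ~= 0" | r c h v x where "r \<in> W" "(c, h, v) \<in> set r" "x \<in> B r" "y = (s h x, v)"
      unfolding A_def by blast
    then show "y \<in> \<Omega> \<times> V"
    proof cases
      case 1
      then show ?thesis by (auto simp: Lap_def split: if_splits)
    next
      case 2
      then show ?thesis using s WV B by blast
    qed
  qed
  have "pairing (Lap u) H = (\<Sum>y\<in>A. Lap u y * H y)"
    using finA FS_supp[OF finite_supp_Lap[OF u]] by (intro pairing_eq) (auto simp: A_def)
  also have "... = (\<Sum>y\<in>A. \<Sum>r\<in>W. H y * rule_adj s' r (rv r u) y)"
    using AO by (intro sum.cong refl) (auto simp: Lap_def sum_distrib_left mult.commute)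
  also have "... = (\<Sum>r\<in>W. \<Sum>y\<in>A. H y * rule_adj s' r (rv r u) y)" by (rule sum.swap)
  also have "... = (\<Sum>r\<in>W. \<Sum>x\<in>B r. rule_eval s r H x * rv r u x)"
  proof (intro sum.cong refl)
    fix r assume r: "r \<in> W"
    show "(\<Sum>y\<in>A. H y * rule_adj s' r (rv r u) y) = (\<Sum>x\<in>B r. rule_eval s r H x * rv r u x)"
    proof (rule sum_rule_eval_mult[where \<Omega> = \<Omega>, symmetric])
      fix c h v x assume c: "(c, h, v) \<in> set r" and x: "x \<in> \<Omega>"
      show "s h x \<in> \<Omega> \<and> s' h (s h x) = x" by (rule s[OF r c x])
      show "s' h x \<in> \<Omega> \<and> s h (s' h x) = x" by (rule s'[OF r c x])
      assume "rv r u x ~= 0"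
      then have "x \<in> B r" by (simp add: B_def)
      then show "x \<in> B r \<and> (s h x, v) \<in> A" unfolding A_def using r c by blast
    qed (use finA AO B[OF r] in auto)
  qed
  also have "... = 0" using H B by (intro sum.neutral ballI) (simp add: subset_iff)
  finally have z: "pairing (Lap u) H = 0" .
  have fu: "finite_supp u" "finite_supp (Contr u)" by (rule FS_supp[OF u], rule FS_supp[OF Contr_FS[OF u]])
  define C where "C = {y. u y ~= 0} \<union> {y. Lap u y ~= 0}"
  have C: "finite C" using fu FS_supp[OF finite_supp_Lap[OF u]] by (simp add: C_def finite_supp_def)
  have "pairing (Contr u) H = (\<Sum>y\<in>C. Contr u y * H y)"
    using C fu(2) by (intro pairing_eq) (auto simp: C_def Contr_eq[OF u])
  also have "... = (\<Sum>y\<in>C. u y * H y) - (\<Sum>y\<in>C. Lap u y * H y) / rule_bound W"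
    by (simp add: Contr_eq[OF u] left_diff_distrib sum_subtractf sum_divide_distrib)
  also have "(\<Sum>y\<in>C. u y * H y) = pairing u H"
    using C fu(1) by (intro pairing_eq[symmetric]) (auto simp: C_def)
  also have "(\<Sum>y\<in>C. Lap u y * H y) = pairing (Lap u) H"
    using C FS_supp[OF finite_supp_Lap[OF u]] by (intro pairing_eq[symmetric]) (auto simp: C_def)
  finally show ?thesis using z by simp
qed

text \<open>A function in the kernel of all rules is orthogonal to the image of the Laplacian, so each of its
  values is its pairing with every iterate of the contraction on a point mass.\<close>

lemma kernel_value_bound:
  fixes H :: "'x \<times> 'v => real"
  assumes y: "y \<in> \<Omega> \<times> V" and H: "\<And>r x. r \<in> W ==> x \<in> \<Omega> ==> rule_eval s r H x = 0"
  shows "\<exists>A. finite A \<and> A \<subseteq> \<Omega> \<times> V \<and> (H y)\<^sup>2 <= moment y (2 * k) * (\<Sum>a\<in>A. (H a)\<^sup>2)"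
proof -
  define z where "z = (Contr ^^ k) (point_mass y)"
  have z: "z \<in> FS" unfolding z_def by (rule Contr_pow_FS[OF point_mass_FS[OF y]])
  have "pairing ((Contr ^^ j) (point_mass y)) H = H y" for j
  proof (induction j)
    case 0
    show ?case by (simp add: pairing_point_mass)
  next
    case (Suc j)
    then show ?case using pairing_Contr_kernel[OF Contr_pow_FS[OF point_mass_FS[OF y]] H] by simp
  qed
  then have Hy: "H y = (\<Sum>a | z a ~= 0. z a * H a)" by (simp add: z_def pairing_def)
  have "(\<Sum>a | z a ~= 0. z a * H a)\<^sup>2 <= (\<Sum>a | z a ~= 0. (z a)\<^sup>2) * (\<Sum>a | z a ~= 0. (H a)\<^sup>2)"
    by (rule Cauchy_Schwarz_ineq_sum)
  also have "(\<Sum>a | z a ~= 0. (z a)\<^sup>2) = moment y (2 * k)"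
    using pairing_iterates[OF y, of k k] by (simp add: pairing_def z_def power2_eq_square mult_2)
  finally show ?thesis using z Hy by (intro exI[of _ "{a. z a ~= 0}"]) (auto simp: FS_def finite_supp_def)
qed

end

section \<open>Harmonic cochains\<close>

lemma cochains_add_scale:
  assumes "f \<in> cochains L p" "g \<in> cochains L p"
  shows "(\<lambda>x. f x + c * g x) \<in> cochains L p"
  using assms by (simp add: cochains_def distrib_left mult.left_commute)

lemma coboundary_add_scale:
  "coboundary L p (\<lambda>x. f x + c * g x) xs = coboundary L p f xs + c * coboundary L p g xs"
  by (simp add: coboundary_def sum.distrib sum_distrib_left algebra_simps)

lemma cochains_tendsto:
  assumes m: "\<And>k. m k \<in> cochains L p" and lim: "\<And>xs. (\<lambda>k. m k xs) \<longlonglongrightarrow> (f xs :: complex)"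
  shows "f \<in> cochains L p"
  unfolding cochains_def
proof (intro CollectI conjI allI impI ballI)
  fix xs assume "xs \<notin> ordered_simplices L p"
  then have "(\<lambda>k. m k xs) = (\<lambda>k. 0)" using cochainsD(1)[OF m] by auto
  then show "f xs = 0" using LIMSEQ_unique[OF lim[of xs], of 0] by simp
next
  fix xs \<pi> assume xs: "xs \<in> ordered_simplices L p" and \<pi>: "\<pi> permutes {..<length xs}"
  have "(\<lambda>k. m k (permute_list \<pi> xs)) \<longlonglongrightarrow> of_int (sign \<pi>) * f xs"
    unfolding cochainsD(2)[OF m xs \<pi>] by (intro tendsto_intros lim)
  from LIMSEQ_unique[OF lim this] show "f (permute_list \<pi> xs) = of_int (sign \<pi>) * f xs" .
qed

lemma coboundary_tendsto:
  assumes "\<And>xs. (\<lambda>k. m k xs) \<longlonglongrightarrow> (f xs :: complex)"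
  shows "(\<lambda>k. coboundary L p (m k) xs) \<longlonglongrightarrow> coboundary L p f xs"
  by (cases "xs \<in> ordered_simplices L p") (auto simp: coboundary_def intro!: tendsto_intros assms)

context free_complex
begin

abbreviation simplex_type :: "nat => 'v list => 'v list \<times> (nat => nat)" where
  "simplex_type p xs \<equiv> (snd (cof p xs), prm p xs)"

abbreviation simplex_types :: "nat => ('v list \<times> (nat => nat)) set" where
  "simplex_types p \<equiv> reps p \<times> {\<pi>. \<pi> permutes {..<Suc p}}"

lemma simplex_type_in: "xs \<in> simplices p ==> simplex_type p xs \<in> simplex_types p"
  using cof prm by auto

lemma simplex_as_translate:
  assumes xs: "xs \<in> simplices p"
  shows "xs = map (\<alpha> (inv (fst (cof p xs)))) (permute_list (prm p xs) (snd (cof p xs)))"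
    "permute_list (prm p xs) (snd (cof p xs)) \<in> simplices p"
proof -
  have v: "snd (cof p xs) \<in> simplices p" by (rule reps_simplices[OF cof(2)[OF xs]])
  have \<pi>: "prm p xs permutes {..<length (snd (cof p xs))}" using prm(1)[OF xs] simplexD[OF v] by simp
  show "permute_list (prm p xs) (snd (cof p xs)) \<in> simplices p" by (rule permute_ordered_simplices[OF v \<pi>])
  show "xs = map (\<alpha> (inv (fst (cof p xs)))) (permute_list (prm p xs) (snd (cof p xs)))"
    unfolding permute_list_map[OF \<pi>, symmetric] cd_def[symmetric] by (rule prm(2)[OF xs, symmetric])
qed

lemma face_inj:
  assumes xs: "xs \<in> simplices (Suc q)" and ys: "ys \<in> simplices (Suc q)"
    and t: "simplex_type (Suc q) xs = simplex_type (Suc q) ys" and j: "j <= Suc q" and f: "face j xs = face j ys"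
  shows "xs = ys"
proof -
  define w where "w = permute_list (prm (Suc q) xs) (snd (cof (Suc q) xs))"
  define g h where "g = inv (fst (cof (Suc q) xs))" and "h = inv (fst (cof (Suc q) ys))"
  have w: "w \<in> simplices (Suc q)" "xs = map (\<alpha> g) w" "ys = map (\<alpha> h) w"
    using simplex_as_translate[OF xs] simplex_as_translate[OF ys] t by (auto simp: w_def g_def h_def)
  have "map (\<alpha> g) (face j w) = map (\<alpha> h) (face j w)" using f unfolding w(2,3) face_map .
  then have "\<alpha> g ` set (face j w) = \<alpha> h ` set (face j w)" by (metis set_map)
  then have "g = h"
    using \<alpha>_free[of g h "set (face j w)"] simplexD[OF face_ordered_simplices[OF L w(1) j]] cof(1)[OF xs] cof(1)[OF ys]
    by (simp add: g_def h_def)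
  then show ?thesis using w by simp
qed

lemma finite_simplex_types: "finite (reps p) ==> finite (simplex_types p)"
  by (simp add: finite_permutations)

text \<open>The coboundary is bounded on square-summable cochains, since the simplices of one type have
  different \<open>j\<close>-th faces.\<close>

lemma l2_face:
  assumes fin: "finite (reps (Suc q))" and f: "f \<in> l2_space (simplices q)" and j: "j <= Suc q"
  shows "(\<lambda>xs. if xs \<in> simplices (Suc q) then f (face j xs) else 0) \<in> l2_space (simplices (Suc q))"
    (is "?h \<in> l2_space ?S")
proof -
  let ?T = "simplex_types (Suc q)"
  define B where "B = (l2_norm (simplices q) f)\<^sup>2"
  have b: "cmod_L2 ?h F <= sqrt (real (card ?T) * B)" if F: "finite F" "F \<subseteq> ?S" for F
  proof -
    have one: "(\<Sum>xs\<in>{xs \<in> F. simplex_type (Suc q) xs = c}. (cmod (?h xs))\<^sup>2) <= B" for c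
    proof -
      let ?Fc = "{xs \<in> F. simplex_type (Suc q) xs = c}"
      have inj: "inj_on (face j) ?Fc"
        by (rule inj_onI) (use F(2) j in \<open>auto intro: face_inj\<close>)
      have sub: "face j ` ?Fc \<subseteq> simplices q"
        using F(2) face_ordered_simplices[OF L _ j] by blast
      have "(\<Sum>xs\<in>?Fc. (cmod (?h xs))\<^sup>2) = (\<Sum>xs\<in>?Fc. (cmod (f (face j xs)))\<^sup>2)"
        using F(2) by (intro sum.cong refl) auto
      also have "... = (\<Sum>ys\<in>face j ` ?Fc. (cmod (f ys))\<^sup>2)" by (rule sum.reindex[OF inj, symmetric, unfolded o_def])
      also have "... = (cmod_L2 f (face j ` ?Fc))\<^sup>2" by (simp add: L2_set_def sum_nonneg)
      also have "... <= B"
        unfolding B_def using F(1) by (intro power_mono cmod_L2_le_norm[OF f _ sub]) auto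
      finally show ?thesis .
    qed
    have "(\<Sum>xs\<in>F. (cmod (?h xs))\<^sup>2) = (\<Sum>c\<in>?T. \<Sum>xs\<in>{xs \<in> F. simplex_type (Suc q) xs = c}. (cmod (?h xs))\<^sup>2)"
    proof (rule sum.group[symmetric, OF F(1) finite_simplex_types[OF fin]])
      show "simplex_type (Suc q) ` F \<subseteq> ?T" using F(2) simplex_type_in by blast
    qed
    also have "... <= (\<Sum>c\<in>?T. B)" by (rule sum_mono) (rule one)
    finally show ?thesis unfolding L2_set_def by (intro real_sqrt_le_mono) simp
  qed
  show ?thesis by (rule l2_spaceI(1)[OF _ b]) auto
qed

lemma l2_coboundary:
  assumes fin: "finite (reps (Suc q))" and f: "f \<in> l2_space (simplices q)"
  shows "coboundary L (Suc q) f \<in> l2_space (simplices (Suc q))"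
proof -
  have "(\<lambda>xs. \<Sum>j\<in>{..Suc q}. (-1) ^ j * (if xs \<in> simplices (Suc q) then f (face j xs) else 0)) \<in> l2_space (simplices (Suc q))"
    by (intro l2_space_sum l2_space_scale(1) l2_face fin f) auto
  also have "(\<lambda>xs. \<Sum>j\<in>{..Suc q}. (-1) ^ j * (if xs \<in> simplices (Suc q) then f (face j xs) else 0)) = coboundary L (Suc q) f"
    by (simp add: coboundary_face fun_eq_iff del: sum.atMost_Suc)
  finally show ?thesis .
qed

lemma l2_coboundaries_subset:
  assumes fin: "finite (reps (Suc q))"
  shows "l2_coboundaries L (Suc q) \<subseteq> l2_cochains L (Suc q)"
  using l2_coboundary[OF fin] coboundary_in_cochains[OF L] by (auto simp: l2_coboundaries_def l2_cochains_def)

definition rel_cocycles :: "'v set set => nat => ('v list => complex) set" where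
  "rel_cocycles K p = {f \<in> l2_cochains L p. coboundary K (Suc p) f = (\<lambda>xs. 0)}"

text \<open>The cocycles on \<open>K\<close> orthogonal to the coboundaries. Their dimension is that
  of the closure of the image of the reduced cohomology of \<open>K\<close> in the one of a smaller
  subcomplex, if that contains the \<open>p\<close>-skeleton of \<open>L\<close>.\<close>

definition harmonic :: "'v set set => nat => ('v list => complex) set" where
  "harmonic K p = rel_cocycles K p \<inter> l2_orthogonal (simplices p) (closed_coboundaries L p)"

lemma rel_cocycles_closed: "l2_closure (simplices p) (rel_cocycles K p) \<subseteq> rel_cocycles K p"
proof
  fix f assume f: "f \<in> l2_closure (simplices p) (rel_cocycles K p)"
  have sub: "rel_cocycles K p \<subseteq> l2_space (simplices p)" by (auto simp: rel_cocycles_def l2_cochains_def)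
  obtain m where m: "\<And>k. m k \<in> rel_cocycles K p" "\<And>x. (\<lambda>k. m k x) \<longlonglongrightarrow> f x"
    using l2_closure_sequence[OF f sub] by blast
  have "f \<in> cochains L p" by (rule cochains_tendsto[OF _ m(2)]) (use m(1) in \<open>simp add: rel_cocycles_def l2_cochains_def\<close>)
  moreover have "f \<in> l2_space (simplices p)" using f by (simp add: l2_closure_def)
  moreover have "coboundary K (Suc p) f xs = 0" for xs
  proof -
    have "(\<lambda>k. coboundary K (Suc p) (m k) xs) \<longlonglongrightarrow> coboundary K (Suc p) f xs" by (rule coboundary_tendsto[OF m(2)])
    moreover have "(\<lambda>k. coboundary K (Suc p) (m k) xs) = (\<lambda>k. 0)" using m(1) by (simp add: rel_cocycles_def)
    ultimately show ?thesis by (simp add: LIMSEQ_const_iff)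
  qed
  ultimately show "f \<in> rel_cocycles K p" by (auto simp: rel_cocycles_def l2_cochains_def)
qed

lemma rel_cocycles_lin:
  assumes "f \<in> rel_cocycles K p" "g \<in> rel_cocycles K p"
  shows "(\<lambda>x. f x + c * g x) \<in> rel_cocycles K p"
proof -
  have "coboundary K (Suc p) (\<lambda>x. f x + c * g x) xs = 0" for xs
    using assms by (simp add: coboundary_add_scale rel_cocycles_def)
  then show ?thesis
    using assms by (auto simp: rel_cocycles_def l2_cochains_def intro: cochains_add_scale l2_space_add(1) l2_space_scale(1))
qed

lemma harmonic_closed_subspace: "l2_closed_subspace (simplices p) (harmonic K p)"
proof -
  let ?S = "simplices p"
  have sub: "harmonic K p \<subseteq> l2_space ?S" by (auto simp: harmonic_def l2_orthogonal_def)
  have bS: "b \<in> l2_space ?S" if "b \<in> closed_coboundaries L p" for b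
    using that by (simp add: closed_coboundaries_def l2_closure_def)
  have zero: "(\<lambda>x. 0) \<in> harmonic K p"
    by (auto simp: cochains_def harmonic_def rel_cocycles_def l2_cochains_def l2_orthogonal_def l2_space_def l2_inner_def coboundary_def)
  have lin: "(\<lambda>x. f x + c * g x) \<in> harmonic K p" if f: "f \<in> harmonic K p" and g: "g \<in> harmonic K p" for f g c
  proof -
    have "l2_inner ?S (\<lambda>x. f x + c * g x) b = 0" if b: "b \<in> closed_coboundaries L p" for b
    proof -
      have "l2_inner ?S (\<lambda>x. f x + c * g x) b = l2_inner ?S f b + c * l2_inner ?S g b"
        using f g sub bS[OF b] by (subst l2_inner_add) (auto simp: l2_inner_scale intro: l2_space_scale(1))
      then show ?thesis using f g b by (simp add: harmonic_def l2_orthogonal_def)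
    qed
    then show ?thesis
      using f g sub rel_cocycles_lin[of f K p g c] l2_space_add(1)[OF _ l2_space_scale(1), of f ?S g c]
      by (auto simp: harmonic_def l2_orthogonal_def)
  qed
  have "f \<in> harmonic K p" if f: "f \<in> l2_closure ?S (harmonic K p)" for f
  proof -
    obtain m where m: "\<And>k. m k \<in> harmonic K p" "\<And>b. b \<in> l2_space ?S ==> (\<lambda>k. l2_inner ?S (m k) b) \<longlonglongrightarrow> l2_inner ?S f b"
      using l2_closure_sequence[OF f sub] by blast
    have "f \<in> l2_closure ?S (rel_cocycles K p)" using f unfolding l2_closure_def harmonic_def by blast
    then have "f \<in> rel_cocycles K p" using rel_cocycles_closed by blast
    moreover have "l2_inner ?S f b = 0" if b: "b \<in> closed_coboundaries L p" for b
    proof -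
      have "(\<lambda>k. l2_inner ?S (m k) b) = (\<lambda>k. 0)" using m(1) b by (auto simp: harmonic_def l2_orthogonal_def)
      then show ?thesis using m(2)[OF bS[OF b]] by (simp add: LIMSEQ_const_iff)
    qed
    moreover have "f \<in> l2_space ?S" using f by (simp add: l2_closure_def)
    ultimately show ?thesis by (simp add: harmonic_def l2_orthogonal_def)
  qed
  then show ?thesis unfolding l2_closed_subspace_def using sub zero lin by blast
qed

text \<open>Each simplex has \<open>(p + 1)!\<close> orderings.\<close>

lemma sum_over_simplices:
  assumes A: "finite A" "A \<subseteq> carrier G \<times> reps p"
  shows "finite {xs \<in> simplices p. cof p xs \<in> A}"
    "(\<Sum>xs\<in>{xs \<in> simplices p. cof p xs \<in> A}. \<phi> (cof p xs)) = fact (Suc p) * (\<Sum>y\<in>A. \<phi> y :: 'r::{comm_semiring_1,semiring_char_0})"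
proof -
  let ?\<Pi> = "{\<pi>. \<pi> permutes {..<Suc p}}"
  define \<Psi> where "\<Psi> = (\<lambda>(y, \<pi>). permute_list \<pi> (cd (fst y) (snd y)))"
  have P: "finite ?\<Pi>" "card ?\<Pi> = fact (Suc p)" by (simp_all add: finite_permutations card_permutations del: fact_Suc)
  have S: "\<Psi> (y, \<pi>) \<in> simplices p \<and> cof p (\<Psi> (y, \<pi>)) = y" if y: "y \<in> A" and \<pi>: "\<pi> \<in> ?\<Pi>" for y \<pi>
  proof -
    have g: "fst y \<in> carrier G" "snd y \<in> reps p" using y A by auto
    have c: "cd (fst y) (snd y) \<in> simplices p" by (rule cd_simplices[OF g(1) reps_simplices[OF g(2)]])
    show ?thesis
      using permute_ordered_simplices[OF c] prm_permute(1)[OF c] cof_cd(1)[OF g] \<pi> simplexD[OF c] by (simp add: \<Psi>_def)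
  qed
  have inj: "inj_on \<Psi> (A \<times> ?\<Pi>)"
  proof (rule inj_onI)
    fix a b assume a: "a \<in> A \<times> ?\<Pi>" and b: "b \<in> A \<times> ?\<Pi>" and e: "\<Psi> a = \<Psi> b"
    obtain y \<pi> y' \<pi>' where ab: "a = (y, \<pi>)" "b = (y', \<pi>')" by (cases a, cases b)
    have yy: "y = y'" using S[of y \<pi>] S[of y' \<pi>'] a b e ab by auto
    have g: "fst y \<in> carrier G" "snd y \<in> reps p" using a A ab by auto
    have c: "cd (fst y) (snd y) \<in> simplices p" by (rule cd_simplices[OF g(1) reps_simplices[OF g(2)]])
    have "\<pi> = \<pi>'"
      by (rule permute_list_inj[of "cd (fst y) (snd y)"]) (use simplexD[OF c] a b ab e yy in \<open>auto simp: \<Psi>_def\<close>)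
    then show "a = b" using ab yy by simp
  qed
  have img: "\<Psi> ` (A \<times> ?\<Pi>) = {xs \<in> simplices p. cof p xs \<in> A}"
  proof (intro equalityI subsetI)
    fix xs assume "xs \<in> \<Psi> ` (A \<times> ?\<Pi>)"
    then show "xs \<in> {xs \<in> simplices p. cof p xs \<in> A}" using S by auto
  next
    fix xs assume xs: "xs \<in> {xs \<in> simplices p. cof p xs \<in> A}"
    then have "xs = \<Psi> (cof p xs, prm p xs)" "prm p xs \<in> ?\<Pi>" using prm[of xs p] by (auto simp: \<Psi>_def)
    then show "xs \<in> \<Psi> ` (A \<times> ?\<Pi>)" using xs by blast
  qed
  show "finite {xs \<in> simplices p. cof p xs \<in> A}"
    unfolding img[symmetric] using A(1) P(1) by blast
  have "(\<Sum>xs\<in>{xs \<in> simplices p. cof p xs \<in> A}. \<phi> (cof p xs)) = (\<Sum>a\<in>A \<times> ?\<Pi>. \<phi> (cof p (\<Psi> a)))"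
    unfolding img[symmetric] using sum.reindex[OF inj] by (simp add: o_def)
  also have "... = (\<Sum>(y, \<pi>)\<in>A \<times> ?\<Pi>. \<phi> y)"
    using S by (intro sum.cong refl) auto
  also have "... = (\<Sum>y\<in>A. \<Sum>\<pi>\<in>?\<Pi>. \<phi> y)" by (rule sum.cartesian_product[symmetric])
  also have "... = fact (Suc p) * (\<Sum>y\<in>A. \<phi> y)" by (simp add: P(2) sum_distrib_left del: fact_Suc)
  finally show "(\<Sum>xs\<in>{xs \<in> simplices p. cof p xs \<in> A}. \<phi> (cof p xs)) = fact (Suc p) * (\<Sum>y\<in>A. \<phi> y)" .
qed

lemma orientation_square: "xs \<in> simplices p ==> orientation p xs * orientation p xs = 1"
  unfolding orientation_def by (simp add: sign_def)

lemma cochain_value: "f \<in> cochains L p ==> xs \<in> simplices p ==> f xs = of_int (orientation p xs) * coords f (cof p xs)"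
  using cochain_decode[of f p xs] by (simp add: coords_def case_prod_beta)

lemma cochain_norm_bound:
  assumes f: "f \<in> l2_cochains L p" and A: "finite A" "A \<subseteq> carrier G \<times> reps p"
  shows "fact (Suc p) * (\<Sum>y\<in>A. (cmod (coords f y))\<^sup>2) <= (l2_norm (simplices p) f)\<^sup>2"
proof -
  let ?X = "{xs \<in> simplices p. cof p xs \<in> A}"
  have fc: "f \<in> cochains L p" "f \<in> l2_space (simplices p)" using f by (auto simp: l2_cochains_def)
  have "fact (Suc p) * (\<Sum>y\<in>A. (cmod (coords f y))\<^sup>2) = (\<Sum>xs\<in>?X. (cmod (coords f (cof p xs)))\<^sup>2)"
    by (rule sum_over_simplices(2)[OF A, symmetric])
  also have "... = (\<Sum>xs\<in>?X. (cmod (f xs))\<^sup>2)"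
  proof (intro sum.cong refl)
    fix xs assume xs: "xs \<in> ?X"
    have "cmod (of_int (orientation p xs)) = 1" by (simp add: orientation_def sign_def)
    then show "(cmod (coords f (cof p xs)))\<^sup>2 = (cmod (f xs))\<^sup>2" using cochain_value[OF fc(1), of xs] xs by (simp add: norm_mult)
  qed
  also have "... = (cmod_L2 f ?X)\<^sup>2" by (simp add: L2_set_def sum_nonneg)
  also have "... <= (l2_norm (simplices p) f)\<^sup>2"
    using sum_over_simplices(1)[OF A] by (intro power_mono cmod_L2_le_norm[OF fc(2)]) auto
  finally show ?thesis .
qed

text \<open>The transpose of the coboundary as a family of rules: \<open>adj_rule q w\<close> collects the coefficients
  with which the coordinate \<open>w\<close> enters the coboundaries of all \<open>Suc q\<close>-simplices.\<close>

definition adj_rule :: "nat => 'v list => (int \<times> 'g \<times> 'v list) list" where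
  "adj_rule q w = concat (map (\<lambda>v. map (\<lambda>(c, h, w'). (c, inv h, v)) (filter (\<lambda>(c, h, w'). w' = w) (face_rule q v)))
     (SOME vs. set vs = reps (Suc q) \<and> distinct vs))"

lemma adj_rule_list:
  assumes "finite (reps (Suc q))"
  shows "set (SOME vs. set vs = reps (Suc q) \<and> distinct vs) = reps (Suc q) \<and> distinct (SOME vs. set vs = reps (Suc q) \<and> distinct vs)"
  by (rule someI_ex) (use finite_distinct_list[OF assms] in blast)

lemma adj_rule_elems:
  assumes fin: "finite (reps (Suc q))" and e: "(c, h, v) \<in> set (adj_rule q w)"
  shows "h \<in> carrier G" "v \<in> reps (Suc q)"
proof -
  obtain h' where v: "v \<in> reps (Suc q)" and "(c, h', w) \<in> set (face_rule q v)" "h = inv h'"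
    using e adj_rule_list[OF fin] unfolding adj_rule_def by auto
  then show "h \<in> carrier G" "v \<in> reps (Suc q)" using face_rule_elems(1)[OF reps_simplices[OF v]] by auto
qed

lemma rule_eval_adj_rule:
  fixes F :: "'x \<times> 'v list => 'k::comm_ring_1"
  assumes fin: "finite (reps (Suc q))"
  shows "rule_eval s (adj_rule q w) F x
    = (\<Sum>v\<in>reps (Suc q). rule_adj (\<lambda>h. s (inv h)) (face_rule q v) (\<lambda>g. F (g, v)) (x, w))"
proof -
  define vs where "vs = (SOME vs. set vs = reps (Suc q) \<and> distinct vs)"
  have vs: "set vs = reps (Suc q)" "distinct vs" using adj_rule_list[OF fin] by (auto simp: vs_def)
  have one: "(\<Sum>(c, h, v)\<leftarrow>map (\<lambda>(c, h, w'). (c, inv h, v)) (filter (\<lambda>(c, h, w'). w' = w) r). of_int c * F (s h x, v))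
      = rule_adj (\<lambda>h. s (inv h)) r (\<lambda>g. F (g, v)) (x, w)" for r and v :: "'v list"
    unfolding rule_adj_def by (induction r) auto
  have cc: "sum_list (map \<phi> (concat (map \<psi> us))) = (\<Sum>v\<leftarrow>us. sum_list (map \<phi> (\<psi> v)))"
    for \<phi> :: "int \<times> 'g \<times> 'v list => 'k" and \<psi> :: "'v list => (int \<times> 'g \<times> 'v list) list" and us
    by (induction us) simp_all
  have "rule_eval s (adj_rule q w) F x
      = (\<Sum>v\<leftarrow>vs. rule_adj (\<lambda>h. s (inv h)) (face_rule q v) (\<lambda>g. F (g, v)) (x, w))"
    unfolding rule_eval_def adj_rule_def vs_def[symmetric] cc one ..
  then show ?thesis by (simp only: sum_list_distinct_conv_sum_set[OF vs(2)] vs(1))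
qed

text \<open>A cochain orthogonal to all coboundaries is annihilated by the transpose of the coboundary, as
  one sees by testing against the coboundaries of the basis cochains.\<close>

lemma orthogonal_imp_adj_rule_zero:
  fixes f :: "'v list => complex"
  assumes fin: "finite (reps (Suc q))" and f: "f \<in> cochains L (Suc q)"
    and o: "f \<in> l2_orthogonal (simplices (Suc q)) (closed_coboundaries L (Suc q))"
    and w: "w \<in> reps q" and x: "x \<in> carrier G"
  shows "rule_eval (\<otimes>) (adj_rule q w) (coords f) x = 0"
proof -
  let ?S = "simplices (Suc q)" and ?R = "reps (Suc q)"
  define e where "e = lift q (point_mass (x, w) :: _ => complex)"
  define b where "b = coboundary L (Suc q) e"
  define \<beta> where "\<beta> y = rule_eval (\<otimes>) (face_rule q (snd y)) (point_mass (x, w) :: _ => complex) (fst y)" for y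
  have ec: "e \<in> cochains L q" unfolding e_def by (rule lift_in_cochains)
  have bc: "b \<in> cochains L (Suc q)" unfolding b_def by (rule coboundary_in_cochains[OF L ec])
  have "finite {xs. e xs ~= 0}"
    by (rule finite_subset[OF _ sum_over_simplices(1)[of "{(x, w)}" q]])
      (use x w in \<open>auto simp: e_def lift_def point_mass_def split: if_splits\<close>)
  then have el: "e \<in> l2_cochains L q"
    using ec cochainsD(1)[OF ec] by (auto simp: l2_cochains_def intro: l2_space_finite_support)
  have "b \<in> l2_coboundaries L (Suc q)" using el by (simp add: l2_coboundaries_def b_def)
  moreover have bl: "b \<in> l2_space ?S" unfolding b_def using el by (intro l2_coboundary fin) (simp add: l2_cochains_def)
  moreover have "l2_norm ?S (\<lambda>x. b x - b x) = 0" by (simp add: l2_norm_def)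
  ultimately have "b \<in> closed_coboundaries L (Suc q)" unfolding closed_coboundaries_def l2_closure_def by force
  then have i0: "l2_inner ?S f b = 0" using o by (simp add: l2_orthogonal_def)
  have b\<beta>: "coords b (g, v) = \<beta> (g, v)" if "g \<in> carrier G" "v \<in> ?R" for g v
  proof -
    have "coords b (g, v) = b (cd g v)" by (simp add: coords_def)
    also have "... = rule_eval (\<otimes>) (face_rule q v) (coords e) g"
      unfolding b_def by (rule face_rule_eval[OF ec reps_simplices[OF that(2)] that(1), symmetric])
    also have "... = \<beta> (g, v)"
      unfolding e_def \<beta>_def fst_conv snd_conv by (rule rule_eval_coords_lift[OF reps_simplices[OF that(2)] that(1)])
    finally show ?thesis .
  qed
  define Y where "Y = (\<Union>v\<in>?R. \<Union>(c, h, w')\<in>set (face_rule q v). {(inv h \<otimes> x, v)})"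
  have YI: "(g, v) \<in> Y" if v: "v \<in> ?R" and g: "g \<in> carrier G" and r: "(c, h, w') \<in> set (face_rule q v)"
    and p: "point_mass (x, w) (h \<otimes> g, w') ~= (0 :: complex)" for g v c h w'
  proof -
    have "h \<otimes> g = x" using p by (simp add: point_mass_def split: if_splits)
    then have "g = inv h \<otimes> x" using face_rule_elems(1)[OF reps_simplices[OF v] r] g by (metis inv_closed inv_inv inv_solve_left x)
    then show ?thesis using v r unfolding Y_def by blast
  qed
  have Y: "y \<in> Y" if y: "y \<in> carrier G \<times> ?R" "\<beta> y ~= 0" for y
  proof -
    obtain g v where gv: "y = (g, v)" "g \<in> carrier G" "v \<in> ?R" using y(1) by blast
    then obtain c h w' where "(c, h, w') \<in> set (face_rule q v)" "(point_mass (x, w) (h \<otimes> g, w') :: complex) ~= 0"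
      using y(2) unfolding \<beta>_def by (auto elim: rule_eval_nonzeroE)
    then show ?thesis using YI gv by blast
  qed
  have finY: "finite Y" unfolding Y_def using fin by auto
  have YG: "Y \<subseteq> carrier G \<times> ?R"
    unfolding Y_def using face_rule_elems(1)[OF reps_simplices] x by fastforce
  have "l2_inner ?S f b = (\<Sum>xs\<in>{xs \<in> ?S. cof (Suc q) xs \<in> Y}. f xs * cnj (b xs))"
  proof (rule l2_inner_finite_support[OF sum_over_simplices(1)[OF finY YG]])
    fix xs assume xs: "xs \<in> ?S - {xs \<in> ?S. cof (Suc q) xs \<in> Y}"
    then have "\<beta> (cof (Suc q) xs) = 0" using cof[of xs "Suc q"] Y[of "cof (Suc q) xs"] by (auto simp: mem_Times_iff)
    then show "f xs * cnj (b xs) = 0"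
      using xs cochain_value[OF bc, of xs] b\<beta>[of "fst (cof (Suc q) xs)" "snd (cof (Suc q) xs)"] cof[of xs "Suc q"] by simp
  qed auto
  also have "... = (\<Sum>xs\<in>{xs \<in> ?S. cof (Suc q) xs \<in> Y}. coords f (cof (Suc q) xs) * \<beta> (cof (Suc q) xs))"
  proof (intro sum.cong refl)
    fix xs assume "xs \<in> {xs \<in> ?S. cof (Suc q) xs \<in> Y}"
    then have xs: "xs \<in> ?S" by simp
    have c: "coords b (cof (Suc q) xs) = \<beta> (cof (Suc q) xs)"
      using b\<beta>[OF cof(1,2)[OF xs]] by simp
    have cnj\<beta>: "cnj (\<beta> y) = \<beta> y" for y
    proof -
      have "cnj (\<Sum>(c, h, v)\<leftarrow>r. of_int c * point_mass (x, w) (h \<otimes> g, v)) = (\<Sum>(c, h, v)\<leftarrow>r. of_int c * (point_mass (x, w) (h \<otimes> g, v) :: complex))" for r g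
        by (induction r) (auto simp: point_mass_def)
      then show ?thesis by (simp add: \<beta>_def rule_eval_def)
    qed
    have "f xs * cnj (b xs) = (of_int (orientation (Suc q) xs) * of_int (orientation (Suc q) xs)) * (coords f (cof (Suc q) xs) * \<beta> (cof (Suc q) xs))"
      unfolding cochain_value[OF f xs] cochain_value[OF bc xs] c by (simp add: cnj\<beta>)
    also have "of_int (orientation (Suc q) xs) * of_int (orientation (Suc q) xs) = (1 :: complex)"
      using orientation_square[OF xs] by (metis of_int_1 of_int_mult)
    finally show "f xs * cnj (b xs) = coords f (cof (Suc q) xs) * \<beta> (cof (Suc q) xs)" by simp
  qed
  also have "... = fact (Suc (Suc q)) * (\<Sum>y\<in>Y. coords f y * \<beta> y)" by (rule sum_over_simplices(2)[OF finY YG])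
  finally have z: "(\<Sum>y\<in>Y. coords f y * \<beta> y) = 0" using i0 by (metis fact_nonzero mult_eq_0_iff)
  define B where "B = fst ` Y"
  have B: "finite B" "B \<subseteq> carrier G" using finY YG by (auto simp: B_def)
  have "0 = (\<Sum>y\<in>B \<times> ?R. coords f y * \<beta> y)"
    unfolding z[symmetric] using B fin YG Y by (intro sum.mono_neutral_left) (force simp: B_def image_iff)+
  also have "... = (\<Sum>g\<in>B. \<Sum>v\<in>?R. coords f (g, v) * \<beta> (g, v))" by (simp add: sum.cartesian_product)
  also have "... = (\<Sum>v\<in>?R. \<Sum>g\<in>B. \<beta> (g, v) * coords f (g, v))" by (subst sum.swap) (simp add: mult.commute)
  also have "... = (\<Sum>v\<in>?R. rule_adj (\<lambda>h x. inv h \<otimes> x) (face_rule q v) (\<lambda>g. coords f (g, v)) (x, w))"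
  proof (intro sum.cong refl)
    fix v assume v: "v \<in> ?R"
    have "(\<Sum>g\<in>B. \<beta> (g, v) * coords f (g, v)) = (\<Sum>y\<in>{(x, w)}. point_mass (x, w) y * rule_adj (\<lambda>h x. inv h \<otimes> x) (face_rule q v) (\<lambda>g. coords f (g, v)) y)"
      unfolding \<beta>_def fst_conv snd_conv
    proof (rule sum_rule_eval_mult[where \<Omega> = "carrier G"])
      fix c h w' g assume r: "(c, h, w') \<in> set (face_rule q v)" and g: "g \<in> carrier G"
      have h: "h \<in> carrier G" by (rule face_rule_elems(1)[OF reps_simplices[OF v] r])
      show "h \<otimes> g \<in> carrier G \<and> inv h \<otimes> (h \<otimes> g) = g" "inv h \<otimes> g \<in> carrier G \<and> h \<otimes> (inv h \<otimes> g) = g"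
        using h g by (simp_all flip: m_assoc)
      assume p: "point_mass (x, w) (h \<otimes> g, w') ~= (0 :: complex)"
      then have hg: "(h \<otimes> g, w') = (x, w)" by (simp add: point_mass_def split: if_splits)
      show "g \<in> B \<and> (h \<otimes> g, w') \<in> {(x, w)}"
        using YI[OF v g r p] hg unfolding B_def by force
    qed (use B x in auto)
    then show "(\<Sum>g\<in>B. \<beta> (g, v) * coords f (g, v)) = rule_adj (\<lambda>h x. inv h \<otimes> x) (face_rule q v) (\<lambda>g. coords f (g, v)) (x, w)"
      by (simp add: point_mass_def)
  qed
  also have "... = rule_eval (\<otimes>) (adj_rule q w) (coords f) x" by (rule rule_eval_adj_rule[OF fin, symmetric])
  finally show ?thesis by simp
qed

definition laplace_rules :: "'v set set => nat => (int \<times> 'g \<times> 'v list) list set" where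
  "laplace_rules K q = face_rule (Suc q) ` {t \<in> reps (Suc (Suc q)). set t \<in> K} \<union> adj_rule q ` reps q"

lemma laplace_rules_elems:
  assumes fin: "finite (reps (Suc q))" and r: "r \<in> laplace_rules K q" "(c, h, v) \<in> set r"
  shows "h \<in> carrier G" "v \<in> reps (Suc q)"
  using r face_rule_elems[OF reps_simplices] adj_rule_elems[OF fin] unfolding laplace_rules_def by blast+

lemma harmonic_rule_zero:
  assumes fin: "finite (reps (Suc q))" and K: "K \<subseteq> L" "\<And>g s. g \<in> carrier G ==> s \<in> K ==> \<alpha> g ` s \<in> K"
    and f: "f \<in> harmonic K (Suc q)" and r: "r \<in> laplace_rules K q" and x: "x \<in> carrier G"
  shows "rule_eval (\<otimes>) r (coords f) x = 0"
proof -
  have fc: "f \<in> cochains L (Suc q)" "coboundary K (Suc (Suc q)) f = (\<lambda>xs. 0)"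
    "f \<in> l2_orthogonal (simplices (Suc q)) (closed_coboundaries L (Suc q))"
    using f by (auto simp: harmonic_def rel_cocycles_def l2_cochains_def)
  show ?thesis
    using r unfolding laplace_rules_def
  proof
    assume "r \<in> face_rule (Suc q) ` {t \<in> reps (Suc (Suc q)). set t \<in> K}"
    then show ?thesis using coboundary_subcomplex_zero_iff[OF fc(1) K] fc(2) x by blast
  next
    assume "r \<in> adj_rule q ` reps q"
    then show ?thesis using orthogonal_imp_adj_rule_zero[OF fin fc(1,3) _ x] by blast
  qed
qed

lemma laplace_rules_system:
  assumes "sofic_approximation G D \<sigma>" "finite (reps q)" "finite (reps (Suc q))"
    and "finite {t \<in> reps (Suc (Suc q)). set t \<in> K}"
  shows "sofic_rules G D \<sigma> (reps (Suc q)) (laplace_rules K q)"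
proof
  show "finite (laplace_rules K q)" using assms by (simp add: laplace_rules_def)
  fix r c h v assume "r \<in> laplace_rules K q" "(c, h, v) \<in> set r"
  from laplace_rules_elems[OF assms(3) this] show "h \<in> carrier G" "v \<in> reps (Suc q)" .
qed (use assms in auto)

abbreviation laplace_moment :: "'v set set => nat => 'v list => nat => real" where
  "laplace_moment K q v k \<equiv> perm_system.moment (carrier G) (reps (Suc q)) (\<otimes>) (\<lambda>h x. inv h \<otimes> x) (laplace_rules K q) (\<one>, v) k"

text \<open>The projection \<open>m\<close> of the point mass at \<open>s\<close> has value
  \<open>N\<close> at \<open>s\<close>, \<open>N\<close> its squared norm. As \<open>m\<close>
  solves the Laplace rules, \<open>kernel_value_bound\<close> bounds \<open>N\<^sup>2\<close> by the
  moment times \<open>N / (p + 1)!\<close>.\<close>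

lemma harmonic_trace_le:
  assumes sof: "sofic_approximation G D \<sigma>" and fin: "finite (reps q)" "finite (reps (Suc q))"
    and finK: "finite {t \<in> reps (Suc (Suc q)). set t \<in> K}"
    and K: "K \<subseteq> L" "\<And>g s. g \<in> carrier G ==> s \<in> K ==> \<alpha> g ` s \<in> K"
    and s: "s \<in> simplices (Suc q)"
  shows "Re (l2_proj (simplices (Suc q)) (harmonic K (Suc q)) (point_mass s) s)
    <= laplace_moment K q (snd (cof (Suc q) s)) (2 * k) / fact (Suc (Suc q))"
proof -
  interpret W: sofic_rules G D \<sigma> "reps (Suc q)" "laplace_rules K q" by (rule laplace_rules_system[OF sof fin finK])
  define m where "m = l2_proj (simplices (Suc q)) (harmonic K (Suc q)) (point_mass s)"
  define N where "N = (l2_norm (simplices (Suc q)) m)\<^sup>2"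
  define y where "y = cof (Suc q) s"
  define H where "H = (\<lambda>y. Re (coords m y))"
  have m: "m \<in> harmonic K (Suc q)" "m s = of_real N"
    using l2_proj_point_mass(1,2)[OF harmonic_closed_subspace s] by (simp_all add: m_def N_def)
  have ml: "m \<in> l2_cochains L (Suc q)" using m(1) by (simp add: harmonic_def rel_cocycles_def)
  have y: "y \<in> carrier G \<times> reps (Suc q)" using cof[OF s] by (simp add: y_def mem_Times_iff)
  have N0: "0 <= N" by (simp add: N_def)
  have H: "rule_eval (\<otimes>) r H x = 0" if "r \<in> laplace_rules K q" "x \<in> carrier G" for r x
  proof -
    have "Re (\<Sum>(c, h, v)\<leftarrow>r. of_int c * coords m (h \<otimes> x, v)) = (\<Sum>(c, h, v)\<leftarrow>r. of_int c * H (h \<otimes> x, v))" for r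
      by (induction r) (auto simp: H_def)
    then have "rule_eval (\<otimes>) r H x = Re (rule_eval (\<otimes>) r (coords m) x)" by (simp only: rule_eval_def)
    then show ?thesis using harmonic_rule_zero[OF fin(2) K m(1) that] by simp
  qed
  obtain A where A: "finite A" "A \<subseteq> carrier G \<times> reps (Suc q)" "(H y)\<^sup>2 <= W.grp.moment y (2 * k) * (\<Sum>a\<in>A. (H a)\<^sup>2)"
    using W.grp.kernel_value_bound[OF y H, of k] by blast
  have "m s = of_int (orientation (Suc q) s) * coords m y"
    using cochain_value[of m "Suc q" s] ml s by (simp add: l2_cochains_def y_def)
  then have "Re (of_real N) = Re (of_int (orientation (Suc q) s) * coords m y)" using m(2) by simp
  then have "N = of_int (orientation (Suc q) s) * H y" by (simp add: H_def)
  then have "N\<^sup>2 = (of_int (orientation (Suc q) s) * of_int (orientation (Suc q) s)) * (H y)\<^sup>2" by (simp add: power2_eq_square)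
  also have "of_int (orientation (Suc q) s) * of_int (orientation (Suc q) s) = (1 :: real)"
    using orientation_square[OF s] by (metis of_int_1 of_int_mult)
  finally have "N\<^sup>2 <= W.grp.moment y (2 * k) * (\<Sum>a\<in>A. (H a)\<^sup>2)" using A(3) by simp
  also have "(\<Sum>a\<in>A. (H a)\<^sup>2) <= (\<Sum>a\<in>A. (cmod (coords m a))\<^sup>2)"
    unfolding H_def by (intro sum_mono) (simp add: cmod_power2)
  also have "... <= N / fact (Suc (Suc q))"
    using cochain_norm_bound[OF ml A(1,2)] by (simp add: N_def field_simps del: fact_Suc)
  finally have "N\<^sup>2 <= W.grp.moment y (2 * k) * (N / fact (Suc (Suc q)))"
    using W.grp.moment_nonneg[OF y] by (simp add: mult_left_mono del: fact_Suc)
  then have NN: "N * N <= N * (W.grp.moment y (2 * k) / fact (Suc (Suc q)))" by (simp add: power2_eq_square mult_ac del: fact_Suc)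
  have "N <= W.grp.moment y (2 * k) / fact (Suc (Suc q))"
  proof (cases "N = 0")
    case True
    then show ?thesis using W.grp.moment_nonneg[OF y] by (simp del: fact_Suc)
  next
    case False
    then show ?thesis using NN N0 by (simp only: mult_le_cancel_left_pos)
  qed
  moreover have "W.grp.moment y (2 * k) = laplace_moment K q (snd y) (2 * k)"
    using W.moment_translate[of "fst y" "snd y" "2 * k"] y by auto
  ultimately show ?thesis using m(2) by (simp add: y_def m_def[symmetric] del: fact_Suc)
qed

abbreviation "lorbit \<equiv> orbit G (\<lambda>g. map (\<alpha> g))"

lemma lorbit:
  assumes s: "s \<in> simplices p"
  shows "s \<in> lorbit s" "lorbit s \<subseteq> simplices p"
    "t \<in> lorbit s ==> lorbit t = lorbit s"
proof -
  have sL: "set s \<in> L" using simplexD[OF s] by simp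
  show "s \<in> lorbit s" unfolding orbit_def using map_\<alpha>_one[OF sL] by force
  show "lorbit s \<subseteq> simplices p" unfolding orbit_def using map_\<alpha>_simplices[OF _ s] by blast
  assume "t \<in> lorbit s"
  then obtain g where g: "g \<in> carrier G" "t = map (\<alpha> g) s" unfolding orbit_def by blast
  have tL: "set t \<in> L" using simplexD[OF map_\<alpha>_simplices[OF g(1) s]] g(2) by simp
  have s': "s = map (\<alpha> (inv g)) t"
    unfolding g(2) using map_\<alpha>_mult[of "inv g" g s] g(1) sL by (simp add: map_\<alpha>_one del: map_map)
  have "map (\<alpha> h) t \<in> lorbit s" if "h \<in> carrier G" for h
    unfolding g(2) orbit_def using map_\<alpha>_mult[OF that g(1) sL] that g(1) by (auto simp del: map_map)
  moreover have "map (\<alpha> h) s \<in> lorbit t" if h: "h \<in> carrier G" for h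
  proof -
    have "map (\<alpha> h) s = map (\<alpha> (h \<otimes> inv g)) t"
      by (subst s', rule map_\<alpha>_mult) (use h g(1) tL in auto)
    then show ?thesis using h g(1) unfolding orbit_def by blast
  qed
  ultimately show "lorbit t = lorbit s" unfolding orbit_def by blast
qed

lemma lorbits:
  assumes "Q \<in> orbits G (simplices p) (\<lambda>g. map (\<alpha> g))"
  shows "Q ~= {}" "Q \<subseteq> simplices p" "(SOME s. s \<in> Q) \<in> simplices p" "Q = lorbit (SOME s. s \<in> Q)"
proof -
  obtain s where s: "s \<in> simplices p" "Q = lorbit s" using assms by (auto simp: orbits_def)
  show ne: "Q ~= {}" and sub: "Q \<subseteq> simplices p" using lorbit(1,2)[OF s(1)] s(2) by auto
  have some: "(SOME s. s \<in> Q) \<in> Q" using ne by (simp add: some_in_eq)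
  then show "(SOME s. s \<in> Q) \<in> simplices p" using sub by blast
  show "Q = lorbit (SOME s. s \<in> Q)" using lorbit(3)[OF s(1)] some s(2) by simp
qed

abbreviation harmonic_dim :: "'v set set => nat => real" where
  "harmonic_dim K p \<equiv> von_Neumann_dim G (\<lambda>g. map (\<alpha> g)) (simplices p) (harmonic K p)"

lemma harmonic_dim_eq:
  "harmonic_dim K p = (\<Sum>Q\<in>orbits G (simplices p) (\<lambda>g. map (\<alpha> g)).
    Re (l2_proj (simplices p) (harmonic K p) (point_mass (SOME s. s \<in> Q)) (SOME s. s \<in> Q)))"
  by (rule von_Neumann_dim_alt[OF harmonic_closed_subspace]) (use lorbits in blast)

lemma harmonic_dim_nonneg: "0 <= harmonic_dim K p"
  unfolding harmonic_dim_eq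
proof (intro sum_nonneg)
  fix Q assume "Q \<in> orbits G (simplices p) (\<lambda>g. map (\<alpha> g))"
  from l2_proj_point_mass(2)[OF harmonic_closed_subspace lorbits(3)[OF this]]
  show "0 <= Re (l2_proj (simplices p) (harmonic K p) (point_mass (SOME s. s \<in> Q)) (SOME s. s \<in> Q))" by simp
qed

lemma rel_cocycles_antimono:
  assumes "K \<subseteq> K'"
  shows "rel_cocycles K' p \<subseteq> rel_cocycles K p"
proof -
  have "coboundary K (Suc p) f = (\<lambda>xs. 0)" if f: "coboundary K' (Suc p) f = (\<lambda>xs. 0)" for f :: "'v list => complex"
  proof
    fix xs
    show "coboundary K (Suc p) f xs = 0"
    proof (cases "xs \<in> ordered_simplices K (Suc p)")
      case True
      then have "xs \<in> ordered_simplices K' (Suc p)" using assms by (auto simp: ordered_simplices_def)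
      then show ?thesis using True fun_cong[OF f, of xs] by (simp only: coboundary_face if_True)
    qed (simp add: coboundary_face)
  qed
  then show ?thesis unfolding rel_cocycles_def by blast
qed

lemma harmonic_dim_antimono:
  assumes "K \<subseteq> K'"
  shows "harmonic_dim K' p <= harmonic_dim K p"
proof -
  have "harmonic K' p \<subseteq> harmonic K p" unfolding harmonic_def using rel_cocycles_antimono[OF assms] by blast
  then show ?thesis
    unfolding harmonic_dim_eq by (intro sum_mono l2_proj_mono harmonic_closed_subspace) (use lorbits(3) in auto)
qed

text \<open>There is one orbit of ordered simplices for each representative and ordering, and
  \<open>harmonic_trace_le\<close> applies to each of them.\<close>

lemma harmonic_dim_le_moments:
  assumes sof: "sofic_approximation G D \<sigma>" and fin: "finite (reps q)" "finite (reps (Suc q))"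
    and finK: "finite {t \<in> reps (Suc (Suc q)). set t \<in> K}"
    and K: "K \<subseteq> L" "\<And>g s. g \<in> carrier G ==> s \<in> K ==> \<alpha> g ` s \<in> K"
  shows "harmonic_dim K (Suc q) <= (\<Sum>v\<in>reps (Suc q). laplace_moment K q v k)"
proof -
  interpret W: sofic_rules G D \<sigma> "reps (Suc q)" "laplace_rules K q" by (rule laplace_rules_system[OF sof fin finK])
  let ?S = "simplices (Suc q)"
  define Qs where "Qs = orbits G ?S (\<lambda>g. map (\<alpha> g))"
  define b where "b v = laplace_moment K q v (2 * k) / fact (Suc (Suc q))" for v
  define c where "c Q = simplex_type (Suc q) (SOME s. s \<in> Q)" for Q :: "'v list set"
  have inj: "inj_on c Qs"
  proof (rule inj_onI)
    fix Q Q' assume Q: "Q \<in> Qs" and Q': "Q' \<in> Qs" and e: "c Q = c Q'"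
    define s s' where "s = (SOME s. s \<in> Q)" and "s' = (SOME s. s \<in> Q')"
    have s: "s \<in> ?S" "s' \<in> ?S" "Q = lorbit s" "Q' = lorbit s'" using lorbits(3,4) Q Q' unfolding Qs_def s_def s'_def by auto
    define w where "w = permute_list (prm (Suc q) s) (snd (cof (Suc q) s))"
    have w: "w \<in> ?S" "s = map (\<alpha> (inv (fst (cof (Suc q) s)))) w" "s' = map (\<alpha> (inv (fst (cof (Suc q) s')))) w"
      using simplex_as_translate[OF s(1)] simplex_as_translate[OF s(2)] e by (auto simp: w_def c_def s_def[symmetric] s'_def[symmetric])
    have "s \<in> lorbit w" "s' \<in> lorbit w" using w(2,3) cof(1)[OF s(1)] cof(1)[OF s(2)] unfolding orbit_def by (auto simp del: map_eq_conv)
    then show "Q = Q'" using lorbit(3)[OF w(1)] s(3,4) by simp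
  qed
  have cT: "c ` Qs \<subseteq> simplex_types (Suc q)"
    unfolding c_def Qs_def using simplex_type_in[OF lorbits(3)] by blast
  have b0: "0 <= b v" if "v \<in> reps (Suc q)" for v
    using W.grp.moment_nonneg[of "(\<one>, v)"] that by (simp add: b_def)
  have "harmonic_dim K (Suc q) <= (\<Sum>Q\<in>Qs. b (fst (c Q)))"
    unfolding harmonic_dim_eq Qs_def[symmetric]
  proof (intro sum_mono)
    fix Q assume "Q \<in> Qs"
    then show "Re (l2_proj ?S (harmonic K (Suc q)) (point_mass (SOME s. s \<in> Q)) (SOME s. s \<in> Q)) <= b (fst (c Q))"
      unfolding b_def c_def fst_conv Qs_def by (intro harmonic_trace_le[OF sof fin finK K] lorbits(3))
  qed
  also have "... = (\<Sum>a\<in>c ` Qs. b (fst a))" by (rule sum.reindex[OF inj, symmetric, unfolded o_def])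
  also have "... <= (\<Sum>a\<in>simplex_types (Suc q). b (fst a))"
    by (rule sum_mono2[OF finite_simplex_types[OF fin(2)] cT]) (use b0 in auto)
  also have "... = (\<Sum>v\<in>reps (Suc q). \<Sum>\<pi>\<in>{\<pi>. \<pi> permutes {..<Suc (Suc q)}}. b v)"
    by (subst sum.cartesian_product) (simp add: case_prod_unfold)
  also have "... = (\<Sum>v\<in>reps (Suc q). laplace_moment K q v (2 * k))"
    by (simp add: b_def card_permutations del: fact_Suc)
  also have "... <= (\<Sum>v\<in>reps (Suc q). laplace_moment K q v k)"
    by (intro sum_mono W.grp.moment_antimono) auto
  finally show ?thesis .
qed

section \<open>The \<open>\<ell>\<^sup>2\<close>-Betti number\<close>

text \<open>Restriction from \<open>B\<close> to \<open>A\<close> leaves \<open>p\<close>-cochains unchanged when both have the \<open>p\<close>-skeleton of \<open>L\<close>, and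
  the cocycles on \<open>B\<close> form a closed subspace that contains the coboundaries. So the closure of the image
  of the restriction consists of their classes.\<close>

lemma Union_cohomology_closure:
  assumes fin: "finite (reps (Suc q))" and AB: "A \<subseteq> B" "B \<subseteq> L"
    and A: "\<And>r. r <= Suc q ==> ordered_simplices A r = simplices r"
    and B: "\<And>r. r <= Suc q ==> ordered_simplices B r = simplices r"
  shows "\<Union>(cohomology_closure A (Suc q) (restrict_class A (Suc q) ` reduced_cohomology B (Suc q))) = rel_cocycles B (Suc q)"
    and "closed_coboundaries A (Suc q) = closed_coboundaries L (Suc q)"
proof -
  let ?S = "simplices (Suc q)" and ?Z = "rel_cocycles B (Suc q)" and ?B = "closed_coboundaries L (Suc q)"
  have coch: "l2_cochains C r = l2_cochains L r" if "\<And>r. r <= Suc q ==> ordered_simplices C r = simplices r" "r <= Suc q" for C r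
    using that by (simp add: l2_cochains_def cochains_def)
  have cb: "closed_coboundaries C (Suc q) = ?B" if C: "\<And>r. r <= Suc q ==> ordered_simplices C r = simplices r" for C
  proof -
    have "coboundary C (Suc q) = (coboundary L (Suc q) :: ('v list => complex) => _)"
      using C[of "Suc q"] by (simp add: coboundary_def fun_eq_iff)
    then show ?thesis using coch[OF C, of q] C[of "Suc q"] by (simp add: closed_coboundaries_def l2_coboundaries_def)
  qed
  show cbA: "closed_coboundaries A (Suc q) = ?B" by (rule cb[OF A])
  have cbB: "closed_coboundaries B (Suc q) = ?B" by (rule cb[OF B])
  have zA: "l2_cocycles A (Suc q) = rel_cocycles A (Suc q)" and zB: "l2_cocycles B (Suc q) = ?Z"
    using coch[OF A, of "Suc q"] coch[OF B, of "Suc q"] by (auto simp: l2_cocycles_def rel_cocycles_def)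
  have ZA: "?Z \<subseteq> rel_cocycles A (Suc q)" by (rule rel_cocycles_antimono[OF AB(1)])
  have lin: "(\<lambda>x. f x + g x) \<in> ?Z" "(\<lambda>x. f x - g x) \<in> ?Z" if "f \<in> ?Z" "g \<in> ?Z" for f g
    using rel_cocycles_lin[OF that, of 1] rel_cocycles_lin[OF that, of "-1"] by simp_all
  have BZ: "?B \<subseteq> ?Z"
  proof -
    have "l2_coboundaries L (Suc q) \<subseteq> rel_cocycles L (Suc q)"
      using l2_coboundaries_subset[OF fin] coboundary_coboundary[OF L] by (auto simp: rel_cocycles_def l2_coboundaries_def)
    also have "... \<subseteq> ?Z" by (rule rel_cocycles_antimono[OF AB(2)])
    finally have "l2_coboundaries L (Suc q) \<subseteq> ?Z" .
    then have "?B \<subseteq> l2_closure ?S ?Z" unfolding closed_coboundaries_def l2_closure_def by blast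
    then show ?thesis using rel_cocycles_closed by blast
  qed
  have zero: "(\<lambda>xs. 0) \<in> ?B"
  proof -
    have "(\<lambda>xs. 0) \<in> l2_cochains L q" by (simp add: l2_cochains_def cochains_def l2_space_def)
    moreover have "coboundary L (Suc q) (\<lambda>xs. 0 :: complex) = (\<lambda>xs. 0)" by (simp add: coboundary_face fun_eq_iff)
    ultimately have "(\<lambda>xs. 0) \<in> l2_coboundaries L (Suc q)" unfolding l2_coboundaries_def by force
    then show ?thesis unfolding closed_coboundaries_def l2_closure_def by (force simp: l2_space_def l2_norm_def)
  qed
  have self: "z \<in> cohomology_class A (Suc q) z" "z \<in> cohomology_class B (Suc q) z" for z
    unfolding cohomology_class_def cbA cbB using zero by (force intro!: exI[of _ "\<lambda>xs. 0"])+
  have restr: "restrict_cochain A (Suc q) f = f" if "f \<in> ?Z" for f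
    using that A[of "Suc q"] cochainsD(1)[of f L "Suc q"]
    by (auto simp: restrict_cochain_def rel_cocycles_def l2_cochains_def fun_eq_iff)
  have classB: "c \<subseteq> ?Z" if "z \<in> ?Z" "c = cohomology_class B (Suc q) z \<or> c = cohomology_class A (Suc q) z" for c z
    using that lin(1)[OF that(1)] BZ by (auto simp: cohomology_class_def cbA cbB)
  have rc: "restrict_class A (Suc q) (cohomology_class B (Suc q) z) \<subseteq> ?Z" "z \<in> restrict_class A (Suc q) (cohomology_class B (Suc q) z)"
    if z: "z \<in> ?Z" for z
  proof -
    show "restrict_class A (Suc q) (cohomology_class B (Suc q) z) \<subseteq> ?Z"
    proof
      fix x assume "x \<in> restrict_class A (Suc q) (cohomology_class B (Suc q) z)"
      then obtain z' where z': "z' \<in> cohomology_class B (Suc q) z" "x \<in> cohomology_class A (Suc q) (restrict_cochain A (Suc q) z')"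
        unfolding restrict_class_def by blast
      have "z' \<in> ?Z" using classB[OF z] z'(1) by blast
      then show "x \<in> ?Z" using classB[of z'] restr[of z'] z'(2) by auto
    qed
    show "z \<in> restrict_class A (Suc q) (cohomology_class B (Suc q) z)"
      unfolding restrict_class_def using self(2)[of z] self(1)[of z] restr[OF z] by force
  qed
  have ZS: "?Z \<subseteq> l2_space ?S" "rel_cocycles A (Suc q) \<subseteq> l2_space ?S" by (auto simp: rel_cocycles_def l2_cochains_def)
  show "\<Union>(cohomology_closure A (Suc q) (restrict_class A (Suc q) ` reduced_cohomology B (Suc q))) = ?Z"
  proof (intro equalityI subsetI)
    fix x assume "x \<in> \<Union>(cohomology_closure A (Suc q) (restrict_class A (Suc q) ` reduced_cohomology B (Suc q)))"
    then obtain c where c: "x \<in> c" "c \<in> reduced_cohomology A (Suc q)"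
      and cl: "\<And>eps. 0 < eps ==> \<exists>c'\<in>restrict_class A (Suc q) ` reduced_cohomology B (Suc q). class_dist A (Suc q) c c' < eps"
      unfolding cohomology_closure_def by blast
    obtain z where z: "z \<in> rel_cocycles A (Suc q)" "c = cohomology_class A (Suc q) z"
      using c(2) unfolding reduced_cohomology_def zA by blast
    have "z \<in> l2_closure ?S ?Z"
      unfolding l2_closure_def
    proof (intro CollectI conjI allI impI)
      show "z \<in> l2_space ?S" using z(1) ZS by blast
      fix eps :: real assume "0 < eps"
      from cl[OF this] obtain z0 where z0: "z0 \<in> ?Z"
        and d: "class_dist A (Suc q) c (restrict_class A (Suc q) (cohomology_class B (Suc q) z0)) < eps"
        unfolding reduced_cohomology_def zB by blast
      define c' where "c' = restrict_class A (Suc q) (cohomology_class B (Suc q) z0)"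
      have "z \<in> c" "z0 \<in> c'" using self(1) z(2) rc(2)[OF z0] by (auto simp: c'_def)
      then have "{l2_norm ?S (\<lambda>xs. u xs - u' xs) |u u'. u \<in> c \<and> u' \<in> c'} ~= {}" by blast
      moreover have "Inf {l2_norm ?S (\<lambda>xs. u xs - u' xs) |u u'. u \<in> c \<and> u' \<in> c'} < eps"
        using d A[of "Suc q"] by (simp add: class_dist_def c'_def)
      ultimately obtain \<rho> where "\<rho> \<in> {l2_norm ?S (\<lambda>xs. u xs - u' xs) |u u'. u \<in> c \<and> u' \<in> c'}" "\<rho> < eps"
        by (rule cInf_lessD[THEN bexE])
      then obtain u u' where u: "u \<in> c" "u' \<in> c'" "l2_norm ?S (\<lambda>xs. u xs - u' xs) < eps" by blast
      obtain b where b: "b \<in> ?B" "u = (\<lambda>xs. z xs + b xs)" using u(1) z(2) by (auto simp: cohomology_class_def cbA)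
      have "u' \<in> ?Z" using u(2) rc(1)[OF z0] by (auto simp: c'_def)
      then have m: "(\<lambda>xs. u' xs - b xs) \<in> ?Z" using lin(2) b(1) BZ by blast
      have e: "(\<lambda>xs. z xs - (u' xs - b xs)) = (\<lambda>xs. u xs - u' xs)" by (auto simp: b(2))
      show "\<exists>m\<in>?Z. l2_norm ?S (\<lambda>xs. z xs - m xs) < eps"
        by (rule bexI[OF _ m]) (simp only: e u(3))
    qed
    then have "z \<in> ?Z" using rel_cocycles_closed by blast
    then show "x \<in> ?Z" using c(1) z(2) classB by blast
  next
    fix z assume z: "z \<in> ?Z"
    define c c' where "c = cohomology_class A (Suc q) z" and "c' = restrict_class A (Suc q) (cohomology_class B (Suc q) z)"
    have "c \<in> reduced_cohomology A (Suc q)" using z ZA by (auto simp: reduced_cohomology_def zA c_def)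
    moreover have "c' \<in> restrict_class A (Suc q) ` reduced_cohomology B (Suc q)"
      using z by (auto simp: reduced_cohomology_def zB c'_def)
    moreover have "class_dist A (Suc q) c c' <= 0"
    proof -
      have "z \<in> c" "z \<in> c'" using self(1) rc(2)[OF z] by (auto simp: c_def c'_def)
      then have "l2_norm (ordered_simplices A (Suc q)) (\<lambda>xs. z xs - z xs) \<in> {l2_norm (ordered_simplices A (Suc q)) (\<lambda>xs. u xs - u' xs) |u u'. u \<in> c \<and> u' \<in> c'}"
        by blast
      then have "class_dist A (Suc q) c c' <= l2_norm (ordered_simplices A (Suc q)) (\<lambda>xs. z xs - z xs)"
        unfolding class_dist_def by (rule cInf_lower) (auto intro!: bdd_belowI[of _ 0] l2_norm_nonneg)
      then show ?thesis by (simp add: l2_norm_def)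
    qed
    ultimately have "c \<in> cohomology_closure A (Suc q) (restrict_class A (Suc q) ` reduced_cohomology B (Suc q))"
      unfolding cohomology_closure_def by (auto intro: le_less_trans)
    then show "z \<in> \<Union>(cohomology_closure A (Suc q) (restrict_class A (Suc q) ` reduced_cohomology B (Suc q)))"
      using self(1)[of z] by (auto simp: c_def)
  qed
qed

lemma countable_complex:
  assumes "countable (carrier G)" and cc: "cocompact G \<alpha> (skeleton p L)"
  shows "countable L"
proof -
  have fin: "finite s" if "s \<in> L" for s using L that by (auto simp: abstract_simplicial_complex_def)
  have sub: "\<Union>L \<subseteq> (\<Union>Q\<in>orbits G (skeleton p L) (\<lambda>g s. \<alpha> g ` s). \<Union>Q)"
  proof
    fix v assume "v \<in> \<Union>L"
    then obtain s where "s \<in> L" "v \<in> s" by blast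
    moreover have "{v} \<subseteq> s" "{v} ~= {}" using \<open>v \<in> s\<close> by auto
    ultimately have "{v} \<in> L" using L unfolding abstract_simplicial_complex_def by blast
    then have "{v} \<in> skeleton p L" "v \<in> \<Union>(sorbit {v})" using sorbit_self by (auto simp: skeleton_def)
    then show "v \<in> (\<Union>Q\<in>orbits G (skeleton p L) (\<lambda>g s. \<alpha> g ` s). \<Union>Q)" unfolding orbits_def by blast
  qed
  have cQ: "countable (\<Union>Q)" if Q: "Q \<in> orbits G (skeleton p L) (\<lambda>g s. \<alpha> g ` s)" for Q
  proof -
    obtain s where s: "s \<in> L" "Q = sorbit s" using Q by (auto simp: orbits_def skeleton_def)
    have "\<Union>Q = (\<Union>g\<in>carrier G. \<alpha> g ` s)" unfolding s(2) orbit_def by blast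
    then show ?thesis using countable_UN[OF assms(1), of "\<lambda>g. \<alpha> g ` s"] fin[OF s(1)] by (simp add: countable_finite)
  qed
  have "countable (\<Union>Q\<in>orbits G (skeleton p L) (\<lambda>g s. \<alpha> g ` s). \<Union>Q)"
    by (rule countable_UN[OF countable_finite cQ]) (use cc in \<open>simp add: cocompact_def\<close>)
  then have "countable (\<Union>L)" by (rule countable_subset[OF sub])
  then have "countable {A. finite A \<and> A \<subseteq> \<Union>L}" by (rule countable_Collect_finite_subset)
  moreover have "L \<subseteq> {A. finite A \<and> A \<subseteq> \<Union>L}" using fin by blast
  ultimately show ?thesis by (rule countable_subset[rotated])
qed

text \<open>Once a stage contains the skeleton, the inner limit no longer depends on it, and the
  dimensions decrease along the later stages.\<close>

lemma l2_betti_harmonic: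
  assumes cG: "countable (carrier G)" and cc: "cocompact G \<alpha> (skeleton (Suc q) L)"
    and fin: "finite (reps (Suc q))"
  shows "\<exists>K d. cocompact_exhaustion G \<alpha> L K \<and> l2_betti G \<alpha> L (Suc q) = ereal d \<and> (\<forall>j. d <= harmonic_dim (K j) (Suc q))"
proof -
  define K where "K = (SOME K. cocompact_exhaustion G \<alpha> L K)"
  have act: "simplicial_action G \<alpha> L" using free by (simp add: free_simplicial_action_def)
  have KE: "cocompact_exhaustion G \<alpha> L K"
    unfolding K_def by (rule someI_ex[OF cocompact_exhaustion_exists[OF is_group L act countable_complex[OF cG cc]]])
  then have inc: "incseq K" and un: "(\<Union>i. K i) = L" and inv: "\<And>i g s. g \<in> carrier G ==> s \<in> K i ==> \<alpha> g ` s \<in> K i"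
    by (auto simp: cocompact_exhaustion_def)
  have KL: "K i \<subseteq> L" for i using un by blast
  \<comment> \<open>The finitely many orbits of the skeleton are exhausted at a finite stage.\<close>
  have "\<exists>i. Q \<subseteq> K i" if Q: "Q \<in> orbits G (skeleton (Suc q) L) (\<lambda>g s. \<alpha> g ` s)" for Q
  proof -
    obtain s where s: "s \<in> L" "Q = sorbit s" using Q by (auto simp: orbits_def skeleton_def)
    obtain i where "s \<in> K i" using s(1) un by blast
    then have "Q \<subseteq> K i" unfolding s(2) orbit_def using inv by blast
    then show ?thesis by blast
  qed
  then obtain f where f: "\<And>Q. Q \<in> orbits G (skeleton (Suc q) L) (\<lambda>g s. \<alpha> g ` s) ==> Q \<subseteq> K (f Q)" by metis
  define i0 where "i0 = Max (insert 0 (f ` orbits G (skeleton (Suc q) L) (\<lambda>g s. \<alpha> g ` s)))"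
  have skel: "skeleton (Suc q) L \<subseteq> K i" if "i0 <= i" for i
  proof
    fix s assume s: "s \<in> skeleton (Suc q) L"
    then have Q: "sorbit s \<in> orbits G (skeleton (Suc q) L) (\<lambda>g s. \<alpha> g ` s)" by (auto simp: orbits_def)
    have "f (sorbit s) <= i0" unfolding i0_def using cc Q by (intro Max_ge) (auto simp: cocompact_def)
    then have "K (f (sorbit s)) \<subseteq> K i" by (rule incseqD[OF inc order_trans[OF _ that]])
    moreover have "s \<in> K (f (sorbit s))" using f[OF Q] sorbit_self[of s] s by (auto simp: skeleton_def)
    ultimately show "s \<in> K i" by blast
  qed
  have os: "ordered_simplices (K i) r = simplices r" if i: "i0 <= i" and r: "r <= Suc q" for i r
  proof (intro equalityI subsetI)
    fix xs assume "xs \<in> simplices r"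
    then have "set xs \<in> skeleton (Suc q) L" "xs \<in> simplices r"
      using r distinct_card[of xs] by (auto simp: ordered_simplices_def skeleton_def)
    then show "xs \<in> ordered_simplices (K i) r" using skel[OF i] by (auto simp: ordered_simplices_def)
  qed (use KL in \<open>auto simp: ordered_simplices_def\<close>)
  have dim: "cohomology_dim G \<alpha> (K i) (Suc q) (cohomology_closure (K i) (Suc q) (restrict_class (K i) (Suc q) ` reduced_cohomology (K j) (Suc q)))
      = harmonic_dim (K j) (Suc q)" if ij: "i0 <= i" "i <= j" for i j
    unfolding cohomology_dim_def harmonic_def
    using Union_cohomology_closure[OF fin incseqD[OF inc ij(2)] KL os[OF ij(1)] os[of j]] os[OF ij(1), of "Suc q"] ij by simp
  have dec: "decseq (\<lambda>j. harmonic_dim (K j) (Suc q))"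
    by (rule decseq_SucI) (rule harmonic_dim_antimono[OF incseq_SucD[OF inc]])
  obtain d where d: "(\<lambda>j. harmonic_dim (K j) (Suc q)) \<longlonglongrightarrow> d" "\<forall>j. d <= harmonic_dim (K j) (Suc q)"
    by (rule decseq_convergent[OF dec, of 0]) (use harmonic_dim_nonneg in auto)
  define X where "X i j = ereal (cohomology_dim G \<alpha> (K i) (Suc q)
      (cohomology_closure (K i) (Suc q) (restrict_class (K i) (Suc q) ` reduced_cohomology (K j) (Suc q))))" for i j
  have inner: "lim (X i) = ereal d" if i: "i0 <= i" for i
  proof (rule limI)
    have "(\<lambda>j. ereal (harmonic_dim (K j) (Suc q))) \<longlonglongrightarrow> ereal d" using d(1) by simp
    moreover have "\<forall>\<^sub>F j in sequentially. ereal (harmonic_dim (K j) (Suc q)) = X i j"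
      unfolding X_def using dim[OF i] by (intro eventually_sequentiallyI[of i]) simp
    ultimately show "X i \<longlonglongrightarrow> ereal d" by (rule Lim_transform_eventually)
  qed
  have "lim (\<lambda>i. lim (X i)) = ereal d"
    by (rule limI[OF tendsto_eventually[OF eventually_sequentiallyI]]) (rule inner)
  then have "l2_betti G \<alpha> L (Suc q) = ereal d"
    unfolding l2_betti_def l2_betti_wrt_def K_def[symmetric] X_def .
  with KE d(2) have "cocompact_exhaustion G \<alpha> L K \<and> l2_betti G \<alpha> L (Suc q) = ereal d \<and> (\<forall>j. d <= harmonic_dim (K j) (Suc q))"
    by (simp only: conj_assoc simp_thms)
  then show ?thesis by (rule exI[of _ K, OF exI[of _ d]])
qed

end

section \<open>The entropy inequality\<close>

lemma rule_eval_expand: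
  fixes u :: "'x \<times> 'v => 'k::comm_ring_1"
  assumes A: "finite A" and r: "\<And>c h v. (c, h, v) \<in> set r ==> (s h x, v) \<in> A"
  shows "rule_eval s r u x = (\<Sum>y\<in>A. of_int (rule_eval s r (point_mass y) x) * u y)"
  using r
proof (induction r)
  case Nil
  show ?case by (simp add: rule_eval_def)
next
  case (Cons t r)
  obtain c h v where t: "t = (c, h, v)" by (cases t)
  have IH: "rule_eval s r u x = (\<Sum>y\<in>A. of_int (rule_eval s r (point_mass y) x) * u y)"
    by (rule Cons.IH) (use Cons.prems in auto)
  have m: "(s h x, v) \<in> A" using Cons.prems t by auto
  have step: "rule_eval s (t # r) w x = of_int c * w (s h x, v) + rule_eval s r w x" for w :: "'x \<times> 'v => 'r::comm_ring_1"
    by (simp add: rule_eval_def t)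
  have "(\<Sum>y\<in>A. of_int (rule_eval s (t # r) (point_mass y) x) * u y)
      = (\<Sum>y\<in>A. (if y = (s h x, v) then of_int c * u y else 0) + of_int (rule_eval s r (point_mass y) x) * u y)"
    unfolding step by (intro sum.cong refl) (auto simp: point_mass_def distrib_right)
  also have "... = of_int c * u (s h x, v) + rule_eval s r u x"
    unfolding sum.distrib IH using A m by simp
  finally show ?case unfolding step by simp
qed

text \<open>Two independent families that are orthogonal to each other are jointly independent, provided that
  one of them is real: then the span of the latter is closed under conjugation.\<close>

lemma indep_family_Plus:
  fixes f :: "'i => 'y => complex" and g :: "'j => 'y => complex"
  assumes fin: "finite X" "finite I" "finite J" and f: "indep_family X I f" and g: "indep_family X J g"
    and real: "\<And>i x. i \<in> I ==> cnj (f i x) = f i x"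
    and orth: "\<And>i j. i \<in> I ==> j \<in> J ==> (\<Sum>x\<in>X. f i x * g j x) = 0"
  shows "indep_family X (I <+> J) (case_sum f g)"
  unfolding indep_family_def
proof (intro allI impI)
  fix c assume c: "\<forall>x\<in>X. (\<Sum>k\<in>I <+> J. c k * case_sum f g k x) = 0"
  define \<alpha> where "\<alpha> x = (\<Sum>i\<in>I. c (Inl i) * f i x)" for x
  define \<beta> where "\<beta> x = (\<Sum>j\<in>J. c (Inr j) * g j x)" for x
  have ab: "\<alpha> x + \<beta> x = 0" if "x \<in> X" for x
    using c that fin by (simp add: sum.Plus \<alpha>_def \<beta>_def)
  have cnj\<alpha>: "cnj (\<alpha> x) = (\<Sum>i\<in>I. cnj (c (Inl i)) * f i x)" for x
    unfolding \<alpha>_def cnj_sum using real by (intro sum.cong refl) simp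
  have "(\<Sum>x\<in>X. \<beta> x * cnj (\<alpha> x)) = (\<Sum>x\<in>X. \<Sum>j\<in>J. \<Sum>i\<in>I. c (Inr j) * cnj (c (Inl i)) * (f i x * g j x))"
    unfolding cnj\<alpha> \<beta>_def sum_product by (intro sum.cong refl) (simp add: mult_ac)
  also have "... = (\<Sum>j\<in>J. \<Sum>i\<in>I. c (Inr j) * cnj (c (Inl i)) * (\<Sum>x\<in>X. f i x * g j x))"
    unfolding sum_distrib_left by (subst sum.swap) (intro sum.cong refl sum.swap)
  also have "... = 0" using orth by (intro sum.neutral ballI) simp
  finally have z: "(\<Sum>x\<in>X. \<beta> x * cnj (\<alpha> x)) = 0" .
  have "of_real (\<Sum>x\<in>X. (cmod (\<alpha> x))\<^sup>2) = (\<Sum>x\<in>X. \<alpha> x * cnj (\<alpha> x))"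
    unfolding of_real_sum by (intro sum.cong refl complex_norm_square)
  also have "... = (\<Sum>x\<in>X. - (\<beta> x * cnj (\<alpha> x)))"
  proof (intro sum.cong refl)
    fix x assume "x \<in> X"
    then have "\<alpha> x = - \<beta> x" using ab eq_neg_iff_add_eq_0 by blast
    then show "\<alpha> x * cnj (\<alpha> x) = - (\<beta> x * cnj (\<alpha> x))" by simp
  qed
  also have "... = 0" using z by (simp add: sum_negf)
  finally have "(\<Sum>x\<in>X. (cmod (\<alpha> x))\<^sup>2) = 0" by (simp only: of_real_eq_0_iff)
  then have a0: "\<alpha> x = 0" if "x \<in> X" for x
    using that fin(1) by (simp add: sum_nonneg_eq_0_iff)
  have "c (Inl i) = 0" if "i \<in> I" for i
    using indep_familyD[OF f, of "\<lambda>i. c (Inl i)", OF _ that] a0 by (simp add: \<alpha>_def)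
  moreover have "c (Inr j) = 0" if "j \<in> J" for j
    using indep_familyD[OF g, of "\<lambda>j. c (Inr j)", OF _ that] a0 ab by (simp add: \<beta>_def)
  ultimately show "\<forall>k\<in>I <+> J. c k = 0" by auto
qed

context coded_action
begin

text \<open>The lower bound in terms of codimensions: outside a small set of bad points the solutions of the
  model equations still have to vanish, but this costs a negligible number of linear conditions.\<close>

lemma entropy_ge_codim:
  assumes RlG: "\<And>r c h v. r \<in> Rl ==> (c, h, v) \<in> set r ==> h \<in> carrier G \<and> v \<in> V"
    and Rl_ext: "\<And>u. (\<And>r g. r \<in> Rl ==> g \<in> carrier G ==> rule_eval (\<otimes>) r u g = 0) ==>
      \<exists>f\<in>X. \<forall>g\<in>carrier G. \<forall>v\<in>V. f (cd g v) = u (g, v)"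
    and codim: "\<And>R0 \<theta>. finite R0 ==> R0 \<subseteq> Rl ==> 0 < \<theta> ==> frequently (\<lambda>n. \<exists>b. real b <= (\<beta> + \<theta>) * real (card (D n)) \<and>
      CARD('k) ^ card (D n \<times> V) <= CARD('k) ^ b * card {u \<in> supported_fun (D n \<times> V). \<forall>r\<in>R0. \<forall>x\<in>D n. rule_eval (\<sigma> n) r u x = (0 :: 'k)}) sequentially"
  shows "ereal ((real (card V) - \<beta>) * ln CARD('k)) <= top_sofic_entropy G D \<sigma> XT act"
proof (rule entropy_ge[OF RlG Rl_ext])
  fix R0 :: "(int \<times> 'g \<times> 'v) list set" and \<theta> :: real
  assume R0: "finite R0" "R0 \<subseteq> Rl" and \<theta>: "0 < \<theta>"
  define l where "l = ln (real CARD('k))"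
  have K2: "2 <= CARD('k)"
  proof -
    have "card {0, 1 :: 'k} <= CARD('k)" by (rule card_mono) auto
    then show ?thesis by simp
  qed
  then have l: "0 < l" by (simp add: l_def)
  define eps where "eps = \<theta> / (2 * l * (real (card V) + 1))"
  have eps: "0 < eps" using l \<theta> by (simp add: eps_def)
  have "0 < \<theta> / (2 * l)" using l \<theta> by simp
  from codim[OF R0 this] show "\<exists>eps>0. frequently (\<lambda>n. \<forall>Bad\<subseteq>D n. real (card Bad) <= eps * real (card (D n)) -->
      exp (((real (card V) - \<beta>) * ln CARD('k) - \<theta>) * real (card (D n))) <= real (card (model_solutions n R0 Bad))) sequentially"
  proof (intro exI[of _ eps] conjI eps, elim frequently_elim1, intro allI impI)
    fix n Bad
    assume "\<exists>b. real b <= (\<beta> + \<theta> / (2 * l)) * real (card (D n)) \<and>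
      CARD('k) ^ card (D n \<times> V) <= CARD('k) ^ b * card {u \<in> supported_fun (D n \<times> V). \<forall>r\<in>R0. \<forall>x\<in>D n. rule_eval (\<sigma> n) r u x = (0 :: 'k)}"
    then obtain b where b: "real b <= (\<beta> + \<theta> / (2 * l)) * real (card (D n))"
      "CARD('k) ^ card (D n \<times> V) <= CARD('k) ^ b * card {u \<in> supported_fun (D n \<times> V). \<forall>r\<in>R0. \<forall>x\<in>D n. rule_eval (\<sigma> n) r u x = (0 :: 'k)}"
      by blast
    assume Bad: "Bad \<subseteq> D n" "real (card Bad) <= eps * real (card (D n))"
    define H where "H = {u \<in> supported_fun (D n \<times> V). \<forall>r\<in>R0. \<forall>x\<in>D n. rule_eval (\<sigma> n) r u x = (0 :: 'k)}"
    define N where "N = card (model_solutions n R0 Bad :: ('d \<times> 'v => 'k) set)"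
    have finBad: "finite (Bad \<times> V)" using Bad(1) fin_D finV finite_subset by blast
    have finH: "finite H" unfolding H_def by (rule finite_subset[OF _ card_supported_fun(2)]) (use fin_D finV in auto)
    have sub: "rule_eval (\<sigma> n) r (\<lambda>y. u y - w y) x = rule_eval (\<sigma> n) r u x - rule_eval (\<sigma> n) r w x" for r x and u w :: "'d \<times> 'v => 'k"
      unfolding rule_eval_def by (induction r) (auto simp: algebra_simps)
    have "card H <= CARD('k) ^ card (Bad \<times> V) * card {u \<in> H. \<forall>y\<in>Bad \<times> V. u y = 0}"
      by (rule card_le_card_common_kernel[OF finH finBad]) (auto simp: H_def sub supported_fun_def)
    also have "{u \<in> H. \<forall>y\<in>Bad \<times> V. u y = 0} = model_solutions n R0 Bad"
      using Bad(1) unfolding H_def model_solutions_def supported_fun_def by (auto, blast)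
    finally have "CARD('k) ^ card (D n \<times> V) <= CARD('k) ^ b * (CARD('k) ^ card (Bad \<times> V) * N)"
      using b(2) unfolding H_def[symmetric] N_def by (meson le_trans mult_le_mono2)
    then have "real (CARD('k) ^ card (D n \<times> V)) <= real (CARD('k) ^ b * (CARD('k) ^ card (Bad \<times> V) * N))" by (rule of_nat_mono)
    then have "exp (l * card (D n \<times> V)) <= exp (l * b) * (exp (l * card (Bad \<times> V)) * real N)"
      using K2 by (simp add: l_def exp_of_nat2_mult)
    then have "exp (l * card (D n \<times> V) - l * b - l * card (Bad \<times> V)) <= real N"
      by (simp add: exp_diff exp_add field_simps)
    moreover have "((real (card V) - \<beta>) * l - \<theta>) * real (card (D n)) <= l * card (D n \<times> V) - l * b - l * card (Bad \<times> V)"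
    proof -
      have "l * b <= l * ((\<beta> + \<theta> / (2 * l)) * real (card (D n)))" using b(1) l by simp
      also have "... = (l * \<beta> + \<theta> / 2) * real (card (D n))" using l by (simp add: field_simps)
      finally have 1: "l * b <= (l * \<beta> + \<theta> / 2) * real (card (D n))" .
      have "l * card (Bad \<times> V) = (l * card V) * card Bad" by (simp add: card_cartesian_product)
      also have "... <= (l * card V) * (eps * card (D n))" using Bad(2) l by (intro mult_left_mono) auto
      also have "... = (l * card V * eps) * card (D n)" by simp
      also have "... <= (\<theta> / 2) * card (D n)"
      proof (intro mult_right_mono)
        have "l * card V * eps = \<theta> / 2 * (card V / (real (card V) + 1))" using l by (simp add: eps_def)
        also have "... <= \<theta> / 2 * 1" using \<theta> by (intro mult_left_mono) auto
        finally show "l * card V * eps <= \<theta> / 2" by simp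
      qed simp
      finally have 2: "l * card (Bad \<times> V) <= (\<theta> / 2) * card (D n)" .
      have 3: "l * card (D n \<times> V) = l * card V * card (D n)" by (simp add: card_cartesian_product)
      show ?thesis using 1 2 unfolding 3 by (simp add: algebra_simps)
    qed
    ultimately show "exp (((real (card V) - \<beta>) * ln CARD('k) - \<theta>) * real (card (D n))) <= real (card (model_solutions n R0 Bad :: ('d \<times> 'v => 'k) set))"
      unfolding N_def l_def by (meson exp_le_cancel_iff order_trans)
  qed
qed (use assms in auto)

end

lemma real_limsup_exists:
  fixes X :: "nat => real"
  assumes "\<And>n. 0 <= X n" "\<And>n. X n <= B"
  shows "\<exists>R. (\<forall>\<theta>>0. eventually (\<lambda>n. X n <= R + \<theta>) sequentially) \<and> (\<forall>\<theta>>0. frequently (\<lambda>n. R - \<theta> <= X n) sequentially)"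
proof -
  define C where "C = limsup (\<lambda>n. ereal (X n))"
  have "C <= ereal B" unfolding C_def by (rule Limsup_bounded) (use assms(2) in auto)
  moreover have "0 <= C" unfolding C_def by (rule le_Limsup) (use assms(1) in auto)
  ultimately obtain R where R: "C = ereal R" by (cases C) auto
  have "eventually (\<lambda>n. X n <= R + \<theta>) sequentially" if "0 < \<theta>" for \<theta>
  proof -
    have "limsup (\<lambda>n. ereal (X n)) < ereal (R + \<theta>)" using R that by (simp add: C_def[symmetric])
    from Limsup_lessD[OF this] show ?thesis by (rule eventually_mono) simp
  qed
  moreover have "frequently (\<lambda>n. R - \<theta> <= X n) sequentially" if "0 < \<theta>" for \<theta>
  proof -
    have "\<not> eventually (\<lambda>n. \<not> R - \<theta> <= X n) sequentially"
    proof
      assume "eventually (\<lambda>n. \<not> R - \<theta> <= X n) sequentially"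
      then have "C <= ereal (R - \<theta>)" unfolding C_def by (intro Limsup_bounded) (auto elim: eventually_mono)
      then show False using R that by simp
    qed
    then show ?thesis by (simp add: frequently_def)
  qed
  ultimately show ?thesis by blast
qed

locale sofic_complex = free_complex G L \<alpha> + sofic G D \<sigma>
  for G :: "('g, 'm) monoid_scheme" (structure) and L :: "'v set set" and \<alpha> :: "'g => 'v => 'v"
    and D :: "nat => 'd set" and \<sigma> :: "nat => 'g => 'd => 'd" +
  fixes q :: nat
  assumes finU: "finite (reps q)" and finV: "finite (reps (Suc q))"
begin

text \<open>The matrix of the coboundary of degree \<open>r\<close> over \<open>D n\<close>, with
  rows indexed by points and representatives of degree \<open>r + 1\<close>.\<close>

definition model_coboundary :: "nat => nat => 'd \<times> 'v list => 'd \<times> 'v list => int" where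
  "model_coboundary r n z y = rule_eval (\<sigma> n) (face_rule r (snd z)) (point_mass y) (fst z)"

lemma rule_eval_model:
  fixes u :: "'d \<times> 'v list => 'k::comm_ring_1"
  assumes t: "t \<in> reps (Suc r)" and x: "x \<in> D n" and fin: "finite (reps r)"
  shows "rule_eval (\<sigma> n) (face_rule r t) u x = (\<Sum>y\<in>D n \<times> reps r. of_int (model_coboundary r n (x, t) y) * u y)"
  unfolding model_coboundary_def fst_conv snd_conv
proof (rule rule_eval_expand)
  fix c h v assume "(c, h, v) \<in> set (face_rule r t)"
  from face_rule_elems[OF reps_simplices[OF t] this] show "(\<sigma> n h x, v) \<in> D n \<times> reps r" using \<sigma>_in x by auto
qed (use fin_D fin in auto)

definition model_kernel :: "nat => nat => 'v list set => ('d \<times> 'v list => 'k::comm_ring_1) set" where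
  "model_kernel r n T = {u \<in> supported_fun (D n \<times> reps r).
     \<forall>z\<in>D n \<times> T. (\<Sum>y\<in>D n \<times> reps r. of_int (model_coboundary r n z y) * u y) = 0}"

lemma entropy_ker_coboundary_ge_codim:
  assumes fin: "finite (reps r)"
    and codim: "\<And>T \<theta>. finite T ==> T \<subseteq> reps (Suc r) ==> 0 < \<theta> ==>
      frequently (\<lambda>n. \<exists>b T'. T \<subseteq> T' \<and> T' \<subseteq> reps (Suc r) \<and> real b <= (\<beta> + \<theta>) * real (card (D n)) \<and>
        CARD('k) ^ card (D n \<times> reps r) <= CARD('k) ^ b * card (model_kernel r n T' :: ('d \<times> 'v list => 'k::{field, finite}) set)) sequentially"
  shows "ereal ((real (card (reps r)) - \<beta>) * ln CARD('k)) \<le>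
    top_sofic_entropy G D \<sigma> (pointwise_topology (ker_coboundary L (Suc r) :: ('v list => 'k) set)) (cochain_action G \<alpha> L r)"
proof -
  interpret ca: coded_action G D \<sigma> "ker_coboundary L (Suc r) :: ('v list => 'k) set" "cochain_action G \<alpha> L r" cd "reps r"
    by (rule coded_ker_coboundary[OF sofic fin])
  show ?thesis
  proof (rule ca.entropy_ge_codim[where Rl = "face_rule r ` reps (Suc r)"])
    fix \<rho> c h v assume "\<rho> \<in> face_rule r ` reps (Suc r)" "(c, h, v) \<in> set \<rho>"
    then show "h \<in> carrier G \<and> v \<in> reps r" using face_rule_elems reps_simplices by blast
  next
    fix u :: "'g \<times> 'v list => 'k"
    assume "\<And>\<rho> g. \<rho> \<in> face_rule r ` reps (Suc r) ==> g \<in> carrier G ==> rule_eval (\<otimes>) \<rho> u g = 0"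
    then show "\<exists>f\<in>ker_coboundary L (Suc r). \<forall>g\<in>carrier G. \<forall>v\<in>reps r. f (cd g v) = u (g, v)"
      by (rule ker_coboundary_extension)
  next
    fix R0 \<theta> assume R0: "finite R0" "R0 \<subseteq> face_rule r ` reps (Suc r)" and \<theta>: "0 < (\<theta> :: real)"
    obtain T where T: "finite T" "T \<subseteq> reps (Suc r)" "R0 = face_rule r ` T" using finite_subset_image[OF R0] by blast
    have sub: "model_kernel r n T' \<subseteq> {u \<in> supported_fun (D n \<times> reps r). \<forall>\<rho>\<in>R0. \<forall>x\<in>D n. rule_eval (\<sigma> n) \<rho> u x = (0 :: 'k)}"
      if "T \<subseteq> T'" "T' \<subseteq> reps (Suc r)" for n T'
    proof
      fix u :: "'d \<times> 'v list => 'k" assume u: "u \<in> model_kernel r n T'"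
      have "rule_eval (\<sigma> n) (face_rule r t) u x = 0" if "t \<in> T" "x \<in> D n" for t x
      proof -
        have t: "t \<in> T'" "t \<in> reps (Suc r)" using that(1) \<open>T \<subseteq> T'\<close> \<open>T' \<subseteq> reps (Suc r)\<close> by auto
        then show ?thesis unfolding rule_eval_model[OF t(2) that(2) fin] using u that(2) by (simp add: model_kernel_def)
      qed
      then show "u \<in> {u \<in> supported_fun (D n \<times> reps r). \<forall>\<rho>\<in>R0. \<forall>x\<in>D n. rule_eval (\<sigma> n) \<rho> u x = 0}"
        using u T(3) by (auto simp: model_kernel_def)
    qed
    have finX: "finite (D n \<times> reps r)" for n using fin_D fin by simp
    have card: "card (model_kernel r n T' :: ('d \<times> 'v list => 'k) set)
        <= card {u \<in> supported_fun (D n \<times> reps r). \<forall>\<rho>\<in>R0. \<forall>x\<in>D n. rule_eval (\<sigma> n) \<rho> u x = (0 :: 'k)}"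
      if "T \<subseteq> T'" "T' \<subseteq> reps (Suc r)" for n T'
      by (rule card_mono[OF finite_subset[OF _ card_supported_fun(2)[OF finX]] sub[OF that]]) blast
    show "frequently (\<lambda>n. \<exists>b. real b <= (\<beta> + \<theta>) * real (card (D n)) \<and> CARD('k) ^ card (D n \<times> reps r)
       <= CARD('k) ^ b * card {u \<in> supported_fun (D n \<times> reps r). \<forall>\<rho>\<in>R0. \<forall>x\<in>D n. rule_eval (\<sigma> n) \<rho> u x = (0 :: 'k)}) sequentially"
      using codim[OF T(1,2) \<theta>]
      by (rule frequently_elim1) (elim exE conjE, intro exI conjI, assumption, erule order_trans, intro mult_le_mono2 card)
  qed
qed

theorem entropy_ker_coboundary_ge:
  fixes Y :: "nat => ('d \<times> 'v list) set"
  assumes Y: "\<And>n. Y n \<subseteq> D n \<times> reps q"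
    and span: "\<And>n i. i \<in> D n \<times> reps q ==> \<exists>c. \<forall>x\<in>D n \<times> reps (Suc q). of_int (model_coboundary q n x i)
       = (\<Sum>y\<in>Y n. c y * (of_int (model_coboundary q n x y) :: 'k::{field, finite}))"
    and R: "\<And>\<theta>. 0 < \<theta> ==> eventually (\<lambda>n. real (card (Y n)) <= (R + \<theta>) * real (card (D n))) sequentially"
  shows "ereal ((real (card (reps q)) - R) * ln CARD('k)) \<le>
    top_sofic_entropy G D \<sigma> (pointwise_topology (ker_coboundary L (Suc q) :: ('v list => 'k) set)) (cochain_action G \<alpha> L q)"
proof (rule entropy_ker_coboundary_ge_codim[OF finU])
  fix T :: "'v list set" and \<theta> :: real assume T: "T \<subseteq> reps (Suc q)" and \<theta>: "0 < \<theta>"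
  have "CARD('k) ^ card (D n \<times> reps q) <= CARD('k) ^ card (Y n) * card (model_kernel q n (reps (Suc q)) :: ('d \<times> 'v list => 'k) set)" for n
  proof -
    have "finite (D n \<times> reps q)" using fin_D finU by simp
    from card_kernel_columns[OF this Y span] show ?thesis by (simp only: model_kernel_def mult.commute[of "of_int _"])
  qed
  then show "frequently (\<lambda>n. \<exists>b T'. T \<subseteq> T' \<and> T' \<subseteq> reps (Suc q) \<and> real b <= (R + \<theta>) * real (card (D n)) \<and>
      CARD('k) ^ card (D n \<times> reps q) <= CARD('k) ^ b * card (model_kernel q n T' :: ('d \<times> 'v list => 'k) set)) sequentially"
    using T eventually_frequently[OF sequentially_bot R[OF \<theta>]] by (elim frequently_elim1) blast
qed

lemma of_int_rule_eval: "of_int (rule_eval s r u x) = (rule_eval s r (\<lambda>y. of_int (u y)) x :: 'r::comm_ring_1)"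
  unfolding rule_eval_def by (induction r) auto

text \<open>Two successive coboundaries, evaluated at the identity.\<close>

lemma face_rule_face_rule_zero:
  fixes F :: "'g \<times> 'v list => int"
  assumes t: "t \<in> reps (Suc (Suc q))"
  shows "rule_eval (\<otimes>) (face_rule (Suc q) t) (\<lambda>(h, v). rule_eval (\<otimes>) (face_rule q v) F h) \<one> = 0"
proof -
  define f where "f = coboundary L (Suc q) (lift q F)"
  have f: "f \<in> cochains L (Suc q)" unfolding f_def by (rule coboundary_in_cochains[OF L lift_in_cochains])
  have "rule_eval (\<otimes>) (face_rule (Suc q) t) (\<lambda>(h, v). rule_eval (\<otimes>) (face_rule q v) F h) \<one>
      = rule_eval (\<otimes>) (face_rule (Suc q) t) (coords f) \<one>"
  proof (rule rule_eval_cong)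
    fix c h v assume "(c, h, v) \<in> set (face_rule (Suc q) t)"
    from face_rule_elems[OF reps_simplices[OF t] this] have h: "h \<in> carrier G" and v: "v \<in> reps (Suc q)" .
    have "coords f (h, v) = rule_eval (\<otimes>) (face_rule q v) (coords (lift q F)) h"
      unfolding face_rule_eval[OF lift_in_cochains reps_simplices[OF v] h] by (simp add: coords_def f_def)
    also have "... = rule_eval (\<otimes>) (face_rule q v) F h" by (rule rule_eval_coords_lift[OF reps_simplices[OF v] h])
    finally show "(case (h \<otimes> \<one>, v) of (h, v) => rule_eval (\<otimes>) (face_rule q v) F h) = coords f (h \<otimes> \<one>, v)"
      using h by simp
  qed
  also have "... = coboundary L (Suc (Suc q)) f (cd \<one> t)" by (rule face_rule_eval[OF f reps_simplices[OF t] one_closed])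
  also have "... = 0" unfolding f_def coboundary_coboundary[OF L] ..
  finally show ?thesis .
qed

definition composite_shifts :: "'v list set => ('g \<times> 'g) set" where
  "composite_shifts T = (\<Union>t\<in>T. \<Union>e\<in>set (face_rule (Suc q) t). \<Union>e'\<in>set (face_rule q (snd (snd e))). {(fst (snd e'), fst (snd e))})"

definition inverse_shifts :: "('g \<times> 'g) set" where
  "inverse_shifts = (\<Union>v\<in>reps (Suc q). \<Union>e\<in>set (face_rule q v). {(fst (snd e), inv (fst (snd e)))})"

definition nonmult :: "nat => 'v list set => 'd set" where
  "nonmult n T = D n - mult_good n (composite_shifts T \<union> inverse_shifts)"

text \<open>The columns at points outside this small set behave as over the group: they are cocycles of the
  model, and the model of the transposed coboundary computes the pairing with them.\<close>

definition bad_columns :: "nat => 'v list set => 'd set" where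
  "bad_columns n T = nonmult n T \<union> (\<Union>(h', h)\<in>composite_shifts T. (\<lambda>x. \<sigma> n h' (\<sigma> n h x)) ` nonmult n T)"

lemma shifts_finite:
  assumes "finite T" "T \<subseteq> reps (Suc (Suc q))"
  shows "finite (composite_shifts T)" "composite_shifts T \<subseteq> carrier G \<times> carrier G"
    "finite inverse_shifts" "inverse_shifts \<subseteq> carrier G \<times> carrier G"
proof -
  show "finite (composite_shifts T)" "finite inverse_shifts"
    unfolding composite_shifts_def inverse_shifts_def using assms(1) finV by auto
  show "inverse_shifts \<subseteq> carrier G \<times> carrier G"
    unfolding inverse_shifts_def using face_rule_elems(1)[OF reps_simplices] by fastforce
  show "composite_shifts T \<subseteq> carrier G \<times> carrier G"
  proof
    fix p assume "p \<in> composite_shifts T"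
    then obtain t c h v c' h' w where "t \<in> T" "(c, h, v) \<in> set (face_rule (Suc q) t)" "(c', h', w) \<in> set (face_rule q v)" "p = (h', h)"
      unfolding composite_shifts_def by fastforce
    then show "p \<in> carrier G \<times> carrier G"
      using face_rule_elems[OF reps_simplices] assms(2) by (metis SigmaI subsetD)
  qed
qed

lemma composite_shiftsI:
  "t \<in> T ==> (c, h, v) \<in> set (face_rule (Suc q) t) ==> (c', h', w) \<in> set (face_rule q v) ==> (h', h) \<in> composite_shifts T"
  unfolding composite_shifts_def by force

lemma inverse_shiftsI: "v \<in> reps (Suc q) ==> (c, h, w) \<in> set (face_rule q v) ==> (h, inv h) \<in> inverse_shifts"
  unfolding inverse_shifts_def by force

lemma eventually_bad_columns:
  assumes T: "finite T" "T \<subseteq> reps (Suc (Suc q))" and e: "0 < e"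
  shows "eventually (\<lambda>n. real (card (bad_columns n T)) <= e * real (card (D n))) sequentially"
proof -
  note fin = shifts_finite[OF T]
  define N where "N = card (composite_shifts T)"
  have "0 < e / (1 + real N)" using e by (simp add: add_pos_nonneg)
  from eventually_mult_good[OF _ _ this, of "composite_shifts T \<union> inverse_shifts"] fin
  have "eventually (\<lambda>n. real (card (nonmult n T)) <= e / (1 + real N) * real (card (D n))) sequentially"
    unfolding nonmult_def by simp
  then show ?thesis
  proof (rule eventually_mono)
    fix n assume n: "real (card (nonmult n T)) <= e / (1 + real N) * real (card (D n))"
    have finN: "finite (nonmult n T)" unfolding nonmult_def using fin_D by simp
    have "card (\<Union>(h', h)\<in>composite_shifts T. (\<lambda>x. \<sigma> n h' (\<sigma> n h x)) ` nonmult n T)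
        <= (\<Sum>p\<in>composite_shifts T. card (case p of (h', h) => (\<lambda>x. \<sigma> n h' (\<sigma> n h x)) ` nonmult n T))"
      by (rule card_UN_le[OF fin(1)])
    also have "... <= (\<Sum>p\<in>composite_shifts T. card (nonmult n T))"
      by (intro sum_mono) (auto intro: card_image_le[OF finN] split: prod.splits)
    finally have "card (bad_columns n T) <= card (nonmult n T) + N * card (nonmult n T)"
      unfolding bad_columns_def using card_Un_le[of "nonmult n T"] by (simp add: N_def) (meson add_left_mono le_trans)
    then have "real (card (bad_columns n T)) <= real (card (nonmult n T) + N * card (nonmult n T))" by (rule of_nat_mono)
    also have "... = (1 + real N) * real (card (nonmult n T))" by (simp add: distrib_right)
    finally have "real (card (bad_columns n T)) <= (1 + real N) * real (card (nonmult n T))" .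
    also have "... <= (1 + real N) * (e / (1 + real N) * real (card (D n)))" using n by (intro mult_left_mono) auto
    also have "... = e * real (card (D n))" by (simp add: add_pos_nonneg[THEN less_imp_neq, THEN not_sym])
    finally show "real (card (bad_columns n T)) <= e * real (card (D n))" .
  qed
qed

lemma model_coboundary_column_cocycle:
  assumes T: "T \<subseteq> reps (Suc (Suc q))" and t: "t \<in> T" and x: "x \<in> D n" and i: "i \<in> D n - bad_columns n T"
  shows "rule_eval (\<sigma> n) (face_rule (Suc q) t) (\<lambda>z. model_coboundary q n z (i, w)) x = 0"
proof (cases "x \<in> nonmult n T")
  case True
  show ?thesis
  proof (rule ccontr)
    assume "rule_eval (\<sigma> n) (face_rule (Suc q) t) (\<lambda>z. model_coboundary q n z (i, w)) x ~= 0"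
    then obtain c h v where r: "(c, h, v) \<in> set (face_rule (Suc q) t)" and "model_coboundary q n (\<sigma> n h x, v) (i, w) ~= 0"
      by (rule rule_eval_nonzeroE)
    then have "rule_eval (\<sigma> n) (face_rule q v) (point_mass (i, w)) (\<sigma> n h x) ~= (0 :: int)" by (simp add: model_coboundary_def)
    then obtain c' h' w' where r': "(c', h', w') \<in> set (face_rule q v)" and "point_mass (i, w) (\<sigma> n h' (\<sigma> n h x), w') ~= (0 :: int)"
      by (rule rule_eval_nonzeroE)
    then have "i = \<sigma> n h' (\<sigma> n h x)" by (simp add: point_mass_def split: if_splits)
    moreover have "\<sigma> n h' (\<sigma> n h x) \<in> bad_columns n T"
      unfolding bad_columns_def using composite_shiftsI[OF t r r'] True by blast
    ultimately show False using i by blast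
  qed
next
  case False
  define F :: "'g \<times> 'v list => int" where "F = (\<lambda>(g, w'). point_mass (i, w) (\<sigma> n g x, w'))"
  have m: "\<sigma> n h' (\<sigma> n h x) = \<sigma> n (h' \<otimes> h) x" if "(h', h) \<in> composite_shifts T" for h h'
    using False x that unfolding nonmult_def mult_good_def by blast
  have tr: "t \<in> reps (Suc (Suc q))" using T t by blast
  have "rule_eval (\<sigma> n) (face_rule (Suc q) t) (\<lambda>z. model_coboundary q n z (i, w)) x
      = rule_eval (\<otimes>) (face_rule (Suc q) t) (\<lambda>(h, v). rule_eval (\<otimes>) (face_rule q v) F h) \<one>"
  proof (rule rule_eval_cong)
    fix c h v assume r: "(c, h, v) \<in> set (face_rule (Suc q) t)"
    have h: "h \<in> carrier G" by (rule face_rule_elems(1)[OF reps_simplices[OF tr] r])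
    have "rule_eval (\<sigma> n) (face_rule q v) (point_mass (i, w)) (\<sigma> n h x) = rule_eval (\<otimes>) (face_rule q v) F h"
    proof (rule rule_eval_cong)
      fix c' h' w' assume "(c', h', w') \<in> set (face_rule q v)"
      from m[OF composite_shiftsI[OF t r this]]
      show "point_mass (i, w) (\<sigma> n h' (\<sigma> n h x), w') = F (h' \<otimes> h, w')" by (simp add: F_def)
    qed
    then show "model_coboundary q n (\<sigma> n h x, v) (i, w) = (case (h \<otimes> \<one>, v) of (h, v) => rule_eval (\<otimes>) (face_rule q v) F h)"
      using h by (simp add: model_coboundary_def)
  qed
  also have "... = 0" by (rule face_rule_face_rule_zero[OF tr])
  finally show ?thesis .
qed

lemma model_coboundary_column_pairing:
  fixes u :: "'d \<times> 'v list => complex"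
  assumes i: "i \<in> D n - bad_columns n T"
  shows "(\<Sum>z\<in>D n \<times> reps (Suc q). of_int (model_coboundary q n z (i, w)) * u z) = rule_eval (\<sigma> n) (adj_rule q w) u i"
proof -
  have iD: "i \<in> D n" using i by blast
  have good: "\<sigma> n h (\<sigma> n (inv h) i) = i" if "v \<in> reps (Suc q)" "(c, h, w') \<in> set (face_rule q v)" for c h v w'
  proof -
    have "i \<in> mult_good n (composite_shifts T \<union> inverse_shifts)" using i by (auto simp: bad_columns_def nonmult_def)
    then have "\<sigma> n h (\<sigma> n (inv h) i) = \<sigma> n (h \<otimes> inv h) i"
      using inverse_shiftsI[OF that] unfolding mult_good_def by blast
    then show ?thesis using face_rule_elems(1)[OF reps_simplices[OF that(1)] that(2)] \<sigma>_one[OF iD] by simp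
  qed
  have "(\<Sum>z\<in>D n \<times> reps (Suc q). of_int (model_coboundary q n z (i, w)) * u z)
      = (\<Sum>v\<in>reps (Suc q). \<Sum>x\<in>D n. of_int (model_coboundary q n (x, v) (i, w)) * u (x, v))"
    by (subst sum.swap) (simp add: sum.cartesian_product case_prod_unfold)
  also have "... = (\<Sum>v\<in>reps (Suc q). rule_adj (\<lambda>h. \<sigma> n (inv h)) (face_rule q v) (\<lambda>x. u (x, v)) (i, w))"
  proof (intro sum.cong refl)
    fix v assume v: "v \<in> reps (Suc q)"
    define \<tau> where "\<tau> h = inv_into (D n) (\<sigma> n h)" for h
    have "(\<Sum>x\<in>D n. of_int (model_coboundary q n (x, v) (i, w)) * u (x, v))
        = (\<Sum>x\<in>D n. rule_eval (\<sigma> n) (face_rule q v) (\<lambda>y. of_int (point_mass (i, w) y)) x * u (x, v))"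
      unfolding model_coboundary_def of_int_rule_eval by simp
    also have "... = (\<Sum>y\<in>{(i, w)}. of_int (point_mass (i, w) y) * rule_adj \<tau> (face_rule q v) (\<lambda>x. u (x, v)) y)"
    proof (rule sum_rule_eval_mult[where \<Omega> = "D n"])
      fix c h w' x assume r: "(c, h, w') \<in> set (face_rule q v)" and x: "x \<in> D n"
      have h: "h \<in> carrier G" by (rule face_rule_elems(1)[OF reps_simplices[OF v] r])
      show "\<sigma> n h x \<in> D n \<and> \<tau> h (\<sigma> n h x) = x" "\<tau> h x \<in> D n \<and> \<sigma> n h (\<tau> h x) = x"
        using bij_\<sigma>[OF h, of n] x by (auto simp: \<tau>_def bij_betw_def inv_into_into f_inv_into_f)
      assume "of_int (point_mass (i, w) (\<sigma> n h x, w')) ~= (0 :: complex)"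
      then show "x \<in> D n \<and> (\<sigma> n h x, w') \<in> {(i, w)}" using x by (simp add: point_mass_def split: if_splits)
    qed (use fin_D iD in auto)
    also have "... = rule_adj \<tau> (face_rule q v) (\<lambda>x. u (x, v)) (i, w)" by (simp add: point_mass_def)
    also have "... = rule_adj (\<lambda>h. \<sigma> n (inv h)) (face_rule q v) (\<lambda>x. u (x, v)) (i, w)"
    proof -
      have "\<tau> h i = \<sigma> n (inv h) i" if r: "(c, h, w') \<in> set (face_rule q v)" for c h w'
      proof -
        have h: "h \<in> carrier G" by (rule face_rule_elems(1)[OF reps_simplices[OF v] r])
        have "\<tau> h (\<sigma> n h (\<sigma> n (inv h) i)) = \<sigma> n (inv h) i"
          using bij_\<sigma>[OF h, of n] \<sigma>_in[OF inv_closed[OF h] iD] by (simp add: \<tau>_def bij_betw_def)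
        then show ?thesis using good[OF v r] by simp
      qed
      then show ?thesis
        unfolding rule_adj_def fst_conv snd_conv by (intro arg_cong[of _ _ sum_list] map_cong refl) auto
    qed
    finally show "(\<Sum>x\<in>D n. of_int (model_coboundary q n (x, v) (i, w)) * u (x, v))
        = rule_adj (\<lambda>h. \<sigma> n (inv h)) (face_rule q v) (\<lambda>x. u (x, v)) (i, w)" .
  qed
  also have "... = rule_eval (\<sigma> n) (adj_rule q w) u i" by (rule rule_eval_adj_rule[OF finV, symmetric])
  finally show ?thesis .
qed

text \<open>Three kinds of vectors that are orthogonal to each other: good columns of the first model
  coboundary, rows of the second one, and joint solutions of the Laplace rules.\<close>

lemma model_rank_bound:
  fixes K :: "'v set set" and w :: "nat => 'd \<times> 'v list => complex"
  defines "T \<equiv> {t \<in> reps (Suc (Suc q)). set t \<in> K}"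
  assumes finT: "finite T"
    and C: "C \<subseteq> (D n - bad_columns n T) \<times> reps q"
    and Ci: "indep_family (D n \<times> reps (Suc q)) C (\<lambda>y z. of_int (model_coboundary q n z y) :: 'k::field)"
    and B: "B \<subseteq> D n \<times> T"
    and Bi: "indep_family (D n \<times> reps (Suc q)) B (\<lambda>z y. of_int (model_coboundary (Suc q) n z y) :: 'k)"
    and Z: "finite Z" "indep_family (D n \<times> reps (Suc q)) Z w"
    and w: "\<And>a r x. a \<in> Z ==> r \<in> laplace_rules K q ==> x \<in> D n ==> rule_eval (\<sigma> n) r (w a) x = 0"
  shows "card C + (card B + card Z) <= card (D n) * card (reps (Suc q))"
proof -
  let ?X = "D n \<times> reps (Suc q)"
  define f where "f y z = (of_int (model_coboundary q n z y) :: complex)" for y z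
  define g where "g z y = (of_int (model_coboundary (Suc q) n z y) :: complex)" for z y
  have finX: "finite ?X" using fin_D finV by simp
  have finC: "finite C" by (rule finite_subset[OF C]) (use fin_D finU in auto)
  have finB: "finite B" by (rule finite_subset[OF B]) (use fin_D finT in auto)
  have fi: "indep_family ?X C f" unfolding f_def by (rule indep_family_of_int_char_0[OF finC Ci])
  have gi: "indep_family ?X B g" unfolding g_def by (rule indep_family_of_int_char_0[OF finB Bi])
  have row: "(\<Sum>y\<in>?X. g z y * u y) = rule_eval (\<sigma> n) (face_rule (Suc q) (snd z)) u (fst z)" if "z \<in> B" for z u
    using that B rule_eval_model[of "snd z" "Suc q" "fst z" n u] finV by (auto simp: T_def g_def)
  have gw: "indep_family ?X (B <+> Z) (case_sum g w)"
  proof (rule indep_family_Plus[OF finX finB Z(1) gi Z(2)])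
    fix z a assume z: "z \<in> B" and a: "a \<in> Z"
    have "face_rule (Suc q) (snd z) \<in> laplace_rules K q" "fst z \<in> D n" using z B by (auto simp: T_def laplace_rules_def)
    then show "(\<Sum>y\<in>?X. g z y * w a y) = 0" unfolding row[OF z] by (rule w[OF a])
  qed (simp add: g_def)
  have fgw: "indep_family ?X (C <+> (B <+> Z)) (case_sum f (case_sum g w))"
  proof (rule indep_family_Plus[OF finX finC _ fi gw])
    fix y k assume y: "y \<in> C" and k: "k \<in> B <+> Z"
    obtain i v where yv: "y = (i, v)" "i \<in> D n - bad_columns n T" "v \<in> reps q" using y C by blast
    from k show "(\<Sum>z\<in>?X. f y z * case_sum g w k z) = 0"
    proof
      fix z assume z: "z \<in> B" "k = Inl z"
      have "(\<Sum>z'\<in>?X. f y z' * case_sum g w k z') = (\<Sum>z'\<in>?X. g z z' * f y z')" using z(2) by (simp add: mult.commute)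
      also have "... = of_int (rule_eval (\<sigma> n) (face_rule (Suc q) (snd z)) (\<lambda>z'. model_coboundary q n z' y) (fst z))"
        unfolding row[OF z(1)] of_int_rule_eval f_def ..
      also have "... = 0"
        unfolding yv(1) using z(1) B yv(2) by (subst model_coboundary_column_cocycle[of T]) (auto simp: T_def)
      finally show ?thesis .
    next
      fix a assume a: "a \<in> Z" "k = Inr a"
      have "(\<Sum>z\<in>?X. f y z * case_sum g w k z) = rule_eval (\<sigma> n) (adj_rule q v) (w a) i"
        using model_coboundary_column_pairing[OF yv(2)] a(2) by (simp add: f_def yv(1))
      also have "... = 0" using yv(2,3) by (intro w[OF a(1)]) (auto simp: laplace_rules_def)
      finally show ?thesis .
    qed
  qed (use finB Z in \<open>simp_all add: f_def\<close>)
  have "card (C <+> (B <+> Z)) <= card ?X" by (rule indep_family_card_le[OF finX _ fgw]) (use finC finB Z in simp)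
  then show ?thesis using finC finB Z by (simp add: card_Plus card_cartesian_product)
qed

text \<open>The codimension of the kernel of the second model coboundary is the number of its
  independent rows, which \<open>model_rank_bound\<close> limits; the number of good columns is
  frequently close to \<open>R\<close> per point, and the kernel of the Laplace rules always
  contributes \<open>d\<close>.\<close>

theorem entropy_ker_coboundary_Suc_ge:
  fixes Y :: "nat => ('d \<times> 'v list) set"
  assumes Y: "\<And>n. Y n \<subseteq> D n \<times> reps q"
    and indep: "\<And>n. indep_family (D n \<times> reps (Suc q)) (Y n) (\<lambda>y z. of_int (model_coboundary q n z y) :: 'k::{field, finite})"
    and R: "\<And>\<theta>. 0 < \<theta> ==> frequently (\<lambda>n. (R - \<theta>) * real (card (D n)) <= real (card (Y n))) sequentially"
    and K: "cocompact_exhaustion G \<alpha> L K" and d: "\<And>j. d <= harmonic_dim (K j) (Suc q)"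
  shows "ereal ((R + d) * ln CARD('k)) \<le>
    top_sofic_entropy G D \<sigma> (pointwise_topology (ker_coboundary L (Suc (Suc q)) :: ('v list => 'k) set)) (cochain_action G \<alpha> L (Suc q))"
proof -
  let ?V = "reps (Suc q)"
  have inc: "incseq K" and un: "(\<Union>i. K i) = L" and inv: "\<And>i g s. g \<in> carrier G ==> s \<in> K i ==> \<alpha> g ` s \<in> K i"
    and coc: "\<And>i. finite (orbits G (K i) (\<lambda>g s. \<alpha> g ` s))"
    using K by (auto simp: cocompact_exhaustion_def cocompact_def)
  have KL: "K i \<subseteq> L" for i using un by blast
  have "ereal ((real (card ?V) - (real (card ?V) - R - d)) * ln CARD('k)) \<le>
    top_sofic_entropy G D \<sigma> (pointwise_topology (ker_coboundary L (Suc (Suc q)) :: ('v list => 'k) set)) (cochain_action G \<alpha> L (Suc q))"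
  proof (rule entropy_ker_coboundary_ge_codim[OF finV])
    fix T0 :: "'v list set" and \<theta> :: real assume T0: "finite T0" "T0 \<subseteq> reps (Suc (Suc q))" and \<theta>: "0 < \<theta>"
    \<comment> \<open>Finitely many simplices lie in one stage of the exhaustion.\<close>
    have "\<exists>j. \<forall>t\<in>T0. set t \<in> K j"
      using T0(1,2)
    proof (induction T0)
      case (insert t T)
      then obtain j where j: "\<forall>t\<in>T. set t \<in> K j" by auto
      have "set t \<in> L" using simplexD[OF reps_simplices[of t "Suc (Suc q)"]] insert.prems by simp
      then obtain j' where "set t \<in> K j'" using un by blast
      then have "\<forall>t\<in>insert t T. set t \<in> K (max j j')"
        using j incseqD[OF inc, of j "max j j'"] incseqD[OF inc, of j' "max j j'"] by auto
      then show ?case by blast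
    qed simp
    then obtain j where j: "\<forall>t\<in>T0. set t \<in> K j" by blast
    define T where "T = {t \<in> reps (Suc (Suc q)). set t \<in> K j}"
    have T: "finite T" "T \<subseteq> reps (Suc (Suc q))" "T0 \<subseteq> T" unfolding T_def using finite_reps[OF coc] j T0(2) by auto
    interpret W: sofic_rules G D \<sigma> ?V "laplace_rules (K j) q"
      by (rule laplace_rules_system[OF sofic finU finV]) (use T(1) in \<open>simp add: T_def\<close>)
    have "d <= (\<Sum>v\<in>?V. laplace_moment (K j) q v k)" for k
    proof -
      have "harmonic_dim (K j) (Suc q) <= (\<Sum>v\<in>?V. laplace_moment (K j) q v k)"
        by (rule harmonic_dim_le_moments[OF sofic finU finV _ KL inv]) (use T(1) in \<open>simp_all add: T_def\<close>)
      then show ?thesis using d[of j] by simp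
    qed
    from W.eventually_kernel_dim_ge[OF this, of "\<theta> / 3"] \<theta>
    have ev1: "eventually (\<lambda>n. \<exists>(Z :: nat set) (w :: nat => 'd \<times> 'v list => complex). finite Z \<and>
      (\<forall>a\<in>Z. \<forall>r\<in>laplace_rules (K j) q. \<forall>x\<in>D n. rule_eval (\<sigma> n) r (w a) x = 0) \<and>
      indep_family (D n \<times> ?V) Z w \<and> (d - \<theta> / 3) * real (card (D n)) <= real (card Z)) sequentially" by simp
    have "0 < \<theta> / (3 * (real (card (reps q)) + 1))" using \<theta> by simp
    from eventually_bad_columns[OF T(1,2) this]
    have ev2: "eventually (\<lambda>n. real (card (bad_columns n T)) <= \<theta> / (3 * (real (card (reps q)) + 1)) * real (card (D n))) sequentially" .
    have "0 < \<theta> / 3" using \<theta> by simp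
    from frequently_eventually_frequently[OF R[OF this] eventually_conj[OF ev1 ev2]]
    show "frequently (\<lambda>n. \<exists>b T'. T0 \<subseteq> T' \<and> T' \<subseteq> reps (Suc (Suc q)) \<and> real b <= (real (card ?V) - R - d + \<theta>) * real (card (D n)) \<and>
        CARD('k) ^ card (D n \<times> ?V) <= CARD('k) ^ b * card (model_kernel (Suc q) n T' :: ('d \<times> 'v list => 'k) set)) sequentially"
    proof (rule frequently_elim1, elim conjE exE)
      fix n and Z :: "nat set" and w :: "nat => 'd \<times> 'v list => complex"
      assume Z: "finite Z" "\<forall>a\<in>Z. \<forall>r\<in>laplace_rules (K j) q. \<forall>x\<in>D n. rule_eval (\<sigma> n) r (w a) x = 0"
        "indep_family (D n \<times> ?V) Z w" "(d - \<theta> / 3) * real (card (D n)) <= real (card Z)"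
        and bad: "real (card (bad_columns n T)) <= \<theta> / (3 * (real (card (reps q)) + 1)) * real (card (D n))"
        and r: "(R - \<theta> / 3) * real (card (D n)) <= real (card (Y n))"
      define C where "C = {y \<in> Y n. fst y \<notin> bad_columns n T}"
      have finY: "finite (Y n)" by (rule finite_subset[OF Y]) (use fin_D finU in auto)
      have finBad: "finite (bad_columns n T)"
        unfolding bad_columns_def nonmult_def using fin_D shifts_finite(1)[OF T(1,2)] by auto
      have "Y n \<subseteq> C \<union> bad_columns n T \<times> reps q" using Y[of n] by (auto simp: C_def)
      then have "card (Y n) <= card (C \<union> bad_columns n T \<times> reps q)"
        using finY finBad finU by (intro card_mono) (auto simp: C_def)
      also have "... <= card C + card (bad_columns n T \<times> reps q)" by (rule card_Un_le)
      finally have c1: "real (card (Y n)) <= real (card C) + real (card (bad_columns n T)) * real (card (reps q))"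
        by (simp add: card_cartesian_product flip: of_nat_add of_nat_mult)
      have "real (card (bad_columns n T)) * real (card (reps q))
          <= (\<theta> / (3 * (real (card (reps q)) + 1)) * real (card (D n))) * (real (card (reps q)) + 1)"
        using bad \<theta> by (intro mult_mono) auto
      also have "... = \<theta> / 3 * real (card (D n))" by (simp add: field_simps)
      finally have c2: "real (card (bad_columns n T)) * real (card (reps q)) <= \<theta> / 3 * real (card (D n))" .
      have finT: "finite (D n \<times> T)" using fin_D T(1) by simp
      obtain B where B: "B \<subseteq> D n \<times> T" "indep_family (D n \<times> ?V) B (\<lambda>z y. of_int (model_coboundary (Suc q) n z y) :: 'k)"
        and Bspan: "\<And>i. i \<in> D n \<times> T ==> \<exists>c. \<forall>x\<in>D n \<times> ?V. of_int (model_coboundary (Suc q) n i x) = (\<Sum>y\<in>B. c y * (of_int (model_coboundary (Suc q) n y x) :: 'k))"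
        using exists_spanning_indep_subfamily[OF finT, of "D n \<times> ?V" "\<lambda>z y. of_int (model_coboundary (Suc q) n z y) :: 'k"]
        by blast
      have "card C + (card B + card Z) <= card (D n) * card ?V"
      proof (rule model_rank_bound[where K = "K j" and w = w and 'k = 'k, folded T_def])
        show "C \<subseteq> (D n - bad_columns n T) \<times> reps q" using Y[of n] by (auto simp: C_def)
        show "indep_family (D n \<times> ?V) C (\<lambda>y z. of_int (model_coboundary q n z y) :: 'k)"
          by (rule indep_family_mono[OF indep _ finY]) (auto simp: C_def)
      qed (use T B Z in auto)
      then have c3: "real (card C) + (real (card B) + real (card Z)) <= real (card (D n)) * real (card ?V)"
        by (simp flip: of_nat_add of_nat_mult)
      have "real (card B) <= (real (card ?V) - R - d + \<theta>) * real (card (D n))"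
        using c1 c2 c3 r Z(4) by (simp add: algebra_simps)
      moreover have "CARD('k) ^ card (D n \<times> ?V) <= CARD('k) ^ card B * card (model_kernel (Suc q) n T :: ('d \<times> 'v list => 'k) set)"
        unfolding model_kernel_def
        by (rule card_kernel_rows[OF _ finite_subset[OF B(1) finT] Bspan]) (use fin_D finV in auto)
      ultimately show "\<exists>b T'. T0 \<subseteq> T' \<and> T' \<subseteq> reps (Suc (Suc q)) \<and> real b <= (real (card ?V) - R - d + \<theta>) * real (card (D n)) \<and>
        CARD('k) ^ card (D n \<times> ?V) <= CARD('k) ^ b * card (model_kernel (Suc q) n T' :: ('d \<times> 'v list => 'k) set)"
        using T(2,3) by blast
    qed
  qed
  then show ?thesis by simp
qed

end

theorem theorem5p8:
  fixes G :: "('g, 'm) monoid_scheme"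
    and D :: "nat \<Rightarrow> 'd set"
    and \<sigma> :: "nat \<Rightarrow> 'g \<Rightarrow> 'd \<Rightarrow> 'd"
    and L :: "'v set set"
    and \<alpha> :: "'g \<Rightarrow> 'v \<Rightarrow> 'v"
    and p :: nat
  assumes "group G" and "countable (carrier G)"
    and "sofic_approximation G D \<sigma>"
    and "abstract_simplicial_complex L"
    and "free_simplicial_action G \<alpha> L"
    and "p \<ge> 1"
    and "cocompact G \<alpha> (skeleton p L)"
  shows "top_sofic_entropy G D \<sigma>
           (pointwise_topology (cochains L (p - 1) :: ('v list \<Rightarrow> 'k::{field, finite}) set))
           (cochain_action G \<alpha> L (p - 1))
         + l2_betti G \<alpha> L p * ereal (ln (real CARD('k)))
       \<le> top_sofic_entropy G D \<sigma>
           (pointwise_topology (ker_coboundary L p :: ('v list \<Rightarrow> 'k) set))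
           (cochain_action G \<alpha> L (p - 1))
         + top_sofic_entropy G D \<sigma>
           (pointwise_topology (ker_coboundary L (p + 1) :: ('v list \<Rightarrow> 'k) set))
           (cochain_action G \<alpha> L p)"
proof -
  obtain q where p: "p = Suc q" using assms(6) by (cases p) auto
  interpret free_complex G L \<alpha> using assms by (intro free_complex.intro free_complex_axioms.intro)
  have fin: "finite (reps r)" if "r <= p" for r
  proof -
    have "reps r \<subseteq> {t \<in> reps r. set t \<in> skeleton p L}"
      using that simplexD[OF reps_simplices] distinct_card by (fastforce simp: skeleton_def)
    then show ?thesis using finite_reps[of "skeleton p L" r] assms(7) finite_subset unfolding cocompact_def by blast
  qed
  interpret sofic_complex G L \<alpha> D \<sigma> q
    by unfold_locales (use assms(3) fin p in auto)
  interpret co: coded_action G D \<sigma> "cochains L q :: ('v list => 'k) set" "cochain_action G \<alpha> L q" cd "reps q"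
    by (rule coded_cochains[OF assms(3) finU])
  obtain K d where K: "cocompact_exhaustion G \<alpha> L K" and b: "l2_betti G \<alpha> L (Suc q) = ereal d"
    and d: "\<And>j. d <= harmonic_dim (K j) (Suc q)"
    using l2_betti_harmonic[OF assms(2) _ finV] assms(7) p by auto
  \<comment> \<open>A maximal independent set of columns of the first model coboundary; its size is the rank.\<close>
  define good where "good n Y \<longleftrightarrow> Y \<subseteq> D n \<times> reps q \<and>
      indep_family (D n \<times> reps (Suc q)) Y (\<lambda>y z. of_int (model_coboundary q n z y) :: 'k) \<and>
      (\<forall>i\<in>D n \<times> reps q. \<exists>c. \<forall>x\<in>D n \<times> reps (Suc q). of_int (model_coboundary q n x i) = (\<Sum>y\<in>Y. c y * (of_int (model_coboundary q n x y) :: 'k)))" for n Y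
  have "\<exists>Y. good n Y" for n
    unfolding good_def using exists_spanning_indep_subfamily[of "D n \<times> reps q"] fin_D finU by blast
  then obtain Y where good: "\<And>n. good n (Y n)" by metis
  have Y: "\<And>n. Y n \<subseteq> D n \<times> reps q"
    "\<And>n. indep_family (D n \<times> reps (Suc q)) (Y n) (\<lambda>y z. of_int (model_coboundary q n z y) :: 'k)"
    "\<And>n i. i \<in> D n \<times> reps q ==> \<exists>c. \<forall>x\<in>D n \<times> reps (Suc q). of_int (model_coboundary q n x i) = (\<Sum>y\<in>Y n. c y * (of_int (model_coboundary q n x y) :: 'k))"
    using good unfolding good_def by blast+
  have le: "real (card (Y n)) / real (card (D n)) <= real (card (reps q))" for n
  proof -
    have "card (Y n) <= card (D n \<times> reps q)" using Y(1) fin_D finU by (intro card_mono) auto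
    then have "real (card (Y n)) <= real (card (reps q)) * real (card (D n))"
      by (simp add: card_cartesian_product mult.commute flip: of_nat_mult)
    then show ?thesis by (cases "card (D n) = 0") (auto simp: divide_le_eq)
  qed
  \<comment> \<open>The limit superior of the normalised ranks.\<close>
  obtain R where R: "\<And>\<theta>. 0 < \<theta> ==> eventually (\<lambda>n. real (card (Y n)) / real (card (D n)) <= R + \<theta>) sequentially"
    "\<And>\<theta>. 0 < \<theta> ==> frequently (\<lambda>n. R - \<theta> <= real (card (Y n)) / real (card (D n))) sequentially"
    using real_limsup_exists[of "\<lambda>n. real (card (Y n)) / real (card (D n))", OF _ le] by auto
  have R1: "eventually (\<lambda>n. real (card (Y n)) <= (R + \<theta>) * real (card (D n))) sequentially" if "0 < \<theta>" for \<theta>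
    using eventually_conj[OF R(1)[OF that] eventually_D_pos] by (rule eventually_mono) (auto simp: divide_le_eq)
  have R2: "frequently (\<lambda>n. (R - \<theta>) * real (card (D n)) <= real (card (Y n))) sequentially" if "0 < \<theta>" for \<theta>
    using frequently_eventually_frequently[OF R(2)[OF that] eventually_D_pos] by (rule frequently_elim1) (auto simp: le_divide_eq)
  define l where "l = ln (real CARD('k))"
  define h0 where "h0 = top_sofic_entropy G D \<sigma> (pointwise_topology (cochains L q :: ('v list => 'k) set)) (cochain_action G \<alpha> L q)"
  define h1 where "h1 = top_sofic_entropy G D \<sigma> (pointwise_topology (ker_coboundary L (Suc q) :: ('v list => 'k) set)) (cochain_action G \<alpha> L q)"
  define h2 where "h2 = top_sofic_entropy G D \<sigma> (pointwise_topology (ker_coboundary L (Suc (Suc q)) :: ('v list => 'k) set)) (cochain_action G \<alpha> L (Suc q))"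
  have 0: "h0 <= ereal (card (reps q) * l)" unfolding h0_def l_def by (rule co.entropy_le)
  have 1: "ereal ((real (card (reps q)) - R) * l) <= h1"
    unfolding h1_def l_def by (rule entropy_ker_coboundary_ge[OF Y(1,3) R1])
  have 2: "ereal ((R + d) * l) <= h2"
    unfolding h2_def l_def by (rule entropy_ker_coboundary_Suc_ge[OF Y(1,2) R2 K d])
  have "h0 + ereal (d * l) <= ereal (card (reps q) * l) + ereal (d * l)" by (rule add_mono[OF 0 order_refl])
  also have "... = ereal ((real (card (reps q)) - R) * l) + ereal ((R + d) * l)" by (simp add: algebra_simps)
  also have "... <= h1 + h2" by (rule add_mono[OF 1 2])
  finally have "h0 + ereal (d * l) <= h1 + h2" .
  then show ?thesis unfolding h0_def h1_def h2_def l_def p using b by simp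
qed

end
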